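(* Let $R$ be a commutative ring with identity. The following statements are equivalent (here the unit ideal $R$ is regarded as the empty product, so the factorization conditions concern proper ideals). (1) $R$ is a general Krull ring. (2) Each principal ideal of $R$ is a finite $u$-product of prime ideals. (3) For each $a \in R$, $(aR)_u$ is a finite $u$-product of prime ideals. (4) Each integral $u$-ideal of $R$ is a finite $u$-product of prime ideals. (5) $R$ is a Krull ring, each minimal prime ideal of $R$ is a principal ideal, and $\dim(T(R)) = 0$. (6) $R$ is a Krull ring, the zero element of $R$ is a finite product of prime elements, and $\dim(T(R)) = 0$.
   Context: All rings are commutative with nonzero identity. $T(R)$ is the total quotient ring of $R$; a regular element is a non-zero-divisor; a submodule or ideal is regular if it contains a regular element of $R$. $\dim$ is Krull dimension. For an $R$-submodule $I$ of $T(R)$, $I^{-1} = \{x \in T(R) : xI \subseteq R\}$. Let $\mathrm{rGV}(R)$ be the set of finitely generated regular ideals $J$ of $R$ with $J^{-1} = R$. For an $R$-submodule $I$ of $T(R)$, $I_u = \{x \in T(R) : xJ \subseteq I \text{ for some } J \in \mathrm{rGV}(R)\}$. An integral $u$-ideal of $R$ is an ideal $I \subseteq R$ with $I_u = I$. An ideal $I$ is a finite $u$-product of prime ideals if $I = (P_1 \cdots P_n)_u$ for some prime ideals $P_1, \ldots, P_n$ of $R$. A special primary ring (SPR) is a local ring whose maximal ideal $M$ is principal and satisfies $M^n = (0)$ for some $n \geq 1$ (so a field is an SPR). A general Krull ring is a finite direct product of Krull domains and SPRs (a field counts as a Krull domain). A prime element is an element $p$ such that $pR$ is a prime ideal. A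 rank-one discrete valuation on $T(R)$ is a surjective map $v : T(R) \to \mathbb{Z} \cup \{\infty\}$ with $v(ab) = v(a)+v(b)$ and $v(a+b) \geq \min\{v(a), v(b)\}$; with $V = \{x : v(x) \geq 0\}$ and $P = \{x : v(x) > 0\}$, the pair $(V,P)$ is called a rank-one DVR. $R$ is a Krull ring if there is a family $\{(V_\alpha, P_\alpha)\}$ of rank-one DVRs (of $T(R)$) such that (i) $R = \bigcap_\alpha V_\alpha$ (the empty family being allowed, in which case $R = T(R)$), (ii) for each regular $a \in R$, $aV_\alpha = V_\alpha$ for all but finitely many $\alpha$, and (iii) each $P_\alpha$ is a regular ideal. *)

theory Defs
  imports "HOL-Algebra.Algebra" "HOL-Library.Extended" "HOL-Library.Extended_Nat"
begin

section \<open>The total quotient ring\<close>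

definition regular_elements :: "('a, 'b) ring_scheme \<Rightarrow> 'a set" where
  "regular_elements R =
     {s \<in> carrier R. \<forall>b \<in> carrier R. s \<otimes>\<^bsub>R\<^esub> b = \<zero>\<^bsub>R\<^esub> \<longrightarrow> b = \<zero>\<^bsub>R\<^esub>}"

text \<open>The fraction \<open>a/s\<close> as the class of all pairs \<open>(b, t)\<close> with \<open>b/t = a/s\<close>. Since the
  denominators are non-zero-divisors, plain cross multiplication is already transitive.\<close>

definition tq_frac :: "('a, 'b) ring_scheme \<Rightarrow> 'a \<Rightarrow> 'a \<Rightarrow> ('a \<times> 'a) set" where
  "tq_frac R a s =
     {(b, t). b \<in> carrier R \<and> t \<in> regular_elements R \<and> a \<otimes>\<^bsub>R\<^esub> t = b \<otimes>\<^bsub>R\<^esub> s}"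

text \<open>In sums and products of classes, all choices of representatives give the same fraction
  (lemmas \<open>tq_add_frac\<close> and \<open>tq_mult_frac\<close> below), so the unions are unions of equal sets.\<close>

definition total_quotient_ring :: "('a, 'b) ring_scheme \<Rightarrow> ('a \<times> 'a) set ring" where
  "total_quotient_ring R =
     \<lparr> carrier = {tq_frac R a s | a s. a \<in> carrier R \<and> s \<in> regular_elements R},
       monoid.mult = (\<lambda>A B. \<Union>(a, s) \<in> A. \<Union>(b, t) \<in> B. tq_frac R (a \<otimes>\<^bsub>R\<^esub> b) (s \<otimes>\<^bsub>R\<^esub> t)),
       one = tq_frac R \<one>\<^bsub>R\<^esub> \<one>\<^bsub>R\<^esub>,
       ring.zero = tq_frac R \<zero>\<^bsub>R\<^esub> \<one>\<^bsub>R\<^esub>,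
       ring.add = (\<lambda>A B. \<Union>(a, s) \<in> A. \<Union>(b, t) \<in> B.
                 tq_frac R ((a \<otimes>\<^bsub>R\<^esub> t) \<oplus>\<^bsub>R\<^esub> (b \<otimes>\<^bsub>R\<^esub> s)) (s \<otimes>\<^bsub>R\<^esub> t)) \<rparr>"

text \<open>The canonical embedding of \<open>R\<close> into \<open>T(R)\<close>. Below, \<open>R\<close> and its ideals are identified
  with their images under this map whenever they are regarded as submodules of \<open>T(R)\<close>.\<close>

definition tq_embed :: "('a, 'b) ring_scheme \<Rightarrow> 'a \<Rightarrow> ('a \<times> 'a) set" where
  "tq_embed R a = tq_frac R a \<one>\<^bsub>R\<^esub>"


section \<open>The u-operation\<close>

definition frac_inverse :: "('a, 'b) ring_scheme \<Rightarrow> ('a \<times> 'a) set set \<Rightarrow> ('a \<times> 'a) set set" where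
  "frac_inverse R I =
     {x \<in> carrier (total_quotient_ring R).
        \<forall>y \<in> I. x \<otimes>\<^bsub>total_quotient_ring R\<^esub> y \<in> tq_embed R ` carrier R}"

definition rGV :: "('a, 'b) ring_scheme \<Rightarrow> 'a set set" where
  "rGV R =
     {J. ideal J R \<and> (\<exists>A \<subseteq> carrier R. finite A \<and> J = genideal R A) \<and>
         J \<inter> regular_elements R \<noteq> {} \<and>
         frac_inverse R (tq_embed R ` J) = tq_embed R ` carrier R}"

definition u_closure :: "('a, 'b) ring_scheme \<Rightarrow> ('a \<times> 'a) set set \<Rightarrow> ('a \<times> 'a) set set" where
  "u_closure R I =
     {x \<in> carrier (total_quotient_ring R).
        \<exists>J \<in> rGV R. \<forall>j \<in> J. x \<otimes>\<^bsub>total_quotient_ring R\<^esub> tq_embed R j \<in> I}"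

definition integral_u_ideal :: "('a, 'b) ring_scheme \<Rightarrow> 'a set \<Rightarrow> bool" where
  "integral_u_ideal R I \<longleftrightarrow> ideal I R \<and> u_closure R (tq_embed R ` I) = tq_embed R ` I"

definition ideal_prod_list :: "('a, 'b) ring_scheme \<Rightarrow> 'a set list \<Rightarrow> 'a set" where
  "ideal_prod_list R Is = foldr (ideal_prod R) Is (carrier R)"

text \<open>The empty list is allowed; as \<open>R\<^sub>u = R\<close>, it contributes exactly the unit ideal.\<close>

definition finite_u_product_of_primes ::
    "('a, 'b) ring_scheme \<Rightarrow> ('a \<times> 'a) set set \<Rightarrow> bool" where
  "finite_u_product_of_primes R I \<longleftrightarrow>
     (\<exists>Ps. (\<forall>P \<in> set Ps. primeideal P R) \<and>
           I = u_closure R (tq_embed R ` ideal_prod_list R Ps))"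


section \<open>Krull rings and general Krull rings\<close>

text \<open>\<open>int extended\<close> also has an element \<open>Minf\<close>; the condition on the image
  excludes it as a value and expresses surjectivity onto the integers with \<open>Pinf\<close>.\<close>

definition rank_one_discrete_valuation ::
    "('c, 'd) ring_scheme \<Rightarrow> ('c \<Rightarrow> int extended) \<Rightarrow> bool" where
  "rank_one_discrete_valuation T v \<longleftrightarrow>
     v ` carrier T = insert Pinf (range Fin) \<and>
     (\<forall>a \<in> carrier T. \<forall>b \<in> carrier T. v (a \<otimes>\<^bsub>T\<^esub> b) = v a + v b) \<and>
     (\<forall>a \<in> carrier T. \<forall>b \<in> carrier T. v (a \<oplus>\<^bsub>T\<^esub> b) \<ge> min (v a) (v b))"

definition rank_one_DVR :: "('c, 'd) ring_scheme \<Rightarrow> 'c set \<Rightarrow> 'c set \<Rightarrow> bool" where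
  "rank_one_DVR T V P \<longleftrightarrow>
     (\<exists>v. rank_one_discrete_valuation T v \<and>
          V = {x \<in> carrier T. v x \<ge> 0} \<and> P = {x \<in> carrier T. v x > 0})"

definition krull_ring :: "('a, 'b) ring_scheme \<Rightarrow> bool" where
  "krull_ring R \<longleftrightarrow> cring R \<and> \<one>\<^bsub>R\<^esub> \<noteq> \<zero>\<^bsub>R\<^esub> \<and>
     (\<exists>F. (\<forall>(V, P) \<in> F. rank_one_DVR (total_quotient_ring R) V P) \<and>
          tq_embed R ` carrier R = {x \<in> carrier (total_quotient_ring R). \<forall>(V, P) \<in> F. x \<in> V} \<and>
          (\<forall>a \<in> regular_elements R.
             finite {(V, P) \<in> F. (\<lambda>x. tq_embed R a \<otimes>\<^bsub>total_quotient_ring R\<^esub> x) ` V \<noteq> V}) \<and>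
          (\<forall>(V, P) \<in> F. P \<inter> tq_embed R ` regular_elements R \<noteq> {}))"

definition krull_domain :: "('a, 'b) ring_scheme \<Rightarrow> bool" where
  "krull_domain R \<longleftrightarrow> domain R \<and> krull_ring R"

definition special_primary_ring :: "('a, 'b) ring_scheme \<Rightarrow> bool" where
  "special_primary_ring R \<longleftrightarrow> cring R \<and>
     (\<exists>M. maximalideal M R \<and> (\<forall>M'. maximalideal M' R \<longrightarrow> M' = M) \<and> principalideal M R \<and>
          (\<exists>n \<ge> 1. ideal_prod_list R (replicate n M) = {\<zero>\<^bsub>R\<^esub>}))"

text \<open>The factors may be taken over the element type of \<open>R\<close> without loss of generality: if \<open>R\<close> is
  a finite product of rings, the factors are isomorphic to the rings \<open>eR\<close> with unit \<open>e\<close> for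
  suitable idempotents \<open>e\<close> of \<open>R\<close>.\<close>

definition general_krull_ring :: "('a, 'b) ring_scheme \<Rightarrow> bool" where
  "general_krull_ring R \<longleftrightarrow>
     (\<exists>Rs :: 'a ring list. (\<forall>S \<in> set Rs. krull_domain S \<or> special_primary_ring S) \<and>
        R \<simeq> RDirProd_list Rs)"


section \<open>Dimension, minimal primes and prime elements\<close>

definition krull_dim :: "('a, 'b) ring_scheme \<Rightarrow> enat" where
  "krull_dim R =
     Sup {enat n | n. \<exists>P. (\<forall>i \<le> n. primeideal (P i) R) \<and> (\<forall>i < n. P i \<subset> P (Suc i))}"

definition minimal_prime :: "('a, 'b) ring_scheme \<Rightarrow> 'a set \<Rightarrow> bool" where
  "minimal_prime R P \<longleftrightarrow> primeideal P R \<and> (\<forall>Q. primeideal Q R \<and> Q \<subseteq> P \<longrightarrow> Q = P)"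

text \<open>Unlike the library's \<open>ring_prime\<close>, this does not exclude zero.\<close>

definition prime_element :: "('a, 'b) ring_scheme \<Rightarrow> 'a \<Rightarrow> bool" where
  "prime_element R p \<longleftrightarrow> p \<in> carrier R \<and> primeideal (PIdl\<^bsub>R\<^esub> p) R"


section \<open>The total quotient ring is well defined\<close>

context cring
begin

lemma regular_closed: "s \<in> regular_elements R \<Longrightarrow> s \<in> carrier R"
  by (simp add: regular_elements_def)

lemma regular_cancel:
  assumes "s \<in> regular_elements R" "a \<in> carrier R" "b \<in> carrier R" "s \<otimes> a = s \<otimes> b"
  shows "a = b"
proof -
  have "s \<otimes> (a \<ominus> b) = \<zero>"
    using assms regular_closed[OF assms(1)] by (simp add: r_minus minus_eq r_distr r_neg)
  then have "a \<ominus> b = \<zero>" using assms by (auto simp: regular_elements_def)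
  then show ?thesis using assms by simp
qed

lemma regular_one: "\<one> \<in> regular_elements R"
  by (simp add: regular_elements_def)

lemma regular_mult:
  assumes "s \<in> regular_elements R" "t \<in> regular_elements R"
  shows "s \<otimes> t \<in> regular_elements R"
proof -
  note closed = assms[THEN regular_closed]
  have "b = \<zero>" if b: "b \<in> carrier R" "(s \<otimes> t) \<otimes> b = \<zero>" for b
  proof -
    have "s \<otimes> (t \<otimes> b) = s \<otimes> \<zero>" using b closed by (simp add: m_assoc)
    then have "t \<otimes> b = t \<otimes> \<zero>"
      using regular_cancel[OF assms(1), of "t \<otimes> b" \<zero>] b closed by simp
    then show ?thesis using regular_cancel[OF assms(2), of b \<zero>] b by simp
  qed
  then show ?thesis using closed by (simp add: regular_elements_def)
qed

lemma tq_frac_eq_iff: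
  assumes "a \<in> carrier R" "b \<in> carrier R" "s \<in> regular_elements R" "t \<in> regular_elements R"
  shows "tq_frac R a s = tq_frac R b t \<longleftrightarrow> a \<otimes> t = b \<otimes> s"
proof
  assume "tq_frac R a s = tq_frac R b t"
  moreover have "(b, t) \<in> tq_frac R b t" using assms by (simp add: tq_frac_def)
  ultimately show "a \<otimes> t = b \<otimes> s" by (auto simp: tq_frac_def)
next
  have aux: "tq_frac R a s \<subseteq> tq_frac R b t"
    if h: "a \<in> carrier R" "b \<in> carrier R" "s \<in> regular_elements R" "t \<in> regular_elements R"
      "a \<otimes> t = b \<otimes> s" for a b s t
  proof
    fix z assume "z \<in> tq_frac R a s"
    then obtain c u where z: "z = (c, u)" "c \<in> carrier R" "u \<in> regular_elements R"
      "a \<otimes> u = c \<otimes> s" by (auto simp: tq_frac_def)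
    note [simp] = h(1,2) regular_closed[OF h(3)] regular_closed[OF h(4)] z(2)
      regular_closed[OF z(3)]
    have "s \<otimes> (b \<otimes> u) = (b \<otimes> s) \<otimes> u" by (simp add: m_ac)
    also have "\<dots> = (a \<otimes> t) \<otimes> u" using h(5) by simp
    also have "\<dots> = (a \<otimes> u) \<otimes> t" by (simp add: m_ac)
    also have "\<dots> = s \<otimes> (c \<otimes> t)" using z(4) by (simp add: m_ac)
    finally have "b \<otimes> u = c \<otimes> t" using regular_cancel[OF h(3)] by simp
    then show "z \<in> tq_frac R b t" using z by (simp add: tq_frac_def)
  qed
  assume "a \<otimes> t = b \<otimes> s"
  then show "tq_frac R a s = tq_frac R b t"
    using aux[of a b s t] aux[of b a t s] assms by auto
qed

lemma tq_mult_frac: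
  assumes "a \<in> carrier R" "b \<in> carrier R" "s \<in> regular_elements R" "t \<in> regular_elements R"
  shows "tq_frac R a s \<otimes>\<^bsub>total_quotient_ring R\<^esub> tq_frac R b t = tq_frac R (a \<otimes> b) (s \<otimes> t)"
proof -
  have eq: "tq_frac R (a' \<otimes> b') (s' \<otimes> t') = tq_frac R (a \<otimes> b) (s \<otimes> t)"
    if "(a', s') \<in> tq_frac R a s" "(b', t') \<in> tq_frac R b t" for a' s' b' t'
  proof -
    have h: "a' \<in> carrier R" "s' \<in> regular_elements R" "a \<otimes> s' = a' \<otimes> s"
      "b' \<in> carrier R" "t' \<in> regular_elements R" "b \<otimes> t' = b' \<otimes> t"
      using that by (auto simp: tq_frac_def)
    note [simp] = assms(1,2) h(1,4) assms(3,4)[THEN regular_closed] h(2,5)[THEN regular_closed]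
    have "(a' \<otimes> b') \<otimes> (s \<otimes> t) = (a' \<otimes> s) \<otimes> (b' \<otimes> t)" by (simp add: m_ac)
    also have "\<dots> = (a \<otimes> s') \<otimes> (b \<otimes> t')" using h by simp
    also have "\<dots> = (a \<otimes> b) \<otimes> (s' \<otimes> t')" by (simp add: m_ac)
    finally show ?thesis using assms h by (subst tq_frac_eq_iff) (auto simp: regular_mult)
  qed
  have "(a, s) \<in> tq_frac R a s" "(b, t) \<in> tq_frac R b t"
    using assms by (auto simp: tq_frac_def)
  then have "(\<Union>(a', s') \<in> tq_frac R a s. \<Union>(b', t') \<in> tq_frac R b t.
      tq_frac R (a' \<otimes> b') (s' \<otimes> t')) = tq_frac R (a \<otimes> b) (s \<otimes> t)"
    using eq by (intro equalityI subsetI) blast+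
  then show ?thesis by (simp add: total_quotient_ring_def)
qed

lemma tq_add_frac:
  assumes "a \<in> carrier R" "b \<in> carrier R" "s \<in> regular_elements R" "t \<in> regular_elements R"
  shows "tq_frac R a s \<oplus>\<^bsub>total_quotient_ring R\<^esub> tq_frac R b t =
    tq_frac R ((a \<otimes> t) \<oplus> (b \<otimes> s)) (s \<otimes> t)"
proof -
  have eq: "tq_frac R ((a' \<otimes> t') \<oplus> (b' \<otimes> s')) (s' \<otimes> t') =
      tq_frac R ((a \<otimes> t) \<oplus> (b \<otimes> s)) (s \<otimes> t)"
    if "(a', s') \<in> tq_frac R a s" "(b', t') \<in> tq_frac R b t" for a' s' b' t'
  proof -
    have h: "a' \<in> carrier R" "s' \<in> regular_elements R" "a \<otimes> s' = a' \<otimes> s"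
      "b' \<in> carrier R" "t' \<in> regular_elements R" "b \<otimes> t' = b' \<otimes> t"
      using that by (auto simp: tq_frac_def)
    note [simp] = assms(1,2) h(1,4) assms(3,4)[THEN regular_closed] h(2,5)[THEN regular_closed]
    have "((a' \<otimes> t') \<oplus> (b' \<otimes> s')) \<otimes> (s \<otimes> t) =
        ((a' \<otimes> s) \<otimes> (t \<otimes> t')) \<oplus> ((b' \<otimes> t) \<otimes> (s \<otimes> s'))" by (simp add: m_ac l_distr r_distr)
    also have "\<dots> = ((a \<otimes> s') \<otimes> (t \<otimes> t')) \<oplus> ((b \<otimes> t') \<otimes> (s \<otimes> s'))" using h by simp
    also have "\<dots> = ((a \<otimes> t) \<oplus> (b \<otimes> s)) \<otimes> (s' \<otimes> t')" by (simp add: m_ac l_distr r_distr)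
    finally show ?thesis using assms h by (subst tq_frac_eq_iff) (auto simp: regular_mult)
  qed
  have "(a, s) \<in> tq_frac R a s" "(b, t) \<in> tq_frac R b t"
    using assms by (auto simp: tq_frac_def)
  then have "(\<Union>(a', s') \<in> tq_frac R a s. \<Union>(b', t') \<in> tq_frac R b t.
      tq_frac R ((a' \<otimes> t') \<oplus> (b' \<otimes> s')) (s' \<otimes> t')) = tq_frac R ((a \<otimes> t) \<oplus> (b \<otimes> s)) (s \<otimes> t)"
    using eq by (intro equalityI subsetI) blast+
  then show ?thesis by (simp add: total_quotient_ring_def)
qed

lemma tq_carrierE:
  assumes "x \<in> carrier (total_quotient_ring R)"
  obtains a s where "a \<in> carrier R" "s \<in> regular_elements R" "x = tq_frac R a s"
  using assms by (auto simp: total_quotient_ring_def)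

lemma tq_frac_closed:
  "a \<in> carrier R \<Longrightarrow> s \<in> regular_elements R \<Longrightarrow> tq_frac R a s \<in> carrier (total_quotient_ring R)"
  by (auto simp: total_quotient_ring_def)

lemma tq_one: "\<one>\<^bsub>total_quotient_ring R\<^esub> = tq_frac R \<one> \<one>"
  and tq_zero: "\<zero>\<^bsub>total_quotient_ring R\<^esub> = tq_frac R \<zero> \<one>"
  by (simp_all add: total_quotient_ring_def)

lemma total_quotient_ring_cring: "cring (total_quotient_ring R)"
proof (intro cringI abelian_groupI comm_monoidI)
  let ?T = "total_quotient_ring R"
  note frac = tq_frac_closed tq_mult_frac tq_add_frac regular_mult regular_one regular_closed
    tq_one tq_zero
  show "\<one>\<^bsub>?T\<^esub> \<in> carrier ?T" "\<zero>\<^bsub>?T\<^esub> \<in> carrier ?T" by (simp_all add: frac)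
  fix x assume "x \<in> carrier ?T"
  then obtain a s where x: "a \<in> carrier R" "s \<in> regular_elements R" "x = tq_frac R a s"
    by (rule tq_carrierE)
  show "\<one>\<^bsub>?T\<^esub> \<otimes>\<^bsub>?T\<^esub> x = x" "\<zero>\<^bsub>?T\<^esub> \<oplus>\<^bsub>?T\<^esub> x = x"
    using x by (simp_all add: frac)
  have "tq_frac R (\<ominus> a) s \<oplus>\<^bsub>?T\<^esub> x = \<zero>\<^bsub>?T\<^esub>"
    using x by (simp add: frac tq_frac_eq_iff l_minus l_neg)
  then show "\<exists>y \<in> carrier ?T. y \<oplus>\<^bsub>?T\<^esub> x = \<zero>\<^bsub>?T\<^esub>" using x by (blast intro: tq_frac_closed a_inv_closed)
  fix y assume "y \<in> carrier ?T"
  then obtain b t where y: "b \<in> carrier R" "t \<in> regular_elements R" "y = tq_frac R b t"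
    by (rule tq_carrierE)
  show "x \<otimes>\<^bsub>?T\<^esub> y \<in> carrier ?T" "x \<oplus>\<^bsub>?T\<^esub> y \<in> carrier ?T"
    "x \<otimes>\<^bsub>?T\<^esub> y = y \<otimes>\<^bsub>?T\<^esub> x" "x \<oplus>\<^bsub>?T\<^esub> y = y \<oplus>\<^bsub>?T\<^esub> x"
    using x y by (simp_all add: frac m_comm a_comm)
  fix z assume "z \<in> carrier ?T"
  then obtain c u where z: "c \<in> carrier R" "u \<in> regular_elements R" "z = tq_frac R c u"
    by (rule tq_carrierE)
  show "(x \<otimes>\<^bsub>?T\<^esub> y) \<otimes>\<^bsub>?T\<^esub> z = x \<otimes>\<^bsub>?T\<^esub> (y \<otimes>\<^bsub>?T\<^esub> z)"
    using x y z by (simp add: frac m_assoc)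
  show "(x \<oplus>\<^bsub>?T\<^esub> y) \<oplus>\<^bsub>?T\<^esub> z = x \<oplus>\<^bsub>?T\<^esub> (y \<oplus>\<^bsub>?T\<^esub> z)"
    using x y z by (simp add: frac l_distr r_distr m_ac a_ac)
  show "(x \<oplus>\<^bsub>?T\<^esub> y) \<otimes>\<^bsub>?T\<^esub> z = (x \<otimes>\<^bsub>?T\<^esub> z) \<oplus>\<^bsub>?T\<^esub> (y \<otimes>\<^bsub>?T\<^esub> z)"
  proof -
    note [simp] = x(1) y(1) z(1) x(2)[THEN regular_closed] y(2)[THEN regular_closed]
      z(2)[THEN regular_closed]
    define p q where "p = ((a \<otimes> t) \<oplus> (b \<otimes> s)) \<otimes> c" and "q = (s \<otimes> t) \<otimes> u"
    have pq [simp]: "p \<in> carrier R" "q \<in> carrier R" by (simp_all add: p_def q_def)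
    have q: "q \<in> regular_elements R" using x y z by (simp add: q_def regular_mult)
    have "(a \<otimes> c) \<otimes> (t \<otimes> u) \<oplus> (b \<otimes> c) \<otimes> (s \<otimes> u) = p \<otimes> u"
      by (simp add: p_def l_distr r_distr m_ac)
    moreover have "(s \<otimes> u) \<otimes> (t \<otimes> u) = q \<otimes> u" by (simp add: q_def m_ac)
    moreover have "tq_frac R p q = tq_frac R (p \<otimes> u) (q \<otimes> u)"
      using q z by (subst tq_frac_eq_iff) (auto simp: regular_mult m_ac)
    ultimately show ?thesis using x y z by (simp add: frac p_def q_def)
  qed
qed

lemma tq_embed_hom: "tq_embed R \<in> ring_hom R (total_quotient_ring R)"
  by (rule ring_hom_memI)
    (simp_all add: tq_embed_def tq_frac_closed tq_mult_frac tq_add_frac regular_one tq_one)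

lemma tq_embed_inj: "inj_on (tq_embed R) (carrier R)"
  by (rule inj_onI) (simp add: tq_embed_def tq_frac_eq_iff regular_one)

lemma tq_embed_regular_Units:
  assumes "s \<in> regular_elements R"
  shows "tq_embed R s \<in> Units (total_quotient_ring R)"
proof -
  have "tq_frac R \<one> s \<otimes>\<^bsub>total_quotient_ring R\<^esub> tq_embed R s = \<one>\<^bsub>total_quotient_ring R\<^esub>"
    "tq_embed R s \<otimes>\<^bsub>total_quotient_ring R\<^esub> tq_frac R \<one> s = \<one>\<^bsub>total_quotient_ring R\<^esub>"
    using assms by (simp_all add: tq_embed_def tq_mult_frac tq_frac_eq_iff regular_one
        regular_mult regular_closed tq_one)
  moreover have "tq_frac R \<one> s \<in> carrier (total_quotient_ring R)"
    "tq_embed R s \<in> carrier (total_quotient_ring R)"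
    using assms by (simp_all add: tq_embed_def tq_frac_closed regular_one regular_closed)
  ultimately show ?thesis unfolding Units_def by blast
qed

end

end

theory Submission
  imports Defs
begin

text \<open>Write \<open>T\<close> for the total quotient ring and \<open>A\<close> for the image of \<open>R\<close> in it.  If the
  \<open>u\<close>-closures of principal ideals factor, the prime factors of a regular element are
  \<open>u\<close>-invertible, so they are locally principal and carry rank-one discrete valuations, whose common
  valuation ring is \<open>A\<close>; hence \<open>A\<close> is a Krull ring.  Conversely a Krull ring is completely
  integrally closed, so its regular ideals are \<open>u\<close>-invertible, and a chain condition coming from
  the valuations lets the regular \<open>u\<close>-ideals factor.  A local argument in the
  style of Mori shows that nonregular primes are minimal, so
  \<open>dim T = 0\<close> and zero is a product of minimal primes.  Idempotents and nilpotents
  of \<open>T\<close> already lie in a Krull ring \<open>A\<close>, because multiplying their powers by a regular element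
  keeps them bounded; the idempotents attached to the minimal primes therefore split \<open>A\<close> into factors
  that are Krull domains or, when the minimal prime survives in the factor, special primary rings.\<close>

section \<open>The \<open>u\<close>-operation on a pair of rings\<close>

text \<open>The arguments run in an abstract pair: a ring \<open>T\<close> and a subring
  \<open>A\<close> such that non-zero-divisors of \<open>A\<close> are units of \<open>T\<close> and
  every element of \<open>T\<close> is a fraction. Localizations are replaced by multipliers outside
  a prime, and \<open>total_quotient_ring\<close> enters only through a dictionary at the end. The
  pivot is \<open>decomp\<close>, a complete system of orthogonal idempotents: conditions (3) and
  (6) each produce one, and (1), (2) and (4) are read off from it. The obstacle is that the
  valuations do not control nonregular primes. So there is a regular half, ruled by
  \<open>GV\<close> sets and valuations, and a nonregular half, ruled by nilpotents and idempotents.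
  The halves are joined by the fact that every \<open>GV\<close> set contains a unit of
  \<open>T\<close>: no nonregular prime contains such a set, so taking the u-closure of an ideal
  changes nothing after localizing at such a prime. Products and factors are handled through
  valuations restricted to the ring itself, so that the total quotient ring of a product never has
  to be computed.\<close>

locale ring_pair = cring T for T :: "('a, 'b) ring_scheme" (structure) +
  fixes A :: "'a set"
  assumes A_subset: "A \<subseteq> carrier T"
    and A_one [simp]: "\<one> \<in> A"
    and A_add [simp]: "x \<in> A \<Longrightarrow> y \<in> A \<Longrightarrow> x \<oplus> y \<in> A"
    and A_mult [simp]: "x \<in> A \<Longrightarrow> y \<in> A \<Longrightarrow> x \<otimes> y \<in> A"
    and A_neg [simp]: "x \<in> A \<Longrightarrow> \<ominus> x \<in> A"
begin

lemma A_carrier [simp]: "x \<in> A \<Longrightarrow> x \<in> carrier T"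
  using A_subset by blast

lemma A_zero [simp]: "\<zero> \<in> A"
  using A_add[OF A_one A_neg[OF A_one]] by (simp add: r_neg)

lemma A_minus [simp]: "x \<in> A \<Longrightarrow> y \<in> A \<Longrightarrow> x \<ominus> y \<in> A"
  by (simp add: minus_eq)

lemma A_pow [simp]: "x \<in> A \<Longrightarrow> x [^] (n::nat) \<in> A"
  by (induct n) auto

definition A_module :: "'a set \<Rightarrow> bool" where
  "A_module I \<longleftrightarrow> I \<subseteq> carrier T \<and> \<zero> \<in> I \<and> (\<forall>x\<in>I. \<forall>y\<in>I. x \<oplus> y \<in> I) \<and> (\<forall>a\<in>A. \<forall>x\<in>I. a \<otimes> x \<in> I)"

definition A_ideal :: "'a set \<Rightarrow> bool" where
  "A_ideal I \<longleftrightarrow> A_module I \<and> I \<subseteq> A"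

definition A_prime :: "'a set \<Rightarrow> bool" where
  "A_prime P \<longleftrightarrow> A_ideal P \<and> \<one> \<notin> P \<and> (\<forall>a\<in>A. \<forall>b\<in>A. a \<otimes> b \<in> P \<longrightarrow> a \<in> P \<or> b \<in> P)"

text \<open>A finite generating set stands for an ideal in rGV: both J^{-1} = A and the condition
  that x J lies in a module can be tested on generators. The unit is required in \<open>F\<close>
  itself, which costs nothing because a regular element of the ideal can be added to its
  generators.\<close>

definition GV :: "'a set \<Rightarrow> bool" where
  "GV F \<longleftrightarrow> finite F \<and> F \<subseteq> A \<and> F \<inter> Units T \<noteq> {} \<and>
     (\<forall>x\<in>carrier T. (\<forall>f\<in>F. x \<otimes> f \<in> A) \<longrightarrow> x \<in> A)"

definition u_hull :: "'a set \<Rightarrow> 'a set" where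
  "u_hull I = {x \<in> carrier T. \<exists>F. GV F \<and> (\<forall>f\<in>F. x \<otimes> f \<in> I)}"

definition ideal_product :: "'a set list \<Rightarrow> 'a set" where
  "ideal_product Ps = foldr (ideal_prod T) Ps A"

definition principal :: "'a \<Rightarrow> 'a set" where
  "principal a = (\<lambda>c. a \<otimes> c) ` A"

lemma A_moduleI:
  assumes "I \<subseteq> carrier T" "\<zero> \<in> I" "\<And>x y. x \<in> I \<Longrightarrow> y \<in> I \<Longrightarrow> x \<oplus> y \<in> I"
    "\<And>a x. a \<in> A \<Longrightarrow> x \<in> I \<Longrightarrow> a \<otimes> x \<in> I"
  shows "A_module I"
  using assms by (auto simp: A_module_def)

lemma A_moduleD:
  assumes "A_module I"
  shows "\<And>x. x \<in> I \<Longrightarrow> x \<in> carrier T" "\<zero> \<in> I" "\<And>x y. x \<in> I \<Longrightarrow> y \<in> I \<Longrightarrow> x \<oplus> y \<in> I"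
    "\<And>a x. a \<in> A \<Longrightarrow> x \<in> I \<Longrightarrow> a \<otimes> x \<in> I" "\<And>a x. a \<in> A \<Longrightarrow> x \<in> I \<Longrightarrow> x \<otimes> a \<in> I"
    "\<And>x. x \<in> I \<Longrightarrow> \<ominus> x \<in> I" "\<And>x y. x \<in> I \<Longrightarrow> y \<in> I \<Longrightarrow> x \<ominus> y \<in> I"
proof -
  show 1: "\<And>x. x \<in> I \<Longrightarrow> x \<in> carrier T" and 2: "\<zero> \<in> I"
    and 3: "\<And>x y. x \<in> I \<Longrightarrow> y \<in> I \<Longrightarrow> x \<oplus> y \<in> I"
    and 4: "\<And>a x. a \<in> A \<Longrightarrow> x \<in> I \<Longrightarrow> a \<otimes> x \<in> I"
    using assms by (auto simp: A_module_def)
  then show "\<And>a x. a \<in> A \<Longrightarrow> x \<in> I \<Longrightarrow> x \<otimes> a \<in> I" by (simp add: m_comm)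
  show 5: "\<ominus> x \<in> I" if "x \<in> I" for x
    using 4[of "\<ominus> \<one>" x] 1[OF that] that by (simp add: l_minus)
  show "\<And>x y. x \<in> I \<Longrightarrow> y \<in> I \<Longrightarrow> x \<ominus> y \<in> I" using 3 5 by (simp add: minus_eq)
qed

lemma A_ideal_A_module: "A_ideal I \<Longrightarrow> A_module I" by (simp add: A_ideal_def)
lemma A_ideal_A: "A_ideal I \<Longrightarrow> x \<in> I \<Longrightarrow> x \<in> A" by (auto simp: A_ideal_def)
lemma A_prime_A_ideal: "A_prime P \<Longrightarrow> A_ideal P" by (simp add: A_prime_def)
lemmas A_prime_A_module = A_prime_A_ideal[THEN A_ideal_A_module]
lemmas A_prime_A = A_prime_A_ideal[THEN A_ideal_A]
lemma A_prime_one: "A_prime P \<Longrightarrow> \<one> \<notin> P" by (simp add: A_prime_def)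
lemma A_prime_mem: "A_prime P \<Longrightarrow> a \<otimes> b \<in> P \<Longrightarrow> a \<in> A \<Longrightarrow> b \<in> A \<Longrightarrow> a \<in> P \<or> b \<in> P"
  by (simp add: A_prime_def)
lemma A_prime_mult_notin: "A_prime P \<Longrightarrow> a \<in> A - P \<Longrightarrow> b \<in> A - P \<Longrightarrow> a \<otimes> b \<in> A - P"
  using A_prime_mem by auto

lemma A_prime_pow_notin: "A_prime P \<Longrightarrow> a \<in> A - P \<Longrightarrow> a [^] (n::nat) \<in> A - P"
proof (induct n)
  case 0 then show ?case using A_prime_one by auto
next
  case (Suc n) then show ?case using A_prime_mult_notin[OF Suc(2) Suc(1)] by simp
qed

lemma A_prime_pow_mem: "A_prime P \<Longrightarrow> a \<in> A \<Longrightarrow> a [^] (n::nat) \<in> P \<Longrightarrow> a \<in> P"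
  using A_prime_pow_notin[of P a n] by auto

lemma A_module_A: "A_module A"
  by (rule A_moduleI) auto
lemma A_ideal_A_self: "A_ideal A"
  by (simp add: A_ideal_def A_module_A)

lemma A_ideal_eq_A: "A_ideal I \<Longrightarrow> \<one> \<in> I \<Longrightarrow> I = A"
proof -
  assume h: "A_ideal I" "\<one> \<in> I"
  have "a \<in> I" if "a \<in> A" for a using A_moduleD(4)[OF A_ideal_A_module[OF h(1)] that h(2)] that by simp
  then show ?thesis using A_ideal_A[OF h(1)] by auto
qed

lemma A_module_principal: "a \<in> carrier T \<Longrightarrow> A_module (principal a)"
proof (rule A_moduleI)
  assume a: "a \<in> carrier T"
  then show "principal a \<subseteq> carrier T" by (auto simp: principal_def)
  show "\<zero> \<in> principal a" using a by (auto simp: principal_def intro!: image_eqI[of _ _ \<zero>])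
  fix x y assume "x \<in> principal a" "y \<in> principal a"
  then obtain c d where "c \<in> A" "d \<in> A" "x = a \<otimes> c" "y = a \<otimes> d" by (auto simp: principal_def)
  then show "x \<oplus> y \<in> principal a" using a by (auto simp: principal_def r_distr intro!: image_eqI[of _ _ "c \<oplus> d"])
next
  fix b x assume a: "a \<in> carrier T" and "b \<in> A" "x \<in> principal a"
  then obtain c where "c \<in> A" "x = a \<otimes> c" by (auto simp: principal_def)
  then show "b \<otimes> x \<in> principal a"
    using a \<open>b \<in> A\<close> by (auto simp: principal_def m_lcomm intro!: image_eqI[of _ _ "b \<otimes> c"])
qed

lemma A_ideal_principal: "a \<in> A \<Longrightarrow> A_ideal (principal a)"
  by (auto simp: A_ideal_def A_module_principal) (auto simp: principal_def)

lemma principal_self: "a \<in> carrier T \<Longrightarrow> a \<in> principal a"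
  by (auto simp: principal_def intro!: image_eqI[of _ _ \<one>])

lemma principal_mem: "x \<in> principal a \<longleftrightarrow> (\<exists>c\<in>A. x = a \<otimes> c)"
  by (auto simp: principal_def)

lemma principal_subset: "A_module I \<Longrightarrow> a \<in> I \<Longrightarrow> principal a \<subseteq> I"
  by (auto simp: principal_def A_moduleD)

lemma prod_subset:
  assumes "\<And>i j. i \<in> I \<Longrightarrow> j \<in> J \<Longrightarrow> i \<otimes> j \<in> K" "\<And>x y. x \<in> K \<Longrightarrow> y \<in> K \<Longrightarrow> x \<oplus> y \<in> K"
  shows "I \<cdot> J \<subseteq> K"
proof
  fix x assume "x \<in> I \<cdot> J" then show "x \<in> K" by induct (auto intro: assms)
qed

lemma prod_subset_A_module:
  assumes "\<And>i j. i \<in> I \<Longrightarrow> j \<in> J \<Longrightarrow> i \<otimes> j \<in> K" "A_module K"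
  shows "I \<cdot> J \<subseteq> K"
  by (rule prod_subset) (auto intro: assms A_moduleD(3)[OF assms(2)])

lemma A_module_prod:
  assumes "A_module I" "J \<subseteq> carrier T" "J \<noteq> {}"
  shows "A_module (I \<cdot> J)"
proof -
  have c: "I \<cdot> J \<subseteq> carrier T" by (rule prod_subset) (use assms in \<open>auto intro: A_moduleD\<close>)
  show ?thesis
  proof (rule A_moduleI[OF c])
    obtain j where j: "j \<in> J" using assms by auto
    show "\<zero> \<in> I \<cdot> J" using ideal_prod.prod[OF A_moduleD(2)[OF assms(1)] j, of T] j assms by auto
    show "x \<oplus> y \<in> I \<cdot> J" if "x \<in> I \<cdot> J" "y \<in> I \<cdot> J" for x y
      using that by (rule ideal_prod.sum)
    fix a x assume a: "a \<in> A" and "x \<in> I \<cdot> J"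
    from this(2) show "a \<otimes> x \<in> I \<cdot> J"
    proof induct
      case (prod i j)
      then have "a \<otimes> (i \<otimes> j) = (a \<otimes> i) \<otimes> j"
        using a assms A_moduleD(1)[OF assms(1)] by (auto simp: m_assoc)
      then show ?case using ideal_prod.prod[of "a \<otimes> i" I j J T] prod A_moduleD(4)[OF assms(1) a] by simp
    next
      case (sum x y)
      then have "a \<otimes> (x \<oplus> y) = a \<otimes> x \<oplus> a \<otimes> y" using a c by (simp add: r_distr subset_iff)
      then show ?case using sum by (simp add: ideal_prod.sum)
    qed
  qed
qed

lemma A_ideal_prod:
  assumes "A_ideal I" "A_ideal J"
  shows "A_ideal (I \<cdot> J)"
proof -
  have "A_module (I \<cdot> J)" using assms A_moduleD(1,2)[OF A_ideal_A_module[OF assms(2)]]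
    by (intro A_module_prod A_ideal_A_module) auto
  moreover have "I \<cdot> J \<subseteq> A" by (rule prod_subset) (use assms[THEN A_ideal_A] in auto)
  ultimately show ?thesis by (simp add: A_ideal_def)
qed

lemma prod_le:
  assumes "A_ideal I" "A_ideal J"
  shows "I \<cdot> J \<subseteq> I" "I \<cdot> J \<subseteq> J"
proof -
  note m = assms[THEN A_ideal_A_module]
  show "I \<cdot> J \<subseteq> I" by (rule prod_subset_A_module[OF A_moduleD(5)[OF m(1) A_ideal_A[OF assms(2)]] m(1)])
  show "I \<cdot> J \<subseteq> J" by (rule prod_subset_A_module[OF A_moduleD(4)[OF m(2) A_ideal_A[OF assms(1)]] m(2)])
qed

lemma prod_mono: "I \<subseteq> I' \<Longrightarrow> J \<subseteq> J' \<Longrightarrow> I \<cdot> J \<subseteq> I' \<cdot> J'"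
  by (rule prod_subset) (auto intro: ideal_prod.intros)

lemma ideal_product_simps [simp]: "ideal_product [] = A" "ideal_product (P # Ps) = P \<cdot> ideal_product Ps"
  by (simp_all add: ideal_product_def)

lemma A_ideal_ideal_product: "(\<And>P. P \<in> set Ps \<Longrightarrow> A_ideal P) \<Longrightarrow> A_ideal (ideal_product Ps)"
  by (induct Ps) (auto intro: A_ideal_prod A_ideal_A_self)

lemma ideal_product_prime:
  assumes "A_prime P" "ideal_product Ps \<subseteq> P" "\<And>Q. Q \<in> set Ps \<Longrightarrow> A_ideal Q"
  shows "\<exists>Q\<in>set Ps. Q \<subseteq> P"
  using assms(2,3)
proof (induct Ps)
  case Nil
  then show ?case using A_prime_one[OF assms(1)] A_one by (metis ideal_product_simps(1) subsetD)
next
  case (Cons Q Ps)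
  show ?case
  proof (cases "Q \<subseteq> P")
    case False
    then obtain q where q: "q \<in> Q" "q \<notin> P" by auto
    have "x \<in> P" if "x \<in> ideal_product Ps" for x
    proof -
      have "q \<otimes> x \<in> P" using Cons(2) ideal_prod.prod[OF q(1) that, of T] by auto
      then show ?thesis using A_prime_mem[OF assms(1)] q A_ideal_A[OF Cons(3)] A_ideal_A[OF A_ideal_ideal_product[of Ps] that] Cons(3) by auto
    qed
    then show ?thesis using Cons(1,3) by auto
  qed auto
qed

lemma prod_assoc:
  assumes a: "A_ideal P" "A_ideal I" "A_ideal J"
  shows "P \<cdot> (I \<cdot> J) = (P \<cdot> I) \<cdot> J"
proof
  note c = a[THEN A_ideal_A, THEN A_carrier]
  show "P \<cdot> (I \<cdot> J) \<subseteq> (P \<cdot> I) \<cdot> J"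
  proof (rule prod_subset_A_module)
    show m: "A_module ((P \<cdot> I) \<cdot> J)" by (intro A_ideal_A_module A_ideal_prod a)
    fix p z assume p: "p \<in> P" and "z \<in> I \<cdot> J"
    from this(2) show "p \<otimes> z \<in> (P \<cdot> I) \<cdot> J"
    proof induct
      case (prod x y)
      then show ?case using p ideal_prod.prod[OF ideal_prod.prod[OF p prod(1)] prod(2), of T T] c
        by (simp add: m_assoc)
    next
      case (sum x y)
      moreover have "x \<in> carrier T" "y \<in> carrier T" using sum A_ideal_A[OF A_ideal_prod[OF a(2,3)]] by auto
      ultimately show ?case using c(1)[OF p] A_moduleD(3)[OF m] by (simp add: r_distr)
    qed
  qed
  show "(P \<cdot> I) \<cdot> J \<subseteq> P \<cdot> (I \<cdot> J)"
  proof (rule prod_subset_A_module)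
    show m: "A_module (P \<cdot> (I \<cdot> J))" by (intro A_ideal_A_module A_ideal_prod a)
    fix z q assume q: "q \<in> J" and "z \<in> P \<cdot> I"
    from this(2) show "z \<otimes> q \<in> P \<cdot> (I \<cdot> J)"
    proof induct
      case (prod x y)
      then show ?case using q ideal_prod.prod[OF prod(1) ideal_prod.prod[OF prod(2) q], of T T] c
        by (simp add: m_assoc)
    next
      case (sum x y)
      moreover have "x \<in> carrier T" "y \<in> carrier T" using sum A_ideal_A[OF A_ideal_prod[OF a(1,2)]] by auto
      ultimately show ?case using c(3)[OF q] A_moduleD(3)[OF m] by (simp add: l_distr)
    qed
  qed
qed

lemma GV_carrier: "GV F \<Longrightarrow> f \<in> F \<Longrightarrow> f \<in> A"
  unfolding GV_def by blast

lemma GV_D: "GV F \<Longrightarrow> x \<in> carrier T \<Longrightarrow> (\<And>f. f \<in> F \<Longrightarrow> x \<otimes> f \<in> A) \<Longrightarrow> x \<in> A"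
  unfolding GV_def by blast

lemma GV_unit: "GV F \<Longrightarrow> \<exists>f\<in>F. f \<in> Units T"
  unfolding GV_def by blast

lemma GV_one: "GV {\<one>}"
  by (simp add: GV_def)

text \<open>The second set may depend on the element of the first, which is the form that
  idempotence of \<open>u_hull\<close> requires. Membership in \<open>A\<close> is pulled back first
  through each \<open>G f\<close>, then through \<open>F\<close>.\<close>

lemma GV_bind:
  assumes F: "GV F" and G: "\<And>f. f \<in> F \<Longrightarrow> GV (G f)"
  shows "GV (\<Union>f\<in>F. (\<lambda>g. f \<otimes> g) ` G f)"
  unfolding GV_def
proof (intro conjI ballI impI)
  have "finite F" "\<And>f. f \<in> F \<Longrightarrow> finite (G f)" "F \<subseteq> A" "\<And>f. f \<in> F \<Longrightarrow> G f \<subseteq> A"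
    using F G unfolding GV_def by blast+
  then show "finite (\<Union>f\<in>F. (\<otimes>) f ` G f)" "(\<Union>f\<in>F. (\<otimes>) f ` G f) \<subseteq> A"
    by (blast intro: A_mult)+
  obtain f where f: "f \<in> F" "f \<in> Units T" using GV_unit[OF F] by blast
  obtain g where g: "g \<in> G f" "g \<in> Units T" using GV_unit[OF G[OF f(1)]] by blast
  have "f \<otimes> g \<in> Units T" using f g by simp
  then show "(\<Union>f\<in>F. (\<otimes>) f ` G f) \<inter> Units T \<noteq> {}" using f(1) g(1) by blast
  fix x assume x: "x \<in> carrier T" "\<forall>h\<in>\<Union>f\<in>F. (\<otimes>) f ` G f. x \<otimes> h \<in> A"
  have "x \<otimes> f \<in> A" if f: "f \<in> F" for f
  proof (rule GV_D[OF G[OF f]])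
    note fA = GV_carrier[OF F f]
    show "x \<otimes> f \<in> carrier T" using x(1) fA by simp
    fix g assume g: "g \<in> G f"
    show "(x \<otimes> f) \<otimes> g \<in> A"
      using x f g fA GV_carrier[OF G[OF f] g] by (simp add: m_assoc)
  qed
  then show "x \<in> A" by (rule GV_D[OF F x(1)])
qed


lemma u_hullI: "x \<in> carrier T \<Longrightarrow> GV F \<Longrightarrow> (\<And>f. f \<in> F \<Longrightarrow> x \<otimes> f \<in> I) \<Longrightarrow> x \<in> u_hull I"
  by (auto simp: u_hull_def)

lemma u_hull_carrier: "x \<in> u_hull I \<Longrightarrow> x \<in> carrier T"
  by (simp add: u_hull_def)

lemma u_hull_incl: "I \<subseteq> carrier T \<Longrightarrow> I \<subseteq> u_hull I"
proof
  fix x assume "I \<subseteq> carrier T" "x \<in> I"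
  then show "x \<in> u_hull I" by (intro u_hullI[OF _ GV_one]) auto
qed

lemma u_hull_mono: "I \<subseteq> J \<Longrightarrow> u_hull I \<subseteq> u_hull J"
  unfolding u_hull_def by blast

lemma u_hull_idem: 
  assumes "I \<subseteq> carrier T"
  shows "u_hull (u_hull I) = u_hull I"
proof
  show "u_hull I \<subseteq> u_hull (u_hull I)" by (intro u_hull_incl subsetI u_hull_carrier)
  show "u_hull (u_hull I) \<subseteq> u_hull I"
  proof
    fix x assume "x \<in> u_hull (u_hull I)"
    then obtain F where F: "x \<in> carrier T" "GV F" "\<And>f. f \<in> F \<Longrightarrow> x \<otimes> f \<in> u_hull I" by (auto simp: u_hull_def)
    then have "\<forall>f\<in>F. \<exists>G. GV G \<and> (\<forall>g\<in>G. (x \<otimes> f) \<otimes> g \<in> I)" by (auto simp: u_hull_def)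
    then obtain G where G: "\<And>f. f \<in> F \<Longrightarrow> GV (G f)" "\<And>f g. f \<in> F \<Longrightarrow> g \<in> G f \<Longrightarrow> (x \<otimes> f) \<otimes> g \<in> I"
      by metis
    show "x \<in> u_hull I"
    proof (rule u_hullI[OF F(1) GV_bind[OF F(2) G(1)]])
      fix h assume "h \<in> (\<Union>f\<in>F. (\<otimes>) f ` G f)"
      then show "x \<otimes> h \<in> I" using G(2) F(1) GV_carrier[OF F(2)] GV_carrier[OF G(1)]
        by (auto simp: m_assoc[symmetric])
    qed
  qed
qed

lemma u_hull_A: "u_hull A = A"
proof
  show "A \<subseteq> u_hull A" by (rule u_hull_incl) auto
  show "u_hull A \<subseteq> A" by (auto simp: u_hull_def intro: GV_D)
qed

lemma A_module_u_hull:
  assumes "A_module I"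
  shows "A_module (u_hull I)"
proof (rule A_moduleI)
  note I = A_moduleD[OF assms]
  show "u_hull I \<subseteq> carrier T" by (auto intro: u_hull_carrier)
  show "\<zero> \<in> u_hull I" using u_hull_incl[of I] I by auto
  fix x y assume "x \<in> u_hull I" "y \<in> u_hull I"
  then obtain F G where h: "x \<in> carrier T" "y \<in> carrier T" "GV F" "GV G"
    "\<And>f. f \<in> F \<Longrightarrow> x \<otimes> f \<in> I" "\<And>f. f \<in> G \<Longrightarrow> y \<otimes> f \<in> I" by (auto simp: u_hull_def)
  show "x \<oplus> y \<in> u_hull I"
  proof (rule u_hullI[OF _ GV_bind[OF h(3), of "\<lambda>_. G"]])
    fix k assume "k \<in> (\<Union>f\<in>F. (\<otimes>) f ` G)"
    then obtain f g where fg: "f \<in> F" "g \<in> G" "k = f \<otimes> g" by auto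
    note A = GV_carrier[OF h(3) fg(1)] GV_carrier[OF h(4) fg(2)]
    have "(x \<oplus> y) \<otimes> k = g \<otimes> (x \<otimes> f) \<oplus> f \<otimes> (y \<otimes> g)"
      using A h(1,2) fg(3) by (simp add: l_distr r_distr m_ac)
    then show "(x \<oplus> y) \<otimes> k \<in> I" using I(3,4) A h(5,6) fg by auto
  qed (use h in auto)
next
  note I = A_moduleD[OF assms]
  fix a x assume a: "a \<in> A" and "x \<in> u_hull I"
  then obtain F where h: "x \<in> carrier T" "GV F" "\<And>f. f \<in> F \<Longrightarrow> x \<otimes> f \<in> I" by (auto simp: u_hull_def)
  show "a \<otimes> x \<in> u_hull I"
    by (rule u_hullI[OF _ h(2)]) (use a h I(4) GV_carrier[OF h(2)] in \<open>auto simp: m_assoc\<close>)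
qed

lemma A_ideal_u_hull: "A_ideal I \<Longrightarrow> A_ideal (u_hull I)"
  using A_module_u_hull[of I] u_hull_mono[of I A] by (auto simp: A_ideal_def u_hull_A)

lemma u_hull_prod_subset:
  assumes "A_module I" "A_module K"
  shows "I \<cdot> u_hull K \<subseteq> u_hull (I \<cdot> K)"
proof (rule prod_subset_A_module)
  note c = A_moduleD(1)[OF assms(1)] A_moduleD(1)[OF assms(2)]
  show "A_module (u_hull (I \<cdot> K))" using assms A_moduleD(2)[OF assms(2)] c by (intro A_module_u_hull A_module_prod) auto
  fix i x assume i: "i \<in> I" "x \<in> u_hull K"
  then obtain F where h: "x \<in> carrier T" "GV F" "\<And>f. f \<in> F \<Longrightarrow> x \<otimes> f \<in> K" by (auto simp: u_hull_def)
  show "i \<otimes> x \<in> u_hull (I \<cdot> K)"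
  proof (rule u_hullI[OF _ h(2)])
    fix f assume f: "f \<in> F"
    have "i \<otimes> x \<otimes> f = i \<otimes> (x \<otimes> f)" using c i h GV_carrier[OF h(2) f] by (simp add: m_assoc)
    then show "i \<otimes> x \<otimes> f \<in> I \<cdot> K" using ideal_prod.prod[OF i(1) h(3)[OF f], of T] by simp
  qed (use i c h in auto)
qed

text \<open>Lets closures inside a product be inserted or removed under an outer closure, so that
  factorizations can be assembled one prime at a time.\<close>

lemma u_hull_prod_u_hull:
  assumes "A_module I" "A_module K"
  shows "u_hull (I \<cdot> u_hull K) = u_hull (I \<cdot> K)"
proof
  have c: "I \<subseteq> carrier T" "K \<subseteq> carrier T" using A_moduleD(1)[OF assms(1)] A_moduleD(1)[OF assms(2)] by auto
  have "I \<cdot> K \<subseteq> carrier T" using A_moduleD(1)[OF A_module_prod[OF assms(1) c(2)]] A_moduleD(2)[OF assms(2)] by auto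
  then show "u_hull (I \<cdot> u_hull K) \<subseteq> u_hull (I \<cdot> K)"
    using u_hull_mono[OF u_hull_prod_subset[OF assms]] by (simp add: u_hull_idem)
  show "u_hull (I \<cdot> K) \<subseteq> u_hull (I \<cdot> u_hull K)"
    using u_hull_incl[OF c(2)] by (intro u_hull_mono prod_mono) auto
qed

lemma prod_comm:
  assumes "I \<subseteq> carrier T" "J \<subseteq> carrier T"
  shows "I \<cdot> J = J \<cdot> I"
proof -
  have "I \<cdot> J \<subseteq> J \<cdot> I" if c: "I \<subseteq> carrier T" "J \<subseteq> carrier T" for I J
  proof (rule prod_subset)
    fix i j assume "i \<in> I" "j \<in> J"
    then show "i \<otimes> j \<in> J \<cdot> I" using ideal_prod.prod[of j J i I T] c m_comm[of i j] by (simp add: subset_iff)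
  qed (rule ideal_prod.sum)
  then show ?thesis using assms by blast
qed

lemma ideal_product_extract:
  assumes "P \<in> set Ps" "\<And>P. P \<in> set Ps \<Longrightarrow> A_ideal P"
  shows "ideal_product Ps = P \<cdot> ideal_product (remove1 P Ps)"
  using assms
proof (induct Ps)
  case (Cons Q Ps)
  show ?case
  proof (cases "P = Q")
    case False
    then have P: "P \<in> set Ps" using Cons(2) by auto
    have a: "A_ideal P" "A_ideal Q" "A_ideal (ideal_product (remove1 P Ps))"
      using Cons(3) P set_remove1_subset[of P Ps] by (auto intro!: A_ideal_ideal_product)
    note c = a[THEN A_ideal_A, THEN A_carrier]
    have "ideal_product (Q # Ps) = Q \<cdot> (P \<cdot> ideal_product (remove1 P Ps))" using Cons(1)[OF P] Cons(3) by simp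
    also have "\<dots> = (P \<cdot> Q) \<cdot> ideal_product (remove1 P Ps)"
      unfolding prod_assoc[OF a(2,1,3)] using prod_comm[of P Q] c by (simp add: subsetI)
    also have "\<dots> = P \<cdot> ideal_product (remove1 P (Q # Ps))" using prod_assoc[OF a] False by auto
    finally show ?thesis .
  qed simp
qed simp

end

section \<open>Elementary properties of discrete valuations\<close>

context cring
begin

lemma valuation_mult:
  assumes "rank_one_discrete_valuation R v" "a \<in> carrier R" "b \<in> carrier R"
  shows "v (a \<otimes> b) = v a + v b"
  using assms by (simp add: rank_one_discrete_valuation_def)

lemma valuation_add:
  assumes "rank_one_discrete_valuation R v" "a \<in> carrier R" "b \<in> carrier R"
  shows "min (v a) (v b) \<le> v (a \<oplus> b)"
  using assms by (simp add: rank_one_discrete_valuation_def)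

lemma valuation_cases:
  assumes "rank_one_discrete_valuation R v" "a \<in> carrier R"
  obtains "v a = Pinf" | n where "v a = Fin n"
proof -
  have "v a \<in> insert Pinf (range Fin)"
    using assms imageI[of a "carrier R" v] by (simp add: rank_one_discrete_valuation_def)
  then show thesis using that by auto
qed

text \<open>The equation v(a) = v(1) + v(a) determines v(1) only if v(a) is finite; surjectivity
  supplies an element of value 0.\<close>

lemma valuation_one:
  assumes "rank_one_discrete_valuation R v"
  shows "v \<one> = 0"
proof -
  have "v ` carrier R = insert Pinf (range Fin)" using assms by (simp add: rank_one_discrete_valuation_def)
  moreover have "Fin 0 \<in> insert Pinf (range Fin :: int extended set)" by simp
  ultimately have "Fin 0 \<in> v ` carrier R" by metis
  then obtain a where a: "a \<in> carrier R" "v a = Fin 0" by auto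
  have "v a = v \<one> + v a" using valuation_mult[OF assms one_closed a(1)] a by simp
  then show ?thesis using a valuation_cases[OF assms one_closed] by (cases "v \<one>") (auto simp: zero_extended_def)
qed

lemma valuation_zero:
  assumes "rank_one_discrete_valuation R v"
  shows "v \<zero> = Pinf"
proof -
  have "v ` carrier R = insert Pinf (range Fin)" using assms by (simp add: rank_one_discrete_valuation_def)
  moreover have "Pinf \<in> insert Pinf (range Fin :: int extended set)" by simp
  ultimately have "Pinf \<in> v ` carrier R" by metis
  then obtain a where a: "a \<in> carrier R" "v a = Pinf" by auto
  have "v \<zero> = v \<zero> + v a" using valuation_mult[OF assms zero_closed a(1)] a by simp
  then show ?thesis using a by (cases "v \<zero>") auto
qed

lemma valuation_unit:
  assumes v: "rank_one_discrete_valuation R v" and u: "u \<in> Units R"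
  obtains n where "v u = Fin n" "v (inv u) = Fin (- n)"
proof -
  have "v u + v (inv u) = Fin 0"
    using valuation_mult[OF v Units_closed[OF u] Units_inv_closed[OF u]] Units_r_inv[OF u]
      valuation_one[OF v] by (simp add: zero_extended_def)
  then obtain n m where "v u = Fin n" "v (inv u) = Fin m" "n + m = 0"
    by (cases "v u"; cases "v (inv u)") auto
  then show thesis using that[of n] by (simp add: add_eq_0_iff)
qed

lemma valuation_pow:
  assumes v: "rank_one_discrete_valuation R v" and "a \<in> carrier R" "v a = Fin k"
  shows "v (a [^] (n::nat)) = Fin (int n * k)"
proof (induct n)
  case 0 then show ?case using valuation_one[OF v] by (simp add: zero_extended_def)
next
  case (Suc n) then show ?case using valuation_mult[OF v, of "a [^] n" a] assms by (simp add: algebra_simps)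
qed

end

section \<open>Krull rings and regular \<open>u\<close>-ideals\<close>

text \<open>An axiomatic total quotient ring: elements of \<open>T\<close> become elements of
  \<open>A\<close> after multiplication by a unit of \<open>T\<close> lying in \<open>A\<close>, and
  the non-zero-divisors of \<open>A\<close> are units of \<open>T\<close>. No representation of
  fractions is needed.\<close>

locale frac_pair = ring_pair +
  assumes frac: "x \<in> carrier T \<Longrightarrow> \<exists>s\<in>A \<inter> Units T. s \<otimes> x \<in> A"
    and reg_unit: "a \<in> A \<Longrightarrow> (\<And>b. b \<in> A \<Longrightarrow> a \<otimes> b = \<zero> \<Longrightarrow> b = \<zero>) \<Longrightarrow> a \<in> Units T"
    and nontriv: "\<one> \<noteq> \<zero>"
begin

text \<open>The valuations replace the pairs (V, P). For a regular element a of the ring, a V = V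
  means v(a) = 0, and a regular P means that some regular element has positive value.\<close>

definition krull_family :: "('a \<Rightarrow> int extended) set \<Rightarrow> bool" where
  "krull_family W \<longleftrightarrow> (\<forall>v\<in>W. rank_one_discrete_valuation T v) \<and>
     (\<forall>x\<in>carrier T. (\<forall>v\<in>W. 0 \<le> v x) \<longleftrightarrow> x \<in> A) \<and>
     (\<forall>a\<in>A \<inter> Units T. finite {v \<in> W. v a \<noteq> 0}) \<and>
     (\<forall>v\<in>W. \<exists>a\<in>A \<inter> Units T. 0 < v a)"

definition krull :: bool where "krull \<longleftrightarrow> (\<exists>W. krull_family W)"

definition inv_module :: "'a set \<Rightarrow> 'a set" where
  "inv_module Z = {x \<in> carrier T. \<forall>y\<in>Z. x \<otimes> y \<in> A}"

lemma unit_cancel: "u \<in> Units T \<Longrightarrow> x \<in> carrier T \<Longrightarrow> inv u \<otimes> (u \<otimes> x) = x"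
  "u \<in> Units T \<Longrightarrow> x \<in> carrier T \<Longrightarrow> u \<otimes> (inv u \<otimes> x) = x"
  by (simp_all add: m_assoc[symmetric] Units_closed)

lemma fracE:
  assumes "x \<in> carrier T"
  obtains s a where "s \<in> A" "s \<in> Units T" "a \<in> A" "s \<otimes> x = a" "x = inv s \<otimes> a"
  using frac[OF assms] unit_cancel(1)[OF _ assms] by (metis IntE)

lemma krull_familyD:
  assumes "krull_family W"
  shows "\<And>v. v \<in> W \<Longrightarrow> rank_one_discrete_valuation T v"
    "\<And>x. x \<in> carrier T \<Longrightarrow> (\<And>v. v \<in> W \<Longrightarrow> 0 \<le> v x) \<Longrightarrow> x \<in> A"
    "\<And>x v. x \<in> A \<Longrightarrow> v \<in> W \<Longrightarrow> 0 \<le> v x"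
    "\<And>a. a \<in> A \<Longrightarrow> a \<in> Units T \<Longrightarrow> finite {v \<in> W. v a \<noteq> 0}"
  using assms unfolding krull_family_def by (blast, blast, meson A_carrier, blast)

text \<open>At a valuation with v(c) = k and v(x) = m the hypothesis reads k + n m \<ge> 0 for all
  n, which excludes m < 0.\<close>

lemma krull_completely_integrally_closed:
  assumes krull and x: "x \<in> carrier T" and c: "c \<in> Units T" and cx: "\<And>n::nat. c \<otimes> x [^] n \<in> A"
  shows "x \<in> A"
proof -
  obtain W where W: "krull_family W" using \<open>krull\<close> by (auto simp: krull_def)
  show ?thesis
  proof (rule krull_familyD(2)[OF W x])
    fix v assume v: "v \<in> W"
    note val = krull_familyD(1)[OF W v]
    obtain k where k: "v c = Fin k" using valuation_unit[OF val c] .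
    show "0 \<le> v x" using val x
    proof (cases rule: valuation_cases)
      case (2 m)
      have "0 \<le> k + int n * m" for n
        using krull_familyD(3)[OF W cx v, of n] valuation_mult[OF val, of c "x [^] n"] Units_closed[OF c] x k
          valuation_pow[OF val x 2, of n] by (simp add: zero_extended_def)
      \<comment> \<open>With this many factors a negative \<open>m\<close> would outweigh
        \<open>k\<close>.\<close>
      from this[of "nat (\<bar>k\<bar> + 1)"] have "0 \<le> k + (\<bar>k\<bar> + 1) * m" by simp
      have "0 \<le> m"
      proof (rule ccontr)
        assume "\<not> 0 \<le> m"
        then have "(\<bar>k\<bar> + 1) * m \<le> (\<bar>k\<bar> + 1) * (-1)" by (intro mult_left_mono) auto
        then show False using \<open>0 \<le> k + (\<bar>k\<bar> + 1) * m\<close> by (simp add: abs_if split: if_splits)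
      qed
      then show ?thesis using 2 by (simp add: zero_extended_def)
    qed simp
  qed
qed

text \<open>All positive powers of an idempotent coincide, so one denominator clears all of
  them.\<close>

lemma krull_idem:
  assumes krull "x \<in> carrier T" "x \<otimes> x = x"
  shows "x \<in> A"
proof -
  obtain s where s: "s \<in> A" "s \<in> Units T" "s \<otimes> x \<in> A" using frac[OF assms(2)] by auto
  have p: "x [^] (Suc n) = x" for n :: nat using assms(2,3) by (induct n) auto
  have "s \<otimes> x [^] n \<in> A" for n :: nat using p[of "n - 1"] s by (cases n) (auto simp del: nat_pow_Suc)
  then show ?thesis using krull_completely_integrally_closed[OF assms(1,2) s(2)] by simp
qed

text \<open>A finite value of x would give x^n a finite value, but 0 has infinite value. Hence every
  valuation is infinite at x, in particular nonnegative.\<close>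

lemma krull_nilp:
  assumes krull "x \<in> carrier T" "x [^] (n::nat) = \<zero>"
  shows "x \<in> A"
proof -
  obtain W where W: "krull_family W" using \<open>krull\<close> by (auto simp: krull_def)
  show ?thesis
  proof (rule krull_familyD(2)[OF W assms(2)])
    fix v assume v: "v \<in> W"
    note val = krull_familyD(1)[OF W v]
    show "0 \<le> v x" using val assms(2)
    proof (cases rule: valuation_cases)
      case (2 m)
      then show ?thesis using valuation_pow[OF val assms(2) 2, of n] valuation_zero[OF val] assms(3) by simp
    qed simp
  qed
qed

text \<open>A fingerprint of a set \<open>Z\<close> containing the regular element \<open>a\<close>.
  Only the finitely many valuations with v(a) nonzero matter, and only values up to v(a), because
  \<open>a\<close> itself already imposes the bound v(a).\<close>

definition bounded_values :: "('a \<Rightarrow> int extended) set \<Rightarrow> 'a \<Rightarrow> 'a set \<Rightarrow> (('a \<Rightarrow> int extended) \<times> int extended) set" where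
  "bounded_values W a Z = {(v, v y) | v y. v \<in> W \<and> v a \<noteq> 0 \<and> y \<in> Z \<and> v y \<le> v a}"

lemma finite_bounded_values:
  assumes W: "krull_family W" and a: "a \<in> A" "a \<in> Units T" and Z: "Z \<subseteq> A"
  shows "finite (bounded_values W a Z)" "bounded_values W a Z \<subseteq> bounded_values W a A" 
proof -
  have fin: "finite (bounded_values W a A)"
  proof (rule finite_subset)
    show "bounded_values W a A \<subseteq> (SIGMA v:{v \<in> W. v a \<noteq> 0}. Fin ` {0..(THE k. v a = Fin k)})"
    proof
      fix z assume "z \<in> bounded_values W a A"
      then obtain v y where z: "z = (v, v y)" "v \<in> W" "v a \<noteq> 0" "y \<in> A" "v y \<le> v a" by (auto simp: bounded_values_def)
      obtain k where k: "v a = Fin k" using valuation_unit[OF krull_familyD(1)[OF W z(2)] a(2)] .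
      have "0 \<le> v y" using krull_familyD(3)[OF W z(4,2)] .
      then show "z \<in> (SIGMA v:{v \<in> W. v a \<noteq> 0}. Fin ` {0..(THE k. v a = Fin k)})"
        using z k by (cases "v y") (auto simp: zero_extended_def)
    qed
    show "finite (SIGMA v:{v \<in> W. v a \<noteq> 0}. Fin ` {0..(THE k. v a = Fin k)})"
      using krull_familyD(4)[OF W a] by (intro finite_SigmaI) auto
  qed
  show "bounded_values W a Z \<subseteq> bounded_values W a A" using Z by (auto simp: bounded_values_def)
  then show "finite (bounded_values W a Z)" using fin by (rule finite_subset)
qed

text \<open>The fingerprint controls the inverse: where v(y) \<ge> v(a), the constraint that y puts
  on x follows from the one that \<open>a\<close> puts on x; every smaller value is also attained by
  an element of \<open>Z\<close>.\<close>

lemma inv_module_bounded_values: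
  assumes W: "krull_family W" and a: "a \<in> Z" "Z \<subseteq> A" "Y \<subseteq> A" "a \<in> Units T"
    and le: "bounded_values W a Y \<subseteq> bounded_values W a Z"
  shows "inv_module Z \<subseteq> inv_module Y"
proof
  fix x assume x: "x \<in> inv_module Z"
  then have xT: "x \<in> carrier T" and xX: "\<And>y. y \<in> Z \<Longrightarrow> x \<otimes> y \<in> A" by (auto simp: inv_module_def)
  have aA: "a \<in> A" using a by auto
  have "x \<otimes> y \<in> A" if y: "y \<in> Y" for y
  proof (rule krull_familyD(2)[OF W])
    have yT: "y \<in> carrier T" "y \<in> A" using y a by auto
    then show "x \<otimes> y \<in> carrier T" using xT by simp
    fix v assume v: "v \<in> W"
    note val = krull_familyD(1)[OF W v]
    obtain k where k: "v a = Fin k" using valuation_unit[OF val a(4)] .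
    have xa: "0 \<le> v x + v a" using krull_familyD(3)[OF W xX[OF a(1)] v] valuation_mult[OF val xT, of a] aA by simp
    have "0 \<le> v x + v y"
    proof (cases "v a \<noteq> 0 \<and> v y \<le> v a")
      case True
      then have "(v, v y) \<in> bounded_values W a Z" using le v y by (auto simp: bounded_values_def)
      then obtain y' where y': "y' \<in> Z" "v y = v y'" by (auto simp: bounded_values_def)
      then show ?thesis using krull_familyD(3)[OF W xX[OF y'(1)] v] valuation_mult[OF val xT, of y'] a by auto
    next
      case False
      have "0 \<le> v y" using krull_familyD(3)[OF W yT(2) v] .
      then have "v a \<le> v y" using False by auto
      then have "v x + v a \<le> v x + v y" by (rule add_left_mono)
      then show ?thesis using xa by (rule order_trans[rotated])
    qed
    then show "0 \<le> v (x \<otimes> y)" using valuation_mult[OF val xT yT(1)] by simp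
  qed
  then show "x \<in> inv_module Y" using xT by (simp add: inv_module_def)
qed

text \<open>There are only finitely many fingerprints, since all of them are subsets of the finite
  set \<open>bounded_values W a A\<close>.\<close>

lemma finite_inv_module:
  assumes krull and a: "a \<in> A" "a \<in> Units T"
  shows "finite {inv_module Z | Z. Z \<subseteq> A \<and> a \<in> Z}"
proof -
  obtain W where W: "krull_family W" using \<open>krull\<close> by (auto simp: krull_def)
  let ?S = "{Z. Z \<subseteq> A \<and> a \<in> Z}"
  have "finite (bounded_values W a ` ?S)"
    by (rule finite_subset[of _ "Pow (bounded_values W a A)"]) (use finite_bounded_values[OF W a] in auto)
  from finite_subset_image[OF this order_refl]
  obtain B where B: "finite B" "B \<subseteq> ?S" "bounded_values W a ` ?S = bounded_values W a ` B" by auto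
  have "{inv_module Z | Z. Z \<subseteq> A \<and> a \<in> Z} \<subseteq> inv_module ` B"
  proof
    fix z assume "z \<in> {inv_module Z | Z. Z \<subseteq> A \<and> a \<in> Z}"
    then obtain Z where Z: "z = inv_module Z" "Z \<subseteq> A" "a \<in> Z" by blast
    then have "bounded_values W a Z \<in> bounded_values W a ` B" unfolding B(3)[symmetric] by simp
    then obtain Y where Y: "Y \<in> B" "bounded_values W a Z = bounded_values W a Y" by blast
    then have "Y \<subseteq> A" "a \<in> Y" using B(2) by auto
    then have "inv_module Z = inv_module Y" using inv_module_bounded_values[OF W _ _ _ a(2)] Z Y(2) by (intro equalityI) simp_all
    then show "z \<in> inv_module ` B" using Z Y by simp
  qed
  then show ?thesis by (rule finite_surj[OF B(1)])
qed

text \<open>One witness for each value in the fingerprint suffices. This finiteness is what later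
  turns a condition on inverses into a genuine \<open>GV\<close> set, which has to be
  finite.\<close>

lemma inv_module_finite_subset:
  assumes krull and a: "a \<in> Z" "a \<in> Units T" "Z \<subseteq> A"
  obtains F where "finite F" "F \<subseteq> Z" "a \<in> F" "inv_module F \<subseteq> inv_module Z"
proof -
  obtain W where W: "krull_family W" using \<open>krull\<close> by (auto simp: krull_def)
  have aA: "a \<in> A" using a by auto
  have "\<forall>z\<in>bounded_values W a Z. \<exists>y\<in>Z. z = (fst z, fst z y) \<and> fst z \<in> W \<and> fst z a \<noteq> 0 \<and> fst z y \<le> fst z a"
    by (auto simp: bounded_values_def)
  then obtain g where g: "\<And>z. z \<in> bounded_values W a Z \<Longrightarrow>
      g z \<in> Z \<and> z = (fst z, fst z (g z)) \<and> fst z \<in> W \<and> fst z a \<noteq> 0 \<and> fst z (g z) \<le> fst z a"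
    by metis
  let ?F = "insert a (g ` bounded_values W a Z)"
  have F: "finite ?F" "?F \<subseteq> Z" "a \<in> ?F" using finite_bounded_values(1)[OF W aA a(2,3)] g a by auto
  have "bounded_values W a Z \<subseteq> bounded_values W a ?F"
  proof
    fix z assume z: "z \<in> bounded_values W a Z"
    then show "z \<in> bounded_values W a ?F" using g[OF z] unfolding bounded_values_def[of W a ?F] by blast
  qed
  then have "inv_module ?F \<subseteq> inv_module Z" using F a by (intro inv_module_bounded_values[OF W]) auto
  then show thesis using that F by blast
qed

lemma GV_inv_module: "finite F \<Longrightarrow> F \<subseteq> A \<Longrightarrow> a \<in> F \<Longrightarrow> a \<in> Units T \<Longrightarrow> inv_module F \<subseteq> A \<Longrightarrow> GV F"
  unfolding GV_def inv_module_def by blast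

text \<open>A Krull ring is completely integrally closed, which makes regular ideals \<open>u\<close>-invertible.\<close>

lemma krull_u_invertible:
  assumes krull and I: "A_ideal I" and a: "a \<in> I" "a \<in> Units T"
  obtains F where "GV F" "F \<subseteq> I \<cdot> inv_module I"
proof -
  let ?L = "I \<cdot> inv_module I"
  note Im = A_moduleD[OF A_ideal_A_module[OF I]] and IA = A_ideal_A[OF I]
  have one: "\<one> \<in> inv_module I" using IA by (auto simp: inv_module_def)
  have LA: "?L \<subseteq> A" by (rule prod_subset) (use IA in \<open>auto simp: inv_module_def m_comm\<close>)
  have aL: "a \<in> ?L" using ideal_prod.prod[OF a(1) one, of T] Im(1)[OF a(1)] by simp
  obtain F where F: "finite F" "F \<subseteq> ?L" "a \<in> F" "inv_module F \<subseteq> inv_module ?L"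
    using inv_module_finite_subset[OF \<open>krull\<close> aL a(2) LA] .
  have "inv_module ?L \<subseteq> A"
  proof
    fix x assume "x \<in> inv_module ?L"
    then have x: "x \<in> carrier T" "\<And>y. y \<in> ?L \<Longrightarrow> x \<otimes> y \<in> A" by (auto simp: inv_module_def)
    \<comment> \<open>An element x of (I I^{-1})^{-1} maps I^{-1} into itself, so all powers of x
      lie in I^{-1} and have the common denominator \<open>a\<close>.\<close>
    have step: "x \<otimes> b \<in> inv_module I" if b: "b \<in> inv_module I" for b
    proof -
      have bT: "b \<in> carrier T" using b by (simp add: inv_module_def)
      have "(x \<otimes> b) \<otimes> y \<in> A" if y: "y \<in> I" for y
        using x(2)[OF ideal_prod.prod[OF y b]] x(1) bT Im(1)[OF y] by (simp add: m_ac)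
      then show ?thesis using x(1) bT by (simp add: inv_module_def)
    qed
    have pow: "x [^] n \<in> inv_module I" for n :: nat
    proof (induct n)
      case (Suc n) then show ?case using step[OF Suc] x(1) by (simp add: m_comm)
    qed (simp add: one)
    have "a \<otimes> x [^] n \<in> A" for n :: nat
      using pow[of n] a x(1) m_comm[OF Im(1)[OF a(1)], of "x [^] n"] by (simp add: inv_module_def)
    then show "x \<in> A" by (rule krull_completely_integrally_closed[OF \<open>krull\<close> x(1) a(2)])
  qed
  then have "GV F" using F LA a(2) by (intro GV_inv_module) auto
  then show thesis using that F by blast
qed

text \<open>An element x of the double inverse multiplies I I^{-1} into I, and I I^{-1} contains a
  \<open>GV\<close> set; hence x lies in the u-closure of I.\<close>

lemma krull_u_ideal_divisorial:
  assumes krull and I: "A_ideal I" and a: "a \<in> I" "a \<in> Units T" and u: "u_hull I = I"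
  shows "inv_module (inv_module I) = I"
proof
  note Im = A_moduleD[OF A_ideal_A_module[OF I]] and IA = A_ideal_A[OF I]
  show "I \<subseteq> inv_module (inv_module I)" using Im(1) by (auto simp: inv_module_def m_comm)
  show "inv_module (inv_module I) \<subseteq> I"
  proof
    fix x assume "x \<in> inv_module (inv_module I)"
    then have x: "x \<in> carrier T" "\<And>y. y \<in> inv_module I \<Longrightarrow> x \<otimes> y \<in> A" by (auto simp: inv_module_def)
    obtain F where F: "GV F" "F \<subseteq> I \<cdot> inv_module I" using krull_u_invertible[OF assms(1-4)] .
    have c: "inv_module I \<subseteq> carrier T" by (auto simp: inv_module_def)
    have Lc: "I \<cdot> inv_module I \<subseteq> carrier T" by (rule prod_subset) (use Im(1) c in auto)
    have xl: "x \<otimes> l \<in> I" if "l \<in> I \<cdot> inv_module I" for l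
      using that
    proof induct
      case (prod i j)
      have "x \<otimes> (i \<otimes> j) = i \<otimes> (x \<otimes> j)" using prod x(1) Im(1) c by (auto simp: m_lcomm)
      then show ?case using Im(5) x(2) prod by simp
    next
      case (sum s t)
      have "s \<in> carrier T" "t \<in> carrier T"
        using sum Lc by auto
      then show ?case using sum Im(3) x(1) by (simp add: r_distr)
    qed
    have "x \<in> u_hull I" by (rule u_hullI[OF x(1) F(1)]) (use xl F in auto)
    then show "x \<in> I" using u by simp
  qed
qed

text \<open>Being divisorial, such an ideal is determined by its inverse, and only finitely many
  inverses occur. This is the chain condition behind the factorization of regular ideals.\<close>

lemma finite_u_ideals:
  assumes krull and a: "a \<in> A" "a \<in> Units T"
  shows "finite {I. A_ideal I \<and> a \<in> I \<and> u_hull I = I}" (is "finite ?S")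
proof -
  have "?S \<subseteq> inv_module ` {inv_module Z | Z. Z \<subseteq> A \<and> a \<in> Z}"
  proof
    fix I assume "I \<in> ?S"
    then have I: "A_ideal I" "a \<in> I" "u_hull I = I" by auto
    then have "I = inv_module (inv_module I)" using krull_u_ideal_divisorial[OF assms(1) I(1,2) a(2) I(3)] by simp
    moreover have "I \<subseteq> A" using A_ideal_A[OF I(1)] by auto
    ultimately show "I \<in> inv_module ` {inv_module Z | Z. Z \<subseteq> A \<and> a \<in> Z}" using I by blast
  qed
  then show ?thesis by (rule finite_surj[OF finite_inv_module[OF assms]])
qed

lemma A_ideal_sum_principal:
  assumes "A_ideal I" "x \<in> A"
  shows "A_ideal {i \<oplus> x \<otimes> c | i c. i \<in> I \<and> c \<in> A}" (is "A_ideal ?J")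
    "I \<subseteq> {i \<oplus> x \<otimes> c | i c. i \<in> I \<and> c \<in> A}" "x \<in> {i \<oplus> x \<otimes> c | i c. i \<in> I \<and> c \<in> A}"
proof -
  note I = A_moduleD[OF A_ideal_A_module[OF assms(1)]] and IA = A_ideal_A[OF assms(1)]
  have "A_module ?J"
  proof (rule A_moduleI)
    show "?J \<subseteq> carrier T" using I assms by auto
    show "\<zero> \<in> ?J" using I(2) assms by (auto intro!: exI[of _ \<zero>])
    fix y z assume "y \<in> ?J" "z \<in> ?J"
    then obtain i c j d where h: "i \<in> I" "j \<in> I" "c \<in> A" "d \<in> A" "y = i \<oplus> x \<otimes> c" "z = j \<oplus> x \<otimes> d"
      by blast
    then have "y \<oplus> z = (i \<oplus> j) \<oplus> x \<otimes> (c \<oplus> d)" using assms(2) I(1) by (simp add: r_distr a_ac)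
    then show "y \<oplus> z \<in> ?J" using h I(3) A_add by blast
  next
    note I = A_moduleD[OF A_ideal_A_module[OF assms(1)]]
    fix b z assume "b \<in> A" "z \<in> ?J"
    then obtain i c where h: "i \<in> I" "c \<in> A" "z = i \<oplus> x \<otimes> c" by blast
    then have "b \<otimes> z = (b \<otimes> i) \<oplus> x \<otimes> (b \<otimes> c)" using assms(2) I(1) \<open>b \<in> A\<close> by (simp add: r_distr m_ac)
    then show "b \<otimes> z \<in> ?J" using h I(4) A_mult \<open>b \<in> A\<close> by blast
  qed
  moreover have "?J \<subseteq> A" using IA assms(2) by auto
  ultimately show "A_ideal ?J" by (simp add: A_ideal_def)
  show "I \<subseteq> ?J" 
  proof
    fix i assume "i \<in> I"
    then have "i = i \<oplus> x \<otimes> \<zero> \<and> i \<in> I \<and> \<zero> \<in> A" using I(1) assms(2) by simp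
    then show "i \<in> ?J" by blast
  qed
  have "x = \<zero> \<oplus> x \<otimes> \<one> \<and> \<zero> \<in> I \<and> \<one> \<in> A" using I(2) assms(2) by simp
  then show "x \<in> ?J" by blast
qed

text \<open>Let P be maximal among the proper u-ideals containing I. Then I is the u-closure of P I'
  with I' the u-closure of I P^{-1}. Since I' is strictly larger than I, fewer u-ideals lie above
  it.\<close>

lemma krull_regular_factor:
  assumes krull and a: "a \<in> A" "a \<in> Units T"
  shows "A_ideal I \<Longrightarrow> a \<in> I \<Longrightarrow> u_hull I = I \<Longrightarrow> \<exists>Ps. (\<forall>P\<in>set Ps. A_prime P) \<and> I = u_hull (ideal_product Ps)"
proof (induct "card {J. A_ideal J \<and> a \<in> J \<and> u_hull J = J \<and> I \<subseteq> J}" arbitrary: I rule: less_induct)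
  case less
  let ?S = "\<lambda>I. {J. A_ideal J \<and> a \<in> J \<and> u_hull J = J \<and> I \<subseteq> J}"
  note I = less(2-4)
  note Im = A_moduleD[OF A_ideal_A_module[OF I(1)]] and IA = A_ideal_A[OF I(1)]
  have fin: "finite (?S J)" for J by (rule finite_subset[OF _ finite_u_ideals[OF assms]]) auto
  show ?case
  proof (cases "I = A")
    case True
    then show ?thesis by (intro exI[of _ "[]"]) (simp add: u_hull_A)
  next
    case False
    let ?M = "?S I - {A}"
    have "finite ?M" "I \<in> ?M" using fin[of I] I False by auto
    from finite_has_maximal2[OF this] obtain P where P: "P \<in> ?M" "I \<subseteq> P"
      "\<forall>Q\<in>?M. P \<subseteq> Q \<longrightarrow> P = Q" by (elim bexE conjE)
    have Pa: "A_ideal P" "u_hull P = P" "a \<in> P" "P \<noteq> A" using P(1) by auto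
    note Pm = A_moduleD[OF A_ideal_A_module[OF Pa(1)]]
    have nP: "\<one> \<notin> P" using A_ideal_eq_A Pa by blast
    have prime: "A_prime P"
      unfolding A_prime_def
    proof (intro conjI ballI impI)
      fix x y assume xy: "x \<in> A" "y \<in> A" "x \<otimes> y \<in> P"
      show "x \<in> P \<or> y \<in> P"
      proof (rule disjCI)
        assume "y \<notin> P"
        let ?J = "{i \<oplus> y \<otimes> c | i c. i \<in> P \<and> c \<in> A}"
        note J = A_ideal_sum_principal[OF Pa(1) xy(2)]
        have sub: "?J \<subseteq> u_hull ?J" using A_ideal_A[OF J(1), THEN A_carrier] by (intro u_hull_incl subsetI)
        \<comment> \<open>By maximality P + yA has u-closure A, so it contains a \<open>GV\<close>
          set F. Then x F lies in P because x y does, and P is u-closed.\<close>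
        have "u_hull ?J = A"
        proof (rule ccontr)
          assume "u_hull ?J \<noteq> A"
          moreover have "?J \<subseteq> carrier T" using A_ideal_A[OF J(1), THEN A_carrier] by (rule subsetI)
          then have "u_hull (u_hull ?J) = u_hull ?J" by (rule u_hull_idem)
          moreover have "I \<subseteq> u_hull ?J" "a \<in> u_hull ?J" "P \<subseteq> u_hull ?J" using P(2) Pa(3) J(2) sub by blast+
          ultimately have "u_hull ?J \<in> ?M" using A_ideal_u_hull[OF J(1)] by simp
          then have "P = u_hull ?J" using bspec[OF P(3)] \<open>P \<subseteq> u_hull ?J\<close> by simp
          then show False using J(3) sub \<open>y \<notin> P\<close> by blast
        qed
        then have "\<one> \<in> u_hull ?J" by simp
        then obtain F where F: "GV F" "\<And>f. f \<in> F \<Longrightarrow> f \<in> ?J" unfolding u_hull_def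
          using GV_carrier by fastforce
        have "x \<in> u_hull P"
        proof (rule u_hullI[OF _ F(1)])
          fix f assume "f \<in> F"
          then obtain i c where f: "f = i \<oplus> y \<otimes> c" "i \<in> P" "c \<in> A" using F(2) by blast
          then have "x \<otimes> f = x \<otimes> i \<oplus> c \<otimes> (x \<otimes> y)" using xy Pm(1) by (simp add: r_distr m_ac)
          then show "x \<otimes> f \<in> P" using f xy Pm(3,4) by simp
        qed (use xy in auto)
        then show "x \<in> P" using Pa by simp
      qed
    qed (use Pa nP in auto)
    let ?B = "inv_module P"
    have Bc: "?B \<subseteq> carrier T" and B1: "\<one> \<in> ?B" using A_ideal_A[OF Pa(1)] by (auto simp: inv_module_def)
    let ?J = "I \<cdot> ?B" let ?I' = "u_hull ?J"
    have "?J \<subseteq> A"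
    proof (rule prod_subset)
      fix i j assume "i \<in> I" "j \<in> ?B"
      then show "i \<otimes> j \<in> A" using P(2) m_comm[of i j] Im(1)[of i] by (auto simp: inv_module_def)
    qed simp
    moreover have "A_module ?J" using Bc B1 A_ideal_A_module[OF I(1)] by (intro A_module_prod) auto
    ultimately have J: "A_ideal ?J" by (simp add: A_ideal_def)
    have Jc: "?J \<subseteq> carrier T" using A_ideal_A[OF J] by auto
    have I': "A_ideal ?I'" "u_hull ?I' = ?I'" using A_ideal_u_hull[OF J] u_hull_idem[OF Jc] by auto
    have sub: "I \<subseteq> ?I'"
    proof
      fix x assume "x \<in> I"
      then have "x \<otimes> \<one> \<in> ?J" using B1 by (intro ideal_prod.prod)
      then show "x \<in> ?I'" using u_hull_incl[OF Jc] Im(1)[OF \<open>x \<in> I\<close>] by auto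
    qed
    obtain F where F: "GV F" "F \<subseteq> P \<cdot> ?B" using krull_u_invertible[OF assms(1) Pa(1,3) a(2)] .
    \<comment> \<open>If I' = I, then P^{-1} maps I into itself, so each of its elements has all
      powers over the common denominator \<open>a\<close> and lies in A. Then P P^{-1} is inside P,
      and P contains a \<open>GV\<close> set.\<close>
    have ne: "I \<noteq> ?I'"
    proof
      assume eq: "I = ?I'"
      have "b \<in> A" if b: "b \<in> ?B" for b
      proof (rule krull_completely_integrally_closed[OF \<open>krull\<close> _ a(2)])
        show bT: "b \<in> carrier T" using b Bc by auto
        have "b [^] n \<otimes> a \<in> I" for n :: nat
        proof (induct n)
          case 0 then show ?case using I Im(1) by simp
        next
          case (Suc n)
          then have "(b [^] n \<otimes> a) \<otimes> b \<in> ?I'" using ideal_prod.prod[OF Suc b, of T] u_hull_incl[OF Jc] by auto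
          then show ?case using eq bT a by (simp add: m_ac)
        qed
        then show "a \<otimes> b [^] n \<in> A" for n :: nat using IA bT a by (simp add: m_comm)
      qed
      then have "P \<cdot> ?B \<subseteq> P" using Pm by (intro prod_subset) auto
      then have "\<one> \<in> u_hull P" using F GV_carrier[OF F(1)] by (intro u_hullI[OF _ F(1)]) auto
      then show False using nP Pa by simp
    qed
    have "?S ?I' \<subset> ?S I" using sub ne I by auto
    then have "card (?S ?I') < card (?S I)" using fin by (intro psubset_card_mono)
    then obtain Ps where Ps: "\<forall>P\<in>set Ps. A_prime P" "?I' = u_hull (ideal_product Ps)"
      using less(1)[of ?I'] I' sub I by blast
    have ideal_product: "A_ideal (ideal_product Ps)" by (rule A_ideal_ideal_product) (use Ps(1) A_prime_A_ideal in blast)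
    \<comment> \<open>For x in I the set x P P^{-1} lies in P I', and P P^{-1} contains a
      \<open>GV\<close> set; conversely P (I P^{-1}) lies in I because P P^{-1} is inside A.\<close>
    have "I = u_hull (P \<cdot> ?I')"
    proof
      show "I \<subseteq> u_hull (P \<cdot> ?I')"
      proof
        fix x assume x: "x \<in> I"
        have m: "A_module (P \<cdot> ?I')" by (intro A_ideal_A_module A_ideal_prod Pa I')
        have xl: "x \<otimes> l \<in> P \<cdot> ?I'" if "l \<in> P \<cdot> ?B" for l
          using that
        proof induct
          case (prod p b)
          then have "x \<otimes> b \<in> ?I'" using ideal_prod.prod[OF x prod(2), of T] u_hull_incl[OF Jc] by auto
          moreover have "x \<otimes> (p \<otimes> b) = p \<otimes> (x \<otimes> b)" using prod Im(1)[OF x] Pm(1) Bc by (simp add: m_lcomm subset_iff)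
          ultimately show ?case using ideal_prod.prod[OF prod(1), of "x \<otimes> b" ?I' T] by simp
        next
          case (sum s t)
          have "P \<cdot> ?B \<subseteq> carrier T" by (rule prod_subset) (use Pm(1) Bc in auto)
          then show ?case using sum A_moduleD(3)[OF m] Im(1)[OF x] by (simp add: r_distr subset_iff)
        qed
        show "x \<in> u_hull (P \<cdot> ?I')" by (rule u_hullI[OF Im(1)[OF x] F(1)]) (use xl F in auto)
      qed
      have "P \<cdot> ?I' \<subseteq> I"
      proof (rule prod_subset_A_module[OF _ A_ideal_A_module[OF I(1)]])
        fix p z assume p: "p \<in> P" and "z \<in> ?I'"
        then obtain G where G: "GV G" "z \<in> carrier T" "\<And>g. g \<in> G \<Longrightarrow> z \<otimes> g \<in> ?J" by (auto simp: u_hull_def)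
        have pl: "p \<otimes> l \<in> I" if "l \<in> ?J" for l
          using that
        proof induct
          case (prod i b)
          have "p \<otimes> (i \<otimes> b) = i \<otimes> (b \<otimes> p)" using prod Im(1) Pm(1)[OF p] Bc by (simp add: m_ac subset_iff)
          moreover have "b \<otimes> p \<in> A" using prod(2) p by (simp add: inv_module_def)
          ultimately show ?case using Im(5) prod by simp
        next
          case (sum s t)
          then show ?case using Im(3) Pm(1)[OF p] Jc by (simp add: r_distr subset_iff)
        qed
        have "p \<otimes> z \<in> u_hull I"
          by (rule u_hullI[OF _ G(1)]) (use pl G(2,3) Pm(1)[OF p] GV_carrier[OF G(1)] in \<open>auto simp: m_assoc\<close>)
        then show "p \<otimes> z \<in> I" using I by simp
      qed
      then show "u_hull (P \<cdot> ?I') \<subseteq> I" using u_hull_mono[of _ I] I by blast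
    qed
    also have "\<dots> = u_hull (ideal_product (P # Ps))"
      using u_hull_prod_u_hull[OF A_ideal_A_module[OF Pa(1)] A_ideal_A_module[OF ideal_product]] Ps(2) by simp
    finally show ?thesis using Ps(1) prime by (intro exI[of _ "P # Ps"]) auto
  qed
qed

end

section \<open>Prime factors of regular elements\<close>

context frac_pair
begin

lemma u_hull_self: "A_module I \<Longrightarrow> x \<in> I \<Longrightarrow> x \<in> u_hull I"
  using u_hull_incl[of I] A_moduleD(1)[of I] by blast

lemma uclE:
  assumes "x \<in> u_hull I"
  obtains F where "GV F" "\<forall>f\<in>F. x \<otimes> f \<in> I"
  using assms by (auto simp: u_hull_def)

text \<open>Take for t a product of elements outside \<open>P\<close>, one from each factor other
  than \<open>P\<close>; they exist because no other factor is contained in \<open>P\<close>. The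
  power of x accounts for the copies of \<open>P\<close>.\<close>

lemma ideal_product_pow_mem:
  assumes P: "A_prime P" and "\<And>Q. Q \<in> set Ps \<Longrightarrow> A_ideal Q" "\<And>Q. Q \<in> set Ps \<Longrightarrow> Q = P \<or> \<not> Q \<subseteq> P"
  shows "\<exists>t\<in>A - P. (\<forall>Q\<in>set Ps. Q \<noteq> P \<longrightarrow> t \<in> Q) \<and> (\<forall>x\<in>P. t \<otimes> x [^] count_list Ps P \<in> ideal_product Ps)"
  using assms(2,3)
proof (induct Ps)
  case Nil
  have "\<one> \<in> A - P" "\<forall>x\<in>P. \<one> \<otimes> x [^] count_list [] P \<in> ideal_product []" using A_prime_one[OF P] by auto
  then show ?case by (intro bexI[of _ \<one>]) auto
next
  case (Cons Q Ps)
  then obtain t where t: "t \<in> A - P" "\<And>Q. Q \<in> set Ps \<Longrightarrow> Q \<noteq> P \<Longrightarrow> t \<in> Q"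
    "\<And>x. x \<in> P \<Longrightarrow> t \<otimes> x [^] count_list Ps P \<in> ideal_product Ps" by auto
  show ?case
  proof (cases "Q = P")
    case True
    have "t \<otimes> x [^] count_list (Q # Ps) P \<in> ideal_product (Q # Ps)" if x: "x \<in> P" for x
    proof -
      have "x \<otimes> (t \<otimes> x [^] count_list Ps P) \<in> ideal_product (Q # Ps)" using True x t(3)[OF x] by (auto intro: ideal_prod.prod)
      moreover have "x \<otimes> (t \<otimes> x [^] count_list Ps P) = t \<otimes> x [^] Suc (count_list Ps P)"
        using t(1) A_prime_A[OF P x] by (simp add: m_ac)
      ultimately show ?thesis using True by simp
    qed
    then show ?thesis using t True by auto
  next
    case False
    then obtain q where q: "q \<in> Q" "q \<notin> P" using Cons(3)[of Q] by auto
    have aQ: "A_ideal Q" using Cons(2) by simp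
    have qA: "q \<in> A" using A_ideal_A[OF aQ q(1)] .
    have "(q \<otimes> t) \<otimes> x [^] count_list (Q # Ps) P \<in> ideal_product (Q # Ps)" if x: "x \<in> P" for x
    proof -
      have "q \<otimes> (t \<otimes> x [^] count_list Ps P) \<in> ideal_product (Q # Ps)" using q(1) t(3)[OF x] by (auto intro: ideal_prod.prod)
      moreover have "q \<otimes> (t \<otimes> x [^] count_list Ps P) = (q \<otimes> t) \<otimes> x [^] count_list Ps P"
        using t(1) qA A_prime_A[OF P x] by (simp add: m_assoc)
      ultimately show ?thesis using False by simp
    qed
    moreover have "q \<otimes> t \<in> A - P" using A_prime_mult_notin[OF P _ t(1)] q qA by simp
    moreover have "q \<otimes> t \<in> R" if "R \<in> set (Q # Ps)" "R \<noteq> P" for R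
    proof (cases "R = Q")
      case True then show ?thesis using A_moduleD(5)[OF A_ideal_A_module[OF aQ] _ q(1)] t(1) by auto
    next
      case False
      then have "R \<in> set Ps" using that by simp
      then show ?thesis using A_moduleD(4)[OF A_ideal_A_module[OF Cons(2)[of R]] qA t(2)[of R]] that by simp
    qed
    ultimately show ?thesis by blast
  qed
qed

definition principal_u_factorization :: bool where
  "principal_u_factorization \<longleftrightarrow> (\<forall>a\<in>A. \<exists>Ps. (\<forall>P\<in>set Ps. A_prime P) \<and> u_hull (principal a) = u_hull (ideal_product Ps))"

text \<open>For a prime ideal P this means that P equals its u-closure: if x F is inside P and F is
  not, then x is in P.\<close>

definition GV_free :: "'a set \<Rightarrow> bool" where
  "GV_free P \<longleftrightarrow> \<not> (\<exists>F. GV F \<and> F \<subseteq> P)"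

text \<open>Says that the u-closure of P P^{-1} is the whole ring. The witness \<open>B\<close> may
  be any subset of P^{-1}, so a convenient one can be exhibited.\<close>

definition u_invertible :: "'a set \<Rightarrow> bool" where
  "u_invertible P \<longleftrightarrow> (\<exists>B. B \<subseteq> carrier T \<and> (\<forall>b\<in>B. \<forall>x\<in>P. b \<otimes> x \<in> A) \<and> (\<exists>F. GV F \<and> F \<subseteq> P \<cdot> B))"

definition u_invertible_prime :: "'a set \<Rightarrow> bool" where
  "u_invertible_prime P \<longleftrightarrow> A_prime P \<and> GV_free P \<and> u_invertible P \<and> P \<inter> Units T \<noteq> {}"

text \<open>A factor containing a \<open>GV\<close> set F is invisible to the closure: F multiplies
  the product of the remaining factors into the full product.\<close>

lemma u_hull_ideal_product_filter:
  assumes "\<And>P. P \<in> set Ps \<Longrightarrow> A_ideal P"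
  shows "u_hull (ideal_product Ps) = u_hull (ideal_product (filter GV_free Ps))"
  using assms
proof (induct Ps)
  case (Cons P Ps)
  have c: "\<And>Q. Q \<in> set Ps \<Longrightarrow> A_ideal Q" "\<And>Q. Q \<in> set (filter GV_free Ps) \<Longrightarrow> A_ideal Q"
    using Cons(2) by simp_all
  have a: "A_ideal P" "A_ideal (ideal_product Ps)" "A_ideal (ideal_product (filter GV_free Ps))" 
    using Cons(2)[of P] A_ideal_ideal_product[of Ps] A_ideal_ideal_product[of "filter GV_free Ps"] c by simp_all
  note m = a[THEN A_ideal_A_module]
  have IH: "u_hull (ideal_product Ps) = u_hull (ideal_product (filter GV_free Ps))" using Cons by simp
  show ?case
  proof (cases "GV_free P")
    case True
    have "u_hull (P \<cdot> ideal_product Ps) = u_hull (P \<cdot> u_hull (ideal_product Ps))" using u_hull_prod_u_hull[OF m(1,2)] by simp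
    also have "\<dots> = u_hull (P \<cdot> ideal_product (filter GV_free Ps))" using u_hull_prod_u_hull[OF m(1,3)] IH by simp
    finally show ?thesis using True by simp
  next
    case False
    then obtain F where F: "GV F" "F \<subseteq> P" by (auto simp: GV_free_def)
    have "u_hull (P \<cdot> ideal_product Ps) = u_hull (ideal_product Ps)"
    proof
      show "u_hull (P \<cdot> ideal_product Ps) \<subseteq> u_hull (ideal_product Ps)" using prod_le(2)[OF a(1,2)] by (rule u_hull_mono)
      have "ideal_product Ps \<subseteq> u_hull (P \<cdot> ideal_product Ps)"
      proof
        fix x assume x: "x \<in> ideal_product Ps"
        show "x \<in> u_hull (P \<cdot> ideal_product Ps)"
        proof (rule u_hullI[OF _ F(1)])
          show xT: "x \<in> carrier T" using A_moduleD(1)[OF m(2) x] .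
          fix f assume f: "f \<in> F"
          then have "f \<otimes> x \<in> P \<cdot> ideal_product Ps" using F(2) x by (intro ideal_prod.prod) auto
          then show "x \<otimes> f \<in> P \<cdot> ideal_product Ps" using xT GV_carrier[OF F(1) f] by (simp add: m_comm)
        qed
      qed
      moreover have "P \<cdot> ideal_product Ps \<subseteq> carrier T" using A_ideal_A[OF A_ideal_prod[OF a(1,2)]] by auto
      ultimately show "u_hull (ideal_product Ps) \<subseteq> u_hull (P \<cdot> ideal_product Ps)" using u_hull_mono u_hull_idem by metis
    qed
    then show ?thesis using IH False by simp
  qed
qed simp

text \<open>The inverse of a factor is the product of the other factors divided by \<open>s\<close>.
  The factor is regular because it contains s f for a unit f from a \<open>GV\<close> set.\<close>

lemma factor_u_invertible:
  assumes s: "s \<in> A" "s \<in> Units T" and Ps: "\<And>P. P \<in> set Ps \<Longrightarrow> A_ideal P"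
    and eq: "u_hull (principal s) = u_hull (ideal_product Ps)" and P: "P \<in> set Ps"
  shows "u_invertible P" "P \<inter> Units T \<noteq> {}"
proof -
  let ?I = "ideal_product (remove1 P Ps)"
  have ex: "ideal_product Ps = P \<cdot> ?I" using ideal_product_extract[OF P Ps] .
  have a: "A_ideal P" "A_ideal ?I" using P Ps set_remove1_subset[of P Ps] by (auto intro!: A_ideal_ideal_product)
  note c = a[THEN A_ideal_A, THEN A_carrier]
  have isT: "inv s \<in> carrier T" using s by simp
  have "s \<in> u_hull (ideal_product Ps)" using eq u_hull_incl[of "principal s"] principal_self[of s] A_moduleD(1)[OF A_module_principal[of s]] s by auto
  then obtain F where F: "GV F" "\<And>f. f \<in> F \<Longrightarrow> s \<otimes> f \<in> P \<cdot> ?I" by (auto simp: u_hull_def ex)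
  obtain f where f: "f \<in> F" "f \<in> Units T" using GV_unit[OF F(1)] by blast
  have "s \<otimes> f \<in> P" using F(2)[OF f(1)] prod_le(1)[OF a] by auto
  then show "P \<inter> Units T \<noteq> {}" using f s Units_m_closed by blast
  let ?B = "(\<lambda>y. inv s \<otimes> y) ` ?I"
  have B: "?B \<subseteq> carrier T" using isT c by auto
  have PB: "inv s \<otimes> z \<in> P \<cdot> ?B" if "z \<in> P \<cdot> ?I" for z
    using that
  proof induct
    case (prod p y)
    have "inv s \<otimes> (p \<otimes> y) = p \<otimes> (inv s \<otimes> y)" using prod c isT by (simp add: m_lcomm)
    then show ?case using ideal_prod.prod[OF prod(1), of "inv s \<otimes> y" ?B T] prod by auto
  next
    case (sum x y)
    then have "x \<in> carrier T" "y \<in> carrier T" using A_ideal_A[OF A_ideal_prod[OF a]] by auto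
    then show ?case using sum isT by (simp add: r_distr ideal_prod.sum)
  qed
  have "b \<otimes> x \<in> A" if b: "b \<in> ?B" and x: "x \<in> P" for b x
  proof -
    obtain y where y: "y \<in> ?I" "b = inv s \<otimes> y" using b by auto
    have "x \<otimes> y \<in> ideal_product Ps" using ideal_prod.prod[OF x y(1), of T] ex by simp
    then have "x \<otimes> y \<in> u_hull (principal s)" using u_hull_self[OF A_ideal_A_module[OF A_ideal_ideal_product[OF Ps]]] eq by simp
    then obtain G where G: "GV G" "\<And>g. g \<in> G \<Longrightarrow> (x \<otimes> y) \<otimes> g \<in> principal s" by (auto simp: u_hull_def)
    have "inv s \<otimes> (x \<otimes> y) \<in> A"
    proof (rule GV_D[OF G(1)])
      show "inv s \<otimes> (x \<otimes> y) \<in> carrier T" using isT c x y by simp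
      fix g assume g: "g \<in> G"
      then obtain d where d: "d \<in> A" "(x \<otimes> y) \<otimes> g = s \<otimes> d" using G(2) by (auto simp: principal_mem)
      have "inv s \<otimes> (x \<otimes> y) \<otimes> g = inv s \<otimes> ((x \<otimes> y) \<otimes> g)"
        using isT c(1)[OF x] c(2)[OF y(1)] GV_carrier[OF G(1) g] by (simp add: m_assoc)
      also have "\<dots> = d" unfolding d(2) using unit_cancel(1)[OF s(2)] d by simp
      finally show "inv s \<otimes> (x \<otimes> y) \<otimes> g \<in> A" using d by simp
    qed
    then show ?thesis using isT c(1)[OF x] c(2)[OF y(1)] y(2) by (simp add: m_ac)
  qed
  moreover have "F \<subseteq> P \<cdot> ?B"
  proof
    fix f assume f: "f \<in> F"
    have "f = inv s \<otimes> (s \<otimes> f)" using unit_cancel(1)[OF s(2)] GV_carrier[OF F(1) f] by simp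
    then show "f \<in> P \<cdot> ?B" using PB[OF F(2)[OF f]] by simp
  qed
  ultimately show "u_invertible P" using B F(1) unfolding u_invertible_def by blast
qed

lemma principal_u_factorization_regular:
  assumes principal_u_factorization "s \<in> A" "s \<in> Units T"
  obtains Ps where "\<forall>P\<in>set Ps. u_invertible_prime P" "u_hull (principal s) = u_hull (ideal_product Ps)"
proof -
  obtain Ps where Ps: "\<forall>P\<in>set Ps. A_prime P" "u_hull (principal s) = u_hull (ideal_product Ps)"
    using assms by (auto simp: principal_u_factorization_def)
  let ?Q = "filter GV_free Ps"
  have a: "\<And>P. P \<in> set Ps \<Longrightarrow> A_ideal P" using Ps(1) A_prime_A_ideal by blast
  have eq: "u_hull (principal s) = u_hull (ideal_product ?Q)" using Ps(2) u_hull_ideal_product_filter[OF a] by simp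
  have "u_invertible_prime P" if "P \<in> set ?Q" for P
    using factor_u_invertible[OF assms(2,3) _ eq that] a that Ps(1) by (auto simp: u_invertible_prime_def)
  then show thesis using that eq by blast
qed

text \<open>A \<open>GV\<close> set inside Q B cannot lie in \<open>P\<close>, so some product q b
  is a unit locally at \<open>P\<close>. Then q generates \<open>Q\<close> locally: (q b) x = (b x)
  q with b x in A.\<close>

lemma u_invertible_local:
  assumes "u_invertible Q" "A_ideal Q" "A_prime P" "GV_free P"
  obtains q b where "q \<in> Q" "b \<in> carrier T" "\<forall>x\<in>Q. b \<otimes> x \<in> A" "q \<otimes> b \<in> A - P"
proof -
  obtain B F where B: "B \<subseteq> carrier T" "\<And>b x. b \<in> B \<Longrightarrow> x \<in> Q \<Longrightarrow> b \<otimes> x \<in> A" "GV F" "F \<subseteq> Q \<cdot> B"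
    using assms(1) by (auto simp: u_invertible_def)
  have "\<not> Q \<cdot> B \<subseteq> P" using assms(4) B(3,4) by (auto simp: GV_free_def)
  then obtain q b where qb: "q \<in> Q" "b \<in> B" "q \<otimes> b \<notin> P"
    using prod_subset_A_module[OF _ A_prime_A_module[OF assms(3)], of Q B] by blast
  have "b \<otimes> q \<in> A" "b \<in> carrier T" "q \<in> carrier T" using B qb A_ideal_A[OF assms(2)] by auto
  then have "q \<otimes> b \<in> A" by (simp add: m_comm)
  then show thesis using that[of q b] qb B by auto
qed

text \<open>Locally at \<open>P\<close> both primes are principal, generated by p and q. If p is in
  \<open>Q\<close>, then \<open>P\<close> is inside \<open>Q\<close>. Otherwise q is p times an
  element of \<open>Q\<close>, hence locally a multiple of p q; cancelling q, which has the inverse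
  b' up to a local unit, makes p a unit at \<open>P\<close>.\<close>

lemma u_invertible_prime_antichain:
  assumes Q: "u_invertible_prime Q" and P: "u_invertible_prime P" and "Q \<subseteq> P"
  shows "Q = P"
proof -
  have h: "A_prime Q" "u_invertible Q" "A_prime P" "u_invertible P" "GV_free P" using Q P by (auto simp: u_invertible_prime_def)
  obtain p b where p: "p \<in> P" "b \<in> carrier T" "\<forall>x\<in>P. b \<otimes> x \<in> A" "p \<otimes> b \<in> A - P"
    using u_invertible_local[OF h(4) A_prime_A_ideal[OF h(3)] h(3,5)] .
  obtain q b' where q: "q \<in> Q" "b' \<in> carrier T" "\<forall>x\<in>Q. b' \<otimes> x \<in> A" "q \<otimes> b' \<in> A - P"
    using u_invertible_local[OF h(2) A_prime_A_ideal[OF h(1)] h(3,5)] .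
  note Pm = A_moduleD[OF A_prime_A_module[OF h(3)]] and Qm = A_moduleD[OF A_prime_A_module[OF h(1)]]
  have pA: "p \<in> A" using A_prime_A[OF h(3) p(1)] .
  show ?thesis
  proof (cases "p \<in> Q")
    case True
    have "x \<in> Q" if x: "x \<in> P" for x
    proof -
      have xA: "x \<in> A" using A_prime_A[OF h(3) x] .
      have "(p \<otimes> b) \<otimes> x = (b \<otimes> x) \<otimes> p" using xA pA p(2) by (simp add: m_ac)
      then have "(p \<otimes> b) \<otimes> x \<in> Q" using Qm(4)[OF bspec[OF p(3) x] True] by simp
      then show ?thesis using A_prime_mem[OF h(1) _ _ xA, of "p \<otimes> b"] p(4) assms(3) by auto
    qed
    then show ?thesis using assms(3) by auto
  next
    case False
    have qP: "q \<in> P" using q(1) assms(3) by auto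
    have bq: "b \<otimes> q \<in> A" using bspec[OF p(3) qP] .
    have qT: "q \<in> carrier T" using Pm(1)[OF qP] .
    have "p \<otimes> (b \<otimes> q) = (p \<otimes> b) \<otimes> q" using pA p(2) qT by (simp add: m_assoc)
    then have "p \<otimes> (b \<otimes> q) \<in> Q" using Qm(4)[OF _ q(1)] p(4) by simp
    then have "b \<otimes> q \<in> Q" using A_prime_mem[OF h(1) _ pA bq] False by simp
    then have "b' \<otimes> (b \<otimes> q) \<in> A" by (rule bspec[OF q(3)])
    then have "(b' \<otimes> (b \<otimes> q)) \<otimes> p \<in> P" by (rule Pm(4)[OF _ p(1)])
    moreover have "(b' \<otimes> (b \<otimes> q)) \<otimes> p = (p \<otimes> b) \<otimes> (q \<otimes> b')" using pA p(2) qT q(2) by (simp add: m_ac)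
    ultimately show ?thesis using A_prime_mult_notin[OF h(3) p(4) q(4)] by simp
  qed
qed

end

text \<open>The valuation of a regular prime \<open>P\<close> that is locally generated by \<open>p\<close>: up to
  elements outside \<open>P\<close>, the element \<open>b\<close> is an inverse of \<open>p\<close>, and \<open>val_ge x n\<close> says that locally
  \<open>x\<close> lies in the fractional ideal generated by \<open>p\<^sup>n\<close>.\<close>

locale val_data = frac_pair +
  fixes P p b
  assumes prime: "A_prime P" and p: "p \<in> P" and b: "b \<in> carrier T"
    and bP: "\<And>x. x \<in> P \<Longrightarrow> b \<otimes> x \<in> A" and pb: "p \<otimes> b \<in> A - P"
    and reg: "\<And>s. s \<in> A \<Longrightarrow> s \<in> Units T \<Longrightarrow> \<exists>t\<in>A - P. \<exists>c\<in>A. \<exists>n::nat. t \<otimes> p [^] n = s \<otimes> c"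
begin

definition val_ge :: "'a \<Rightarrow> int \<Rightarrow> bool" where
  "val_ge x n \<longleftrightarrow> (\<exists>t\<in>A - P. \<exists>c\<in>A. \<exists>m k. t \<otimes> (p [^] (m::nat) \<otimes> x) = c \<otimes> p [^] (k::nat) \<and> n = int k - int m)"

text \<open>The exact version of \<open>val_ge\<close>: the coefficient \<open>c\<close> has to be a
  local unit.\<close>

definition has_val :: "'a \<Rightarrow> int \<Rightarrow> bool" where
  "has_val x n \<longleftrightarrow> (\<exists>t\<in>A - P. \<exists>c\<in>A - P. \<exists>m k. t \<otimes> (p [^] (m::nat) \<otimes> x) = c \<otimes> p [^] (k::nat) \<and> n = int k - int m)"

text \<open>An element without exact value is locally divisible by every power of p, so infinity is
  the right default.\<close>

definition loc_val :: "'a \<Rightarrow> int extended" where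
  "loc_val x = (if \<exists>n. has_val x n then Fin (THE n. has_val x n) else Pinf)"

lemma pA [simp]: "p \<in> A" using A_prime_A[OF prime p] .
lemma bT [simp]: "b \<in> carrier T" by (rule b)

lemma one_notin: "\<one> \<in> A - P"
  using A_prime_one[OF prime] by simp

lemma geI: "t \<in> A - P \<Longrightarrow> c \<in> A \<Longrightarrow> t \<otimes> (p [^] m \<otimes> x) = c \<otimes> p [^] k \<Longrightarrow> n = int k - int m \<Longrightarrow> val_ge x n"
  unfolding val_ge_def by blast

lemma geE:
  assumes "val_ge x n"
  obtains t c m k where "t \<in> A - P" "c \<in> A" "t \<otimes> (p [^] (m::nat) \<otimes> x) = c \<otimes> p [^] (k::nat)"
    "n = int k - int m"
  using assms unfolding val_ge_def by blast

lemma has_valI: "t \<in> A - P \<Longrightarrow> c \<in> A - P \<Longrightarrow> t \<otimes> (p [^] m \<otimes> x) = c \<otimes> p [^] k \<Longrightarrow> n = int k - int m \<Longrightarrow> has_val x n"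
  unfolding has_val_def by blast

lemma odE:
  assumes "has_val x n"
  obtains t c m k where "t \<in> A - P" "c \<in> A - P" "t \<otimes> (p [^] (m::nat) \<otimes> x) = c \<otimes> p [^] (k::nat)"
    "n = int k - int m"
  using assms unfolding has_val_def by blast

lemma has_val_val_ge: "has_val x n \<Longrightarrow> val_ge x n"
  unfolding has_val_def val_ge_def by blast

text \<open>Multiplying by b^i cancels p^i up to the local unit (p b)^i. If j exceeded i, a factor p
  would survive on the right and put a product of two elements outside \<open>P\<close> into
  \<open>P\<close>.\<close>

lemma pow_cmp:
  assumes "y \<in> A - P" "z \<in> A" "y \<otimes> p [^] (i::nat) = z \<otimes> p [^] (j::nat)"
  shows "j \<le> i"
proof (rule ccontr)
  assume "\<not> j \<le> i"
  then obtain d where d: "j = i + Suc d" using less_imp_Suc_add[of i j] by auto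
  define t where "t = (p \<otimes> b) [^] i"
  have tp: "t = p [^] i \<otimes> b [^] i" by (simp add: t_def nat_pow_distrib)
  have t: "t \<in> A - P" unfolding t_def by (rule A_prime_pow_notin[OF prime pb])
  have "y \<otimes> t = (y \<otimes> p [^] i) \<otimes> b [^] i" using assms(1) by (simp add: tp m_assoc)
  also have "\<dots> = z \<otimes> (p [^] i \<otimes> p [^] Suc d) \<otimes> b [^] i" unfolding assms(3) d by (simp only: nat_pow_mult pA A_carrier)
  also have "\<dots> = (z \<otimes> p [^] d \<otimes> t) \<otimes> p" using assms(2) by (simp add: tp m_ac)
  also have "\<dots> \<in> P" using A_moduleD(4)[OF A_prime_A_module[OF prime] _ p] t assms(2) by simp
  finally show False using A_prime_mult_notin[OF prime assms(1) t] by simp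
qed

lemma has_val_val_ge_le:
  assumes "has_val x n" "val_ge x n'" "x \<in> carrier T"
  shows "n' \<le> n"
proof -
  obtain t u m k where 1: "t \<in> A - P" "u \<in> A - P" "t \<otimes> (p [^] (m::nat) \<otimes> x) = u \<otimes> p [^] (k::nat)" "n = int k - int m"
    using odE[OF assms(1)] .
  obtain t' c m' k' where 2: "t' \<in> A - P" "c \<in> A" "t' \<otimes> (p [^] (m'::nat) \<otimes> x) = c \<otimes> p [^] (k'::nat)" "n' = int k' - int m'"
    using geE[OF assms(2)] .
  have "(t' \<otimes> u) \<otimes> p [^] (m' + k) = (t' \<otimes> p [^] m') \<otimes> (u \<otimes> p [^] k)"
    using 1 2 by (simp add: nat_pow_mult[symmetric] m_ac)
  also have "\<dots> = (t \<otimes> p [^] m) \<otimes> (t' \<otimes> (p [^] m' \<otimes> x))"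
    unfolding 1(3)[symmetric] using 1(1) 2(1) assms(3) by (simp add: m_ac)
  also have "\<dots> = (t \<otimes> c) \<otimes> p [^] (m + k')"
    unfolding 2(3) using 1(1) 2(2) by (simp add: nat_pow_mult[symmetric] m_ac)
  finally have "m + k' \<le> m' + k"
    by (rule pow_cmp[OF A_prime_mult_notin[OF prime 2(1) 1(2)], rotated]) (use 1 2 in auto)
  then show ?thesis using 1 2 by linarith
qed

lemma has_val_unique: "has_val x n \<Longrightarrow> has_val x m \<Longrightarrow> x \<in> carrier T \<Longrightarrow> n = m"
  using has_val_val_ge_le[OF _ has_val_val_ge] by (metis order_antisym)

lemma val_ge_mono:
  assumes "val_ge x n" "n' \<le> n" "x \<in> carrier T"
  shows "val_ge x n'"
proof -
  obtain t c m k where 1: "t \<in> A - P" "c \<in> A" "t \<otimes> (p [^] (m::nat) \<otimes> x) = c \<otimes> p [^] (k::nat)" "n = int k - int m"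
    using geE[OF assms(1)] .
  obtain d :: nat where d: "n' = n - int d" using assms(2) by (metis zle_iff_zadd add_diff_cancel_right')
  show ?thesis
  proof (rule geI[OF 1(1)])
    have "t \<otimes> (p [^] (m + d) \<otimes> x) = p [^] d \<otimes> (t \<otimes> (p [^] m \<otimes> x))"
      using 1(1) assms(3) by (simp add: nat_pow_mult[symmetric] m_ac)
    then show "t \<otimes> (p [^] (m + d) \<otimes> x) = (c \<otimes> p [^] d) \<otimes> p [^] k"
      unfolding 1(3) using 1(2) by (simp add: m_ac)
  qed (use 1 d in auto)
qed

text \<open>This is what the assumption \<open>reg\<close> is for: a denominator divides a power p^n
  locally, so a fraction has value at least -n.\<close>

lemma val_ge_exists:
  assumes "x \<in> carrier T"
  shows "\<exists>n. val_ge x n"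
proof -
  obtain s a where s: "s \<in> A" "s \<in> Units T" "a \<in> A" "s \<otimes> x = a" using fracE[OF assms] by metis
  obtain t c n where t: "t \<in> A - P" "c \<in> A" "t \<otimes> p [^] (n::nat) = s \<otimes> c" using reg[OF s(1,2)] by blast
  have "t \<otimes> (p [^] n \<otimes> x) = (s \<otimes> c) \<otimes> x" using t assms by (simp add: t(3)[symmetric] m_assoc)
  also have "\<dots> = (c \<otimes> a) \<otimes> p [^] (0::nat)" using s(1) t(2) assms by (simp add: s(4)[symmetric] m_ac)
  finally have "val_ge x (int 0 - int n)" by (rule geI[OF t(1) A_mult[OF t(2) s(3)] _ refl])
  then show ?thesis ..
qed

text \<open>If the value is not exact, the coefficient c lies in \<open>P\<close>, so b c is in A,
  and multiplying by the local unit p b turns c p^k into (b c) p^(k+1).\<close>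

lemma val_ge_step:
  assumes "val_ge x n" "\<not> has_val x n" "x \<in> carrier T"
  shows "val_ge x (n + 1)"
proof -
  obtain t c m k where 1: "t \<in> A - P" "c \<in> A" "t \<otimes> (p [^] (m::nat) \<otimes> x) = c \<otimes> p [^] (k::nat)" "n = int k - int m"
    using geE[OF assms(1)] .
  have c: "c \<in> P" using 1 assms(2) has_valI[OF 1(1) _ 1(3,4)] by blast
  show ?thesis
  proof (rule geI)
    show "(p \<otimes> b) \<otimes> t \<in> A - P" by (rule A_prime_mult_notin[OF prime pb 1(1)])
    have "((p \<otimes> b) \<otimes> t) \<otimes> (p [^] m \<otimes> x) = (p \<otimes> b) \<otimes> (t \<otimes> (p [^] m \<otimes> x))"
      using 1(1) assms(3) by (simp add: m_assoc)
    also have "\<dots> = (b \<otimes> c) \<otimes> p [^] Suc k" unfolding 1(3) using 1(2) by (simp add: m_ac)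
    finally show "((p \<otimes> b) \<otimes> t) \<otimes> (p [^] m \<otimes> x) = (b \<otimes> c) \<otimes> p [^] Suc k" .
  qed (use bP[OF c] 1 in auto)
qed

lemma val_ge_all:
  assumes "\<not> (\<exists>n. has_val x n)" "x \<in> carrier T"
  shows "val_ge x n"
proof -
  obtain n0 where n0: "val_ge x n0" using val_ge_exists[OF assms(2)] ..
  have "val_ge x m" if "n0 \<le> m" for m
    using that by (induct m rule: int_ge_induct) (use n0 val_ge_step assms in auto)
  then show ?thesis using val_ge_mono[OF n0 _ assms(2)] by (cases "n0 \<le> n") auto
qed

lemma loc_val_has_val: "has_val x n \<Longrightarrow> x \<in> carrier T \<Longrightarrow> loc_val x = Fin n"
  unfolding loc_val_def using the_equality[of "has_val x" n] has_val_unique by metis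

lemma loc_val_val_ge: "x \<in> carrier T \<Longrightarrow> Fin n \<le> loc_val x \<longleftrightarrow> val_ge x n"
proof (cases "\<exists>n. has_val x n")
  case True
  assume x: "x \<in> carrier T"
  obtain N where N: "has_val x N" using True ..
  show ?thesis using loc_val_has_val[OF N x] has_val_val_ge_le[OF N _ x] val_ge_mono[OF has_val_val_ge[OF N] _ x] by auto
next
  case False
  assume "x \<in> carrier T"
  then show ?thesis using False val_ge_all[OF False] by (simp add: loc_val_def)
qed

lemma val_ge_add:
  assumes "val_ge x n" "val_ge y n" "x \<in> carrier T" "y \<in> carrier T"
  shows "val_ge (x \<oplus> y) n"
proof -
  obtain t c m k where 1: "t \<in> A - P" "c \<in> A" "t \<otimes> (p [^] (m::nat) \<otimes> x) = c \<otimes> p [^] (k::nat)" "n = int k - int m"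
    using geE[OF assms(1)] .
  obtain t' c' m' k' where 2: "t' \<in> A - P" "c' \<in> A" "t' \<otimes> (p [^] (m'::nat) \<otimes> y) = c' \<otimes> p [^] (k'::nat)" "n = int k' - int m'"
    using geE[OF assms(2)] .
  have k: "m' + k = m + k'" using 1 2 by linarith
  show ?thesis
  proof (rule geI)
    show "t \<otimes> t' \<in> A - P" by (rule A_prime_mult_notin[OF prime 1(1) 2(1)])
    have "(t \<otimes> t') \<otimes> (p [^] (m + m') \<otimes> (x \<oplus> y)) =
        (t' \<otimes> p [^] m') \<otimes> (t \<otimes> (p [^] m \<otimes> x)) \<oplus> (t \<otimes> p [^] m) \<otimes> (t' \<otimes> (p [^] m' \<otimes> y))"
      using 1(1) 2(1) assms(3,4) by (simp add: nat_pow_mult[symmetric] m_ac r_distr)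
    also have "\<dots> = (t' \<otimes> c) \<otimes> p [^] (m' + k) \<oplus> (t \<otimes> c') \<otimes> p [^] (m + k')"
      unfolding 1(3) 2(3) using 1(1,2) 2(1,2) by (simp add: nat_pow_mult[symmetric] m_ac)
    also have "\<dots> = (t' \<otimes> c \<oplus> t \<otimes> c') \<otimes> p [^] (m' + k)"
      unfolding k using 1(1,2) 2(1,2) by (simp add: l_distr)
    finally show "(t \<otimes> t') \<otimes> (p [^] (m + m') \<otimes> (x \<oplus> y)) = (t' \<otimes> c \<oplus> t \<otimes> c') \<otimes> p [^] (m' + k)" .
  qed (use 1 2 in auto)
qed

lemma mult_aux:
  assumes "t \<in> A" "t' \<in> A" "c \<in> A" "c' \<in> A" "x \<in> carrier T" "y \<in> carrier T"
    "t \<otimes> (p [^] (m::nat) \<otimes> x) = c \<otimes> p [^] (k::nat)" "t' \<otimes> (p [^] (m'::nat) \<otimes> y) = c' \<otimes> p [^] (k'::nat)"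
  shows "(t \<otimes> t') \<otimes> (p [^] (m + m') \<otimes> (x \<otimes> y)) = (c \<otimes> c') \<otimes> p [^] (k + k')"
proof -
  have "(t \<otimes> t') \<otimes> (p [^] (m + m') \<otimes> (x \<otimes> y)) = (t \<otimes> (p [^] m \<otimes> x)) \<otimes> (t' \<otimes> (p [^] m' \<otimes> y))"
    using assms(1-6) by (simp add: nat_pow_mult[symmetric] m_ac)
  also have "\<dots> = (c \<otimes> c') \<otimes> p [^] (k + k')"
    unfolding assms(7,8) using assms(3,4) by (simp add: nat_pow_mult[symmetric] m_ac)
  finally show ?thesis .
qed

lemma val_ge_mult:
  assumes "val_ge x n" "val_ge y n'" "x \<in> carrier T" "y \<in> carrier T"
  shows "val_ge (x \<otimes> y) (n + n')"
proof -
  obtain t c m k where 1: "t \<in> A - P" "c \<in> A" "t \<otimes> (p [^] (m::nat) \<otimes> x) = c \<otimes> p [^] (k::nat)" "n = int k - int m"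
    using geE[OF assms(1)] .
  obtain t' c' m' k' where 2: "t' \<in> A - P" "c' \<in> A" "t' \<otimes> (p [^] (m'::nat) \<otimes> y) = c' \<otimes> p [^] (k'::nat)" "n' = int k' - int m'"
    using geE[OF assms(2)] .
  show ?thesis
    by (rule geI[OF A_prime_mult_notin[OF prime 1(1) 2(1)] _ mult_aux[OF _ _ _ _ assms(3,4) 1(3) 2(3)]])
      (use 1 2 in auto)
qed

lemma has_val_mult:
  assumes "has_val x n" "has_val y n'" "x \<in> carrier T" "y \<in> carrier T"
  shows "has_val (x \<otimes> y) (n + n')"
proof -
  obtain t c m k where 1: "t \<in> A - P" "c \<in> A - P" "t \<otimes> (p [^] (m::nat) \<otimes> x) = c \<otimes> p [^] (k::nat)" "n = int k - int m"
    using odE[OF assms(1)] .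
  obtain t' c' m' k' where 2: "t' \<in> A - P" "c' \<in> A - P" "t' \<otimes> (p [^] (m'::nat) \<otimes> y) = c' \<otimes> p [^] (k'::nat)" "n' = int k' - int m'"
    using odE[OF assms(2)] .
  show ?thesis
    by (rule has_valI[OF A_prime_mult_notin[OF prime 1(1) 2(1)] A_prime_mult_notin[OF prime 1(2) 2(2)]
          mult_aux[OF _ _ _ _ assms(3,4) 1(3) 2(3)]]) (use 1 2 in auto)
qed

lemma val_ge_A: "x \<in> A \<Longrightarrow> val_ge x 0"
  by (rule geI[OF one_notin, of x 0 x 0]) auto

lemma val_ge_P: "x \<in> P \<Longrightarrow> val_ge x 1"
proof (rule geI[OF pb])
  assume x: "x \<in> P"
  then have "x \<in> A" by (rule A_prime_A[OF prime])
  then show "(p \<otimes> b) \<otimes> (p [^] (0::nat) \<otimes> x) = (b \<otimes> x) \<otimes> p [^] (1::nat)"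
    by (simp add: m_ac nat_pow_eone)
qed (auto intro: bP)

lemma has_val_notin: "x \<in> A - P \<Longrightarrow> has_val x 0"
  by (rule has_valI[OF one_notin, of x 0 x 0]) auto

lemma no_has_val_mult:
  assumes "\<not> (\<exists>n. has_val x n)" "x \<in> carrier T" "y \<in> carrier T"
  shows "\<not> (\<exists>n. has_val (x \<otimes> y) n)"
proof
  assume "\<exists>n. has_val (x \<otimes> y) n"
  then obtain N where N: "has_val (x \<otimes> y) N" ..
  obtain n0 where "val_ge y n0" using val_ge_exists[OF assms(3)] ..
  \<comment> \<open>The exponent for x is chosen so that the product would have value at least N +
    1, contradicting the exact value N.\<close>
  then have "val_ge (x \<otimes> y) ((N - n0 + 1) + n0)" using val_ge_all[OF assms(1,2)] assms by (intro val_ge_mult)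
  then show False using has_val_val_ge_le[OF N] assms by fastforce
qed

text \<open>Reduces an inequality between values to the integers below them, which is what
  \<open>val_ge\<close> describes; all integers together detect infinity.\<close>

lemma ext_le: "(\<And>n. Fin n \<le> e \<Longrightarrow> Fin n \<le> e') \<Longrightarrow> e \<le> (e' :: int extended)"
proof (cases e)
  case (Fin x1) assume "\<And>n. Fin n \<le> e \<Longrightarrow> Fin n \<le> e'" then show ?thesis using Fin by simp
next
  case Pinf assume h: "\<And>n. Fin n \<le> e \<Longrightarrow> Fin n \<le> e'"
  show ?thesis
  proof (cases e')
    case (Fin x) then show ?thesis using h[of "x + 1"] Pinf by simp
  next
    case Minf then show ?thesis using h[of 0] Pinf by simp
  qed simp
qed simp

lemma loc_val_valuation: "rank_one_discrete_valuation T loc_val"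
  unfolding rank_one_discrete_valuation_def
proof (intro conjI ballI)
  show "loc_val ` carrier T = insert Pinf (range Fin)"
  proof
    show "loc_val ` carrier T \<subseteq> insert Pinf (range Fin)" by (auto simp: loc_val_def)
    have "Fin n \<in> loc_val ` carrier T" for n
    proof (cases "0 \<le> n")
      case True
      then obtain m where m: "n = int m" by (rule nonneg_int_cases)
      have "has_val (p [^] m) n"
        by (rule has_valI[OF one_notin one_notin, of 0 _ m]) (use m in simp_all)
      then have "loc_val (p [^] m) = Fin n" by (rule loc_val_has_val) simp
      then show ?thesis by (metis A_carrier A_pow imageI pA)
    next
      case False
      \<comment> \<open>Negative values are taken by powers of b, since p^m b^m is the local unit (p
        b)^m.\<close>
      obtain m where m: "n = - int m" by (rule that[of "nat (- n)"]) (use False in simp)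
      have "has_val (b [^] m) n"
        by (rule has_valI[OF one_notin A_prime_pow_notin[OF prime pb, of m], of m _ 0])
          (use m in \<open>simp_all add: nat_pow_distrib\<close>)
      then have "loc_val (b [^] m) = Fin n" by (rule loc_val_has_val) simp
      then show ?thesis by (metis bT nat_pow_closed imageI)
    qed
    moreover have "Pinf \<in> loc_val ` carrier T"
    proof -
      have "\<not> has_val \<zero> n" for n
      proof
        assume "has_val \<zero> n"
        \<comment> \<open>Zero is divisible by every power of p; n + 1 is written as a difference of
          two natural numbers, at least one of which is 0.\<close>
        moreover have "val_ge \<zero> (n + 1)"
          by (rule geI[OF one_notin A_zero, of "nat (- (n + 1))" _ "nat (n + 1)"]) auto
        ultimately show False using has_val_val_ge_le by fastforce
      qed
      then have "loc_val \<zero> = Pinf" by (simp add: loc_val_def)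
      then show ?thesis by (metis image_eqI zero_closed)
    qed
    ultimately show "insert Pinf (range Fin) \<subseteq> loc_val ` carrier T" by auto
  qed
  fix x y assume xy: "x \<in> carrier T" "y \<in> carrier T"
  have nM: "loc_val z = Pinf \<or> (\<exists>n. loc_val z = Fin n)" for z by (auto simp: loc_val_def)
  show "loc_val (x \<otimes> y) = loc_val x + loc_val y"
  proof (cases "\<exists>n. has_val x n")
    case False
    then have "loc_val (x \<otimes> y) = Pinf" "loc_val x = Pinf" using no_has_val_mult[OF False xy] by (auto simp: loc_val_def)
    then show ?thesis using nM[of y] by auto
  next
    case True
    then obtain n where n: "has_val x n" ..
    show ?thesis
    proof (cases "\<exists>n. has_val y n")
      case False
      then have "loc_val (y \<otimes> x) = Pinf" "loc_val y = Pinf" using no_has_val_mult[OF False xy(2,1)] by (auto simp: loc_val_def)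
      then show ?thesis using nM[of x] xy by (auto simp: m_comm)
    next
      case True
      then obtain n' where "has_val y n'" ..
      then show ?thesis using n loc_val_has_val has_val_mult xy by simp
    qed
  qed
  show "min (loc_val x) (loc_val y) \<le> loc_val (x \<oplus> y)"
    by (rule ext_le) (use xy loc_val_val_ge val_ge_add in auto)
qed

lemma val_ge_ideal_product:
  assumes "\<And>Q. Q \<in> set Qs \<Longrightarrow> A_ideal Q" "z \<in> ideal_product Qs"
  shows "val_ge z (int (count_list Qs P))"
  using assms
proof (induct Qs arbitrary: z)
  case Nil then show ?case using val_ge_A by simp
next
  case (Cons Q Qs)
  have a: "A_ideal Q" "A_ideal (ideal_product Qs)" using Cons(2) by (auto intro: A_ideal_ideal_product)
  from Cons(3) have "z \<in> Q \<cdot> ideal_product Qs" by simp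
  then show ?case
  proof induct
    case (prod q y)
    have "val_ge q (if Q = P then 1 else 0)" using val_ge_P val_ge_A prod(1) A_ideal_A[OF a(1)] by auto
    moreover have "val_ge y (int (count_list Qs P))" using Cons(1)[OF _ prod(2)] Cons(2) by simp
    moreover have "q \<in> carrier T" "y \<in> carrier T" using prod A_ideal_A[OF a(1)] A_ideal_A[OF a(2)] by auto
    ultimately have "val_ge (q \<otimes> y) ((if Q = P then 1 else 0) + int (count_list Qs P))" by (rule val_ge_mult)
    then show ?case by (cases "Q = P") (auto simp: add.commute)
  next
    case (sum x y)
    then show ?case using A_ideal_A[OF A_ideal_prod[OF a]] by (intro val_ge_add) auto
  qed
qed

lemma val_ge_transfer:
  assumes "val_ge y n" "y \<in> carrier T" "y' \<in> carrier T" "q \<in> A - P" "r \<in> A" "q \<otimes> y' = r \<otimes> y"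
  shows "val_ge y' n"
proof -
  obtain t c m k where 1: "t \<in> A - P" "c \<in> A" "t \<otimes> (p [^] (m::nat) \<otimes> y) = c \<otimes> p [^] (k::nat)" "n = int k - int m"
    using geE[OF assms(1)] .
  have "(t \<otimes> q) \<otimes> (p [^] m \<otimes> y') = t \<otimes> (p [^] m \<otimes> (q \<otimes> y'))"
    using 1(1) assms(3,4) by (simp add: m_ac)
  also have "\<dots> = r \<otimes> (t \<otimes> (p [^] m \<otimes> y))" unfolding assms(6) using 1(1) assms(2,5) by (simp add: m_ac)
  also have "\<dots> = (r \<otimes> c) \<otimes> p [^] k" unfolding 1(3) using 1 assms by (simp add: m_ac)
  finally show ?thesis
    by (intro geI[OF A_prime_mult_notin[OF prime 1(1) assms(4)] _ _ 1(4)]) (use 1 assms in auto)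
qed

lemma val_ge_lower:
  assumes "val_ge y (n + 1)" "y \<in> carrier T" "b' \<in> carrier T" "\<And>x. x \<in> P \<Longrightarrow> b' \<otimes> x \<in> A"
  shows "val_ge (y \<otimes> b') n"
proof -
  \<comment> \<open>Elements of P^{-1} have value at least -1, because multiplying by p brings them
    into A.\<close>
  have "val_ge b' (-1)"
    by (rule geI[OF one_notin, of "b' \<otimes> p" 1 _ 0]) (use assms(3) assms(4)[OF p] in \<open>auto simp: m_comm nat_pow_eone\<close>)
  then show ?thesis using val_ge_mult[OF assms(1) _ assms(2,3), of "-1"] by simp
qed

end

section \<open>From the factorization of principal ideals to a family of valuations\<close>

context frac_pair
begin

text \<open>Local generation by p is given by u-invertibility. That a regular s divides a power of p
  locally is read off from its factorization: all factors other than \<open>P\<close> contain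
  elements outside \<open>P\<close>, and the exponent is the multiplicity of \<open>P\<close>. The
  closure is removed by an element of a \<open>GV\<close> set outside \<open>P\<close>.\<close>

lemma u_invertible_prime_val_data:
  assumes principal_u_factorization "u_invertible_prime P"
  obtains p b where "val_data T A P p b"
proof -
  have h: "A_prime P" "u_invertible P" "GV_free P" using assms(2) by (auto simp: u_invertible_prime_def)
  obtain p b where p: "p \<in> P" "b \<in> carrier T" "\<forall>x\<in>P. b \<otimes> x \<in> A" "p \<otimes> b \<in> A - P"
    using u_invertible_local[OF h(2) A_prime_A_ideal[OF h(1)] h(1,3)] .
  have "\<exists>t\<in>A - P. \<exists>c\<in>A. \<exists>n::nat. t \<otimes> p [^] n = s \<otimes> c" if s: "s \<in> A" "s \<in> Units T" for s
  proof -
    obtain Ps where Ps: "\<forall>P\<in>set Ps. u_invertible_prime P" "u_hull (principal s) = u_hull (ideal_product Ps)"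
      using principal_u_factorization_regular[OF assms(1) s] .
    have "Q = P \<or> \<not> Q \<subseteq> P" if "Q \<in> set Ps" for Q using u_invertible_prime_antichain[OF bspec[OF Ps(1) that] assms(2)] by blast
    then obtain t where "t \<in> A - P" "\<forall>x\<in>P. t \<otimes> x [^] count_list Ps P \<in> ideal_product Ps"
      using ideal_product_pow_mem[OF h(1), of Ps] Ps(1) by (metis A_prime_A_ideal u_invertible_prime_def)
    then obtain n where t: "t \<in> A - P" "t \<otimes> p [^] (n::nat) \<in> ideal_product Ps" using p(1) by blast
    have "A_ideal (ideal_product Ps)" using Ps(1) by (intro A_ideal_ideal_product A_prime_A_ideal) (simp add: u_invertible_prime_def)
    then have "t \<otimes> p [^] n \<in> u_hull (principal s)" using u_hull_self[OF A_ideal_A_module t(2)] Ps(2) by simp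
    then obtain F where F: "GV F" "\<And>f. f \<in> F \<Longrightarrow> (t \<otimes> p [^] n) \<otimes> f \<in> principal s" by (auto simp: u_hull_def)
    obtain f where f: "f \<in> F" "f \<notin> P" using F(1) h(3) by (auto simp: GV_free_def)
    obtain c where c: "c \<in> A" "(t \<otimes> p [^] n) \<otimes> f = s \<otimes> c" using F(2)[OF f(1)] by (auto simp: principal_mem)
    have fA: "f \<in> A" using GV_carrier[OF F(1) f(1)] .
    have pA: "p \<in> A" using p h A_prime_A by blast
    have "(t \<otimes> f) \<otimes> p [^] n = s \<otimes> c" using c(2) t(1) fA pA by (simp add: m_ac)
    moreover have "t \<otimes> f \<in> A - P" using A_prime_mult_notin[OF h(1) t(1)] f fA by simp
    ultimately show ?thesis using c(1) by blast
  qed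
  then have "val_data T A P p b" using p h by unfold_locales auto
  then show thesis by (rule that)
qed

text \<open>The u-closed product is recovered from the valuations. Dividing y by the first prime P,
  that is, multiplying by elements of P^{-1}, costs one unit of value at P and nothing at the other
  primes, so induction applies to the remaining factors.\<close>

lemma principal_u_factorization_u_hull_ideal_product:
  assumes vd: "\<And>P. u_invertible_prime P \<Longrightarrow> val_data T A P (p P) (b P)"
    and "\<And>P. P \<in> set Ps \<Longrightarrow> u_invertible_prime P" and "y \<in> A"
    and "\<And>P. u_invertible_prime P \<Longrightarrow> val_data.val_ge T A P (p P) y (int (count_list Ps P))"
  shows "y \<in> u_hull (ideal_product Ps)"
  using assms(2-)
proof (induct Ps arbitrary: y)
  case Nil then show ?case by (simp add: u_hull_A)
next
  case (Cons P Ps)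
  have P: "u_invertible_prime P" "A_prime P" "u_invertible P" using Cons(2)[of P] by (auto simp: u_invertible_prime_def)
  interpret V: val_data T A P "p P" "b P" by (rule vd[OF P(1)])
  have a: "A_ideal (ideal_product Ps)" using Cons(2) by (intro A_ideal_ideal_product A_prime_A_ideal) (simp add: u_invertible_prime_def)
  have val_ge: "V.val_ge y (int (count_list Ps P) + 1)" using Cons(4)[OF P(1)] by (simp add: add.commute)
  have yP: "y \<in> P"
  proof (rule ccontr)
    assume "y \<notin> P"
    then have "V.has_val y 0" using Cons(3) V.has_val_notin by simp
    then show False using V.has_val_val_ge_le[OF _ val_ge] Cons(3) by fastforce
  qed
  obtain B F where B: "B \<subseteq> carrier T" "\<And>b x. b \<in> B \<Longrightarrow> x \<in> P \<Longrightarrow> b \<otimes> x \<in> A" "GV F" "F \<subseteq> P \<cdot> B"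
    using P(3) by (auto simp: u_invertible_def)
  have yT: "y \<in> carrier T" using Cons(3) by simp
  have yb: "y \<otimes> c \<in> u_hull (ideal_product Ps)" if c: "c \<in> B" for c
  proof (rule Cons(1))
    have cT: "c \<in> carrier T" using B c by auto
    show ycA: "y \<otimes> c \<in> A" using B(2)[OF c yP] yT cT by (simp add: m_comm)
    fix Q assume Q: "u_invertible_prime Q"
    interpret Q: val_data T A Q "p Q" "b Q" by (rule vd[OF Q])
    show "Q.val_ge (y \<otimes> c) (int (count_list Ps Q))"
    proof (cases "Q = P")
      case True
      then show ?thesis using V.val_ge_lower[OF val_ge yT cT B(2)[OF c]] by simp
    next
      case False
      \<comment> \<open>At Q the element q of P is a local unit, and c q lies in A; so
        multiplication by c does not lower the value there.\<close>
      then obtain q where q: "q \<in> P" "q \<notin> Q" using u_invertible_prime_antichain[OF P(1) Q] by auto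
      have qA: "q \<in> A" using A_prime_A[OF P(2) q(1)] .
      have "Q.val_ge y (int (count_list Ps Q))" using Cons(4)[OF Q] False by simp
      then show ?thesis
        by (rule Q.val_ge_transfer[of _ _ _ q "c \<otimes> q"]) (use yT cT q qA B(2)[OF c] in \<open>auto simp: m_ac\<close>)
    qed
  qed (use Cons(2) in auto)
  let ?L = "P \<cdot> u_hull (ideal_product Ps)"
  have m: "A_module ?L" by (intro A_ideal_A_module A_ideal_prod A_ideal_u_hull A_prime_A_ideal P a)
  have yl: "y \<otimes> l \<in> ?L" if "l \<in> P \<cdot> B" for l
    using that
  proof induct
    case (prod x c)
    have "x \<in> carrier T" "c \<in> carrier T" using prod B(1) A_prime_A[OF P(2)] by auto
    then have "y \<otimes> (x \<otimes> c) = x \<otimes> (y \<otimes> c)" using yT by (simp add: m_lcomm)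
    then show ?case using ideal_prod.prod[OF prod(1) yb[OF prod(2)], of T] by simp
  next
    case (sum s t)
    have "P \<cdot> B \<subseteq> carrier T" by (rule prod_subset) (use B(1) A_prime_A[OF P(2)] in auto)
    then show ?case using sum A_moduleD(3)[OF m] yT by (simp add: r_distr subset_iff)
  qed
  have "y \<in> u_hull ?L" by (rule u_hullI[OF yT B(3)]) (use yl B in auto)
  then show ?case using u_hull_prod_u_hull[OF A_prime_A_module[OF P(2)] A_ideal_A_module[OF a]] by simp
qed

text \<open>For x = y/s with nonnegative values, the values of y dominate those of s, hence the
  multiplicities of the factors of s; so y lies in the u-closure of s A and x lies in A. Only the
  prime factors of a regular element can give it nonzero value.\<close>

lemma principal_u_factorization_krull:
  assumes principal_u_factorization
  shows krull
proof -
  have "\<forall>P. \<exists>p b. u_invertible_prime P \<longrightarrow> val_data T A P p b" using u_invertible_prime_val_data[OF assms] by metis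
  then obtain p b where vd: "\<And>P. u_invertible_prime P \<Longrightarrow> val_data T A P (p P) (b P)" by metis
  define v where "v = (\<lambda>P. val_data.loc_val T A P (p P))"
  let ?W = "v ` {P. u_invertible_prime P}"
  have vge: "Fin n \<le> v P x \<longleftrightarrow> val_data.val_ge T A P (p P) x n" if "u_invertible_prime P" "x \<in> carrier T" for P x n
    using val_data.loc_val_val_ge[OF vd[OF that(1)] that(2)] by (simp add: v_def)
  have "krull_family ?W"
    unfolding krull_family_def
  proof (intro conjI ballI)
    fix w assume "w \<in> ?W"
    then obtain P where P: "u_invertible_prime P" "w = v P" by auto
    then show "rank_one_discrete_valuation T w" using val_data.loc_val_valuation[OF vd[OF P(1)]] by (simp add: v_def)
    obtain u where u: "u \<in> P" "u \<in> Units T" using P by (auto simp: u_invertible_prime_def)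
    have uA: "u \<in> A" using u P A_prime_A by (auto simp: u_invertible_prime_def)
    have "Fin 1 \<le> w u" unfolding P(2) vge[OF P(1) A_carrier[OF uA]] by (rule val_data.val_ge_P[OF vd[OF P(1)] u(1)])
    then have "0 < w u" by (cases "w u") (auto simp: zero_extended_def)
    then show "\<exists>a\<in>A \<inter> Units T. 0 < w a" using u uA by blast
  next
    fix x assume x: "x \<in> carrier T"
    show "(\<forall>w\<in>?W. 0 \<le> w x) \<longleftrightarrow> x \<in> A"
    proof
      assume "x \<in> A"
      then show "\<forall>w\<in>?W. 0 \<le> w x" using vge[OF _ x, of _ 0] val_data.val_ge_A[OF vd] by (auto simp: zero_extended_def)
    next
      assume "\<forall>w\<in>?W. 0 \<le> w x"
      then have gx: "val_data.val_ge T A P (p P) x 0" if "u_invertible_prime P" for P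
        using that vge[OF that x, of 0] by (auto simp: zero_extended_def)
      obtain s y where s: "s \<in> A" "s \<in> Units T" "y \<in> A" "s \<otimes> x = y" "x = inv s \<otimes> y" using fracE[OF x] .
      obtain Ps where Ps: "\<forall>P\<in>set Ps. u_invertible_prime P" "u_hull (principal s) = u_hull (ideal_product Ps)"
        using principal_u_factorization_regular[OF assms s(1,2)] .
      have aPs: "\<And>P. P \<in> set Ps \<Longrightarrow> A_ideal P" using Ps(1) by (intro A_prime_A_ideal) (simp add: u_invertible_prime_def)
      have "y \<in> u_hull (ideal_product Ps)"
      proof (rule principal_u_factorization_u_hull_ideal_product[OF vd bspec[OF Ps(1)] s(3)])
        fix P assume P: "u_invertible_prime P"
        interpret V: val_data T A P "p P" "b P" by (rule vd[OF P])
        have "s \<in> u_hull (ideal_product Ps)" using Ps(2) u_hull_incl[of "principal s"] principal_self[of s] A_moduleD(1)[OF A_module_principal[of s]] s by auto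
        then obtain F where F: "GV F" "\<And>f. f \<in> F \<Longrightarrow> s \<otimes> f \<in> ideal_product Ps" by (auto simp: u_hull_def)
        obtain f where f: "f \<in> F" "f \<notin> P" using F(1) P by (auto simp: GV_free_def u_invertible_prime_def)
        have fA: "f \<in> A" using GV_carrier[OF F(1) f(1)] .
        have "V.val_ge (s \<otimes> f) (int (count_list Ps P))" using V.val_ge_ideal_product[OF aPs F(2)[OF f(1)]] .
        \<comment> \<open>The factor f from the \<open>GV\<close> set is outside P, so it does not
          contribute to the value.\<close>
        then have "V.val_ge s (int (count_list Ps P))"
          by (rule V.val_ge_transfer[of _ _ _ f \<one>]) (use s fA f in \<open>auto simp: m_comm\<close>)
        then have "V.val_ge (s \<otimes> x) (int (count_list Ps P) + 0)" using gx[OF P] s(1) x by (intro V.val_ge_mult) auto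
        then show "V.val_ge y (int (count_list Ps P))" using s(4) by simp
      qed
      then have "y \<in> u_hull (principal s)" using Ps(2) by simp
      then obtain F where F: "GV F" "\<And>f. f \<in> F \<Longrightarrow> y \<otimes> f \<in> principal s" by (auto simp: u_hull_def)
      show "x \<in> A"
      proof (rule GV_D[OF F(1) x])
        fix f assume f: "f \<in> F"
        obtain c where c: "c \<in> A" "y \<otimes> f = s \<otimes> c" using F(2)[OF f] by (auto simp: principal_mem)
        have "x \<otimes> f = inv s \<otimes> (y \<otimes> f)" using s GV_carrier[OF F(1) f] by (simp add: m_assoc)
        then show "x \<otimes> f \<in> A" unfolding c(2) using unit_cancel(1)[OF s(2), of c] c(1) by simp
      qed
    qed
  next
    fix a assume "a \<in> A \<inter> Units T"
    then have a: "a \<in> A" "a \<in> Units T" by auto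
    obtain Ps where Ps: "\<forall>P\<in>set Ps. u_invertible_prime P" "u_hull (principal a) = u_hull (ideal_product Ps)"
      using principal_u_factorization_regular[OF assms a] .
    have aPs: "\<And>P. P \<in> set Ps \<Longrightarrow> A_ideal P" using Ps(1) by (intro A_prime_A_ideal) (simp add: u_invertible_prime_def)
    have "{w \<in> ?W. w a \<noteq> 0} \<subseteq> v ` set Ps"
    proof
      fix w assume "w \<in> {w \<in> ?W. w a \<noteq> 0}"
      then obtain P where P: "u_invertible_prime P" "w = v P" "v P a \<noteq> 0" by auto
      interpret V: val_data T A P "p P" "b P" by (rule vd[OF P(1)])
      have aP: "a \<in> P"
      proof (rule ccontr)
        assume "a \<notin> P"
        then have "V.has_val a 0" using a V.has_val_notin by simp
        then show False using P(3) V.loc_val_has_val a by (auto simp: v_def zero_extended_def)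
      qed
      \<comment> \<open>Since P contains \<open>a\<close> and is GV-free, it contains the whole
        product, hence some factor; by the antichain property P is that factor.\<close>
      have "ideal_product Ps \<subseteq> P"
      proof
        fix z assume z: "z \<in> ideal_product Ps"
        have zA: "z \<in> A" using A_ideal_A[OF A_ideal_ideal_product[OF aPs] z] .
        have "z \<in> u_hull (principal a)" using u_hull_self[OF A_ideal_A_module[OF A_ideal_ideal_product[OF aPs]] z] Ps(2) by simp
        then obtain F where F: "GV F" "\<And>f. f \<in> F \<Longrightarrow> z \<otimes> f \<in> principal a" by (auto simp: u_hull_def)
        obtain f where f: "f \<in> F" "f \<notin> P" using F(1) P(1) by (auto simp: GV_free_def u_invertible_prime_def)
        have "z \<otimes> f \<in> P" using F(2)[OF f(1)] principal_subset[OF A_prime_A_module[OF V.prime] aP] by auto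
        then show "z \<in> P" using A_prime_mem[OF V.prime _ zA GV_carrier[OF F(1) f(1)]] f by auto
      qed
      from ideal_product_prime[OF V.prime this aPs] obtain Q where "Q \<in> set Ps" "Q \<subseteq> P" by blast
      then have "P \<in> set Ps" using u_invertible_prime_antichain[OF bspec[OF Ps(1)] P(1)] by auto
      then show "w \<in> v ` set Ps" using P by simp
    qed
    then show "finite {w \<in> ?W. w a \<noteq> 0}" by (rule finite_subset) simp
  qed
  then show ?thesis unfolding krull_def by blast
qed

end

section \<open>Existence and avoidance of primes\<close>

context frac_pair
begin

lemma add_minus_left: "x \<in> carrier T \<Longrightarrow> y \<in> carrier T \<Longrightarrow> x \<oplus> y \<ominus> x = y"
  and add_minus_right: "x \<in> carrier T \<Longrightarrow> y \<in> carrier T \<Longrightarrow> x \<oplus> y \<ominus> y = x"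
proof -
  assume "x \<in> carrier T" "y \<in> carrier T"
  then show "x \<oplus> y \<ominus> y = x" by (simp add: minus_eq a_assoc r_neg)
next
  assume h: "x \<in> carrier T" "y \<in> carrier T"
  then have "x \<oplus> y \<ominus> x = y \<oplus> x \<ominus> x" by (simp add: a_comm)
  then show "x \<oplus> y \<ominus> x = y" using h by (simp add: minus_eq a_assoc r_neg)
qed

text \<open>An ideal maximal among those above I and disjoint from the multiplicative set is prime:
  two elements outside it would each generate with it an ideal meeting the set, and so would their
  product.\<close>

lemma exists_prime_avoiding:
  assumes I: "A_ideal I" "I \<inter> S = {}" and S: "S \<subseteq> A" "\<And>x y. x \<in> S \<Longrightarrow> y \<in> S \<Longrightarrow> x \<otimes> y \<in> S" "\<one> \<in> S"
  obtains Q where "A_prime Q" "I \<subseteq> Q" "Q \<inter> S = {}"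
proof -
  let ?F = "{J. A_ideal J \<and> I \<subseteq> J \<and> J \<inter> S = {}}"
  have "\<exists>M\<in>?F. \<forall>Z\<in>?F. M \<subseteq> Z \<longrightarrow> Z = M"
  proof (rule subset_Zorn_nonempty)
    show "?F \<noteq> {}" using I by blast
    fix C assume C: "C \<noteq> {}" "subset.chain ?F C"
    then have CF: "\<And>J. J \<in> C \<Longrightarrow> A_ideal J \<and> I \<subseteq> J \<and> J \<inter> S = {}"
      and lin: "\<And>J K. J \<in> C \<Longrightarrow> K \<in> C \<Longrightarrow> J \<subseteq> K \<or> K \<subseteq> J"
      unfolding subset_chain_def by blast+
    have CA: "x \<in> A" if "J \<in> C" "x \<in> J" for J x using CF[OF that(1)] A_ideal_A[of J x] that(2) by simp
    have Cm: "A_module J" if "J \<in> C" for J using CF[OF that] A_ideal_A_module by simp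
    have "A_module (\<Union>C)"
    proof (rule A_moduleI)
      show "\<Union>C \<subseteq> carrier T" using CA A_subset by blast
      show "\<zero> \<in> \<Union>C" using C(1) A_moduleD(2)[OF Cm] by blast
      fix x y assume "x \<in> \<Union>C" "y \<in> \<Union>C"
      then obtain J K where "J \<in> C" "x \<in> J" "K \<in> C" "y \<in> K" by blast
      then obtain L where L: "L \<in> C" "x \<in> L" "y \<in> L" using lin by blast
      then have "x \<oplus> y \<in> L" using A_moduleD(3)[OF Cm] by simp
      then show "x \<oplus> y \<in> \<Union>C" using L by blast
    next
      fix a x assume a: "a \<in> A" and "x \<in> \<Union>C"
      then obtain J where J: "J \<in> C" "x \<in> J" by blast
      then show "a \<otimes> x \<in> \<Union>C" using A_moduleD(4)[OF Cm[OF J(1)] a J(2)] by blast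
    qed
    moreover have "\<Union>C \<subseteq> A" using CA by blast
    ultimately have "A_ideal (\<Union>C)" by (simp add: A_ideal_def)
    moreover have "I \<subseteq> \<Union>C" using C(1) CF by blast
    moreover have "\<Union>C \<inter> S = {}" using CF by blast
    ultimately show "\<Union>C \<in> ?F" by blast
  qed
  then obtain Q where Q0: "Q \<in> ?F" "\<forall>Z\<in>?F. Q \<subseteq> Z \<longrightarrow> Z = Q" by (elim bexE)
  have Q: "A_ideal Q" "I \<subseteq> Q" "Q \<inter> S = {}" using Q0(1) by simp_all
  have max: "J = Q" if "A_ideal J" "J \<inter> S = {}" "Q \<subseteq> J" for J
    using bspec[OF Q0(2), of J] that Q(2) by simp
  note Qm = A_moduleD[OF A_ideal_A_module[OF Q(1)]] and QA = A_ideal_A[OF Q(1)]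
  have meet: "\<exists>i c. i \<in> Q \<and> c \<in> A \<and> i \<oplus> x \<otimes> c \<in> S" if "x \<in> A" "x \<notin> Q" for x
  proof -
    let ?J = "{i \<oplus> x \<otimes> c | i c. i \<in> Q \<and> c \<in> A}"
    note J = A_ideal_sum_principal[OF Q(1) that(1)]
    have "?J \<inter> S \<noteq> {}"
    proof
      assume "?J \<inter> S = {}"
      from max[OF J(1) this J(2)] J(3) show False using that(2) by simp
    qed
    then show ?thesis by blast
  qed
  have "A_prime Q"
    unfolding A_prime_def
  proof (intro conjI ballI impI)
    show "\<one> \<notin> Q" using Q(3) S(3) by blast
    fix x y assume xy: "x \<in> A" "y \<in> A" "x \<otimes> y \<in> Q"
    show "x \<in> Q \<or> y \<in> Q"
    proof (rule ccontr)
      assume "\<not> (x \<in> Q \<or> y \<in> Q)"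
      then obtain i c j d where h: "i \<in> Q" "c \<in> A" "i \<oplus> x \<otimes> c \<in> S" "j \<in> Q" "d \<in> A" "j \<oplus> y \<otimes> d \<in> S"
        using meet xy by metis
      have "(i \<oplus> x \<otimes> c) \<otimes> (j \<oplus> y \<otimes> d) = (j \<oplus> y \<otimes> d) \<otimes> i \<oplus> ((x \<otimes> c) \<otimes> j \<oplus> (c \<otimes> d) \<otimes> (x \<otimes> y))"
        using h(1,2,4,5) Qm(1) xy(1,2) by (simp add: l_distr r_distr m_ac a_ac)
      also have "\<dots> \<in> Q" using h xy S(1) QA[OF h(4)] by (intro Qm(3) Qm(4)[OF _ h(1)] Qm(4)[OF _ h(4)] Qm(4)[OF _ xy(3)]) auto
      finally show False using S(2)[OF h(3,6)] Q(3) by blast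
    qed
  qed (rule Q)
  then show thesis using Q that by blast
qed

text \<open>If x avoids the earlier primes but lies in the new prime P, it is corrected by z m,
  where m is in M but not in P, and z is in all earlier primes but not in P.\<close>

lemma avoid_primes:
  assumes "finite S" "\<And>P. P \<in> S \<Longrightarrow> A_prime P" "\<And>P Q. P \<in> S \<Longrightarrow> Q \<in> S \<Longrightarrow> P \<subseteq> Q \<Longrightarrow> P = Q"
    "A_ideal M" "\<And>P. P \<in> S \<Longrightarrow> \<not> M \<subseteq> P"
  shows "\<exists>x\<in>M. \<forall>P\<in>S. x \<notin> P"
  using assms(1-3,5)
proof (induct S)
  case empty
  then show ?case using A_moduleD(2)[OF A_ideal_A_module[OF assms(4)]] by auto
next
  case (insert P S)
  note Mm = A_moduleD[OF A_ideal_A_module[OF assms(4)]]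
  note pr = insert(4) and anti = insert(5)
  obtain x where x: "x \<in> M" "\<forall>P\<in>S. x \<notin> P" using insert by (metis insertCI)
  have P: "A_prime P" using insert by simp
  show ?case
  proof (cases "x \<in> P")
    case True
    obtain m where m: "m \<in> M" "m \<notin> P" using insert(6)[of P] by auto
    have mA: "m \<in> A" using A_ideal_A[OF assms(4) m(1)] .
    \<comment> \<open>A product of elements, one from each earlier prime and all outside P;
      incomparability of the primes supplies them.\<close>
    have "\<exists>z\<in>A - P. \<forall>Q\<in>S'. z \<in> Q" if "finite S'" "S' \<subseteq> S" for S'
      using that
    proof (induct S')
      case empty then show ?case using A_prime_one[OF P] by (intro bexI[of _ \<one>]) auto
    next
      case (insert Q S')
      then obtain z where z: "z \<in> A - P" "\<forall>Q\<in>S'. z \<in> Q" by auto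
      have Q: "Q \<in> S" "A_prime Q" using insert(4) pr by auto
      have "\<not> Q \<subseteq> P" using Q(1) anti[of Q P] \<open>P \<notin> S\<close> by blast
      then obtain q where q: "q \<in> Q" "q \<notin> P" by auto
      have qA: "q \<in> A" using A_prime_A[OF Q(2) q(1)] .
      have "q \<otimes> z \<in> A - P" using A_prime_mult_notin[OF P _ z(1)] q qA by simp
      moreover have "q \<otimes> z \<in> R" if "R \<in> insert Q S'" for R
      proof (cases "R = Q")
        case True then show ?thesis using A_moduleD(5)[OF A_prime_A_module[OF Q(2)] _ q(1)] z by auto
      next
        case False
        then have "R \<in> S'" using that by simp
        moreover have "A_prime R" using \<open>R \<in> S'\<close> insert(4) pr by auto
        ultimately show ?thesis using A_moduleD(4)[OF A_prime_A_module qA] z(2) by blast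
      qed
      ultimately show ?case by blast
    qed
    then obtain z where z: "z \<in> A - P" "\<forall>Q\<in>S. z \<in> Q" using \<open>finite S\<close> by blast
    have zm: "z \<otimes> m \<in> A - P" using A_prime_mult_notin[OF P z(1)] m mA by simp
    let ?y = "x \<oplus> z \<otimes> m"
    have xA: "x \<in> A" using A_ideal_A[OF assms(4) x(1)] .
    have sub: "x \<in> Q" if "A_prime Q" "z \<otimes> m \<in> Q" "?y \<in> Q" for Q
    proof -
      have "?y \<ominus> z \<otimes> m = x" using xA zm by (simp add: add_minus_right)
      then show ?thesis using A_moduleD(7)[OF A_prime_A_module[OF that(1)] that(3,2)] by simp
    qed
    have "?y \<in> M" using x(1) m(1) z(1) by (intro Mm(3,4)) auto
    moreover have "?y \<notin> P"
    proof
      assume "?y \<in> P"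
      then have "?y \<ominus> x \<in> P" using A_moduleD(7)[OF A_prime_A_module[OF P] _ True] by simp
      moreover have "?y \<ominus> x = z \<otimes> m" using xA zm by (simp add: add_minus_left)
      ultimately show False using zm by simp
    qed
    moreover have "?y \<notin> Q" if Q: "Q \<in> S" for Q
    proof
      assume y: "?y \<in> Q"
      have "A_prime Q" using insert(4)[of Q] Q by simp
      moreover have "z \<otimes> m \<in> Q" using A_moduleD(5)[OF A_prime_A_module[OF \<open>A_prime Q\<close>] mA] z(2) Q by auto
      ultimately show False using sub y x(2) Q by blast
    qed
    ultimately show ?thesis by blast
  next
    case False then show ?thesis using x by blast
  qed
qed

definition min_prime :: "'a set \<Rightarrow> bool" where
  "min_prime P \<longleftrightarrow> A_prime P \<and> (\<forall>Q. A_prime Q \<and> Q \<subseteq> P \<longrightarrow> Q = P)"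

section \<open>Localization at nonregular primes\<close>

text \<open>\<open>locally_zero M\<close>: the elements that vanish in the localization at \<open>M\<close>; \<open>local_contraction M a\<close>: the
  contraction of the ideal generated by \<open>a\<close> in the localization at \<open>M\<close>.\<close>

definition locally_zero :: "'a set \<Rightarrow> 'a \<Rightarrow> bool" where
  "locally_zero M y \<longleftrightarrow> (\<exists>t\<in>A - M. t \<otimes> y = \<zero>)"

definition local_contraction :: "'a set \<Rightarrow> 'a \<Rightarrow> 'a set" where
  "local_contraction M a = {x \<in> A. \<exists>t\<in>A - M. t \<otimes> x \<in> principal a}"

text \<open>Says that in the localization at \<open>M\<close> principal ideals are products of prime
  ideals. Multipliers outside \<open>M\<close> express the two inclusions, so no localized ring has
  to be formed.\<close>

definition local_principal_factorization :: "'a set \<Rightarrow> bool" where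
  "local_principal_factorization M \<longleftrightarrow> A_prime M \<and> (\<forall>a\<in>A. \<exists>Ns. (\<forall>N\<in>set Ns. A_prime N \<and> N \<subseteq> M) \<and>
     (\<exists>t\<in>A - M. t \<otimes> a \<in> ideal_product Ns) \<and> (\<forall>y\<in>ideal_product Ns. \<exists>t\<in>A - M. t \<otimes> y \<in> principal a))"

lemma local_principal_factorizationE:
  assumes "local_principal_factorization M" "a \<in> A"
  obtains Ns t where "\<forall>N\<in>set Ns. A_prime N" "\<forall>N\<in>set Ns. N \<subseteq> M" "t \<in> A - M" "t \<otimes> a \<in> ideal_product Ns"
    "\<forall>z\<in>ideal_product Ns. \<exists>t\<in>A - M. t \<otimes> z \<in> principal a"
proof -
  have "\<exists>Ns. (\<forall>N\<in>set Ns. A_prime N \<and> N \<subseteq> M) \<and>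
     (\<exists>t\<in>A - M. t \<otimes> a \<in> ideal_product Ns) \<and> (\<forall>y\<in>ideal_product Ns. \<exists>t\<in>A - M. t \<otimes> y \<in> principal a)"
    using assms(1) unfolding local_principal_factorization_def by (elim conjE) (erule bspec[OF _ assms(2)])
  then show thesis by (elim exE conjE bexE) (rule that, auto)
qed

lemma nonreg_GV_free: "M \<inter> Units T = {} \<Longrightarrow> GV_free M"
  unfolding GV_free_def using GV_unit by blast

text \<open>Factors meeting a multiplicative set become trivial after inverting it. The lemma is
  used with the complement of a prime and with the regular elements.\<close>

lemma ideal_product_filter_mult:
  assumes S: "S \<subseteq> A" "\<one> \<in> S" "\<And>x y. x \<in> S \<Longrightarrow> y \<in> S \<Longrightarrow> x \<otimes> y \<in> S"
    and "\<And>Q. Q \<in> set Qs \<Longrightarrow> A_ideal Q" "\<And>Q. Q \<in> set Qs \<Longrightarrow> \<not> p Q \<Longrightarrow> Q \<inter> S \<noteq> {}"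
  shows "\<exists>t\<in>S. \<forall>y\<in>ideal_product (filter p Qs). t \<otimes> y \<in> ideal_product Qs"
  using assms(4,5)
proof (induct Qs)
  case Nil
  show ?case using S(2) by (intro bexI[of _ \<one>]) auto
next
  case (Cons Q Qs)
  then obtain t where t: "t \<in> S" "\<And>y. y \<in> ideal_product (filter p Qs) \<Longrightarrow> t \<otimes> y \<in> ideal_product Qs" by auto
  have tA: "t \<in> A" using t S by blast
  have c: "A_ideal Q" "A_ideal (ideal_product Qs)" "A_ideal (ideal_product (filter p Qs))"
    using Cons(2)[of Q] A_ideal_ideal_product[of Qs] A_ideal_ideal_product[of "filter p Qs"] Cons(2) by simp_all
  note m = A_moduleD[OF A_ideal_A_module[OF A_ideal_prod[OF c(1,2)]]]
  show ?case
  proof (cases "p Q")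
    case True
    have "t \<otimes> y \<in> Q \<cdot> ideal_product Qs" if "y \<in> Q \<cdot> ideal_product (filter p Qs)" for y
      using that
    proof induct
      case (prod i j)
      have "t \<otimes> (i \<otimes> j) = i \<otimes> (t \<otimes> j)" using A_ideal_A[OF c(1) prod(1)] A_ideal_A[OF c(3) prod(2)] tA by (simp add: m_lcomm)
      then show ?case using ideal_prod.prod[OF prod(1) t(2)[OF prod(2)], of T] by simp
    next
      case (sum x y)
      then have "x \<in> A" "y \<in> A" using A_ideal_A[OF A_ideal_prod[OF c(1,3)]] by auto
      then show ?case using sum m(3) tA by (simp add: r_distr)
    qed
    then show ?thesis using True t(1) by auto
  next
    case False
    then obtain q where q: "q \<in> Q" "q \<in> S" using Cons(3)[of Q] by auto
    have qA: "q \<in> A" using A_ideal_A[OF c(1) q(1)] .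
    have "(q \<otimes> t) \<otimes> y \<in> Q \<cdot> ideal_product Qs" if y: "y \<in> ideal_product (filter p Qs)" for y
      using ideal_prod.prod[OF q(1) t(2)[OF y], of T] qA tA A_ideal_A[OF c(3) y] by (simp add: m_assoc)
    then show ?thesis using False S(3)[OF q(2) t(1)] by auto
  qed
qed

text \<open>Every \<open>GV\<close> set has an element outside a GV-free prime, so one multiplier
  removes the u-closure. Factors not contained in \<open>M\<close> become trivial locally and are
  dropped.\<close>

lemma principal_u_factorization_local:
  assumes principal_u_factorization "A_prime M" "GV_free M"
  shows "local_principal_factorization M"
  unfolding local_principal_factorization_def
proof (intro conjI ballI)
  fix a assume a: "a \<in> A"
  then obtain Ps where Ps: "\<forall>P\<in>set Ps. A_prime P" "u_hull (principal a) = u_hull (ideal_product Ps)" using assms(1) by (auto simp: principal_u_factorization_def)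
  let ?Ns = "filter (\<lambda>P. P \<subseteq> M) Ps"
  have A_ideal: "A_ideal P" if "P \<in> set Ps" for P using Ps(1) that A_prime_A_ideal by blast
  have prdm: "A_module (ideal_product Ps)" by (rule A_ideal_A_module[OF A_ideal_ideal_product[OF A_ideal]])
  have GVn: "\<exists>f\<in>F. f \<in> A - M" if "GV F" for F using assms(3) that GV_carrier[OF that] by (auto simp: GV_free_def)
  have sub: "ideal_product Qs \<subseteq> ideal_product (filter (\<lambda>P. P \<subseteq> M) Qs)" if "\<And>P. P \<in> set Qs \<Longrightarrow> A_ideal P" for Qs
    using that
  proof (induct Qs)
    case (Cons Q Qs)
    then have IH: "ideal_product Qs \<subseteq> ideal_product (filter (\<lambda>P. P \<subseteq> M) Qs)" by simp
    have "A_ideal Q" "A_ideal (ideal_product Qs)" using Cons(2)[of Q] A_ideal_ideal_product[of Qs] Cons(2) by simp_all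
    then have "Q \<cdot> ideal_product Qs \<subseteq> ideal_product Qs" by (rule prod_le)
    then show ?case using IH prod_mono[OF order_refl IH, of Q] by auto
  qed simp
  show "\<exists>Ns. (\<forall>N\<in>set Ns. A_prime N \<and> N \<subseteq> M) \<and> (\<exists>t\<in>A - M. t \<otimes> a \<in> ideal_product Ns) \<and>
     (\<forall>y\<in>ideal_product Ns. \<exists>t\<in>A - M. t \<otimes> y \<in> principal a)"
  proof (intro exI[of _ ?Ns] conjI ballI)
    fix N assume "N \<in> set ?Ns" then show "A_prime N" "N \<subseteq> M" using Ps(1) by auto
  next
    have "a \<in> u_hull (ideal_product Ps)" using u_hull_self[OF A_module_principal[of a] principal_self[of a]] a Ps(2) by simp
    then obtain F where F: "GV F" "\<forall>f\<in>F. a \<otimes> f \<in> ideal_product Ps" by (rule uclE)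
    obtain f where f: "f \<in> F" "f \<in> A - M" using GVn[OF F(1)] by blast
    have "f \<otimes> a \<in> ideal_product ?Ns" using f F(2) sub[OF A_ideal] a by (auto simp: m_comm)
    then show "\<exists>t\<in>A - M. t \<otimes> a \<in> ideal_product ?Ns" using f by blast
  next
    fix y assume y: "y \<in> ideal_product ?Ns"
    have yA: "y \<in> A" using A_ideal_A[OF A_ideal_ideal_product y] A_ideal by simp
    have "\<exists>t\<in>A - M. \<forall>y\<in>ideal_product ?Ns. t \<otimes> y \<in> ideal_product Ps"
    proof (rule ideal_product_filter_mult)
      show "\<one> \<in> A - M" using A_prime_one[OF assms(2)] by simp
      fix Q assume Q: "Q \<in> set Ps"
      then show "A_ideal Q" by (rule A_ideal)
      assume "\<not> Q \<subseteq> M"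
      then show "Q \<inter> (A - M) \<noteq> {}" using A_ideal_A[OF A_ideal[OF Q]] by blast
    qed (use A_prime_mult_notin[OF assms(2)] in auto)
    then obtain t where t: "t \<in> A - M" "t \<otimes> y \<in> ideal_product Ps" using y by blast
    then have "t \<otimes> y \<in> u_hull (principal a)" using u_hull_self[OF prdm] Ps(2) by simp
    then obtain F where F: "GV F" "\<forall>f\<in>F. (t \<otimes> y) \<otimes> f \<in> principal a" by (rule uclE)
    obtain f where f: "f \<in> F" "f \<in> A - M" using GVn[OF F(1)] by blast
    have "(t \<otimes> f) \<otimes> y \<in> principal a" using F(2) f t(1) yA by (auto simp: m_ac)
    then show "\<exists>t\<in>A - M. t \<otimes> y \<in> principal a" using A_prime_mult_notin[OF assms(2) t(1) f(2)] by blast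
  qed
qed (rule assms)

text \<open>Nakayama's lemma for one generator: the element t - m lies outside \<open>M\<close> and
  kills y.\<close>

lemma locally_zero_cancel:
  assumes "A_prime M" "y \<in> A" "t \<in> A - M" "m \<in> M" "t \<otimes> y = m \<otimes> y"
  shows "locally_zero M y"
proof -
  have mA: "m \<in> A" using A_prime_A[OF assms(1,4)] .
  have "t \<ominus> m \<in> A - M"
  proof -
    have "t \<in> M" if "t \<ominus> m \<in> M"
      using A_moduleD(3)[OF A_prime_A_module[OF assms(1)] that assms(4)] assms(3) mA by (simp add: minus_eq a_assoc l_neg)
    then show ?thesis using assms(3) mA by auto
  qed
  moreover have "(t \<ominus> m) \<otimes> y = \<zero>"
    using assms(2,3,5) mA by (simp add: minus_eq l_distr l_minus r_neg)
  ultimately show ?thesis unfolding locally_zero_def by blast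
qed

text \<open>The local Nakayama argument: a principal ideal that is a product of primes and is nonzero
  in the localization at \<open>M\<close> is locally generated by a product of elements, one from each
  factor, and each of them generates a prime ideal.\<close>

lemma local_principal_factorization_factor:
  assumes L: "local_principal_factorization M" and P: "A_prime P" "P \<subseteq> M" and y: "y \<in> P" "\<not> locally_zero M y"
  obtains a where "a \<in> P" "\<not> locally_zero M a" "y \<in> local_contraction M a" "A_prime (local_contraction M a)" "local_contraction M a \<subseteq> P"
proof -
  have M: "A_prime M" using L by (simp add: local_principal_factorization_def)
  have yA: "y \<in> A" using A_prime_A[OF P(1) y(1)] .
  obtain Ns t0 where Ns0: "\<forall>N\<in>set Ns. A_prime N" "\<forall>N\<in>set Ns. N \<subseteq> M" "t0 \<in> A - M" "t0 \<otimes> y \<in> ideal_product Ns"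
    "\<forall>z\<in>ideal_product Ns. \<exists>t\<in>A - M. t \<otimes> z \<in> principal y" using local_principal_factorizationE[OF L yA] .
  note Ns = bspec[OF Ns0(1)] bspec[OF Ns0(2)] Ns0(3,4) bspec[OF Ns0(5)]
  have aNs: "\<And>N. N \<in> set Ns \<Longrightarrow> A_ideal N" using Ns(1) A_prime_A_ideal by blast
  have "ideal_product Ns \<subseteq> P"
  proof
    fix z assume z: "z \<in> ideal_product Ns"
    obtain t where t: "t \<in> A - M" "t \<otimes> z \<in> principal y" using Ns(5)[OF z] by blast
    have "t \<otimes> z \<in> P" using t(2) principal_subset[OF A_prime_A_module[OF P(1)] y(1)] by blast
    then show "z \<in> P" using A_prime_mem[OF P(1) _ _ A_ideal_A[OF A_ideal_ideal_product[OF aNs] z], of t] t(1) P(2) by blast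
  qed
  from ideal_product_prime[OF P(1) this aNs] obtain N where N: "N \<in> set Ns" "N \<subseteq> P" by blast
  define I where "I = ideal_product (remove1 N Ns)"
  have aI: "A_ideal I" unfolding I_def by (rule A_ideal_ideal_product) (use aNs set_remove1_subset[of N Ns] in blast)
  have ex: "ideal_product Ns = N \<cdot> I" unfolding I_def by (rule ideal_product_extract[OF N(1) aNs])
  have Np: "A_prime N" "A_ideal N" using Ns(1)[OF N(1)] aNs[OF N(1)] by auto
  note Mm = A_moduleD[OF A_prime_A_module[OF M]]
  \<comment> \<open>Write z as a sum of products a b, each a multiple of y locally. Either some
    coefficient is a local unit, and then that product generates the same local ideal as y, or z
    lies in M y.\<close>
  have dich: "(\<exists>a\<in>N. \<exists>b\<in>I. \<exists>t\<in>A - M. \<exists>c\<in>A - M. t \<otimes> (a \<otimes> b) = c \<otimes> y) \<or>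
      (\<exists>t\<in>A - M. \<exists>m\<in>M. t \<otimes> z = m \<otimes> y)" if "z \<in> N \<cdot> I" for z
    using that
  proof induct
    case (prod i j)
    obtain t where t: "t \<in> A - M" "t \<otimes> (i \<otimes> j) \<in> principal y"
      using Ns(5)[of "i \<otimes> j"] ex ideal_prod.prod[OF prod, of T] by auto
    then obtain c where c: "c \<in> A" "t \<otimes> (i \<otimes> j) = c \<otimes> y" using yA by (auto simp: principal_mem m_comm)
    show ?case
    proof (cases "c \<in> M")
      case True then show ?thesis using t(1) c(2) by blast
    next
      case False then show ?thesis using t(1) c prod by blast
    qed
  next
    case (sum z z')
    show ?case
    proof (cases "\<exists>a\<in>N. \<exists>b\<in>I. \<exists>t\<in>A - M. \<exists>c\<in>A - M. t \<otimes> (a \<otimes> b) = c \<otimes> y")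
      case False
      then obtain t m t' m' where h: "t \<in> A - M" "m \<in> M" "t \<otimes> z = m \<otimes> y" "t' \<in> A - M" "m' \<in> M" "t' \<otimes> z' = m' \<otimes> y"
        using sum by blast
      have zA: "z \<in> A" "z' \<in> A" using sum A_ideal_A[OF A_ideal_prod[OF Np(2) aI]] by auto
      have "(t \<otimes> t') \<otimes> (z \<oplus> z') = t' \<otimes> (t \<otimes> z) \<oplus> t \<otimes> (t' \<otimes> z')"
        using h(1,4) zA by (simp add: r_distr m_ac)
      also have "\<dots> = (t' \<otimes> m \<oplus> t \<otimes> m') \<otimes> y"
        unfolding h(3,6) using h(1,4) yA Mm(1)[OF h(2)] Mm(1)[OF h(5)] by (simp add: l_distr m_assoc)
      finally have "(t \<otimes> t') \<otimes> (z \<oplus> z') = (t' \<otimes> m \<oplus> t \<otimes> m') \<otimes> y" .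
      moreover have "t' \<otimes> m \<oplus> t \<otimes> m' \<in> M" using h by (intro Mm(3,4)) auto
      ultimately show ?thesis using A_prime_mult_notin[OF M h(1,4)] by blast
    qed simp
  qed
  have nodeg: False if h: "t \<in> A - M" "c \<in> A - M" "m \<in> M" "t \<otimes> (c \<otimes> y) = m \<otimes> y" for t c m
    using locally_zero_cancel[OF M yA A_prime_mult_notin[OF M h(1,2)] h(3)] h yA y(2) by (simp add: m_assoc)
  have "\<exists>a\<in>N. \<exists>b\<in>I. \<exists>t\<in>A - M. \<exists>c\<in>A - M. t \<otimes> (a \<otimes> b) = c \<otimes> y"
  proof -
    \<comment> \<open>Applied to y itself the second alternative is excluded by
      \<open>nodeg\<close>, the Nakayama argument.\<close>
    have "t0 \<otimes> y \<in> N \<cdot> I" using Ns(4) ex by simp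
    from dich[OF this] show ?thesis using nodeg[OF _ Ns(3)] by blast
  qed
  then obtain a b t c where ab: "a \<in> N" "b \<in> I" "t \<in> A - M" "c \<in> A - M" "t \<otimes> (a \<otimes> b) = c \<otimes> y" by blast
  have A: "a \<in> A" "b \<in> A" using A_ideal_A[OF Np(2) ab(1)] A_ideal_A[OF aI ab(2)] by auto
  have nz: "\<not> locally_zero M a"
  proof
    assume "locally_zero M a"
    then obtain t1 where t1: "t1 \<in> A - M" "t1 \<otimes> a = \<zero>" by (auto simp: locally_zero_def)
    have "(t1 \<otimes> c) \<otimes> y = t1 \<otimes> (t \<otimes> (a \<otimes> b))" using t1(1) ab(4) yA by (simp add: ab(5) m_assoc)
    also have "\<dots> = (t \<otimes> b) \<otimes> (t1 \<otimes> a)" using t1(1) ab(3) A by (simp add: m_ac)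
    also have "\<dots> = \<zero>" unfolding t1(2) using ab(3) A by simp
    finally show False using y(2) A_prime_mult_notin[OF M t1(1) ab(4)] by (auto simp: locally_zero_def)
  qed
  have ysat: "y \<in> local_contraction M a"
  proof -
    have "c \<otimes> y = a \<otimes> (t \<otimes> b)" using ab(3) A by (simp add: ab(5)[symmetric] m_lcomm)
    then have "c \<otimes> y \<in> principal a" using ab(3) A by (auto simp: principal_mem)
    then show ?thesis using yA ab(4) by (auto simp: local_contraction_def)
  qed
  obtain Ns' t' where Ns0': "\<forall>N\<in>set Ns'. A_prime N" "\<forall>N\<in>set Ns'. N \<subseteq> M" "t' \<in> A - M" "t' \<otimes> a \<in> ideal_product Ns'"
    "\<forall>z\<in>ideal_product Ns'. \<exists>t\<in>A - M. t \<otimes> z \<in> principal a" using local_principal_factorizationE[OF L A(1)] .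
  note Ns' = bspec[OF Ns0'(1)] bspec[OF Ns0'(2)] Ns0'(3,4) bspec[OF Ns0'(5)]
  have aNs': "\<And>N. N \<in> set Ns' \<Longrightarrow> A_ideal N" using Ns'(1) A_prime_A_ideal by blast
  have "ideal_product Ns' \<subseteq> N"
  proof
    fix z assume z: "z \<in> ideal_product Ns'"
    obtain t where t: "t \<in> A - M" "t \<otimes> z \<in> principal a" using Ns'(5)[OF z] by blast
    have "t \<otimes> z \<in> N" using t(2) principal_subset[OF A_prime_A_module[OF Np(1)] ab(1)] by blast
    then show "z \<in> N" using A_prime_mem[OF Np(1) _ _ A_ideal_A[OF A_ideal_ideal_product[OF aNs'] z], of t] t(1) Ns(2)[OF N(1)] by blast
  qed
  from ideal_product_prime[OF Np(1) this aNs'] obtain N' where N': "N' \<in> set Ns'" "N' \<subseteq> N" by blast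
  define I' where "I' = ideal_product (remove1 N' Ns')"
  have rem: "\<And>Q. Q \<in> set (remove1 N' Ns') \<Longrightarrow> Q \<in> set Ns'" using set_remove1_subset[of N' Ns'] by blast
  have aI': "A_ideal I'" unfolding I'_def by (rule A_ideal_ideal_product) (use aNs' rem in blast)
  have ex': "ideal_product Ns' = N' \<cdot> I'" unfolding I'_def by (rule ideal_product_extract[OF N'(1) aNs'])
  have N'p: "A_prime N'" using Ns'(1)[OF N'(1)] .
  \<comment> \<open>A second factor inside M would put N' I' b into M y locally; as this set
    contains a b up to a local unit, y would lie in M y locally and vanish there.\<close>
  have "remove1 N' Ns' = []"
  proof (rule ccontr)
    assume "remove1 N' Ns' \<noteq> []"
    then obtain Q Qs where Q: "remove1 N' Ns' = Q # Qs" by (cases "remove1 N' Ns'") auto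
    then have Qin: "Q \<in> set Ns'" "set Qs \<subseteq> set Ns'" using rem by auto
    have "A_ideal (ideal_product Qs)" by (rule A_ideal_ideal_product) (use aNs' Qin in blast)
    then have "I' \<subseteq> Q" unfolding I'_def Q using prod_le(1)[OF aNs'[OF Qin(1)]] by simp
    then have IM: "I' \<subseteq> M" using Ns'(2)[OF Qin(1)] by blast
    have "\<exists>s\<in>A - M. \<exists>m\<in>M. s \<otimes> (z \<otimes> b) = m \<otimes> y" if "z \<in> N' \<cdot> I'" for z
      using that
    proof induct
      case (prod n i)
      have c: "n \<in> A" "i \<in> A" using A_prime_A[OF N'p prod(1)] A_ideal_A[OF aI' prod(2)] by auto
      have "n \<otimes> b \<in> ideal_product Ns" unfolding ex using prod(1) N'(2) ab(2) by (intro ideal_prod.prod) auto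
      then obtain s where s: "s \<in> A - M" "s \<otimes> (n \<otimes> b) \<in> principal y" using Ns(5) by blast
      then obtain d where d: "d \<in> A" "s \<otimes> (n \<otimes> b) = y \<otimes> d" by (auto simp: principal_mem)
      have "s \<otimes> ((n \<otimes> i) \<otimes> b) = i \<otimes> (s \<otimes> (n \<otimes> b))" using s(1) c A by (simp add: m_ac)
      also have "\<dots> = (d \<otimes> i) \<otimes> y" unfolding d(2) using c d(1) yA by (simp add: m_ac)
      finally show ?case using s(1) Mm(4)[OF d(1)] IM prod(2) by blast
    next
      case (sum z z')
      then obtain s m s' m' where h: "s \<in> A - M" "m \<in> M" "s \<otimes> (z \<otimes> b) = m \<otimes> y"
        "s' \<in> A - M" "m' \<in> M" "s' \<otimes> (z' \<otimes> b) = m' \<otimes> y" by blast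
      have zA: "z \<in> A" "z' \<in> A" using sum A_ideal_A[OF A_ideal_prod[OF A_prime_A_ideal[OF N'p] aI']] by auto
      have "(s \<otimes> s') \<otimes> ((z \<oplus> z') \<otimes> b) = s' \<otimes> (s \<otimes> (z \<otimes> b)) \<oplus> s \<otimes> (s' \<otimes> (z' \<otimes> b))"
        using h(1,4) zA A by (simp add: r_distr l_distr m_ac)
      also have "\<dots> = (s' \<otimes> m \<oplus> s \<otimes> m') \<otimes> y"
        unfolding h(3,6) using h(1,4) yA Mm(1)[OF h(2)] Mm(1)[OF h(5)] by (simp add: l_distr m_assoc)
      finally have "(s \<otimes> s') \<otimes> ((z \<oplus> z') \<otimes> b) = (s' \<otimes> m \<oplus> s \<otimes> m') \<otimes> y" .
      moreover have "s' \<otimes> m \<oplus> s \<otimes> m' \<in> M" using h by (intro Mm(3,4)) auto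
      ultimately show ?case using A_prime_mult_notin[OF M h(1,4)] by blast
    qed
    then obtain s m where s: "s \<in> A - M" "m \<in> M" "s \<otimes> ((t' \<otimes> a) \<otimes> b) = m \<otimes> y" using Ns'(4) ex' by metis
    have "(s \<otimes> t') \<otimes> (c \<otimes> y) = t \<otimes> (s \<otimes> ((t' \<otimes> a) \<otimes> b))"
      unfolding ab(5)[symmetric] using s(1) Ns'(3) ab(3) A by (simp add: m_ac)
    also have "\<dots> = (t \<otimes> m) \<otimes> y" unfolding s(3) using ab(3) Mm(1)[OF s(2)] yA by (simp add: m_assoc)
    finally show False using nodeg[OF A_prime_mult_notin[OF M s(1) Ns'(3)] ab(4)] Mm(4)[OF _ s(2), of t] ab(3) by blast
  qed
  then have prd': "ideal_product Ns' = N'" unfolding ex' I'_def 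
    using prod_le(1)[OF A_prime_A_ideal[OF N'p] A_ideal_A_self] ideal_prod.prod[OF _ A_one, of _ N' T] A_prime_A[OF N'p] by force
  have "local_contraction M a = N'"
  proof
    show "local_contraction M a \<subseteq> N'"
    proof
      fix x assume "x \<in> local_contraction M a"
      then obtain s d where x: "x \<in> A" "s \<in> A - M" "s \<otimes> x = a \<otimes> d" "d \<in> A" by (auto simp: local_contraction_def principal_mem)
      have "(t' \<otimes> s) \<otimes> x = d \<otimes> (t' \<otimes> a)" using x Ns'(3) A(1) by (simp add: m_assoc) (simp add: m_ac)
      also have "\<dots> \<in> N'" using A_moduleD(4)[OF A_prime_A_module[OF N'p] x(4)] Ns'(4) prd' by simp
      finally have "(t' \<otimes> s) \<otimes> x \<in> N'" .
      then show "x \<in> N'"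
        using A_prime_mem[OF N'p _ _ x(1), of "t' \<otimes> s"] A_prime_mult_notin[OF M Ns'(3) x(2)] Ns'(2)[OF N'(1)] by auto
    qed
    show "N' \<subseteq> local_contraction M a" using Ns'(5) prd' A_prime_A[OF N'p] by (auto simp: local_contraction_def)
  qed
  then show thesis using that[of a] N N' N'p ab(1) nz ysat by auto
qed

text \<open>Factor the ideal generated by 0. By minimality no factor lies properly inside
  \<open>P\<close>, so t p^n is in the product for some t outside \<open>P\<close>, and the product
  is locally zero.\<close>

lemma local_principal_factorization_nilpotent:
  assumes L: "local_principal_factorization M" and P: "min_prime P" "P \<subseteq> M" and p: "p \<in> P"
  obtains s n where "s \<in> A - P" "s \<otimes> p [^] (n::nat) = \<zero>"
proof -
  have Pp: "A_prime P" using P by (simp add: min_prime_def)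
  obtain Ns t0 where Ns0: "\<forall>N\<in>set Ns. A_prime N" "\<forall>N\<in>set Ns. N \<subseteq> M" "t0 \<in> A - M" "t0 \<otimes> \<zero> \<in> ideal_product Ns"
    "\<forall>z\<in>ideal_product Ns. \<exists>t\<in>A - M. t \<otimes> z \<in> principal \<zero>" using local_principal_factorizationE[OF L A_zero] .
  note Ns = bspec[OF Ns0(1)] bspec[OF Ns0(5)]
  have aNs: "\<And>N. N \<in> set Ns \<Longrightarrow> A_ideal N" using Ns(1) A_prime_A_ideal by blast
  have "\<exists>t\<in>A - P. (\<forall>Q\<in>set Ns. Q \<noteq> P \<longrightarrow> t \<in> Q) \<and> (\<forall>x\<in>P. t \<otimes> x [^] count_list Ns P \<in> ideal_product Ns)"
    by (rule ideal_product_pow_mem[OF Pp aNs]) (use Ns(1) P in \<open>auto simp: min_prime_def\<close>)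
  then obtain t n where t: "t \<in> A - P" "t \<otimes> p [^] (n::nat) \<in> ideal_product Ns" using p by blast
  obtain t' where t': "t' \<in> A - M" "t' \<otimes> (t \<otimes> p [^] n) \<in> principal \<zero>" using Ns(2)[OF t(2)] by blast
  have "(t' \<otimes> t) \<otimes> p [^] n = \<zero>" using t' t(1) A_prime_A[OF Pp p] by (auto simp: principal_mem m_assoc)
  moreover have "t' \<otimes> t \<in> A - P" using A_prime_mult_notin[OF Pp _ t(1)] t'(1) P(2) by blast
  ultimately show thesis by (rule that[rotated])
qed

text \<open>If \<open>p\<close> locally generates a minimal prime \<open>P\<close> properly inside \<open>M\<close> and \<open>p\<^sup>n s' = 0\<close> with
  \<open>s'\<close> in \<open>M\<close> outside \<open>P\<close>, then a prime factor of \<open>p + s'\<close> divides both \<open>p\<close> and \<open>s'\<close>, which is absurd.\<close>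

lemma local_principal_factorization_domain:
  assumes L: "local_principal_factorization M" and P: "min_prime P" "P \<subset> M" and y: "y \<in> P"
  shows "locally_zero M y"
proof (rule ccontr)
  assume ny: "\<not> locally_zero M y"
  have M: "A_prime M" using L by (simp add: local_principal_factorization_def)
  have Pp: "A_prime P" and PM: "P \<subseteq> M" and min: "\<And>Q. A_prime Q \<Longrightarrow> Q \<subseteq> P \<Longrightarrow> Q = P" using P by (auto simp: min_prime_def)
  obtain p where p: "p \<in> P" "\<not> locally_zero M p" "A_prime (local_contraction M p)" "local_contraction M p \<subseteq> P"
    using local_principal_factorization_factor[OF L Pp PM y ny] by metis
  have satp: "local_contraction M p = P" by (rule min[OF p(3,4)])
  obtain s n where s: "s \<in> A - P" "s \<otimes> p [^] (n::nat) = \<zero>" using local_principal_factorization_nilpotent[OF L P(1) PM p(1)] .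
  obtain q where q: "q \<in> M" "q \<notin> P" using P(2) by blast
  have c: "q \<in> A" "p \<in> A" using A_prime_A[OF M q(1)] A_prime_A[OF Pp p(1)] by auto
  \<comment> \<open>The annihilating element s need not lie in M; multiplying by q moves it into M
    while keeping it outside P.\<close>
  define s' where "s' = s \<otimes> q"
  have s': "s' \<in> A - P" "s' \<in> M" using A_prime_mult_notin[OF Pp s(1)] q c s(1) A_moduleD(4)[OF A_prime_A_module[OF M] _ q(1)] by (auto simp: s'_def)
  have ps: "p [^] n \<otimes> s' = \<zero>"
  proof -
    have "p [^] n \<otimes> s' = q \<otimes> (s \<otimes> p [^] n)" using c s(1) by (simp add: s'_def m_ac)
    then show ?thesis using s(2) c by simp
  qed
  define w where "w = p \<oplus> s'"
  have wM: "w \<in> M" using A_moduleD(3)[OF A_prime_A_module[OF M]] p(1) PM s'(2) by (auto simp: w_def)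
  have wA: "w \<in> A" using A_prime_A[OF M wM] .
  have ws: "w \<ominus> p = s'" "w \<ominus> s' = p" using c s'(1) by (simp_all add: w_def add_minus_left add_minus_right)
  have wP: "w \<notin> P" using A_moduleD(7)[OF A_prime_A_module[OF Pp] _ p(1), of w] ws s' by auto
  have "\<not> locally_zero M w"
  proof
    assume "locally_zero M w"
    then obtain t where t: "t \<in> A - M" "t \<otimes> w = \<zero>" by (auto simp: locally_zero_def)
    then have "t \<otimes> w \<in> P" using A_moduleD(2)[OF A_prime_A_module[OF Pp]] by simp
    then show False using A_prime_mem[OF Pp _ _ wA, of t] t(1) PM wP by blast
  qed
  then obtain r where r: "r \<in> M" "\<not> locally_zero M r" "w \<in> local_contraction M r" "A_prime (local_contraction M r)" "local_contraction M r \<subseteq> M"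
    using local_principal_factorization_factor[OF L M order_refl wM] by metis
  let ?N = "local_contraction M r"
  note Nm = A_moduleD[OF A_prime_A_module[OF r(4)]]
  have rA: "r \<in> A" using A_prime_A[OF M r(1)] .
  have "p [^] n \<otimes> s' \<in> ?N" unfolding ps by (rule Nm(2))
  then have "p \<in> ?N \<or> s' \<in> ?N" using A_prime_mem[OF r(4), of "p [^] n" s'] A_prime_pow_mem[OF r(4) c(2)] c s'(1) by auto
  \<comment> \<open>The prime ?N contains one of p and s' because it contains their zero product p^n
    s', and then the other because it contains their sum w.\<close>
  then have both: "p \<in> ?N" "s' \<in> ?N" using Nm(7)[OF r(3)] ws by metis+
  obtain t d where t: "t \<in> A - M" "d \<in> A" "t \<otimes> p = r \<otimes> d" using both(1) by (auto simp: local_contraction_def principal_mem)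
  have "r \<otimes> d \<in> P" using A_moduleD(4)[OF A_prime_A_module[OF Pp] _ p(1), of t] t by simp
  \<comment> \<open>If r is in P, then s' is in P as well. If d is in P, then d is locally a
    multiple of p, so p is locally a multiple of r p with r in M, and Nakayama makes p
    vanish.\<close>
  then consider "r \<in> P" | "d \<in> P" using A_prime_mem[OF Pp _ rA t(2)] by blast
  then show False
  proof cases
    case 1
    obtain t' d' where t': "t' \<in> A - M" "d' \<in> A" "t' \<otimes> s' = r \<otimes> d'" using both(2) by (auto simp: local_contraction_def principal_mem)
    have "t' \<otimes> s' \<in> P" using A_moduleD(5)[OF A_prime_A_module[OF Pp] t'(2) 1] t'(3) by simp
    then show False using A_prime_mem[OF Pp, of t' s'] t'(1) s'(1) PM by blast
  next
    case 2
    then obtain t' d' where t': "t' \<in> A - M" "d' \<in> A" "t' \<otimes> d = p \<otimes> d'" using satp by (auto simp: local_contraction_def principal_mem)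
    have "(t \<otimes> t') \<otimes> p = t' \<otimes> (t \<otimes> p)" using t(1) t'(1) c by (simp add: m_ac)
    also have "\<dots> = r \<otimes> (t' \<otimes> d)" unfolding t(3) using t'(1) t(2) rA by (simp add: m_lcomm)
    also have "\<dots> = (d' \<otimes> r) \<otimes> p" unfolding t'(3) using rA t'(2) c by (simp add: m_ac)
    finally show False
      using locally_zero_cancel[OF M c(2) A_prime_mult_notin[OF M t(1) t'(1)] A_moduleD(4)[OF A_prime_A_module[OF M] t'(2) r(1)]] p(2) by simp
  qed
qed

text \<open>The closure of the zero ideal is zero because a \<open>GV\<close> set contains a unit,
  so the factorization of 0 holds without any closure.\<close>

lemma ideal_product_zero:
  assumes principal_u_factorization
  obtains Ps where "\<forall>P\<in>set Ps. A_prime P" "ideal_product Ps = {\<zero>}"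
proof -
  obtain Ps where Ps: "\<forall>P\<in>set Ps. A_prime P" "u_hull (principal \<zero>) = u_hull (ideal_product Ps)" using assms A_zero unfolding principal_u_factorization_def by blast
  have aPs: "A_ideal (ideal_product Ps)" by (rule A_ideal_ideal_product) (use Ps(1) A_prime_A_ideal in blast)
  have "z = \<zero>" if z: "z \<in> ideal_product Ps" for z
  proof -
    have "z \<in> u_hull (principal \<zero>)" using u_hull_self[OF A_ideal_A_module[OF aPs] z] Ps(2) by simp
    then obtain F where F: "GV F" "\<forall>f\<in>F. z \<otimes> f \<in> principal \<zero>" by (rule uclE)
    obtain f where f: "f \<in> F" "f \<in> Units T" using GV_unit[OF F(1)] by blast
    have "z \<otimes> f = \<zero>" using F(2) f(1) by (auto simp: principal_mem)
    then have "inv f \<otimes> (f \<otimes> z) = \<zero>" using A_ideal_A[OF aPs z] f(2) by (simp add: m_comm Units_closed)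
    then show ?thesis using unit_cancel(1)[OF f(2)] A_ideal_A[OF aPs z] by simp
  qed
  then have "ideal_product Ps = {\<zero>}" using A_moduleD(2)[OF A_ideal_A_module[OF aPs]] by blast
  then show thesis using that Ps(1) by blast
qed

lemma annihilator_A_ideal: "b \<in> A \<Longrightarrow> A_ideal {a \<in> A. a \<otimes> b = \<zero>}"
  unfolding A_ideal_def by (intro conjI A_moduleI) (auto simp: l_distr m_assoc)

text \<open>If \<open>M\<close> is not minimal, it contains an x outside all minimal primes, which
  are finite in number. This x is a zero divisor, say x b = 0. In a nonregular prime N above the
  annihilator of b there is a minimal prime P without x, so b is in P and vanishes locally at N; but
  the annihilator of b lies inside N.\<close>

lemma nonreg_prime_minimal:
  assumes principal_u_factorization and M: "A_prime M" "M \<inter> Units T = {}"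
  shows "min_prime M"
proof (rule ccontr)
  assume "\<not> min_prime M"
  then obtain Q where Q: "A_prime Q" "Q \<subset> M" using M(1) by (auto simp: min_prime_def)
  obtain Ps where Ps: "\<forall>P\<in>set Ps. A_prime P" "ideal_product Ps = {\<zero>}" using ideal_product_zero[OF assms(1)] .
  have aPs: "\<And>P. P \<in> set Ps \<Longrightarrow> A_ideal P" using Ps(1) A_prime_A_ideal by blast
  let ?S = "{P \<in> set Ps. min_prime P}"
  \<comment> \<open>Every prime contains a factor of the zero product, so the minimal primes occur
    among these finitely many factors.\<close>
  have below: "\<exists>P\<in>?S. P \<subseteq> R" if R: "A_prime R" for R
  proof -
    have ex: "\<exists>P\<in>set Ps. P \<subseteq> R'" if "A_prime R'" for R'
      using ideal_product_prime[OF that _ aPs] Ps(2) A_moduleD(2)[OF A_prime_A_module[OF that]] by auto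
    obtain P0 where P0: "P0 \<in> set Ps" "P0 \<subseteq> R" using ex[OF R] by blast
    from finite_has_minimal2[OF finite_set P0(1)] obtain P where P: "P \<in> set Ps" "P \<subseteq> P0"
      "\<forall>P'\<in>set Ps. P' \<subseteq> P \<longrightarrow> P = P'" by (elim bexE conjE)
    have "min_prime P" unfolding min_prime_def
    proof (intro conjI allI impI)
      show "A_prime P" using Ps(1) P(1) by blast
      fix R' assume R': "A_prime R' \<and> R' \<subseteq> P"
      then obtain P' where "P' \<in> set Ps" "P' \<subseteq> R'" using ex by blast
      then show "R' = P" using bspec[OF P(3), of P'] R' by auto
    qed
    then show ?thesis using P P0 by blast
  qed
  have "\<exists>x\<in>M. \<forall>P\<in>?S. x \<notin> P"
  proof (rule avoid_primes)
    show "finite ?S" by simp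
    show "\<And>P Q. P \<in> ?S \<Longrightarrow> Q \<in> ?S \<Longrightarrow> P \<subseteq> Q \<Longrightarrow> P = Q" by (auto simp: min_prime_def)
    show "A_ideal M" by (rule A_prime_A_ideal[OF M(1)])
    fix P assume P: "P \<in> ?S"
    then show "A_prime P" by (simp add: min_prime_def)
    show "\<not> M \<subseteq> P"
    proof
      assume MP: "M \<subseteq> P"
      have "Q = P" "M = P" using P Q M(1) MP unfolding min_prime_def by blast+
      then show False using Q(2) by blast
    qed
  qed
  then obtain x where x: "x \<in> M" "\<forall>P\<in>?S. x \<notin> P" by blast
  have xA: "x \<in> A" using A_prime_A[OF M(1) x(1)] .
  have "x \<notin> Units T" using x M(2) by blast
  then obtain b where b: "b \<in> A" "x \<otimes> b = \<zero>" "b \<noteq> \<zero>" using reg_unit[OF xA] by blast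
  let ?I = "{a \<in> A. a \<otimes> b = \<zero>}"
  have "?I \<inter> (A \<inter> Units T) = {}"
  proof -
    have False if "u \<in> Units T" "u \<otimes> b = \<zero>" for u
      using unit_cancel(1)[OF that(1), of b] that b by simp
    then show ?thesis by blast
  qed
  then obtain N where N: "A_prime N" "?I \<subseteq> N" "N \<inter> (A \<inter> Units T) = {}"
    using exists_prime_avoiding[OF annihilator_A_ideal[OF b(1)], of "A \<inter> Units T"] by auto
  have Nu: "N \<inter> Units T = {}" using N A_prime_A[OF N(1)] by blast
  obtain P where P: "min_prime P" "P \<subseteq> N" "x \<notin> P" using below[OF N(1)] x(2) by blast
  have Pp: "A_prime P" using P(1) by (simp add: min_prime_def)
  have xN: "x \<in> N" using N(2) xA b(2) by blast
  have "x \<otimes> b \<in> P" unfolding b(2) by (rule A_moduleD(2)[OF A_prime_A_module[OF Pp]])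
  then have bP: "b \<in> P" using A_prime_mem[OF Pp _ xA b(1)] P(3) by blast
  \<comment> \<open>x belongs to N and not to P, so P is properly contained in N and the local
    vanishing result applies.\<close>
  have "locally_zero N b" by (rule local_principal_factorization_domain[OF principal_u_factorization_local[OF assms(1) N(1) nonreg_GV_free[OF Nu]] P(1) _ bP]) (use P xN in blast)
  then show False using N(2) by (auto simp: locally_zero_def)
qed

text \<open>If everything in \<open>M\<close> vanishes locally, 0 is a generator. Otherwise a local
  factor generates a prime inside \<open>M\<close>, which is \<open>M\<close> itself because
  \<open>M\<close> is minimal.\<close>

lemma nonreg_prime_generator:
  assumes principal_u_factorization and M: "A_prime M" "M \<inter> Units T = {}"
  obtains p where "p \<in> M" "\<forall>x\<in>M. \<exists>t\<in>A - M. t \<otimes> x \<in> principal p"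
proof (cases "\<forall>y\<in>M. locally_zero M y")
  case True
  then have "\<forall>x\<in>M. \<exists>t\<in>A - M. t \<otimes> x \<in> principal \<zero>" by (auto simp: locally_zero_def principal_mem intro!: bexI[of _ \<zero>])
  then show thesis using that[of \<zero>] A_moduleD(2)[OF A_prime_A_module[OF M(1)]] by blast
next
  case False
  then obtain y where y: "y \<in> M" "\<not> locally_zero M y" by blast
  obtain a where a: "a \<in> M" "A_prime (local_contraction M a)" "local_contraction M a \<subseteq> M"
    using local_principal_factorization_factor[OF principal_u_factorization_local[OF assms(1) M(1) nonreg_GV_free[OF M(2)]] M(1) order_refl y] by metis
  have "local_contraction M a = M" using nonreg_prime_minimal[OF assms] a by (simp add: min_prime_def)
  then show thesis using that[of a] a(1) by (auto simp: local_contraction_def)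
qed

end

lemma (in cring) geometric:
  assumes "z \<in> carrier R"
  shows "\<exists>w\<in>carrier R. \<one> \<ominus> z [^] (n::nat) = (\<one> \<ominus> z) \<otimes> w"
proof (induct n)
  case 0
  show ?case using assms by (intro bexI[of _ \<zero>]) (auto simp: minus_eq r_neg)
next
  case (Suc n)
  then obtain w where w: "w \<in> carrier R" "\<one> \<ominus> z [^] n = (\<one> \<ominus> z) \<otimes> w" by blast
  have zn: "z [^] n \<in> carrier R" using assms by simp
  have "z [^] n \<otimes> (\<one> \<ominus> z) = z [^] n \<ominus> z [^] Suc n"
    using assms by (simp add: minus_eq r_distr r_minus)
  then have "\<one> \<ominus> z [^] Suc n = (\<one> \<ominus> z [^] n) \<oplus> z [^] n \<otimes> (\<one> \<ominus> z)"
    using assms by (simp add: minus_eq a_assoc r_neg1 l_neg r_neg2)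
  also have "\<dots> = (\<one> \<ominus> z) \<otimes> (w \<oplus> z [^] n)" unfolding w(2) using w(1) assms by (simp add: r_distr m_comm)
  finally show ?case using w(1) assms by (intro bexI[of _ "w \<oplus> z [^] n"]) auto
qed

context frac_pair
begin

section \<open>Decomposition by idempotents\<close>

text \<open>Describes the factor e A attached to P. Elements outside P are invertible in e T. Either
  e P = 0, so that e A is a domain, or e T is contained in A and e P is generated by a nilpotent, so
  that e A is a special primary ring.\<close>

definition component :: "'a \<Rightarrow> 'a set \<Rightarrow> bool" where
  "component e P \<longleftrightarrow> e \<in> A \<and> e \<otimes> e = e \<and> A_prime P \<and> e \<notin> P \<and> \<one> \<ominus> e \<in> P \<and>
     (\<forall>x\<in>A - P. \<exists>y\<in>carrier T. e \<otimes> (x \<otimes> y) = e) \<and>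
     ((\<forall>x\<in>P. e \<otimes> x = \<zero>) \<or>
      (\<forall>x\<in>carrier T. e \<otimes> x \<in> A) \<and>
      (\<exists>p\<in>P. \<exists>n::nat. e \<otimes> p [^] n = \<zero> \<and> (\<forall>x\<in>P. \<exists>c\<in>A. e \<otimes> x = e \<otimes> (p \<otimes> c))))"

definition decomp :: "'a set set \<Rightarrow> ('a set \<Rightarrow> 'a) \<Rightarrow> bool" where
  "decomp S e \<longleftrightarrow> finite S \<and> (\<forall>P\<in>S. component (e P) P) \<and>
     (\<forall>P\<in>S. \<forall>Q\<in>S. P \<noteq> Q \<longrightarrow> e P \<otimes> e Q = \<zero>) \<and> (\<Oplus>P\<in>S. e P) = \<one>"

text \<open>The primes of \<open>T\<close> correspond to the nonregular primes of \<open>A\<close>,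
  so this is dimension zero of \<open>T\<close> stated inside \<open>A\<close>.\<close>

definition zero_dimensional :: bool where
  "zero_dimensional \<longleftrightarrow> (\<forall>P Q. A_prime P \<and> A_prime Q \<and> P \<subseteq> Q \<and> Q \<inter> Units T = {} \<longrightarrow> P = Q)"

lemma idem_pow: "e \<in> carrier T \<Longrightarrow> e \<otimes> e = e \<Longrightarrow> e [^] Suc n = e"
  by (induct n) auto

text \<open>The exponent \<open>Suc n\<close> is positive even for n = 0, so that the power of e is
  e itself.\<close>

lemma idem_nilpotent:
  assumes "e \<in> carrier T" "e \<otimes> e = e" "x \<in> carrier T" "y \<in> carrier T" "e \<otimes> x [^] (n::nat) = \<zero>"
  shows "(e \<otimes> (x \<otimes> y)) [^] Suc n = \<zero>"
proof -
  have "(e \<otimes> (x \<otimes> y)) [^] Suc n = e [^] Suc n \<otimes> (x [^] Suc n \<otimes> y [^] Suc n)"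
    using assms(1,3,4) by (simp only: nat_pow_distrib m_closed)
  also have "\<dots> = (e \<otimes> x [^] n) \<otimes> (x \<otimes> y [^] Suc n)"
    unfolding idem_pow[OF assms(1,2)] using assms(1,3,4) by (simp add: m_assoc)
  finally show ?thesis using assms by simp
qed

text \<open>Shaped so that under \<open>zero_dimensional\<close> every prime satisfies it; a regular
  prime does so vacuously.\<close>

definition max_nonregular :: "'a set \<Rightarrow> bool" where
  "max_nonregular P \<longleftrightarrow> A_prime P \<and> (\<forall>Q. A_prime Q \<and> Q \<inter> Units T = {} \<and> P \<subseteq> Q \<longrightarrow> P = Q)"

lemma max_nonregular_A_prime: "max_nonregular P \<Longrightarrow> A_prime P"
  by (simp add: max_nonregular_def)

lemma zero_dimensional_max_nonregular: "zero_dimensional \<Longrightarrow> A_prime P \<Longrightarrow> max_nonregular P"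
  by (simp add: max_nonregular_def zero_dimensional_def)

text \<open>The ideal P + xA must contain a unit of \<open>T\<close>, since otherwise it would lie
  in a nonregular prime strictly above \<open>P\<close>.\<close>

lemma maximal_nonreg:
  assumes max: "max_nonregular P" and x: "x \<in> A - P"
  obtains s m c where "s \<in> A" "s \<in> Units T" "m \<in> P" "c \<in> A" "s = m \<oplus> x \<otimes> c"
proof -
  let ?J = "{i \<oplus> x \<otimes> c | i c. i \<in> P \<and> c \<in> A}"
  have xA: "x \<in> A" using x by simp
  note J = A_ideal_sum_principal[OF A_prime_A_ideal[OF max_nonregular_A_prime[OF max]] xA]
  have "?J \<inter> (A \<inter> Units T) \<noteq> {}"
  proof
    assume e: "?J \<inter> (A \<inter> Units T) = {}"
    obtain Q where Q: "A_prime Q" "?J \<subseteq> Q" "Q \<inter> (A \<inter> Units T) = {}"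
      using exists_prime_avoiding[OF J(1) e] by auto
    have "Q \<inter> Units T = {}" using Q(3) A_prime_A[OF Q(1)] by blast
    then have "P = Q" using max J(2) Q(1,2) unfolding max_nonregular_def by blast
    then show False using J(3) Q(2) x by blast
  qed
  then obtain s where s: "s \<in> ?J" "s \<in> A" "s \<in> Units T" by blast
  then obtain m c where "m \<in> P" "c \<in> A" "s = m \<oplus> x \<otimes> c" by blast
  then show thesis using that s by blast
qed

lemma frac_complement:
  assumes "s \<in> Units T" "m \<in> carrier T" "d \<in> carrier T" "s = m \<oplus> d"
  shows "\<one> \<ominus> inv s \<otimes> m = inv s \<otimes> d"
proof -
  have "\<one> = inv s \<otimes> m \<oplus> inv s \<otimes> d" using assms Units_l_inv[OF assms(1)] by (simp add: r_distr[symmetric])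
  then have "\<one> \<ominus> inv s \<otimes> m = (inv s \<otimes> m \<oplus> inv s \<otimes> d) \<ominus> inv s \<otimes> m" by simp
  then show ?thesis using assms add_minus_left[of "inv s \<otimes> m" "inv s \<otimes> d"] by simp
qed

text \<open>Take t outside \<open>P\<close>, in all other factors, with t x^k = 0 on
  \<open>P\<close>, and a regular s = m + t c with m in \<open>P\<close>. For z = m/s the element e
  = 1 - z^k is a multiple of t in \<open>T\<close>, so it kills k-th powers of elements of
  \<open>P\<close>. In particular e z^k = 0, which makes e idempotent.\<close>

lemma exists_idempotent:
  assumes krull and Ps: "\<And>P. P \<in> set Ps \<Longrightarrow> A_prime P" "\<And>P. P \<in> set Ps \<Longrightarrow> P \<inter> Units T = {}" "ideal_product Ps = {\<zero>}"
    and zero_dimensional and P: "P \<in> set Ps"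
  obtains e n where "e \<in> A" "e \<otimes> e = e" "e \<notin> P" "\<one> \<ominus> e \<in> P" "\<forall>Q\<in>set Ps. Q \<noteq> P \<longrightarrow> e \<in> Q"
    "\<forall>x\<in>P. e \<otimes> x [^] (n::nat) = \<zero>"
proof -
  have Pp: "A_prime P" and Pn: "P \<inter> Units T = {}" using Ps P by auto
  have max: "max_nonregular P" by (rule zero_dimensional_max_nonregular[OF \<open>zero_dimensional\<close> Pp])
  define k where "k = count_list Ps P"
  have k: "k \<noteq> 0" using P by (simp add: k_def count_list_0_iff)
  have "\<exists>t\<in>A - P. (\<forall>Q\<in>set Ps. Q \<noteq> P \<longrightarrow> t \<in> Q) \<and> (\<forall>x\<in>P. t \<otimes> x [^] k \<in> ideal_product Ps)"
    unfolding k_def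
  proof (rule ideal_product_pow_mem[OF Pp])
    fix Q assume Q: "Q \<in> set Ps"
    show "A_ideal Q" using Ps(1)[OF Q] A_prime_A_ideal by blast
    show "Q = P \<or> \<not> Q \<subseteq> P" using \<open>zero_dimensional\<close> Ps(1)[OF Q] Pp Pn unfolding zero_dimensional_def by blast
  qed
  then obtain t where t0: "t \<in> A - P" "\<forall>Q\<in>set Ps. Q \<noteq> P \<longrightarrow> t \<in> Q" "\<forall>x\<in>P. t \<otimes> x [^] k \<in> ideal_product Ps"
    by (elim bexE conjE)
  have t: "t \<in> A - P" "\<forall>Q\<in>set Ps. Q \<noteq> P \<longrightarrow> t \<in> Q" "\<And>x. x \<in> P \<Longrightarrow> t \<otimes> x [^] k = \<zero>"
    using t0 Ps(3) by simp_all
  obtain s m c where s: "s \<in> A" "s \<in> Units T" "m \<in> P" "c \<in> A" "s = m \<oplus> t \<otimes> c"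
    using maximal_nonreg[OF max t(1)] .
  have mA: "m \<in> A" using A_prime_A[OF Pp s(3)] .
  define z where "z = inv s \<otimes> m"
  have zT: "z \<in> carrier T" using s mA by (simp add: z_def)
  obtain w0 where w0: "w0 \<in> carrier T" "\<one> \<ominus> z [^] k = (\<one> \<ominus> z) \<otimes> w0" using geometric[OF zT] by blast
  have "\<one> \<ominus> z = inv s \<otimes> (t \<otimes> c)" unfolding z_def by (rule frac_complement[OF s(2) _ _ s(5)]) (use mA t s in auto)
  then have "\<exists>w\<in>carrier T. \<one> \<ominus> z [^] k = t \<otimes> w"
    using w0 s t(1) by (intro bexI[of _ "inv s \<otimes> (c \<otimes> w0)"]) (auto simp: m_ac)
  then obtain w where w: "w \<in> carrier T" "\<one> \<ominus> z [^] k = t \<otimes> w" by blast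
  define e where "e = \<one> \<ominus> z [^] k"
  have eT: "e \<in> carrier T" using zT by (simp add: e_def)
  have kill: "e \<otimes> x [^] k = \<zero>" if x: "x \<in> P" for x
  proof -
    have "e \<otimes> x [^] k = w \<otimes> (t \<otimes> x [^] k)" unfolding e_def w(2) using w t(1) A_prime_A[OF Pp x] by (simp add: m_ac)
    then show ?thesis using t(3)[OF x] w by simp
  qed
  have zk: "z [^] k = inv s [^] k \<otimes> m [^] k" unfolding z_def using s mA by (simp add: nat_pow_distrib)
  have "e \<otimes> z [^] k = inv s [^] k \<otimes> (e \<otimes> m [^] k)" unfolding zk using eT s mA by (simp add: m_lcomm)
  then have ez: "e \<otimes> z [^] k = \<zero>" using kill[OF s(3)] s by simp
  have "e \<otimes> e = e \<otimes> \<one> \<ominus> e \<otimes> z [^] k"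
    using eT zT by (subst (2) e_def) (simp add: minus_eq r_distr r_minus)
  then have ee: "e \<otimes> e = e" using eT ez by (simp add: minus_eq)
  \<comment> \<open>The construction only gives an idempotent of T; the Krull property brings it
    into A.\<close>
  have eA: "e \<in> A" by (rule krull_idem[OF \<open>krull\<close> eT ee])
  have "\<one> \<ominus> e = z [^] k" 
  proof -
    have "\<one> = z [^] k \<oplus> e" using zT by (simp add: e_def minus_eq a_lcomm r_neg)
    then have "\<one> \<ominus> e = (z [^] k \<oplus> e) \<ominus> e" by simp
    then show ?thesis using add_minus_right zT eT by simp
  qed
  then have "s [^] k \<otimes> (\<one> \<ominus> e) = (s [^] k \<otimes> inv s [^] k) \<otimes> m [^] k"
    unfolding zk using s(1) Units_inv_closed[OF s(2)] mA by (simp add: m_assoc)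
  also have "\<dots> = (s \<otimes> inv s) [^] k \<otimes> m [^] k"
    using nat_pow_distrib[of s "inv s" k] s(1) Units_inv_closed[OF s(2)] by simp
  \<comment> \<open>Clearing denominators shows 1 - e in P: the element m^k is in P while the
    regular s^k is not.\<close>
  finally have sk: "s [^] k \<otimes> (\<one> \<ominus> e) = m [^] k" using s(2) mA by simp
  have "m [^] k \<in> P"
  proof -
    obtain k' where "k = Suc k'" using k by (cases k) auto
    then show ?thesis using A_moduleD(4)[OF A_prime_A_module[OF Pp] _ s(3)] mA by simp
  qed
  moreover have "s [^] k \<in> A - P" using A_prime_pow_notin[OF Pp, of s] s Pn by blast
  ultimately have e1: "\<one> \<ominus> e \<in> P" using A_prime_mem[OF Pp, of "s [^] k" "\<one> \<ominus> e"] sk eA by auto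
  have eP: "e \<notin> P"
  proof
    assume "e \<in> P"
    then have "(\<one> \<ominus> e) \<oplus> e \<in> P" using A_moduleD(3)[OF A_prime_A_module[OF Pp] e1] by simp
    then show False using A_prime_one[OF Pp] eT by (simp add: minus_eq a_assoc l_neg)
  qed
  have "e \<in> Q" if Q: "Q \<in> set Ps" "Q \<noteq> P" for Q
  proof -
    obtain s' a where s': "s' \<in> A" "s' \<in> Units T" "a \<in> A" "s' \<otimes> w = a" using fracE[OF w(1)] by metis
    have Qp: "A_prime Q" "t \<in> Q" "s' \<notin> Q" using Q Ps t(2) s' by blast+
    have "s' \<otimes> e = t \<otimes> a" unfolding e_def w(2) using s'(1) t(1) w(1) by (simp add: s'(4)[symmetric] m_lcomm)
    then have "s' \<otimes> e \<in> Q" using A_moduleD(5)[OF A_prime_A_module[OF Qp(1)] s'(3) Qp(2)] by simp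
    then show ?thesis using A_prime_mem[OF Qp(1) _ s'(1) eA] Qp(3) by blast
  qed
  then show thesis using that[OF eA ee eP e1] kill by blast
qed

text \<open>With s = m + x c regular and z = m/s, the relation e z^n = 0 gives e = e (1 - z^n),
  which is a multiple of 1 - z = x c/s.\<close>

lemma idem_unit:
  assumes max: "max_nonregular P" and e: "e \<in> A" "\<forall>x\<in>P. e \<otimes> x [^] (n::nat) = \<zero>" and x: "x \<in> A - P"
  obtains y where "y \<in> carrier T" "e \<otimes> (x \<otimes> y) = e"
proof -
  obtain s m c where s: "s \<in> A" "s \<in> Units T" "m \<in> P" "c \<in> A" "s = m \<oplus> x \<otimes> c"
    using maximal_nonreg[OF max x] .
  have mA: "m \<in> A" using A_prime_A[OF max_nonregular_A_prime[OF max] s(3)] .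
  define z where "z = inv s \<otimes> m"
  have zT: "z \<in> carrier T" using s mA by (simp add: z_def)
  have eT: "e \<in> carrier T" using e by simp
  have zn: "z [^] n = inv s [^] n \<otimes> m [^] n" unfolding z_def using s mA by (simp add: nat_pow_distrib)
  have "e \<otimes> z [^] n = inv s [^] n \<otimes> (e \<otimes> m [^] n)" unfolding zn using eT s mA by (simp add: m_lcomm)
  then have ez: "e \<otimes> z [^] n = \<zero>" using e(2) s by simp
  obtain w where w: "w \<in> carrier T" "\<one> \<ominus> z [^] n = (\<one> \<ominus> z) \<otimes> w" using geometric[OF zT] by blast
  have z1: "\<one> \<ominus> z = inv s \<otimes> (x \<otimes> c)" unfolding z_def by (rule frac_complement[OF s(2) _ _ s(5)]) (use mA x s in auto)
  have "e = e \<otimes> (\<one> \<ominus> z [^] n)" using eT zT ez by (simp add: minus_eq r_distr r_minus)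
  also have "\<dots> = e \<otimes> (x \<otimes> (inv s \<otimes> (c \<otimes> w)))" unfolding w(2) z1 using w(1) s x by (simp add: m_ac)
  finally have "e \<otimes> (x \<otimes> (inv s \<otimes> (c \<otimes> w))) = e" by simp
  then show thesis using that[of "inv s \<otimes> (c \<otimes> w)"] w(1) s(4) Units_inv_closed[OF s(2)] by simp
qed

text \<open>The criterion for the local factor \<open>eT\<close> to be contained in the Krull ring.\<close>

lemma idem_full:
  assumes krull and max: "max_nonregular P"
    and e: "e \<in> A" "e \<otimes> e = e" "\<forall>x\<in>P. e \<otimes> x [^] (n::nat) = \<zero>"
    and p: "p \<in> P" "e \<otimes> p \<noteq> \<zero>"
    and F: "\<And>s. s \<in> A \<Longrightarrow> s \<in> Units T \<Longrightarrow>
      \<exists>F. GV F \<and> (\<forall>f\<in>F. \<exists>r\<in>A. (e \<otimes> (p \<otimes> inv s)) \<otimes> f = e \<otimes> (p \<otimes> r))"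
    and x: "x \<in> carrier T"
  shows "e \<otimes> x \<in> A"
proof -
  obtain s a where s: "s \<in> A" "s \<in> Units T" "a \<in> A" "s \<otimes> x = a" "x = inv s \<otimes> a" using fracE[OF x] .
  obtain F where F: "GV F" "\<forall>f\<in>F. \<exists>r\<in>A. (e \<otimes> (p \<otimes> inv s)) \<otimes> f = e \<otimes> (p \<otimes> r)" using F[OF s(1,2)] by blast
  note P = max_nonregular_A_prime[OF max]
  have pA: "p \<in> A" using A_prime_A[OF P p(1)] .
  have "e \<otimes> inv s \<in> A"
  proof (rule GV_D[OF F(1)])
    show "e \<otimes> inv s \<in> carrier T" using e s by simp
    fix f assume f: "f \<in> F"
    then obtain r where r: "r \<in> A" "(e \<otimes> (p \<otimes> inv s)) \<otimes> f = e \<otimes> (p \<otimes> r)" using F(2) by blast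
    have fA: "f \<in> A" using GV_carrier[OF F(1) f] .
    \<comment> \<open>d measures how far f is from being divisible by s. Since e p d = 0 and e p is
      nonzero, d lies in P; so e d/s is nilpotent, hence in A, and e f/s = e d/s + e r.\<close>
    define d where "d = f \<ominus> s \<otimes> r"
    have dA: "d \<in> A" using fA s r by (simp add: d_def)
    have fd: "f = d \<oplus> s \<otimes> r" using fA s r by (simp add: d_def minus_eq a_assoc l_neg)
    have "(e \<otimes> p) \<otimes> f = s \<otimes> ((e \<otimes> (p \<otimes> inv s)) \<otimes> f)"
    proof -
      have "s \<otimes> ((e \<otimes> (p \<otimes> inv s)) \<otimes> f) = (s \<otimes> inv s) \<otimes> ((e \<otimes> p) \<otimes> f)"
        using e(1) pA s(1) fA Units_inv_closed[OF s(2)] by (simp add: m_ac)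
      then show ?thesis using s(2) e pA fA by simp
    qed
    then have "(e \<otimes> p) \<otimes> f = (e \<otimes> p) \<otimes> (s \<otimes> r)" unfolding r(2) using e(1) pA s(1) r(1) by (simp add: m_ac)
    then have epd: "(e \<otimes> p) \<otimes> d = \<zero>"
      unfolding d_def using e(1) pA s(1) r(1) fA by (simp add: minus_eq r_distr r_minus r_neg)
    have "d \<in> P"
    proof (rule ccontr)
      assume "d \<notin> P"
      then obtain y where y: "y \<in> carrier T" "e \<otimes> (d \<otimes> y) = e" using idem_unit[OF max e(1,3), of d] dA by auto
      have "e \<otimes> p = (e \<otimes> (d \<otimes> y)) \<otimes> p" using y(2) by simp
      also have "\<dots> = y \<otimes> ((e \<otimes> p) \<otimes> d)" using y(1) dA e(1) pA by (simp add: m_ac)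
      finally show False using epd y(1) p(2) by simp
    qed
    then have "(e \<otimes> (d \<otimes> inv s)) [^] Suc n = \<zero>" using e dA s by (intro idem_nilpotent) auto
    from krull_nilp[OF \<open>krull\<close> _ this] have ed: "e \<otimes> (d \<otimes> inv s) \<in> A" using e dA s by simp
    have "(e \<otimes> inv s) \<otimes> f = e \<otimes> (d \<otimes> inv s) \<oplus> e \<otimes> ((s \<otimes> inv s) \<otimes> r)"
      unfolding fd using e(1) s(1) r(1) dA Units_inv_closed[OF s(2)] by (simp add: r_distr m_ac)
    also have "\<dots> = e \<otimes> (d \<otimes> inv s) \<oplus> e \<otimes> r" using s r by simp
    also have "\<dots> \<in> A" using ed e r by simp
    finally show "(e \<otimes> inv s) \<otimes> f \<in> A" .
  qed
  then have "(e \<otimes> inv s) \<otimes> a \<in> A" using s by simp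
  then show ?thesis using s e by (simp add: m_assoc)
qed

text \<open>The dropped factors contain units of \<open>T\<close>, and a unit can be cancelled from
  a zero product.\<close>

lemma ideal_product_filter_nonreg:
  assumes "\<And>P. P \<in> set Ps \<Longrightarrow> A_prime P" "ideal_product Ps = {\<zero>}"
  shows "ideal_product (filter (\<lambda>P. P \<inter> Units T = {}) Ps) = {\<zero>}"
proof -
  let ?Q = "filter (\<lambda>P. P \<inter> Units T = {}) Ps"
  have A_ideal: "\<And>P. P \<in> set Ps \<Longrightarrow> A_ideal P" using assms(1) A_prime_A_ideal by blast
  have "\<exists>t\<in>A \<inter> Units T. \<forall>y\<in>ideal_product ?Q. t \<otimes> y \<in> ideal_product Ps"
  proof (rule ideal_product_filter_mult)
    fix Q assume "Q \<in> set Ps" "Q \<inter> Units T \<noteq> {}"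
    then show "Q \<inter> (A \<inter> Units T) \<noteq> {}" using A_prime_A assms(1) by blast
  qed (use A_ideal in auto)
  then obtain t where t0: "t \<in> A \<inter> Units T" "\<forall>y\<in>ideal_product ?Q. t \<otimes> y \<in> ideal_product Ps" by (elim bexE)
  have t: "t \<in> Units T" "\<And>y. y \<in> ideal_product ?Q \<Longrightarrow> t \<otimes> y = \<zero>" using t0 assms(2) by simp_all
  have Q: "A_ideal (ideal_product ?Q)" by (rule A_ideal_ideal_product) (use A_ideal in auto)
  have "y = \<zero>" if "y \<in> ideal_product ?Q" for y
    using unit_cancel(1)[OF t(1), of y] t(2)[OF that] A_ideal_A[OF Q that] t(1) by simp
  then show ?thesis using A_moduleD(2)[OF A_ideal_A_module[OF Q]] by blast
qed

text \<open>Orthogonality and completeness of the idempotents both hold because an idempotent that lies in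
  all the primes of a product equal to zero vanishes.\<close>

lemma decomp_exists:
  assumes krull and Ps: "\<And>P. P \<in> set Ps \<Longrightarrow> A_prime P" "\<And>P. P \<in> set Ps \<Longrightarrow> P \<inter> Units T = {}" "ideal_product Ps = {\<zero>}"
    and zero_dimensional
    and case_dist: "\<And>P e n. P \<in> set Ps \<Longrightarrow> e \<in> A \<Longrightarrow> e \<otimes> e = e \<Longrightarrow> e \<notin> P \<Longrightarrow> \<forall>x\<in>P. e \<otimes> x [^] (n::nat) = \<zero> \<Longrightarrow>
      (\<forall>x\<in>P. e \<otimes> x = \<zero>) \<or> (\<forall>x\<in>carrier T. e \<otimes> x \<in> A) \<and> (\<exists>p\<in>P. \<forall>x\<in>P. \<exists>c\<in>carrier T. e \<otimes> x = e \<otimes> (p \<otimes> c))"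
  shows "\<exists>S e. decomp S e"
proof -
  have "\<forall>P\<in>set Ps. \<exists>e n. e \<in> A \<and> e \<otimes> e = e \<and> e \<notin> P \<and> \<one> \<ominus> e \<in> P \<and> (\<forall>Q\<in>set Ps. Q \<noteq> P \<longrightarrow> e \<in> Q) \<and>
    (\<forall>x\<in>P. e \<otimes> x [^] (n::nat) = \<zero>)"
    using exists_idempotent[OF \<open>krull\<close> Ps \<open>zero_dimensional\<close>] by metis
  from bchoice[OF this] obtain e where "\<forall>P\<in>set Ps. \<exists>n. e P \<in> A \<and> e P \<otimes> e P = e P \<and> e P \<notin> P \<and> \<one> \<ominus> e P \<in> P \<and>
    (\<forall>Q\<in>set Ps. Q \<noteq> P \<longrightarrow> e P \<in> Q) \<and> (\<forall>x\<in>P. e P \<otimes> x [^] (n::nat) = \<zero>)" ..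
  then have e: "e P \<in> A" "e P \<otimes> e P = e P" "e P \<notin> P" "\<one> \<ominus> e P \<in> P"
      "\<forall>Q\<in>set Ps. Q \<noteq> P \<longrightarrow> e P \<in> Q" "\<exists>n. \<forall>x\<in>P. e P \<otimes> x [^] (n::nat) = \<zero>" if "P \<in> set Ps" for P
    using that by auto
  \<comment> \<open>Nonemptiness makes the exponent \<open>length Ps\<close> positive, so that this
    power of an idempotent is the idempotent itself.\<close>
  have ne: "Ps \<noteq> []"
  proof
    assume "Ps = []"
    then have "A = {\<zero>}" using Ps(3) by simp
    then show False using A_one nontriv by blast
  qed
  have pm: "g [^] length Qs \<in> ideal_product Qs" if "g \<in> A" "\<forall>P\<in>set Qs. g \<in> P" for g Qs
    using that(2)
  proof (induct Qs)
    case (Cons Q Qs)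
    then have "g \<otimes> g [^] length Qs \<in> ideal_product (Q # Qs)" by (auto intro: ideal_prod.prod)
    then show ?case using that(1) by (simp add: m_comm)
  qed auto
  have z: "g = \<zero>" if "g \<in> A" "g \<otimes> g = g" "\<forall>P\<in>set Ps. g \<in> P" for g
  proof -
    obtain n where "length Ps = Suc n" using ne by (cases Ps) auto
    then show ?thesis using pm[OF that(1,3)] idem_pow[of g n] that Ps(3) by simp
  qed
  have orth: "e P \<otimes> e Q = \<zero>" if "P \<in> set Ps" "Q \<in> set Ps" "P \<noteq> Q" for P Q
  proof (rule z)
    note c = e(1,2)[OF that(1)] e(1,2)[OF that(2)]
    show "e P \<otimes> e Q \<in> A" using c by simp
    have "e P \<otimes> e Q \<otimes> (e P \<otimes> e Q) = (e P \<otimes> e P) \<otimes> (e Q \<otimes> e Q)" using c(1,3) by (simp add: m_ac)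
    then show "e P \<otimes> e Q \<otimes> (e P \<otimes> e Q) = e P \<otimes> e Q" using c by simp
    show "\<forall>R\<in>set Ps. e P \<otimes> e Q \<in> R"
    proof
      fix R assume R: "R \<in> set Ps"
      note m = A_moduleD[OF A_prime_A_module[OF Ps(1)[OF R]]]
      show "e P \<otimes> e Q \<in> R"
      proof (cases "R = P")
        case True
        then have "e Q \<in> R" using e(5)[OF that(2)] that R by blast
        then show ?thesis using m(4) c by blast
      next
        case False
        then have "e P \<in> R" using e(5)[OF that(1)] R by blast
        then show ?thesis using m(5) c by blast
      qed
    qed
  qed
  let ?S = "set Ps"
  define f where "f = (\<Oplus>P\<in>?S. e P)"
  have eT: "e \<in> ?S \<rightarrow> carrier T" using e(1) by auto
  have fin_A: "(\<Oplus>P\<in>S'. e P) \<in> A" if "S' \<subseteq> ?S" for S'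
  proof -
    have "finite S'" using that finite_subset by auto
    then show ?thesis using that
    proof (induct S')
      case (insert P S')
      have "e \<in> S' \<rightarrow> carrier T" "e P \<in> carrier T" using insert eT by auto
      then show ?case using insert e(1) by simp
    qed simp
  qed
  have fA: "f \<in> A" unfolding f_def by (rule fin_A) simp
  have ef: "e P \<otimes> f = e P" if P: "P \<in> ?S" for P
  proof -
    have "e P \<otimes> f = (\<Oplus>Q\<in>?S. e P \<otimes> e Q)" unfolding f_def using eT e(1)[OF P] by (intro finsum_rdistr) auto
    also have "\<dots> = (\<Oplus>Q\<in>?S. if P = Q then e Q else \<zero>)"
      by (rule finsum_cong') (use orth[OF P] e(2)[OF P] e(1) in auto)
    also have "\<dots> = e P" using P eT by (intro finsum_singleton) auto
    finally show ?thesis .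
  qed
  have "f \<otimes> f = (\<Oplus>P\<in>?S. e P \<otimes> f)" unfolding f_def
    by (rule finsum_ldistr) (use eT fA f_def in auto)
  also have "\<dots> = f" unfolding f_def[symmetric] using ef e(1) unfolding f_def by (intro finsum_cong') (auto simp: f_def[symmetric])
  finally have ff: "f \<otimes> f = f" .
  have "\<one> \<ominus> f = \<zero>"
  proof (rule z)
    show "\<one> \<ominus> f \<in> A" using fA by simp
    show "(\<one> \<ominus> f) \<otimes> (\<one> \<ominus> f) = \<one> \<ominus> f" using fA ff by (simp add: minus_eq l_distr r_distr l_minus r_minus l_neg r_neg a_assoc)
    show "\<forall>P\<in>?S. \<one> \<ominus> f \<in> P"
    proof
      fix P assume P: "P \<in> ?S"
      have "e P \<otimes> (\<one> \<ominus> f) = \<zero>" using ef[OF P] e(1)[OF P] fA by (simp add: minus_eq r_distr r_minus r_neg)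
      then have "e P \<otimes> (\<one> \<ominus> f) \<in> P" using A_moduleD(2)[OF A_prime_A_module[OF Ps(1)[OF P]]] by simp
      from A_prime_mem[OF Ps(1)[OF P] this e(1)[OF P]] show "\<one> \<ominus> f \<in> P" using e(3)[OF P] fA by simp
    qed
  qed
  then have f1: "f = \<one>" using fA by simp
  have "component (e P) P" if P: "P \<in> ?S" for P
  proof -
    obtain n where n: "\<forall>x\<in>P. e P \<otimes> x [^] (n::nat) = \<zero>" using e(6)[OF P] by blast
    have max: "max_nonregular P" by (rule zero_dimensional_max_nonregular[OF \<open>zero_dimensional\<close> Ps(1)[OF P]])
    have "\<forall>x\<in>A - P. \<exists>y\<in>carrier T. e P \<otimes> (x \<otimes> y) = e P"
      using idem_unit[OF max e(1)[OF P] n] by metis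
    moreover have "(\<forall>x\<in>P. e P \<otimes> x = \<zero>) \<or> (\<forall>x\<in>carrier T. e P \<otimes> x \<in> A) \<and>
      (\<exists>p\<in>P. \<exists>n::nat. e P \<otimes> p [^] n = \<zero> \<and> (\<forall>x\<in>P. \<exists>c\<in>A. e P \<otimes> x = e P \<otimes> (p \<otimes> c)))"
      using case_dist[OF P e(1,2,3)[OF P] n]
    proof (elim disjE conjE bexE)
      fix p assume h: "\<forall>x\<in>carrier T. e P \<otimes> x \<in> A" "p \<in> P" "\<forall>x\<in>P. \<exists>c\<in>carrier T. e P \<otimes> x = e P \<otimes> (p \<otimes> c)"
      have "\<exists>c\<in>A. e P \<otimes> x = e P \<otimes> (p \<otimes> c)" if x: "x \<in> P" for x
      proof -
        obtain c where c: "c \<in> carrier T" "e P \<otimes> x = e P \<otimes> (p \<otimes> c)" using h(3) x by blast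
        have pT: "p \<in> carrier T" using A_prime_A[OF Ps(1)[OF P] h(2)] by simp
        \<comment> \<open>The coefficient c is only in T; replacing it by e c moves it into A, and
          the extra e is absorbed.\<close>
        have "e P \<otimes> (p \<otimes> (e P \<otimes> c)) = (e P \<otimes> e P) \<otimes> (p \<otimes> c)" using e(1)[OF P] pT c(1) by (simp add: m_ac)
        then show ?thesis using c h(1) e(2)[OF P] by (intro bexI[of _ "e P \<otimes> c"]) auto
      qed
      then show ?thesis using h(1,2) n by blast
    qed blast
    ultimately show ?thesis unfolding component_def using Ps(1)[OF P] e[OF P] by blast
  qed
  then have "decomp ?S e" unfolding decomp_def using orth f1 f_def by auto
  then show ?thesis by blast
qed

lemma principal_u_factorization_zero_dimensional:
  assumes principal_u_factorization
  shows zero_dimensional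
  unfolding zero_dimensional_def
proof (intro allI impI)
  fix P Q assume h: "A_prime P \<and> A_prime Q \<and> P \<subseteq> Q \<and> Q \<inter> Units T = {}"
  then have "min_prime Q" using nonreg_prime_minimal[OF assms] by blast
  then show "P = Q" using h by (simp add: min_prime_def)
qed

text \<open>The point is the dichotomy for e P. If e p is nonzero for a local generator p, factor
  the ideal of e p. \<open>P\<close> occurs at most once, so t \<open>P\<close> lies in the product
  for some t outside \<open>P\<close>. Since e p/s is nilpotent, hence in \<open>P\<close> up to the
  inverse of t, it falls into the u-closure of e p A, and \<open>idem_full\<close> applies.\<close>

lemma principal_u_factorization_decomp:
  assumes pi: principal_u_factorization
  shows "\<exists>S e. decomp S e"
proof -
  note K = principal_u_factorization_krull[OF pi] and zero_dimensional = principal_u_factorization_zero_dimensional[OF pi]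
  obtain Ps0 where Ps0: "\<forall>P\<in>set Ps0. A_prime P" "ideal_product Ps0 = {\<zero>}" using ideal_product_zero[OF pi] .
  let ?Ps = "filter (\<lambda>P. P \<inter> Units T = {}) Ps0"
  show ?thesis
  proof (rule decomp_exists[OF K _ _ ideal_product_filter_nonreg[OF bspec[OF Ps0(1)] Ps0(2)] zero_dimensional])
    fix P e and n :: nat
    assume "P \<in> set ?Ps" and e: "e \<in> A" "e \<otimes> e = e" "e \<notin> P" "\<forall>x\<in>P. e \<otimes> x [^] n = \<zero>"
    then have P: "A_prime P" "P \<inter> Units T = {}" using Ps0(1) by auto
    have max: "max_nonregular P" by (rule zero_dimensional_max_nonregular[OF zero_dimensional P(1)])
    have min: "Q = P" if "A_prime Q" "Q \<subseteq> P" for Q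
      using zero_dimensional P that by (simp add: zero_dimensional_def)
    note Pm = A_moduleD[OF A_prime_A_module[OF P(1)]]
    have unit: "\<exists>y\<in>carrier T. e \<otimes> (x \<otimes> y) = e" if "x \<in> A - P" for x
      using idem_unit[OF max e(1,4) that] by metis
    obtain p where p: "p \<in> P" "\<forall>x\<in>P. \<exists>t\<in>A - P. t \<otimes> x \<in> principal p" using nonreg_prime_generator[OF pi P] .
    have pA: "p \<in> A" using A_prime_A[OF P(1) p(1)] .
    have gen: "\<exists>c\<in>carrier T. e \<otimes> x = e \<otimes> (p \<otimes> c)" if x: "x \<in> P" for x
    proof -
      have xA: "x \<in> A" using A_prime_A[OF P(1) x] .
      obtain t c where t: "t \<in> A - P" "t \<otimes> x = p \<otimes> c" "c \<in> A" using p(2) x by (auto simp: principal_mem)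
      obtain y where y: "y \<in> carrier T" "e \<otimes> (t \<otimes> y) = e" using unit[OF t(1)] by blast
      have "e \<otimes> x = (e \<otimes> (t \<otimes> y)) \<otimes> x" using y by simp
      also have "\<dots> = e \<otimes> (y \<otimes> (t \<otimes> x))" using y(1) e(1) t(1) xA by (simp add: m_ac)
      also have "\<dots> = e \<otimes> (p \<otimes> (c \<otimes> y))" unfolding t(2) using y(1) e(1) t(3) pA by (simp add: m_ac)
      finally show ?thesis using y(1) t(3) by (intro bexI[of _ "c \<otimes> y"]) auto
    qed
    show "(\<forall>x\<in>P. e \<otimes> x = \<zero>) \<or> (\<forall>x\<in>carrier T. e \<otimes> x \<in> A) \<and> (\<exists>p\<in>P. \<forall>x\<in>P. \<exists>c\<in>carrier T. e \<otimes> x = e \<otimes> (p \<otimes> c))"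
    proof (cases "e \<otimes> p = \<zero>")
      case True
      have "e \<otimes> x = \<zero>" if x: "x \<in> P" for x
      proof -
        obtain c where c: "c \<in> carrier T" "e \<otimes> x = e \<otimes> (p \<otimes> c)" using gen[OF x] by blast
        then have "e \<otimes> x = (e \<otimes> p) \<otimes> c" using e(1) pA by (simp add: m_assoc)
        then show ?thesis using True c by simp
      qed
      then show ?thesis by blast
    next
      case False
      let ?q = "e \<otimes> p"
      have qA: "?q \<in> A" using e pA by simp
      obtain Ns where Ns: "\<forall>N\<in>set Ns. A_prime N" "u_hull (principal ?q) = u_hull (ideal_product Ns)" using pi qA unfolding principal_u_factorization_def by blast
      have aNs: "A_ideal N" if "N \<in> set Ns" for N using Ns(1) that A_prime_A_ideal by blast
      have aprd: "A_ideal (ideal_product Ns)" by (rule A_ideal_ideal_product[OF aNs])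
      have "\<exists>t\<in>A - P. (\<forall>Q\<in>set Ns. Q \<noteq> P \<longrightarrow> t \<in> Q) \<and> (\<forall>x\<in>P. t \<otimes> x [^] count_list Ns P \<in> ideal_product Ns)"
        by (rule ideal_product_pow_mem[OF P(1) aNs]) (use Ns(1) min in blast)+
      then obtain t where t0: "t \<in> A - P" "\<forall>x\<in>P. t \<otimes> x [^] count_list Ns P \<in> ideal_product Ns" by (elim bexE conjE)
      note t = t0(1) bspec[OF t0(2)]
      \<comment> \<open>Two copies of P would make e p, up to a unit from a \<open>GV\<close> set, a
        multiple of e p^2. Then e p = e p d with d a multiple of p, and iterating n times gives e p
        = 0.\<close>
      have cnt: "count_list Ns P \<le> 1"
      proof (rule ccontr)
        assume c2: "\<not> count_list Ns P \<le> 1"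
        let ?R = "remove1 P Ns" let ?R' = "remove1 P ?R"
        have R: "P \<in> set Ns" using c2 count_notin by fastforce
        have cR: "count_list (remove1 P Qs) P = count_list Qs P - 1" for Qs :: "'a set list"
          by (induct Qs) auto
        have R': "P \<in> set ?R" using c2 cR[of Ns] count_notin[of P ?R] by (cases "P \<in> set ?R") auto
        have sub: "set ?R \<subseteq> set Ns" "set ?R' \<subseteq> set Ns" using set_remove1_subset by (metis, metis subset_trans)
        have aR: "A_ideal N" if "N \<in> set ?R" for N using aNs sub that by blast
        have aR': "A_ideal (ideal_product ?R')" by (rule A_ideal_ideal_product) (use aNs sub in blast)
        have "ideal_product Ns = P \<cdot> (P \<cdot> ideal_product ?R')" using ideal_product_extract[OF R aNs] ideal_product_extract[OF R' aR] by simp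
        then have PP: "ideal_product Ns \<subseteq> P \<cdot> P" using prod_mono[OF order_refl prod_le(1)[OF A_prime_A_ideal[OF P(1)] aR']] by simp
        have eP: "\<exists>c\<in>carrier T. e \<otimes> z = e \<otimes> (p \<otimes> (p \<otimes> c))" if "z \<in> P \<cdot> P" for z
          using that
        proof induct
          case (prod i j)
          obtain c d where c: "c \<in> carrier T" "e \<otimes> i = e \<otimes> (p \<otimes> c)" "d \<in> carrier T" "e \<otimes> j = e \<otimes> (p \<otimes> d)"
            using gen[OF prod(1)] gen[OF prod(2)] by blast
          have ij: "i \<in> A" "j \<in> A" using prod A_prime_A[OF P(1)] by auto
          have "e \<otimes> (i \<otimes> j) = (e \<otimes> e) \<otimes> (i \<otimes> j)" using e by simp
          also have "\<dots> = (e \<otimes> i) \<otimes> (e \<otimes> j)" using ij e(1) by (simp add: m_ac)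
          also have "\<dots> = (e \<otimes> e) \<otimes> (p \<otimes> (p \<otimes> (c \<otimes> d)))" unfolding c(2,4) using c(1,3) e(1) pA by (simp add: m_ac)
          finally show ?case using e(2) c by (intro bexI[of _ "c \<otimes> d"]) auto
        next
          case (sum x y)
          then obtain c d where c: "c \<in> carrier T" "e \<otimes> x = e \<otimes> (p \<otimes> (p \<otimes> c))" "d \<in> carrier T" "e \<otimes> y = e \<otimes> (p \<otimes> (p \<otimes> d))"
            by blast
          have xy: "x \<in> A" "y \<in> A" using sum A_ideal_A[OF A_ideal_prod[OF A_prime_A_ideal A_prime_A_ideal, OF P(1) P(1)]] by auto
          have "e \<otimes> (x \<oplus> y) = e \<otimes> (p \<otimes> (p \<otimes> (c \<oplus> d)))" using xy c e(1) pA by (simp add: r_distr)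
          then show ?case using c by (intro bexI[of _ "c \<oplus> d"]) auto
        qed
        have "?q \<in> u_hull (ideal_product Ns)" using u_hull_self[OF A_module_principal principal_self] qA Ns(2) by auto
        then obtain F where F: "GV F" "\<forall>f\<in>F. ?q \<otimes> f \<in> ideal_product Ns" by (rule uclE)
        obtain f where f: "f \<in> F" "f \<in> Units T" using GV_unit[OF F(1)] by blast
        obtain c where c: "c \<in> carrier T" "e \<otimes> (?q \<otimes> f) = e \<otimes> (p \<otimes> (p \<otimes> c))" using eP PP F(2) f(1) by blast
        have fT: "f \<in> carrier T" "inv f \<in> carrier T" using f by auto
        have "?q = ((e \<otimes> e) \<otimes> p) \<otimes> (f \<otimes> inv f)" using e(1,2) f pA by simp
        also have "\<dots> = (e \<otimes> (?q \<otimes> f)) \<otimes> inv f" using e(1) fT pA by (simp add: m_ac)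
        also have "\<dots> = ?q \<otimes> (p \<otimes> (c \<otimes> inv f))" unfolding c(2) using e(1) fT pA c(1) by (simp add: m_ac)
        finally have q: "?q = ?q \<otimes> (p \<otimes> (c \<otimes> inv f))" .
        let ?d = "p \<otimes> (c \<otimes> inv f)"
        have dT: "?d \<in> carrier T" using pA c(1) fT by simp
        have "?q = ?q \<otimes> ?d [^] k" for k :: nat
        proof (induct k)
          case (Suc k)
          have "?q \<otimes> ?d [^] Suc k = (?q \<otimes> ?d [^] k) \<otimes> ?d" using qA dT by (simp add: m_assoc)
          then show ?case using Suc q by simp
        qed (use qA in simp)
        then have "?q = ?q \<otimes> ?d [^] n" .
        also have "\<dots> = (e \<otimes> p [^] n) \<otimes> (p \<otimes> (c \<otimes> inv f) [^] n)"
          using e(1) pA c(1) fT by (simp add: nat_pow_distrib m_ac)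
        also have "\<dots> = \<zero>" using e(4) p(1) c(1) fT pA by simp
        finally show False using False by simp
      qed
      have tP: "t \<otimes> x \<in> ideal_product Ns" if x: "x \<in> P" for x
      proof (cases "count_list Ns P = 0")
        case True
        then have "t \<in> ideal_product Ns" using t(2)[OF x] t(1) by simp
        then show ?thesis using A_moduleD(5)[OF A_ideal_A_module[OF aprd]] A_prime_A[OF P(1) x] by blast
      next
        case False
        then have "count_list Ns P = 1" using cnt by simp
        then show ?thesis using t(2)[OF x] A_prime_A[OF P(1) x] by (simp add: nat_pow_eone)
      qed
      obtain y where y: "y \<in> carrier T" "e \<otimes> (t \<otimes> y) = e" using unit[OF t(1)] by blast
      have full: "e \<otimes> x \<in> A" if "x \<in> carrier T" for x
      proof (rule idem_full[OF K max e(1,2,4) p(1) False _ that])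
        fix s assume s: "s \<in> A" "s \<in> Units T"
        have isT: "inv s \<in> carrier T" using s by simp
        \<comment> \<open>The factor y, inverse to t on the component, is inserted so that t times
          this element is e p/s.\<close>
        let ?x = "e \<otimes> (p \<otimes> (inv s \<otimes> y))"
        have x0: "?x [^] Suc n = \<zero>" by (rule idem_nilpotent) (use e pA isT y p in auto)
        have xA: "?x \<in> A" by (rule krull_nilp[OF K _ x0]) (use e pA isT y in auto)
        have "?x \<in> P" using A_prime_pow_mem[OF P(1) xA, of "Suc n"] x0 Pm(2) by simp
        then have "t \<otimes> ?x \<in> ideal_product Ns" by (rule tP)
        moreover have "t \<otimes> ?x = (e \<otimes> (t \<otimes> y)) \<otimes> (p \<otimes> inv s)" using t(1) e(1) pA isT y(1) by (simp add: m_ac)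
        ultimately have "e \<otimes> (p \<otimes> inv s) \<in> ideal_product Ns" using y(2) by simp
        then have "e \<otimes> (p \<otimes> inv s) \<in> u_hull (principal ?q)" using u_hull_self[OF A_ideal_A_module[OF aprd]] Ns(2) by simp
        then obtain F where F: "GV F" "\<forall>f\<in>F. (e \<otimes> (p \<otimes> inv s)) \<otimes> f \<in> principal ?q" by (rule uclE)
        have "\<exists>r\<in>A. (e \<otimes> (p \<otimes> inv s)) \<otimes> f = e \<otimes> (p \<otimes> r)" if "f \<in> F" for f
          using bspec[OF F(2) that] e(1) pA by (auto simp: principal_mem m_assoc)
        then show "\<exists>F. GV F \<and> (\<forall>f\<in>F. \<exists>r\<in>A. (e \<otimes> (p \<otimes> inv s)) \<otimes> f = e \<otimes> (p \<otimes> r))" using F(1) by blast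
      qed
      then show ?thesis using gen p(1) by blast
    qed
  qed (use Ps0(1) in auto)
qed

lemma ideal_product_map_principal:
  assumes "set ps \<subseteq> A"
  shows "ideal_product (map principal ps) \<subseteq> principal (foldr (\<otimes>) ps \<one>)" "foldr (\<otimes>) ps \<one> \<in> A"
  using assms
proof (induct ps)
  case (Cons p ps)
  {
    case 2 then show ?case using Cons by simp
  next
    case 1
    then have A: "p \<in> A" "foldr (\<otimes>) ps \<one> \<in> A" "ideal_product (map principal ps) \<subseteq> principal (foldr (\<otimes>) ps \<one>)" using Cons by auto
    have "principal p \<cdot> ideal_product (map principal ps) \<subseteq> principal (p \<otimes> foldr (\<otimes>) ps \<one>)"
    proof (rule prod_subset_A_module[OF _ A_module_principal])
      fix i j assume "i \<in> principal p" "j \<in> ideal_product (map principal ps)"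
      then obtain c d where c: "c \<in> A" "i = p \<otimes> c" "d \<in> A" "j = foldr (\<otimes>) ps \<one> \<otimes> d" using A(3) by (meson principal_mem subsetD)
      then have "i \<otimes> j = (p \<otimes> foldr (\<otimes>) ps \<one>) \<otimes> (c \<otimes> d)" using A(1,2) by (simp add: m_ac)
      then show "i \<otimes> j \<in> principal (p \<otimes> foldr (\<otimes>) ps \<one>)" using c by (auto simp: principal_mem)
    qed (use A in auto)
    then show ?case by simp
  }
qed (auto simp: principal_def)

text \<open>Here \<open>P\<close> is the principal ideal p A globally. The nilpotent e p/s lies in
  A, hence in \<open>P\<close>, so it is p r without passing to a closure.\<close>

lemma prime_elements_decomp:
  assumes krull zero_dimensional and ps: "set ps \<subseteq> A" "\<And>p. p \<in> set ps \<Longrightarrow> A_prime (principal p)" "foldr (\<otimes>) ps \<one> = \<zero>"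
  shows "\<exists>S e. decomp S e"
proof -
  have ap: "\<And>P. P \<in> set (map principal ps) \<Longrightarrow> A_prime P" using ps(2) by auto
  have "A_ideal (ideal_product (map principal ps))" by (rule A_ideal_ideal_product) (use ap A_prime_A_ideal in blast)
  then have "ideal_product (map principal ps) = {\<zero>}"
    using ideal_product_map_principal(1)[OF ps(1)] A_moduleD(2)[OF A_ideal_A_module] unfolding ps(3) by (auto simp: principal_def)
  note z = ideal_product_filter_nonreg[OF ap this]
  show ?thesis
  proof (rule decomp_exists[OF assms(1) _ _ z assms(2)])
    fix P e and n :: nat
    assume "P \<in> set (filter (\<lambda>P. P \<inter> Units T = {}) (map principal ps))"
      and e: "e \<in> A" "e \<otimes> e = e" "e \<notin> P" "\<forall>x\<in>P. e \<otimes> x [^] n = \<zero>"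
    then obtain p where p: "p \<in> A" "P = principal p" "A_prime P" "P \<inter> Units T = {}" using ap ps(1) by auto
    have pP: "p \<in> P" using principal_self p by simp
    have max: "max_nonregular P" by (rule zero_dimensional_max_nonregular[OF \<open>zero_dimensional\<close> p(3)])
    show "(\<forall>x\<in>P. e \<otimes> x = \<zero>) \<or> (\<forall>x\<in>carrier T. e \<otimes> x \<in> A) \<and> (\<exists>p\<in>P. \<forall>x\<in>P. \<exists>c\<in>carrier T. e \<otimes> x = e \<otimes> (p \<otimes> c))"
    proof (cases "e \<otimes> p = \<zero>")
      case True
      have "e \<otimes> x = \<zero>" if x: "x \<in> P" for x
      proof -
        obtain c where c: "c \<in> A" "x = p \<otimes> c" using x p(2) by (auto simp: principal_mem)
        then have "e \<otimes> x = (e \<otimes> p) \<otimes> c" using e(1) p(1) by (simp add: m_assoc)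
        then show ?thesis using True c by simp
      qed
      then show ?thesis by blast
    next
      case False
      have "e \<otimes> x \<in> A" if "x \<in> carrier T" for x
      proof (rule idem_full[OF \<open>krull\<close> max e(1,2,4) pP False _ that])
        fix s assume s: "s \<in> A" "s \<in> Units T"
        let ?x = "e \<otimes> (p \<otimes> inv s)"
        have x0: "?x [^] Suc n = \<zero>" by (rule idem_nilpotent) (use e p s pP in auto)
        have xA: "?x \<in> A" by (rule krull_nilp[OF \<open>krull\<close> _ x0]) (use e p s in auto)
        have "?x \<in> P" using A_prime_pow_mem[OF p(3) xA, of "Suc n"] x0 A_moduleD(2)[OF A_prime_A_module[OF p(3)]] by simp
        then obtain r where r: "r \<in> A" "?x = p \<otimes> r" using p(2) by (auto simp: principal_mem)
        have "?x = (e \<otimes> e) \<otimes> (p \<otimes> inv s)" using e by simp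
        also have "\<dots> = e \<otimes> (p \<otimes> r)" unfolding r(2)[symmetric] using e(1) p(1) s by (simp add: m_assoc)
        finally have "?x \<otimes> \<one> = e \<otimes> (p \<otimes> r)" using xA by simp
        \<comment> \<open>The trivial set consisting of 1 suffices, since the required identity
          already holds for e p/s itself.\<close>
        then show "\<exists>F. GV F \<and> (\<forall>f\<in>F. \<exists>r\<in>A. ?x \<otimes> f = e \<otimes> (p \<otimes> r))"
          using r(1) GV_one by (intro exI[of _ "{\<one>}"]) auto
      qed
      moreover have "\<exists>c\<in>carrier T. e \<otimes> x = e \<otimes> (p \<otimes> c)" if "x \<in> P" for x
        using that p(2) by (auto simp: principal_mem)
      ultimately show ?thesis using pP by blast
    qed
  qed (use ap in auto)
qed

end

section \<open>Factoring ideals along a decomposition\<close>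

context frac_pair
begin

lemma ideal_product_append:
  assumes "\<And>P. P \<in> set Ps \<Longrightarrow> A_ideal P" "\<And>P. P \<in> set Qs \<Longrightarrow> A_ideal P"
  shows "ideal_product (Ps @ Qs) = ideal_product Ps \<cdot> ideal_product Qs"
  using assms
proof (induct Ps)
  case Nil
  have q: "A_ideal (ideal_product Qs)" by (rule A_ideal_ideal_product) (rule Nil(2))
  have "x \<in> A \<cdot> ideal_product Qs" if "x \<in> ideal_product Qs" for x
    using ideal_prod.prod[OF A_one that, of T] A_ideal_A[OF q that] by simp
  then show ?case using prod_le(2)[OF A_ideal_A_self q] by auto
next
  case (Cons P Ps)
  have "A_ideal P" "A_ideal (ideal_product Ps)" "A_ideal (ideal_product Qs)"
    using Cons(2)[of P] A_ideal_ideal_product[of Ps] A_ideal_ideal_product[of Qs] Cons(2,3) by simp_all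
  then show ?case using Cons prod_assoc by simp
qed

lemma componentD:
  assumes "component e P"
  shows "e \<in> A" "e \<otimes> e = e" "A_prime P" "e \<notin> P" "\<one> \<ominus> e \<in> P" "e \<in> carrier T"
    "\<And>x. x \<in> A \<Longrightarrow> x \<notin> P \<Longrightarrow> \<exists>y\<in>carrier T. e \<otimes> (x \<otimes> y) = e"
  using assms unfolding component_def by auto

lemma component_cases:
  assumes "component e P"
  obtains (dom) "\<forall>x\<in>P. e \<otimes> x = \<zero>"
  | (spr) p n where "\<forall>x\<in>carrier T. e \<otimes> x \<in> A" "p \<in> P" "e \<otimes> p [^] (n::nat) = \<zero>" "\<forall>x\<in>P. \<exists>c\<in>A. e \<otimes> x = e \<otimes> (p \<otimes> c)"
  using assms unfolding component_def by (elim conjE disjE bexE exE) (rule that, assumption+)+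

lemma component_split: "component e P \<Longrightarrow> x \<in> carrier T \<Longrightarrow> x = x \<otimes> (\<one> \<ominus> e) \<oplus> e \<otimes> x"
  using componentD(6)[of e P] by (simp add: minus_eq r_distr r_minus a_assoc l_neg m_comm)

lemma decompD:
  assumes "decomp S e"
  shows "finite S" "\<And>P. P \<in> S \<Longrightarrow> component (e P) P" "\<And>P Q. P \<in> S \<Longrightarrow> Q \<in> S \<Longrightarrow> P \<noteq> Q \<Longrightarrow> e P \<otimes> e Q = \<zero>"
    "(\<Oplus>P\<in>S. e P) = \<one>"
  using assms unfolding decomp_def by blast+

lemma A_module_finsum:
  assumes "A_module I" "finite S" "\<And>i. i \<in> S \<Longrightarrow> f i \<in> I"
  shows "(\<Oplus>i\<in>S. f i) \<in> I"
  using assms(2,3)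
proof (induct S)
  case empty then show ?case using A_moduleD(2)[OF assms(1)] by simp
next
  case (insert i S)
  then have "f \<in> S \<rightarrow> carrier T" "f i \<in> carrier T" using A_moduleD(1)[OF assms(1)] by auto
  then show ?case using insert A_moduleD(3)[OF assms(1)] by simp
qed

lemma decomp_sum:
  assumes D: "decomp S e" and x: "x \<in> carrier T"
  shows "x = (\<Oplus>P\<in>S. e P \<otimes> x)"
proof -
  have c: "e \<in> S \<rightarrow> carrier T" using componentD(6)[OF decompD(2)[OF D]] by auto
  have "(\<Oplus>P\<in>S. e P) \<otimes> x = (\<Oplus>P\<in>S. e P \<otimes> x)"
    by (rule finsum_ldistr) (use x c decompD(1)[OF D] in auto)
  then show ?thesis using decompD(4)[OF D] x by simp
qed

lemma decomp_mem:
  assumes D: "decomp S e" and I: "A_module I" and x: "x \<in> carrier T" "\<And>P. P \<in> S \<Longrightarrow> e P \<otimes> x \<in> I"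
  shows "x \<in> I"
  by (subst decomp_sum[OF D x(1)]) (rule A_module_finsum[OF I decompD(1)[OF D] x(2)])

lemma decomp_zero:
  assumes D: "decomp S e" and x: "x \<in> carrier T" "\<And>P. P \<in> S \<Longrightarrow> e P \<otimes> x = \<zero>"
  shows "x = \<zero>"
proof -
  have "A_module {\<zero>}" by (rule A_moduleI) auto
  then show ?thesis using decomp_mem[OF D _ x(1), of "{\<zero>}"] x(2) by simp
qed

lemma decomp_other:
  assumes D: "decomp S e" and "P \<in> S" "Q \<in> S" "P \<noteq> Q"
  shows "e P \<in> Q"
proof -
  note P = componentD[OF decompD(2)[OF D assms(2)]] and Q = componentD[OF decompD(2)[OF D assms(3)]]
  have "e P \<otimes> e Q \<in> Q" using decompD(3)[OF D assms(2-4)] A_moduleD(2)[OF A_prime_A_module[OF Q(3)]] by simp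
  then show ?thesis using A_prime_mem[OF Q(3) _ P(1) Q(1)] Q(4) by blast
qed

text \<open>Such an element is invertible on every component, so anything it kills vanishes on every
  component.\<close>

lemma decomp_regular:
  assumes D: "decomp S e" and x: "x \<in> A" "\<And>P. P \<in> S \<Longrightarrow> x \<notin> P"
  shows "x \<in> Units T"
proof (rule reg_unit[OF x(1)])
  fix b assume b: "b \<in> A" "x \<otimes> b = \<zero>"
  show "b = \<zero>"
  proof (rule decomp_zero[OF D])
    fix P assume P: "P \<in> S"
    note c = componentD[OF decompD(2)[OF D P]]
    obtain y where y: "y \<in> carrier T" "e P \<otimes> (x \<otimes> y) = e P" using c(7)[OF x(1) x(2)[OF P]] by blast
    have "e P \<otimes> b = (e P \<otimes> (x \<otimes> y)) \<otimes> b" using y by simp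
    also have "\<dots> = (e P \<otimes> y) \<otimes> (x \<otimes> b)" using y(1) c(1) x(1) b(1) by (simp add: m_ac)
    finally show "e P \<otimes> b = \<zero>" using b y(1) c(1) by simp
  qed (use b in simp)
qed

lemma component_pow:
  assumes "component e P" "p \<in> P" "\<forall>x\<in>P. \<exists>c\<in>A. e \<otimes> x = e \<otimes> (p \<otimes> c)" "z \<in> ideal_product (replicate k P)"
  shows "\<exists>c\<in>A. e \<otimes> z = e \<otimes> (p [^] k \<otimes> c)"
  using assms(4)
proof (induct k arbitrary: z)
  case 0
  then show ?case using componentD[OF assms(1)] by (intro bexI[of _ z]) auto
next
  case (Suc k)
  note c = componentD[OF assms(1)]
  have pA: "p \<in> A" using A_prime_A[OF c(3) assms(2)] .
  have a: "A_ideal P" "A_ideal (ideal_product (replicate k P))" using A_prime_A_ideal[OF c(3)] by (auto intro: A_ideal_ideal_product)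
  from Suc(2) have "z \<in> P \<cdot> ideal_product (replicate k P)" by simp
  then show ?case
  proof induct
    case (prod i j)
    have ij: "i \<in> A" "j \<in> A" using prod A_ideal_A[OF a(1)] A_ideal_A[OF a(2)] by auto
    obtain x y where xy: "x \<in> A" "e \<otimes> i = e \<otimes> (p \<otimes> x)" "y \<in> A" "e \<otimes> j = e \<otimes> (p [^] k \<otimes> y)"
      using assms(3) prod(1) Suc(1)[OF prod(2)] by blast
    have "e \<otimes> (i \<otimes> j) = (e \<otimes> i) \<otimes> j" using c(1) ij by (simp add: m_assoc)
    also have "\<dots> = (p \<otimes> x) \<otimes> (e \<otimes> j)" unfolding xy(2) using c(1) ij pA xy(1) by (simp add: m_ac)
    also have "\<dots> = e \<otimes> (p [^] Suc k \<otimes> (x \<otimes> y))" unfolding xy(4) using c(1) pA xy(1,3) by (simp add: m_ac)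
    finally show ?case using xy by (intro bexI[of _ "x \<otimes> y"]) auto
  next
    case (sum s t)
    then obtain x y where xy: "x \<in> A" "e \<otimes> s = e \<otimes> (p [^] Suc k \<otimes> x)" "y \<in> A" "e \<otimes> t = e \<otimes> (p [^] Suc k \<otimes> y)" by blast
    have st: "s \<in> A" "t \<in> A" using sum A_ideal_A[OF A_ideal_prod[OF a]] by auto
    have "e \<otimes> (s \<oplus> t) = e \<otimes> s \<oplus> e \<otimes> t" using st c(1) by (simp add: r_distr)
    also have "\<dots> = e \<otimes> (p [^] Suc k \<otimes> (x \<oplus> y))" unfolding xy(2,4)
      using st c(1) xy(1,3) pA by (simp add: r_distr del: nat_pow_Suc)
    finally show ?case using xy by (intro bexI[of _ "x \<oplus> y"]) auto
  qed
qed

lemma pow_mem_ideal_product: "A_ideal P \<Longrightarrow> x \<in> P \<Longrightarrow> x [^] k \<in> ideal_product (replicate k P)"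
proof (induct k)
  case (Suc k)
  then have "x \<otimes> x [^] k \<in> P \<cdot> ideal_product (replicate k P)" by (intro ideal_prod.prod)
  then show ?case using A_ideal_A[OF Suc(2,3)] by (simp add: m_comm)
qed simp

text \<open>On the component e A the ideal I agrees with a power of \<open>P\<close>, while I + eA
  is everything. On the complement \<open>P\<close> is everything, since it contains 1 - e, and I +
  eA agrees with I.\<close>

lemma component_ideal_factor:
  assumes C: "component e P" and I: "A_ideal I" "I \<subseteq> P"
  shows "\<exists>k. I = ideal_product (replicate k P) \<cdot> {i \<oplus> e \<otimes> c | i c. i \<in> I \<and> c \<in> A}"
proof -
  note c = componentD[OF C]
  note Im = A_moduleD[OF A_ideal_A_module[OF I(1)]]
  let ?J = "{i \<oplus> e \<otimes> c | i c. i \<in> I \<and> c \<in> A}"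
  note J = A_ideal_sum_principal[OF I(1) c(1)]
  have main: "I = ideal_product (replicate k P) \<cdot> ?J"
    if k: "\<And>z. z \<in> ideal_product (replicate k P) \<Longrightarrow> e \<otimes> z \<in> I"
      "\<And>x. x \<in> I \<Longrightarrow> \<exists>z\<in>ideal_product (replicate k P). e \<otimes> x = e \<otimes> z" for k
  proof
    have a: "A_ideal (ideal_product (replicate k P))" using A_prime_A_ideal[OF c(3)] by (auto intro: A_ideal_ideal_product)
    have m: "A_module (ideal_product (replicate k P) \<cdot> ?J)" by (intro A_ideal_A_module A_ideal_prod a J)
    show "ideal_product (replicate k P) \<cdot> ?J \<subseteq> I"
    proof (rule prod_subset_A_module[OF _ A_ideal_A_module[OF I(1)]])
      fix z j assume z: "z \<in> ideal_product (replicate k P)" and "j \<in> ?J"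
      then obtain i d where j: "i \<in> I" "d \<in> A" "j = i \<oplus> e \<otimes> d" by blast
      have zA: "z \<in> A" using A_ideal_A[OF a z] .
      have "z \<otimes> j = z \<otimes> i \<oplus> d \<otimes> (e \<otimes> z)" unfolding j(3) using zA Im(1)[OF j(1)] c(1) j(2) by (simp add: r_distr m_ac)
      then show "z \<otimes> j \<in> I" using Im(3) Im(4)[OF zA j(1)] Im(4)[OF j(2) k(1)[OF z]] by simp
    qed
    show "I \<subseteq> ideal_product (replicate k P) \<cdot> ?J"
    proof
      fix x assume x: "x \<in> I"
      have xA: "x \<in> A" using A_ideal_A[OF I(1) x] .
      have "(\<one> \<ominus> e) \<otimes> (\<one> \<ominus> e) = \<one> \<ominus> e"
        using c(1,2) by (simp add: minus_eq l_distr r_distr l_minus r_minus l_neg r_neg a_assoc)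
      \<comment> \<open>The idempotent 1 - e belongs to P, hence to every power of P; this is how
        the complementary part of I survives in the product.\<close>
      then have pw: "(\<one> \<ominus> e) [^] k \<otimes> (\<one> \<ominus> e) = \<one> \<ominus> e"
        using idem_pow[of "\<one> \<ominus> e" k] c(1) by simp
      have "((\<one> \<ominus> e) [^] k \<otimes> (\<one> \<ominus> e)) \<otimes> x \<in> ideal_product (replicate k P) \<cdot> ?J"
      proof -
        have "(\<one> \<ominus> e) \<otimes> x \<in> I" using Im(4)[OF _ x] c(1) by simp
        then have "(\<one> \<ominus> e) \<otimes> x \<in> ?J" by (rule subsetD[OF J(2)])
        then have "(\<one> \<ominus> e) [^] k \<otimes> ((\<one> \<ominus> e) \<otimes> x) \<in> ideal_product (replicate k P) \<cdot> ?J"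
          by (intro ideal_prod.prod pow_mem_ideal_product A_prime_A_ideal c(3,5))
        then show ?thesis using c(1) xA by (simp add: m_assoc)
      qed
      then have 1: "x \<otimes> (\<one> \<ominus> e) \<in> ideal_product (replicate k P) \<cdot> ?J" unfolding pw using c(1) xA by (simp add: m_comm)
      obtain z where z: "z \<in> ideal_product (replicate k P)" "e \<otimes> x = e \<otimes> z" using k(2)[OF x] by blast
      have "z \<otimes> e \<in> ideal_product (replicate k P) \<cdot> ?J" using z(1) J(3) by (intro ideal_prod.prod)
      then have "e \<otimes> x \<in> ideal_product (replicate k P) \<cdot> ?J" unfolding z(2) using c(1) A_ideal_A[OF a z(1)] by (simp add: m_comm)
      from A_moduleD(3)[OF m 1 this] show "x \<in> ideal_product (replicate k P) \<cdot> ?J" using component_split[OF C A_carrier[OF xA]] by metis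
    qed
  qed
  from C show ?thesis
  proof (cases rule: component_cases)
    case dom
    \<comment> \<open>Here e P = 0, so any positive power of P has the right component; one copy is
      taken.\<close>
    have P1: "ideal_product (replicate 1 P) = P"
      using prod_le(1)[OF A_prime_A_ideal[OF c(3)] A_ideal_A_self] ideal_prod.prod[OF _ A_one, of _ P T] A_prime_A[OF c(3)] by force
    have "I = ideal_product (replicate 1 P) \<cdot> ?J"
      by (rule main; unfold P1) (use dom Im(2) I(2) in auto)
    then show ?thesis by blast
  next
    case (spr p n)
    have pA: "p \<in> A" using A_prime_A[OF c(3) spr(2)] .
    \<comment> \<open>The exponent is the largest k with e I inside e p^k A. The bound n is harmless
      because e p^n = 0, and it makes the maximum exist.\<close>
    define \<phi> where "\<phi> k \<longleftrightarrow> k \<le> n \<and> (\<forall>x\<in>I. \<exists>d\<in>A. e \<otimes> x = e \<otimes> (p [^] k \<otimes> d))" for k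
    have phi: "\<phi> 0" "\<And>j. \<phi> j \<Longrightarrow> j \<le> n" using A_ideal_A[OF I(1)] by (auto simp: \<phi>_def)
    define k where "k = Greatest \<phi>"
    have k: "\<phi> k" unfolding k_def by (rule GreatestI_nat[where P = \<phi> and b = n and k = 0]) (rule phi)+
    have kmax: "j \<le> k" if "\<phi> j" for j
      unfolding k_def by (rule Greatest_le_nat[where P = \<phi> and b = n]) (rule that, rule phi(2))
    have kn: "k \<le> n" "\<forall>x\<in>I. \<exists>d\<in>A. e \<otimes> x = e \<otimes> (p [^] k \<otimes> d)" using k by (auto simp: \<phi>_def)
    have ep: "e \<otimes> p [^] k \<in> I"
    proof (cases "k = n")
      case True then show ?thesis using spr(3) Im(2) by simp
    next
      case False
      then have "\<not> \<phi> (Suc k)" "Suc k \<le> n" using kmax[of "Suc k"] kn(1) by auto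
      \<comment> \<open>By maximality some x in I has component p^k d with d outside P. As d is
        invertible on the component and the inverse lies in A there, e p^k is in I.\<close>
      then obtain x where x: "x \<in> I" "\<forall>d\<in>A. e \<otimes> x \<noteq> e \<otimes> (p [^] Suc k \<otimes> d)" unfolding \<phi>_def by blast
      obtain d where d: "d \<in> A" "e \<otimes> x = e \<otimes> (p [^] k \<otimes> d)" using kn(2) x(1) by blast
      have "d \<notin> P"
      proof
        assume "d \<in> P"
        then obtain d' where d': "d' \<in> A" "e \<otimes> d = e \<otimes> (p \<otimes> d')" using spr(4) by blast
        have "e \<otimes> x = p [^] k \<otimes> (e \<otimes> d)" unfolding d(2) using c(1) pA d(1) by (simp add: m_lcomm)
        also have "\<dots> = e \<otimes> (p [^] Suc k \<otimes> d')" unfolding d'(2) using c(1) pA d'(1) by (simp add: m_ac)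
        finally show False using bspec[OF x(2) d'(1)] by simp
      qed
      then obtain y where y: "y \<in> carrier T" "e \<otimes> (d \<otimes> y) = e" using c(7)[OF d(1)] by blast
      have eyA: "e \<otimes> y \<in> A" using spr(1) y(1) by blast
      have "e \<otimes> p [^] k = (e \<otimes> e) \<otimes> ((d \<otimes> y) \<otimes> p [^] k)"
      proof -
        have "(e \<otimes> e) \<otimes> ((d \<otimes> y) \<otimes> p [^] k) = (e \<otimes> (d \<otimes> y)) \<otimes> p [^] k"
          unfolding c(2) using c(1) d(1) y(1) pA by (simp add: m_assoc)
        then show ?thesis using y(2) by simp
      qed
      also have "\<dots> = (e \<otimes> y) \<otimes> (e \<otimes> x)" unfolding d(2) using c(1) d(1) y(1) pA by (simp add: m_ac)
      finally show ?thesis using Im(4)[OF eyA Im(4)[OF c(1) x(1)]] by simp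
    qed
    have "I = ideal_product (replicate k P) \<cdot> ?J"
    proof (rule main)
      fix z assume "z \<in> ideal_product (replicate k P)"
      then obtain d where d: "d \<in> A" "e \<otimes> z = e \<otimes> (p [^] k \<otimes> d)" using component_pow[OF C spr(2,4)] by blast
      then have "e \<otimes> z = d \<otimes> (e \<otimes> p [^] k)" using c(1) pA by (simp add: m_ac)
      then show "e \<otimes> z \<in> I" using Im(4)[OF d(1) ep] by simp
    next
      fix x assume "x \<in> I"
      then obtain d where d: "d \<in> A" "e \<otimes> x = e \<otimes> (p [^] k \<otimes> d)" using kn(2) by blast
      have a: "A_ideal (ideal_product (replicate k P))" using A_prime_A_ideal[OF c(3)] by (auto intro: A_ideal_ideal_product)
      have "p [^] k \<otimes> d \<in> ideal_product (replicate k P)"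
        using A_moduleD(5)[OF A_ideal_A_module[OF a] d(1) pow_mem_ideal_product[OF A_prime_A_ideal[OF c(3)] spr(2)]] .
      then show "\<exists>z\<in>ideal_product (replicate k P). e \<otimes> x = e \<otimes> z" using d(2) by blast
    qed
    then show ?thesis by blast
  qed
qed

text \<open>Each prime of \<open>S\<close> containing I is split off as a power, replacing I by I +
  eA, which is no longer inside that prime. An ideal inside none of them contains a regular element
  by prime avoidance, and the regular factorization takes over.\<close>

lemma decomp_factor:
  assumes krull and D: "decomp S e"
  shows "A_ideal I \<Longrightarrow> u_hull I = I \<Longrightarrow> \<exists>Ps. (\<forall>P\<in>set Ps. A_prime P) \<and> I = u_hull (ideal_product Ps)"
proof (induct "card {P \<in> S. I \<subseteq> P}" arbitrary: I rule: less_induct)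
  case less
  note I = less(2,3)
  note Im = A_moduleD[OF A_ideal_A_module[OF I(1)]]
  show ?case
  proof (cases "\<exists>P\<in>S. I \<subseteq> P")
    case True
    then obtain P where P: "P \<in> S" "I \<subseteq> P" by blast
    note C = decompD(2)[OF D P(1)]
    note c = componentD[OF C]
    let ?J = "{i \<oplus> e P \<otimes> c | i c. i \<in> I \<and> c \<in> A}"
    note J = A_ideal_sum_principal[OF I(1) c(1)]
    \<comment> \<open>The ideal stays u-closed: the complementary part of x is tested against I, and
      the e-part belongs to the ideal anyway.\<close>
    have uJ: "u_hull ?J = ?J"
    proof
      show "?J \<subseteq> u_hull ?J" using u_hull_self[OF A_ideal_A_module[OF J(1)]] by blast
      show "u_hull ?J \<subseteq> ?J"
      proof
        fix x assume x: "x \<in> u_hull ?J"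
        have xA: "x \<in> A" using A_ideal_A[OF A_ideal_u_hull[OF J(1)] x] .
        obtain F where F: "GV F" "\<forall>f\<in>F. x \<otimes> f \<in> ?J" using x by (rule uclE)
        have "x \<otimes> (\<one> \<ominus> e P) \<in> u_hull I"
        proof (rule u_hullI[OF _ F(1)])
          show "x \<otimes> (\<one> \<ominus> e P) \<in> carrier T" using xA c(1) by simp
          fix f assume f: "f \<in> F"
          have fA: "f \<in> A" using GV_carrier[OF F(1) f] .
          obtain i d where id: "i \<in> I" "d \<in> A" "x \<otimes> f = i \<oplus> e P \<otimes> d" using bspec[OF F(2) f] by blast
          have "x \<otimes> (\<one> \<ominus> e P) \<otimes> f = (\<one> \<ominus> e P) \<otimes> (x \<otimes> f)" using xA fA c(1) by (simp add: m_ac)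
          also have "\<dots> = (\<one> \<ominus> e P) \<otimes> i \<oplus> ((\<one> \<ominus> e P) \<otimes> e P) \<otimes> d"
            unfolding id(3) using Im(1)[OF id(1)] id(2) c(1) by (simp add: r_distr m_assoc)
          also have "(\<one> \<ominus> e P) \<otimes> e P = \<zero>" using c(1,2) by (simp add: minus_eq l_distr l_minus r_neg)
          finally have "x \<otimes> (\<one> \<ominus> e P) \<otimes> f = (\<one> \<ominus> e P) \<otimes> i" using Im(1)[OF id(1)] id(2) c(1) by simp
          then show "x \<otimes> (\<one> \<ominus> e P) \<otimes> f \<in> I" using Im(4)[OF _ id(1), of "\<one> \<ominus> e P"] c(1) by simp
        qed
        then have "x \<otimes> (\<one> \<ominus> e P) \<in> ?J" using I(2) J(2) by blast
        moreover have "e P \<otimes> x \<in> ?J" using A_moduleD(5)[OF A_ideal_A_module[OF J(1)] xA J(3)] .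
        ultimately have "x \<otimes> (\<one> \<ominus> e P) \<oplus> e P \<otimes> x \<in> ?J" by (rule A_moduleD(3)[OF A_ideal_A_module[OF J(1)]])
        then show "x \<in> ?J" using component_split[OF C A_carrier[OF xA]] by metis
      qed
    qed
    have "{P \<in> S. ?J \<subseteq> P} \<subset> {P \<in> S. I \<subseteq> P}"
    proof
      show "{P \<in> S. ?J \<subseteq> P} \<subseteq> {P \<in> S. I \<subseteq> P}" using J(2) by blast
      have "\<not> ?J \<subseteq> P" using J(3) c(4) by blast
      then show "{P \<in> S. ?J \<subseteq> P} \<noteq> {P \<in> S. I \<subseteq> P}" using P by blast
    qed
    then have "card {P \<in> S. ?J \<subseteq> P} < card {P \<in> S. I \<subseteq> P}"
      using decompD(1)[OF D] by (intro psubset_card_mono) auto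
    from less(1)[OF this J(1) uJ] obtain Ps where Ps: "\<forall>P\<in>set Ps. A_prime P" "?J = u_hull (ideal_product Ps)" by blast
    obtain k where k: "I = ideal_product (replicate k P) \<cdot> ?J" using component_ideal_factor[OF C I(1) P(2)] by blast
    have a: "\<And>Q. Q \<in> set (replicate k P) \<Longrightarrow> A_ideal Q" "\<And>Q. Q \<in> set Ps \<Longrightarrow> A_ideal Q"
      using A_prime_A_ideal[OF c(3)] Ps(1) A_prime_A_ideal by auto
    have "I = u_hull (ideal_product (replicate k P) \<cdot> u_hull (ideal_product Ps))" using I(2) k Ps(2) by simp
    also have "\<dots> = u_hull (ideal_product (replicate k P) \<cdot> ideal_product Ps)"
      by (rule u_hull_prod_u_hull[OF A_ideal_A_module[OF A_ideal_ideal_product[OF a(1)]] A_ideal_A_module[OF A_ideal_ideal_product[OF a(2)]]])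
    also have "\<dots> = u_hull (ideal_product (replicate k P @ Ps))"
      using ideal_product_append[of "replicate k P" Ps] a by simp
    finally show ?thesis using Ps(1) c(3) by (intro exI[of _ "replicate k P @ Ps"]) auto
  next
    case False
    have "\<exists>x\<in>I. \<forall>P\<in>S. x \<notin> P"
    proof (rule avoid_primes)
      show "finite S" by (rule decompD(1)[OF D])
      show "A_ideal I" by (rule I)
      fix P assume P: "P \<in> S"
      then show "A_prime P" using componentD(3) decompD(2)[OF D] by blast
      show "\<not> I \<subseteq> P" using False P by blast
      fix Q assume Q: "Q \<in> S" "P \<subseteq> Q"
      show "P = Q"
      proof (rule ccontr)
        assume "P \<noteq> Q"
        then have "e Q \<in> Q" using decomp_other[OF D Q(1) P] Q(2) by blast
        then show False using componentD(4)[OF decompD(2)[OF D Q(1)]] by blast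
      qed
    qed
    then obtain x where x: "x \<in> I" "\<forall>P\<in>S. x \<notin> P" by blast
    have "x \<in> Units T" by (rule decomp_regular[OF D A_ideal_A[OF I(1) x(1)]]) (use x(2) in blast)
    then show ?thesis using krull_regular_factor[OF \<open>krull\<close> A_ideal_A[OF I(1) x(1)] _ I(1) x(1) I(2)] by blast
  qed
qed

text \<open>Principal ideals are already u-closed, component by component. Where e T is inside A,
  division by a unit from the \<open>GV\<close> set is possible in A. On a domain component
  \<open>a\<close> is either zero or invertible over T, and the quotient lies in A by the
  \<open>GV\<close> test.\<close>

lemma decomp_principal:
  assumes D: "decomp S e" and a: "a \<in> A"
  shows "u_hull (principal a) = principal a"
proof
  note m = A_module_principal[OF A_carrier[OF a]]
  show "principal a \<subseteq> u_hull (principal a)" using u_hull_self[OF m] by blast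
  show "u_hull (principal a) \<subseteq> principal a"
  proof
    fix x assume x: "x \<in> u_hull (principal a)"
    have xA: "x \<in> A" using A_ideal_A[OF A_ideal_u_hull[OF A_ideal_principal[OF a]] x] .
    obtain F where F: "GV F" "\<forall>f\<in>F. x \<otimes> f \<in> principal a" using x by (rule uclE)
    obtain f0 where f0: "f0 \<in> F" "f0 \<in> Units T" using GV_unit[OF F(1)] by blast
    have if0: "inv f0 \<in> carrier T" "f0 \<in> carrier T" using f0 by auto
    show "x \<in> principal a"
    proof (rule decomp_mem[OF D m A_carrier[OF xA]])
      fix P assume P: "P \<in> S"
      note C = decompD(2)[OF D P]
      note c = componentD[OF C]
      obtain d0 where d0: "d0 \<in> A" "x \<otimes> f0 = a \<otimes> d0" using bspec[OF F(2) f0(1)] by (auto simp: principal_mem)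
      have ex: "e P \<otimes> x = a \<otimes> (e P \<otimes> (inv f0 \<otimes> d0))"
      proof -
        have "e P \<otimes> x = e P \<otimes> (x \<otimes> (f0 \<otimes> inv f0))" using f0 c(1) xA by simp
        also have "\<dots> = e P \<otimes> (inv f0 \<otimes> (x \<otimes> f0))" using if0 c(1) xA by (simp add: m_ac)
        also have "\<dots> = a \<otimes> (e P \<otimes> (inv f0 \<otimes> d0))" unfolding d0(2) using if0 c(1) a d0(1) by (simp add: m_ac)
        finally show ?thesis .
      qed
      from C show "e P \<otimes> x \<in> principal a"
      proof (cases rule: component_cases)
        case (spr p n)
        then have "e P \<otimes> (inv f0 \<otimes> d0) \<in> A" using if0 d0(1) by simp
        then show ?thesis using ex by (auto simp: principal_mem)
      next
        case dom
        show ?thesis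
        proof (cases "a \<in> P")
          case True
          have "e P \<otimes> x = (e P \<otimes> a) \<otimes> (inv f0 \<otimes> d0)" using ex c(1) a if0 d0(1) by (simp add: m_lcomm m_assoc)
          then have "e P \<otimes> x = \<zero>" using dom True if0 d0(1) by simp
          then show ?thesis using A_moduleD(2)[OF m] by simp
        next
          case False
          obtain y where y: "y \<in> carrier T" "e P \<otimes> (a \<otimes> y) = e P" using c(7)[OF a False] by blast
          have "(e P \<otimes> y) \<otimes> x \<in> A"
          proof (rule GV_D[OF F(1)])
            show "(e P \<otimes> y) \<otimes> x \<in> carrier T" using c(1) y(1) xA by simp
            fix f assume f: "f \<in> F"
            obtain d where d: "d \<in> A" "x \<otimes> f = a \<otimes> d" using bspec[OF F(2) f] by (auto simp: principal_mem)
            have "(e P \<otimes> y) \<otimes> x \<otimes> f = (e P \<otimes> y) \<otimes> (x \<otimes> f)" using c(1) y(1) xA GV_carrier[OF F(1) f] by (simp add: m_assoc)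
            also have "\<dots> = (e P \<otimes> (a \<otimes> y)) \<otimes> d" unfolding d(2) using c(1) y(1) a d(1) by (simp add: m_ac)
            finally show "(e P \<otimes> y) \<otimes> x \<otimes> f \<in> A" unfolding y(2) using c(1) d(1) by simp
          qed
          moreover have "e P \<otimes> x = a \<otimes> ((e P \<otimes> y) \<otimes> x)"
          proof -
            have "a \<otimes> ((e P \<otimes> y) \<otimes> x) = (e P \<otimes> (a \<otimes> y)) \<otimes> x" using c(1) y(1) a xA by (simp add: m_ac)
            then show ?thesis using y(2) by simp
          qed
          ultimately show ?thesis by (auto simp: principal_mem)
        qed
      qed
    qed
  qed
qed

lemma principal_minimal_primes:
  assumes pm: "\<And>P. min_prime P \<Longrightarrow> \<exists>p\<in>A. P = principal p"
  shows "\<exists>ps. set ps \<subseteq> A \<and> (\<forall>p\<in>set ps. A_prime (principal p)) \<and> foldr (\<otimes>) ps \<one> = \<zero>"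
proof (rule ccontr)
  assume no: "\<not> ?thesis"
  let ?L = "{ps. set ps \<subseteq> A \<and> (\<forall>p\<in>set ps. A_prime (principal p))}"
  let ?S = "(\<lambda>ps. foldr (\<otimes>) ps \<one>) ` ?L"
  have cl: "foldr (\<otimes>) ps \<one> \<in> A" if "set ps \<subseteq> A" for ps using ideal_product_map_principal(2)[OF that] .
  have app: "foldr (\<otimes>) (ps @ qs) \<one> = foldr (\<otimes>) ps \<one> \<otimes> foldr (\<otimes>) qs \<one>" if "set ps \<subseteq> A" "set qs \<subseteq> A" for ps qs
    using that
  proof (induct ps)
    case Nil then show ?case using cl[of qs] by simp
  next
    case (Cons p ps) then show ?case using cl[of qs] cl[of ps] by (simp add: m_assoc)
  qed
  have z: "A_ideal {\<zero>}" unfolding A_ideal_def by (intro conjI A_moduleI) auto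
  have "\<zero> \<notin> ?S"
  proof
    assume "\<zero> \<in> ?S"
    then obtain ps where "set ps \<subseteq> A" "\<forall>p\<in>set ps. A_prime (principal p)" "foldr (\<otimes>) ps \<one> = \<zero>" by auto
    then show False using no by blast
  qed
  then have dis: "{\<zero>} \<inter> ?S = {}" by simp
  have sub: "?S \<subseteq> A" using cl by blast
  have one: "\<one> \<in> ?S" by (rule image_eqI[of _ _ "[]"]) auto
  have mul: "x \<otimes> y \<in> ?S" if xy: "x \<in> ?S" "y \<in> ?S" for x y
  proof -
    obtain ps qs where h: "ps \<in> ?L" "qs \<in> ?L" "x = foldr (\<otimes>) ps \<one>" "y = foldr (\<otimes>) qs \<one>" using xy by blast
    then have "x \<otimes> y = foldr (\<otimes>) (ps @ qs) \<one>" using app[of ps qs] by simp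
    moreover have "ps @ qs \<in> ?L" using h by auto
    ultimately show ?thesis by blast
  qed
  obtain Q where Q: "A_prime Q" "{\<zero>} \<subseteq> Q" "Q \<inter> ?S = {}" using exists_prime_avoiding[OF z dis sub mul one] .
  \<comment> \<open>Zorn's lemma for reverse inclusion: complements of primes form a family closed under unions of chains.\<close>
  let ?F = "{A - P | P. A_prime P \<and> P \<subseteq> Q}"
  have "\<exists>M\<in>?F. \<forall>Z\<in>?F. M \<subseteq> Z \<longrightarrow> Z = M"
  proof (rule subset_Zorn_nonempty)
    show "?F \<noteq> {}" using Q(1) by blast
    fix C assume C: "C \<noteq> {}" "subset.chain ?F C"
    define P where "P = A - \<Union>C"
    have CF: "\<exists>P. A_prime P \<and> P \<subseteq> Q \<and> Z = A - P" if "Z \<in> C" for Z using C(2) that unfolding subset_chain_def by blast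
    have lin: "\<And>Y Z. Y \<in> C \<Longrightarrow> Z \<in> C \<Longrightarrow> Y \<subseteq> Z \<or> Z \<subseteq> Y" using C(2) unfolding subset_chain_def by blast
    have Pm: "x \<in> P \<longleftrightarrow> x \<in> A \<and> (\<forall>Z\<in>C. x \<in> A - Z)" for x using C(1) by (auto simp: P_def)
    have CP: "A_prime (A - Z)" "A - Z \<subseteq> Q" if "Z \<in> C" for Z
    proof -
      from CF[OF that] obtain R where "A_prime R" "R \<subseteq> Q" "Z = A - R" by blast
      moreover have "R \<subseteq> A" using A_prime_A \<open>A_prime R\<close> by blast
      ultimately have "A - Z = R" by blast
      then show "A_prime (A - Z)" "A - Z \<subseteq> Q" using \<open>A_prime R\<close> \<open>R \<subseteq> Q\<close> by auto
    qed
    have CA: "Z \<subseteq> A" if "Z \<in> C" for Z using CF[OF that] by blast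
    have "A_prime P" unfolding A_prime_def A_ideal_def
    proof (intro conjI A_moduleI ballI impI)
      show "P \<subseteq> carrier T" "P \<subseteq> A" using A_subset by (auto simp: P_def)
      show "\<zero> \<in> P" unfolding Pm using A_moduleD(2)[OF A_prime_A_module[OF CP(1)]] by simp
      show "\<one> \<notin> P" using A_prime_one[OF CP(1)] C(1) Pm by blast
      show "x \<oplus> y \<in> P" if "x \<in> P" "y \<in> P" for x y
        using that A_moduleD(3)[OF A_prime_A_module[OF CP(1)]] unfolding Pm by auto
      show "a \<otimes> x \<in> P" if "a \<in> A" "x \<in> P" for a x
        using that A_moduleD(4)[OF A_prime_A_module[OF CP(1)]] unfolding Pm by auto
      fix a b assume ab: "a \<in> A" "b \<in> A" "a \<otimes> b \<in> P"
      show "a \<in> P \<or> b \<in> P"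
      proof (rule ccontr)
        assume "\<not> (a \<in> P \<or> b \<in> P)"
        then obtain Y Z where "Y \<in> C" "Z \<in> C" "a \<in> Y" "b \<in> Z" using ab by (auto simp: P_def)
        then obtain W where W: "W \<in> C" "a \<in> W" "b \<in> W" using lin by blast
        then have "a \<otimes> b \<in> A - W" using ab(3) Pm by blast
        then show False using A_prime_mem[OF CP(1)[OF W(1)] _ ab(1,2)] W by blast
      qed
    qed
    moreover have "P \<subseteq> Q" using C(1) CP(2) Pm by blast
    moreover have "\<Union>C = A - P" using CA by (auto simp: P_def)
    ultimately show "\<Union>C \<in> ?F" by blast
  qed
  then obtain M where M: "M \<in> ?F" "\<forall>Z\<in>?F. M \<subseteq> Z \<longrightarrow> Z = M" by (elim bexE)
  obtain P where P: "A_prime P" "P \<subseteq> Q" "M = A - P" using M(1) by blast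
  have "min_prime P" unfolding min_prime_def
  proof (intro conjI allI impI)
    fix R assume R: "A_prime R \<and> R \<subseteq> P"
    then have "A - R = M" using bspec[OF M(2), of "A - R"] P by blast
    then show "R = P" using P A_prime_A[of R] A_prime_A[of P] R by blast
  qed (rule P)
  then obtain p where p: "p \<in> A" "P = principal p" using pm by blast
  have "foldr (\<otimes>) [p] \<one> \<in> ?S" by (rule imageI) (use p P in auto)
  then have "p \<in> ?S" using p(1) by simp
  moreover have "p \<in> Q" using principal_self p P(2) by auto
  ultimately show False using Q(3) by blast
qed

lemma prime_elements_minimal_primes:
  assumes ps: "set ps \<subseteq> A" "\<And>p. p \<in> set ps \<Longrightarrow> A_prime (principal p)" "foldr (\<otimes>) ps \<one> = \<zero>" and P: "min_prime P"
  shows "\<exists>p\<in>A. P = principal p"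
proof -
  have Pp: "A_prime P" using P by (simp add: min_prime_def)
  have "ideal_product (map principal ps) \<subseteq> P"
    using ideal_product_map_principal(1)[OF ps(1)] A_moduleD(2)[OF A_prime_A_module[OF Pp]] unfolding ps(3) by (auto simp: principal_def)
  then have "\<exists>Q\<in>set (map principal ps). Q \<subseteq> P"
    by (rule ideal_product_prime[OF Pp]) (use ps(2) A_prime_A_ideal in auto)
  then obtain p where "p \<in> set ps" "principal p \<subseteq> P" by auto
  then show ?thesis using P ps(1,2) unfolding min_prime_def by blast
qed

end

lemma (in frac_pair) zero_dimensionalD:
  "zero_dimensional \<Longrightarrow> A_prime P \<Longrightarrow> A_prime N \<Longrightarrow> P \<subseteq> N \<Longrightarrow> N \<inter> Units T = {} \<Longrightarrow> P = N"
  by (simp add: zero_dimensional_def)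

lemma (in cring) ideal_iff:
  "ideal I R \<longleftrightarrow> I \<subseteq> carrier R \<and> \<zero> \<in> I \<and> (\<forall>x\<in>I. \<forall>y\<in>I. x \<oplus> y \<in> I) \<and> (\<forall>a\<in>carrier R. \<forall>x\<in>I. a \<otimes> x \<in> I)"
proof
  assume "ideal I R"
  then interpret ideal I R .
  show "I \<subseteq> carrier R \<and> \<zero> \<in> I \<and> (\<forall>x\<in>I. \<forall>y\<in>I. x \<oplus> y \<in> I) \<and> (\<forall>a\<in>carrier R. \<forall>x\<in>I. a \<otimes> x \<in> I)"
    using a_subset zero_closed a_closed I_l_closed by (intro conjI ballI) simp_all
next
  assume h: "I \<subseteq> carrier R \<and> \<zero> \<in> I \<and> (\<forall>x\<in>I. \<forall>y\<in>I. x \<oplus> y \<in> I) \<and> (\<forall>a\<in>carrier R. \<forall>x\<in>I. a \<otimes> x \<in> I)"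
  have "\<ominus> x \<in> I" if x: "x \<in> I" for x
  proof -
    have "x \<in> carrier R" using h x by blast
    then have "\<ominus> x = (\<ominus> \<one>) \<otimes> x" by (simp add: l_minus)
    then show ?thesis using h x by simp
  qed
  then have "subgroup I (add_monoid R)"
    using h by (auto simp: subgroup_def a_inv_def)
  then show "ideal I R"
  proof (rule idealI[OF ring_axioms])
    fix a x assume ax: "a \<in> I" "x \<in> carrier R"
    then show "x \<otimes> a \<in> I" using h by blast
    then show "a \<otimes> x \<in> I" using h ax m_comm[of a x] by (simp add: subset_iff)
  qed
qed

lemma (in cring) primeideal_iff:
  "primeideal P R \<longleftrightarrow> ideal P R \<and> \<one> \<notin> P \<and>
     (\<forall>a\<in>carrier R. \<forall>b\<in>carrier R. a \<otimes> b \<in> P \<longrightarrow> a \<in> P \<or> b \<in> P)"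
proof
  assume "primeideal P R"
  then interpret primeideal P R .
  show "ideal P R \<and> \<one> \<notin> P \<and> (\<forall>a\<in>carrier R. \<forall>b\<in>carrier R. a \<otimes> b \<in> P \<longrightarrow> a \<in> P \<or> b \<in> P)"
    using is_ideal one_imp_carrier I_notcarr I_prime by blast
next
  assume h: "ideal P R \<and> \<one> \<notin> P \<and> (\<forall>a\<in>carrier R. \<forall>b\<in>carrier R. a \<otimes> b \<in> P \<longrightarrow> a \<in> P \<or> b \<in> P)"
  show "primeideal P R"
    by (rule primeidealI) (use h is_cring in auto)
qed

section \<open>The total quotient ring\<close>

locale nontrivial_cring = cring R for R (structure) +
  assumes one_neq_zero: "\<one> \<noteq> \<zero>"
begin

abbreviation "Q \<equiv> total_quotient_ring R"
abbreviation "\<iota> \<equiv> tq_embed R"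

lemmas iota_hom = ring_hom_memE[OF tq_embed_hom]

lemma iota_simps [simp]:
  "x \<in> carrier R \<Longrightarrow> \<iota> x \<in> carrier Q" "\<iota> \<one> = \<one>\<^bsub>Q\<^esub>"
  "x \<in> carrier R \<Longrightarrow> y \<in> carrier R \<Longrightarrow> \<iota> (x \<otimes> y) = \<iota> x \<otimes>\<^bsub>Q\<^esub> \<iota> y"
  "x \<in> carrier R \<Longrightarrow> y \<in> carrier R \<Longrightarrow> \<iota> (x \<oplus> y) = \<iota> x \<oplus>\<^bsub>Q\<^esub> \<iota> y"
  by (simp_all add: iota_hom)

lemma iota_zero [simp]: "\<iota> \<zero> = \<zero>\<^bsub>Q\<^esub>"
  by (simp add: tq_embed_def tq_zero)

lemma iota_eq [simp]: "x \<in> carrier R \<Longrightarrow> y \<in> carrier R \<Longrightarrow> \<iota> x = \<iota> y \<longleftrightarrow> x = y"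
  using tq_embed_inj by (auto simp: inj_on_def)

lemma iota_mem: "I \<subseteq> carrier R \<Longrightarrow> x \<in> carrier R \<Longrightarrow> \<iota> x \<in> \<iota> ` I \<longleftrightarrow> x \<in> I"
  using tq_embed_inj by (meson inj_on_image_mem_iff)

lemma iota_Units: "s \<in> carrier R \<Longrightarrow> \<iota> s \<in> Units Q \<longleftrightarrow> s \<in> regular_elements R"
proof
  assume s: "s \<in> carrier R" and u: "\<iota> s \<in> Units Q"
  interpret T: cring Q by (rule total_quotient_ring_cring)
  have "b = \<zero>" if b: "b \<in> carrier R" "s \<otimes> b = \<zero>" for b
  proof -
    have "\<iota> s \<otimes>\<^bsub>Q\<^esub> \<iota> b = \<zero>\<^bsub>Q\<^esub>" using b s by (metis iota_simps(3) iota_zero)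
    then have "inv\<^bsub>Q\<^esub> (\<iota> s) \<otimes>\<^bsub>Q\<^esub> (\<iota> s \<otimes>\<^bsub>Q\<^esub> \<iota> b) = \<zero>\<^bsub>Q\<^esub>" using u by simp
    then have "\<iota> b = \<iota> \<zero>" using u b s by (simp add: T.m_assoc[symmetric])
    then show ?thesis using b iota_eq[of b \<zero>] by simp
  qed
  then show "s \<in> regular_elements R" using s by (simp add: regular_elements_def)
qed (rule tq_embed_regular_Units)

lemma tq_frac_mult_denominator:
  assumes "a \<in> carrier R" "s \<in> regular_elements R"
  shows "\<iota> s \<otimes>\<^bsub>Q\<^esub> tq_frac R a s = \<iota> a"
proof -
  have s: "s \<in> carrier R" using regular_closed assms by simp
  have "tq_frac R s \<one> \<otimes>\<^bsub>Q\<^esub> tq_frac R a s = tq_frac R (s \<otimes> a) (\<one> \<otimes> s)"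
    using assms s regular_one by (intro tq_mult_frac)
  also have "\<dots> = tq_frac R a \<one>"
    using assms s regular_one by (subst tq_frac_eq_iff) (auto simp: m_comm)
  finally show ?thesis by (simp add: tq_embed_def)
qed

lemma frac_pair: "frac_pair Q (\<iota> ` carrier R)"
proof -
  interpret T: cring Q by (rule total_quotient_ring_cring)
  let ?A = "\<iota> ` carrier R"
  show ?thesis
  proof unfold_locales
    show "?A \<subseteq> carrier Q" by auto
    show "\<one>\<^bsub>Q\<^esub> \<in> ?A" by (rule image_eqI[of _ _ \<one>]) auto
    fix x assume "x \<in> ?A"
    then obtain a where a: "a \<in> carrier R" "x = \<iota> a" by blast
    have "\<iota> (\<ominus> a) \<oplus>\<^bsub>Q\<^esub> \<iota> a = \<zero>\<^bsub>Q\<^esub>" using a iota_simps(4)[of "\<ominus> a" a] by (simp add: l_neg)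
    then have "\<ominus>\<^bsub>Q\<^esub> x = \<iota> (\<ominus> a)" using a by (metis T.minus_equality iota_simps(1) a_inv_closed)
    then show "\<ominus>\<^bsub>Q\<^esub> x \<in> ?A" using a by simp
    fix y assume "y \<in> ?A"
    then obtain b where b: "b \<in> carrier R" "y = \<iota> b" by blast
    show "x \<oplus>\<^bsub>Q\<^esub> y \<in> ?A" "x \<otimes>\<^bsub>Q\<^esub> y \<in> ?A"
      using a b iota_simps(3,4)[OF a(1) b(1)] by (metis a_closed imageI, metis m_closed imageI)
  next
    fix x assume "x \<in> carrier Q"
    then obtain a s where as: "a \<in> carrier R" "s \<in> regular_elements R" "x = tq_frac R a s" by (rule tq_carrierE)
    then have s: "s \<in> carrier R" by (simp add: regular_closed)
    have "\<iota> s \<in> ?A \<inter> Units Q" "\<iota> s \<otimes>\<^bsub>Q\<^esub> x \<in> ?A"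
      using as s iota_Units tq_frac_mult_denominator by auto
    then show "\<exists>s\<in>?A \<inter> Units Q. s \<otimes>\<^bsub>Q\<^esub> x \<in> ?A" by blast
  next
    fix x assume "x \<in> ?A" and reg: "\<And>b. b \<in> ?A \<Longrightarrow> x \<otimes>\<^bsub>Q\<^esub> b = \<zero>\<^bsub>Q\<^esub> \<Longrightarrow> b = \<zero>\<^bsub>Q\<^esub>"
    then obtain a where a: "a \<in> carrier R" "x = \<iota> a" by blast
    have "b = \<zero>" if b: "b \<in> carrier R" "a \<otimes> b = \<zero>" for b
    proof -
      have "\<iota> b = \<iota> \<zero>" using reg[of "\<iota> b"] a b iota_simps(3)[OF a(1) b(1)] by simp
      then show ?thesis using b iota_eq[of b \<zero>] by simp
    qed
    then show "x \<in> Units Q" using a iota_Units by (simp add: regular_elements_def)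
  next
    show "\<one>\<^bsub>Q\<^esub> \<noteq> \<zero>\<^bsub>Q\<^esub>" using one_neq_zero iota_eq[of \<one> \<zero>] by simp
  qed
qed

sublocale fp: frac_pair Q "\<iota> ` carrier R"
  by (rule frac_pair)

lemma ball_iota: "(\<forall>x\<in>\<iota> ` I. Pr x) \<longleftrightarrow> (\<forall>x\<in>I. Pr (\<iota> x))"
  by blast

lemma A_ideal_iota: 
  assumes I: "I \<subseteq> carrier R"
  shows "fp.A_ideal (\<iota> ` I) \<longleftrightarrow> ideal I R"
proof -
  have A: "\<And>x. x \<in> I \<Longrightarrow> x \<in> carrier R" using I by blast
  have s: "\<iota> x \<oplus>\<^bsub>Q\<^esub> \<iota> y \<in> \<iota> ` I \<longleftrightarrow> x \<oplus> y \<in> I" "\<iota> x \<otimes>\<^bsub>Q\<^esub> \<iota> y \<in> \<iota> ` I \<longleftrightarrow> x \<otimes> y \<in> I"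
    if "x \<in> carrier R" "y \<in> carrier R" for x y
    using that iota_mem[OF I, of "x \<oplus> y"] iota_mem[OF I, of "x \<otimes> y"] by auto
  have z: "\<zero>\<^bsub>Q\<^esub> \<in> \<iota> ` I \<longleftrightarrow> \<zero> \<in> I" using iota_mem[OF I, of \<zero>] by simp
  have sub: "\<iota> ` I \<subseteq> carrier Q" "\<iota> ` I \<subseteq> \<iota> ` carrier R" using I by auto
  show ?thesis
    unfolding fp.A_ideal_def fp.A_module_def ideal_iff ball_iota z
    using I sub s A by (auto simp del: iota_simps(3,4))
qed

lemma A_ideal_preimage:
  assumes "fp.A_ideal J"
  obtains I where "ideal I R" "J = \<iota> ` I"
proof -
  have "J \<subseteq> \<iota> ` carrier R" using fp.A_ideal_A[OF assms] by blast
  then obtain I where I: "I \<subseteq> carrier R" "J = \<iota> ` I" by (meson subset_imageE)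
  then show thesis using that A_ideal_iota assms by blast
qed

lemma ideal_carrier: "ideal I R \<Longrightarrow> I \<subseteq> carrier R"
  by (simp add: ideal_iff)

lemma A_prime_iota:
  assumes P: "P \<subseteq> carrier R"
  shows "fp.A_prime (\<iota> ` P) \<longleftrightarrow> primeideal P R"
proof -
  have s: "\<iota> x \<otimes>\<^bsub>Q\<^esub> \<iota> y \<in> \<iota> ` P \<longleftrightarrow> x \<otimes> y \<in> P" "\<iota> x \<in> \<iota> ` P \<longleftrightarrow> x \<in> P"
    if "x \<in> carrier R" "y \<in> carrier R" for x y
    using that iota_mem[OF P, of x] iota_mem[OF P, of "x \<otimes> y"] by auto
  have o: "\<one>\<^bsub>Q\<^esub> \<in> \<iota> ` P \<longleftrightarrow> \<one> \<in> P" using iota_mem[OF P, of \<one>] by simp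
  show ?thesis unfolding fp.A_prime_def primeideal_iff A_ideal_iota[OF P] ball_iota o
    using s by (auto simp del: iota_simps(3,4))
qed

lemma primeideal_carrier: "primeideal P R \<Longrightarrow> P \<subseteq> carrier R"
  by (simp add: primeideal_iff ideal_iff)

lemma A_prime_preimage:
  assumes "fp.A_prime J"
  obtains P where "primeideal P R" "J = \<iota> ` P"
proof -
  obtain I where I: "ideal I R" "J = \<iota> ` I" using A_ideal_preimage[OF fp.A_prime_A_ideal[OF assms]] .
  then show thesis using that A_prime_iota[OF ideal_carrier[OF I(1)]] assms by blast
qed

lemma principal_iota:
  assumes "a \<in> carrier R"
  shows "\<iota> ` (PIdl a) = fp.principal (\<iota> a)"
proof -
  have "PIdl a = (\<lambda>x. x \<otimes> a) ` carrier R" by (auto simp: cgenideal_def)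
  moreover have "\<iota> (x \<otimes> a) = \<iota> a \<otimes>\<^bsub>Q\<^esub> \<iota> x" if "x \<in> carrier R" for x
    using that assms by (simp add: fp.m_comm)
  ultimately show ?thesis unfolding fp.principal_def by (simp only: image_image cong: image_cong)
qed

lemma prod_iota:
  assumes "I \<subseteq> carrier R" "J \<subseteq> carrier R"
  shows "\<iota> ` (I \<cdot> J) = ideal_prod Q (\<iota> ` I) (\<iota> ` J)"
proof
  have c: "I \<cdot> J \<subseteq> carrier R"
  proof
    fix x assume "x \<in> I \<cdot> J" then show "x \<in> carrier R" by induct (use assms in auto)
  qed
  have "\<iota> x \<in> ideal_prod Q (\<iota> ` I) (\<iota> ` J)" if "x \<in> I \<cdot> J" for x
    using that
  proof induct
    case (prod i j)
    then have "\<iota> (i \<otimes> j) = \<iota> i \<otimes>\<^bsub>Q\<^esub> \<iota> j" using assms by (intro iota_simps(3)) auto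
    then show ?case using prod by (simp add: ideal_prod.prod)
  next
    case (sum s t)
    then have "\<iota> (s \<oplus> t) = \<iota> s \<oplus>\<^bsub>Q\<^esub> \<iota> t" using c by (intro iota_simps(4)) auto
    then show ?case using sum by (simp add: ideal_prod.sum)
  qed
  then show "\<iota> ` (I \<cdot> J) \<subseteq> ideal_prod Q (\<iota> ` I) (\<iota> ` J)" by blast
  show "ideal_prod Q (\<iota> ` I) (\<iota> ` J) \<subseteq> \<iota> ` (I \<cdot> J)"
  proof (rule fp.prod_subset)
    fix i j assume "i \<in> \<iota> ` I" "j \<in> \<iota> ` J"
    then obtain x y where xy: "x \<in> I" "y \<in> J" "i = \<iota> x" "j = \<iota> y" by blast
    then have "i \<otimes>\<^bsub>Q\<^esub> j = \<iota> (x \<otimes> y)" using assms by (simp add: subset_iff)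
    then show "i \<otimes>\<^bsub>Q\<^esub> j \<in> \<iota> ` (I \<cdot> J)" using ideal_prod.prod[OF xy(1,2), of R] by blast
  next
    fix i j assume "i \<in> \<iota> ` (I \<cdot> J)" "j \<in> \<iota> ` (I \<cdot> J)"
    then obtain x y where xy: "x \<in> I \<cdot> J" "y \<in> I \<cdot> J" "i = \<iota> x" "j = \<iota> y" by blast
    then have "i \<oplus>\<^bsub>Q\<^esub> j = \<iota> (x \<oplus> y)" using c by (simp add: subset_iff)
    then show "i \<oplus>\<^bsub>Q\<^esub> j \<in> \<iota> ` (I \<cdot> J)" using ideal_prod.sum[OF xy(1,2)] by blast
  qed
qed

lemma ideal_product_iota:
  assumes "\<And>I. I \<in> set Is \<Longrightarrow> I \<subseteq> carrier R"
  shows "\<iota> ` ideal_prod_list R Is = fp.ideal_product (map ((`) \<iota>) Is)" "ideal_prod_list R Is \<subseteq> carrier R"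
  using assms
proof (induct Is)
  case (Cons I Is)
  have I: "I \<subseteq> carrier R" "ideal_prod_list R Is \<subseteq> carrier R" if "\<And>J. J \<in> set (I # Is) \<Longrightarrow> J \<subseteq> carrier R"
    using Cons(2) that by simp_all
  {
    case 1
    show ?case using prod_iota[OF I] Cons(1) 1 by (simp add: ideal_prod_list_def)
  next
    case 2
    have "x \<in> carrier R" if "x \<in> I \<cdot> ideal_prod_list R Is" for x
      using that by induct (use I 2 in auto)
    then show ?case by (auto simp: ideal_prod_list_def)
  }
qed (simp_all add: ideal_prod_list_def)

text \<open>Lets a condition checked on generators pass to the ideal they generate, by minimality of
  that ideal.\<close>

lemma colon_ideal:
  assumes "fp.A_module Y" "x \<in> carrier Q"
  shows "ideal {j \<in> carrier R. x \<otimes>\<^bsub>Q\<^esub> \<iota> j \<in> Y} R"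
  unfolding ideal_iff
proof (intro conjI ballI)
  note m = fp.A_moduleD[OF assms(1)]
  show "\<zero> \<in> {j \<in> carrier R. x \<otimes>\<^bsub>Q\<^esub> \<iota> j \<in> Y}" using m assms(2) by simp
  fix i j assume "i \<in> {j \<in> carrier R. x \<otimes>\<^bsub>Q\<^esub> \<iota> j \<in> Y}" "j \<in> {j \<in> carrier R. x \<otimes>\<^bsub>Q\<^esub> \<iota> j \<in> Y}"
  then show "i \<oplus> j \<in> {j \<in> carrier R. x \<otimes>\<^bsub>Q\<^esub> \<iota> j \<in> Y}"
    using m(3) assms(2) by (simp add: fp.r_distr)
next
  note m = fp.A_moduleD[OF assms(1)]
  fix a j assume "a \<in> carrier R" "j \<in> {j \<in> carrier R. x \<otimes>\<^bsub>Q\<^esub> \<iota> j \<in> Y}"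
  then show "a \<otimes> j \<in> {j \<in> carrier R. x \<otimes>\<^bsub>Q\<^esub> \<iota> j \<in> Y}"
    using m(4)[of "\<iota> a" "x \<otimes>\<^bsub>Q\<^esub> \<iota> j"] assms(2) by (simp add: fp.m_lcomm)
qed auto

lemma frac_inverse_eq:
  "frac_inverse R (\<iota> ` J) = {x \<in> carrier Q. \<forall>j\<in>J. x \<otimes>\<^bsub>Q\<^esub> \<iota> j \<in> \<iota> ` carrier R}"
  by (auto simp: frac_inverse_def)

text \<open>The dictionary between finitely generated ideals in \<open>rGV\<close> and finite
  \<open>GV\<close> sets.\<close>

lemma u_closure_eq:
  assumes Y: "fp.A_module Y"
  shows "u_closure R Y = fp.u_hull Y"
proof
  show "u_closure R Y \<subseteq> fp.u_hull Y"
  proof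
    fix x assume "x \<in> u_closure R Y"
    then obtain J where x: "x \<in> carrier Q" "J \<in> rGV R" "\<And>j. j \<in> J \<Longrightarrow> x \<otimes>\<^bsub>Q\<^esub> \<iota> j \<in> Y"
      by (auto simp: u_closure_def)
    then obtain B s where J: "ideal J R" "B \<subseteq> carrier R" "finite B" "J = Idl B" "s \<in> J" "s \<in> regular_elements R"
      "frac_inverse R (\<iota> ` J) = \<iota> ` carrier R" by (auto simp: rGV_def)
    have BJ: "insert s B \<subseteq> J" using J genideal_self[OF J(2)] by auto
    have Jc: "J \<subseteq> carrier R" using ideal_carrier[OF J(1)] .
    \<comment> \<open>The given generators need not include a regular element, so the regular s of
      the ideal is adjoined.\<close>
    have "fp.GV (\<iota> ` insert s B)"
      unfolding fp.GV_def
    proof (intro conjI ballI impI)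
      show "finite (\<iota> ` insert s B)" using J by simp
      show "\<iota> ` insert s B \<subseteq> \<iota> ` carrier R" using BJ Jc by blast
      have "\<iota> s \<in> Units Q" using J regular_closed iota_Units by blast
      then show "\<iota> ` insert s B \<inter> Units Q \<noteq> {}" by blast
      fix y assume y: "y \<in> carrier Q" "\<forall>f\<in>\<iota> ` insert s B. y \<otimes>\<^bsub>Q\<^esub> f \<in> \<iota> ` carrier R"
      have "Idl B \<subseteq> {j \<in> carrier R. y \<otimes>\<^bsub>Q\<^esub> \<iota> j \<in> \<iota> ` carrier R}"
        by (rule genideal_minimal[OF colon_ideal[OF fp.A_module_A y(1)]]) (use y(2) J(2) in auto)
      then have "y \<in> frac_inverse R (\<iota> ` J)" using y(1) J(4) by (auto simp: frac_inverse_eq)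
      then show "y \<in> \<iota> ` carrier R" using J(7) by simp
    qed
    then show "x \<in> fp.u_hull Y" using x BJ by (intro fp.u_hullI[OF x(1)]) auto
  qed
  show "fp.u_hull Y \<subseteq> u_closure R Y"
  proof
    fix x assume xu: "x \<in> fp.u_hull Y"
    have x: "x \<in> carrier Q" using fp.u_hull_carrier[OF xu] .
    obtain F where F: "fp.GV F" "\<forall>f\<in>F. x \<otimes>\<^bsub>Q\<^esub> f \<in> Y" using xu by (rule fp.uclE)
    define B where "B = {b \<in> carrier R. \<iota> b \<in> F}"
    have FB: "F = \<iota> ` B" using fp.GV_carrier[OF F(1)] by (auto simp: B_def)
    have Bc: "B \<subseteq> carrier R" by (auto simp: B_def)
    have "finite F" using F(1) by (simp add: fp.GV_def)
    then have finB: "finite B" using FB Bc tq_embed_inj finite_imageD inj_on_subset by blast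
    let ?J = "Idl B"
    have J: "ideal ?J R" by (rule genideal_ideal[OF Bc])
    have BJ: "B \<subseteq> ?J" by (rule genideal_self[OF Bc])
    have inv: "frac_inverse R (\<iota> ` ?J) = \<iota> ` carrier R"
    proof
      show "frac_inverse R (\<iota> ` ?J) \<subseteq> \<iota> ` carrier R"
      proof
        fix y assume "y \<in> frac_inverse R (\<iota> ` ?J)"
        then have y: "y \<in> carrier Q" "\<forall>j\<in>?J. y \<otimes>\<^bsub>Q\<^esub> \<iota> j \<in> \<iota> ` carrier R" by (auto simp: frac_inverse_eq)
        show "y \<in> \<iota> ` carrier R" by (rule fp.GV_D[OF F(1) y(1)]) (use y(2) FB BJ in blast)
      qed
      show "\<iota> ` carrier R \<subseteq> frac_inverse R (\<iota> ` ?J)"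
        using fp.A_mult ideal_carrier[OF J] by (auto simp: frac_inverse_eq simp del: iota_simps(3))
    qed
    obtain f where f: "f \<in> F" "f \<in> Units Q" using fp.GV_unit[OF F(1)] by blast
    then obtain b where b: "b \<in> B" "\<iota> b \<in> Units Q" using FB by blast
    then have "b \<in> ?J \<inter> regular_elements R" using BJ Bc iota_Units by blast
    then have "?J \<in> rGV R" using J Bc finB inv by (auto simp: rGV_def)
    moreover have "?J \<subseteq> {j \<in> carrier R. x \<otimes>\<^bsub>Q\<^esub> \<iota> j \<in> Y}"
      by (rule genideal_minimal[OF colon_ideal[OF Y x]]) (use F(2) FB Bc in auto)
    ultimately show "x \<in> u_closure R Y" using x by (auto simp: u_closure_def)
  qed
qed

lemma finite_u_product_iff:
  "finite_u_product_of_primes R Y \<longleftrightarrow> (\<exists>Ps. (\<forall>P\<in>set Ps. fp.A_prime P) \<and> Y = fp.u_hull (fp.ideal_product Ps))"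
proof
  assume "finite_u_product_of_primes R Y"
  then obtain Ps where Ps: "\<forall>P\<in>set Ps. primeideal P R" "Y = u_closure R (\<iota> ` ideal_prod_list R Ps)"
    by (auto simp: finite_u_product_of_primes_def)
  let ?Ps = "map ((`) \<iota>) Ps"
  have a: "\<forall>P\<in>set ?Ps. fp.A_prime P" using Ps(1) A_prime_iota primeideal_carrier by auto
  have "\<iota> ` ideal_prod_list R Ps = fp.ideal_product ?Ps" by (rule ideal_product_iota) (use Ps(1) primeideal_carrier in blast)
  moreover have "fp.A_module (fp.ideal_product ?Ps)" by (rule fp.A_ideal_A_module[OF fp.A_ideal_ideal_product]) (use a fp.A_prime_A_ideal in blast)
  ultimately have "Y = fp.u_hull (fp.ideal_product ?Ps)" using Ps(2) u_closure_eq by simp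
  then show "\<exists>Ps. (\<forall>P\<in>set Ps. fp.A_prime P) \<and> Y = fp.u_hull (fp.ideal_product Ps)" using a by blast
next
  assume "\<exists>Ps. (\<forall>P\<in>set Ps. fp.A_prime P) \<and> Y = fp.u_hull (fp.ideal_product Ps)"
  then obtain Ps where Ps: "\<forall>P\<in>set Ps. fp.A_prime P" "Y = fp.u_hull (fp.ideal_product Ps)" by blast
  have "\<forall>P\<in>set Ps. \<exists>P'. primeideal P' R \<and> P = \<iota> ` P'" using Ps(1) A_prime_preimage by metis
  from bchoice[OF this] obtain g where g: "\<forall>P\<in>set Ps. primeideal (g P) R \<and> P = \<iota> ` g P" ..
  have eq: "map ((`) \<iota>) (map g Ps) = Ps" using g by (simp add: map_idI)
  have p: "\<forall>P\<in>set (map g Ps). primeideal P R" using g by simp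
  have "\<iota> ` ideal_prod_list R (map g Ps) = fp.ideal_product (map ((`) \<iota>) (map g Ps))"
    by (rule ideal_product_iota) (use p primeideal_carrier in blast)
  then have e: "\<iota> ` ideal_prod_list R (map g Ps) = fp.ideal_product Ps" unfolding eq .
  have "fp.A_module (fp.ideal_product Ps)" by (rule fp.A_ideal_A_module[OF fp.A_ideal_ideal_product]) (use Ps(1) fp.A_prime_A_ideal in blast)
  then have "Y = u_closure R (\<iota> ` ideal_prod_list R (map g Ps))" unfolding e using Ps(2) u_closure_eq by simp
  then show "finite_u_product_of_primes R Y" unfolding finite_u_product_of_primes_def using p by blast
qed

lemma cond2_iff:
  "(\<forall>a\<in>carrier R. finite_u_product_of_primes R (\<iota> ` (PIdl a))) \<longleftrightarrow>
   (\<forall>a\<in>\<iota> ` carrier R. \<exists>Ps. (\<forall>P\<in>set Ps. fp.A_prime P) \<and> fp.principal a = fp.u_hull (fp.ideal_product Ps))"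
  by (simp add: principal_iota finite_u_product_iff)

lemma cond3_iff:
  "(\<forall>a\<in>carrier R. finite_u_product_of_primes R (u_closure R (\<iota> ` (PIdl a)))) \<longleftrightarrow> fp.principal_u_factorization"
proof -
  have "u_closure R (\<iota> ` (PIdl a)) = fp.u_hull (fp.principal (\<iota> a))" if "a \<in> carrier R" for a
    using that by (simp add: principal_iota u_closure_eq fp.A_module_principal)
  then show ?thesis by (simp add: fp.principal_u_factorization_def finite_u_product_iff)
qed

lemma cond4_iff:
  "(\<forall>I. integral_u_ideal R I \<longrightarrow> finite_u_product_of_primes R (\<iota> ` I)) \<longleftrightarrow>
   (\<forall>I. fp.A_ideal I \<and> fp.u_hull I = I \<longrightarrow> (\<exists>Ps. (\<forall>P\<in>set Ps. fp.A_prime P) \<and> I = fp.u_hull (fp.ideal_product Ps)))"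
proof -
  have i: "integral_u_ideal R I \<longleftrightarrow> ideal I R \<and> fp.u_hull (\<iota> ` I) = \<iota> ` I" for I
  proof (cases "ideal I R")
    case True
    then have "fp.A_module (\<iota> ` I)" using A_ideal_iota[OF ideal_carrier] fp.A_ideal_A_module by blast
    then show ?thesis by (simp add: integral_u_ideal_def u_closure_eq)
  qed (simp add: integral_u_ideal_def)
  have a: "fp.A_ideal (\<iota> ` I)" if "ideal I R" for I using that A_ideal_iota[OF ideal_carrier[OF that]] by simp
  show ?thesis unfolding i finite_u_product_iff
  proof (intro iffI allI impI)
    fix J assume h: "\<forall>I. ideal I R \<and> fp.u_hull (\<iota> ` I) = \<iota> ` I \<longrightarrow>
      (\<exists>Ps. (\<forall>P\<in>set Ps. fp.A_prime P) \<and> \<iota> ` I = fp.u_hull (fp.ideal_product Ps))" and J: "fp.A_ideal J \<and> fp.u_hull J = J"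
    obtain I where "ideal I R" "J = \<iota> ` I" using A_ideal_preimage[OF conjunct1[OF J]] .
    then show "\<exists>Ps. (\<forall>P\<in>set Ps. fp.A_prime P) \<and> J = fp.u_hull (fp.ideal_product Ps)" using h J by simp
  next
    fix I assume h: "\<forall>I. fp.A_ideal I \<and> fp.u_hull I = I \<longrightarrow> (\<exists>Ps. (\<forall>P\<in>set Ps. fp.A_prime P) \<and> I = fp.u_hull (fp.ideal_product Ps))"
      and I: "ideal I R \<and> fp.u_hull (\<iota> ` I) = \<iota> ` I"
    show "\<exists>Ps. (\<forall>P\<in>set Ps. fp.A_prime P) \<and> \<iota> ` I = fp.u_hull (fp.ideal_product Ps)"
      by (rule mp[OF spec[OF h]]) (use a I in simp)
  qed
qed

lemma krull_iff: "krull_ring R \<longleftrightarrow> fp.krull"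
proof
  let ?A = "\<iota> ` carrier R"
  assume "krull_ring R"
  then obtain F where F0: "\<forall>(V, P)\<in>F. rank_one_DVR Q V P"
    "?A = {x \<in> carrier Q. \<forall>(V, P)\<in>F. x \<in> V}"
    "\<forall>a\<in>regular_elements R. finite {(V, P) \<in> F. (\<lambda>x. \<iota> a \<otimes>\<^bsub>Q\<^esub> x) ` V \<noteq> V}"
    "\<forall>(V, P)\<in>F. P \<inter> \<iota> ` regular_elements R \<noteq> {}"
    unfolding krull_ring_def by (elim conjE exE)
  have F: "\<forall>z\<in>F. rank_one_DVR Q (fst z) (snd z)"
    "?A = {x \<in> carrier Q. \<forall>z\<in>F. x \<in> fst z}"
    "\<And>a. a \<in> regular_elements R \<Longrightarrow> finite {z \<in> F. (\<lambda>x. \<iota> a \<otimes>\<^bsub>Q\<^esub> x) ` fst z \<noteq> fst z}"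
    "\<forall>z\<in>F. snd z \<inter> \<iota> ` regular_elements R \<noteq> {}"
    using F0 by (simp_all only: case_prod_unfold prod.collapse)
  have "\<forall>z\<in>F. \<exists>v. rank_one_discrete_valuation Q v \<and>
    fst z = {x \<in> carrier Q. v x \<ge> 0} \<and> snd z = {x \<in> carrier Q. v x > 0}"
    using F(1) by (auto simp: rank_one_DVR_def)
  from bchoice[OF this] obtain v where "\<forall>z\<in>F. rank_one_discrete_valuation Q (v z) \<and>
    fst z = {x \<in> carrier Q. v z x \<ge> 0} \<and> snd z = {x \<in> carrier Q. v z x > 0}" ..
  then have v: "\<And>z. z \<in> F \<Longrightarrow> rank_one_discrete_valuation Q (v z)"
    "\<And>z. z \<in> F \<Longrightarrow> fst z = {x \<in> carrier Q. v z x \<ge> 0}"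
    "\<And>z. z \<in> F \<Longrightarrow> snd z = {x \<in> carrier Q. v z x > 0}" by blast+
  have "fp.krull_family (v ` F)"
    unfolding fp.krull_family_def
  proof (intro conjI ballI)
    fix w assume "w \<in> v ` F"
    then obtain z where z: "z \<in> F" "w = v z" by blast
    show "rank_one_discrete_valuation Q w" using v z by simp
    obtain a where a: "a \<in> regular_elements R" "\<iota> a \<in> snd z" using F(4) z by blast
    then have "\<iota> a \<in> ?A \<inter> Units Q" "0 < w (\<iota> a)" using iota_Units regular_closed v(3)[OF z(1)] z by auto
    then show "\<exists>a\<in>?A \<inter> Units Q. 0 < w a" by blast
  next
    fix x assume "x \<in> carrier Q"
    then show "(\<forall>w\<in>v ` F. 0 \<le> w x) \<longleftrightarrow> x \<in> ?A" unfolding F(2) using v(2) by auto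
  next
    fix a assume "a \<in> ?A \<inter> Units Q"
    then obtain r where r: "r \<in> carrier R" "r \<in> regular_elements R" "a = \<iota> r" using iota_Units by blast
    have "{w \<in> v ` F. w a \<noteq> 0} \<subseteq> v ` {z \<in> F. (\<lambda>x. \<iota> r \<otimes>\<^bsub>Q\<^esub> x) ` fst z \<noteq> fst z}"
    proof
      fix w assume "w \<in> {w \<in> v ` F. w a \<noteq> 0}"
      then obtain z where z: "z \<in> F" "w = v z" "v z a \<noteq> 0" by blast
      \<comment> \<open>If a V = V, then 1 = a x with x in V, so the values of a and of x are
        nonnegative with sum 0.\<close>
      have "(\<lambda>x. \<iota> r \<otimes>\<^bsub>Q\<^esub> x) ` fst z \<noteq> fst z"
      proof
        assume eq: "(\<lambda>x. \<iota> r \<otimes>\<^bsub>Q\<^esub> x) ` fst z = fst z"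
        note val = v(1)[OF z(1)]
        have "\<one>\<^bsub>Q\<^esub> \<in> fst z" using v(2)[OF z(1)] fp.valuation_one[OF val] by simp
        then obtain x where x: "x \<in> fst z" "\<one>\<^bsub>Q\<^esub> = \<iota> r \<otimes>\<^bsub>Q\<^esub> x" using eq by blast
        then have xc: "x \<in> carrier Q" "0 \<le> v z x" using v(2)[OF z(1)] by auto
        have "\<iota> r \<in> fst z" using F(2) r z(1) by blast
        then have "0 \<le> v z (\<iota> r)" using v(2)[OF z(1)] by simp
        moreover have "v z (\<iota> r) + v z x = 0"
          using fp.valuation_mult[OF val, of "\<iota> r" x] x xc r fp.valuation_one[OF val] by simp
        ultimately have "v z (\<iota> r) = 0" using xc(2) by (cases "v z (\<iota> r)"; cases "v z x") (auto simp: zero_extended_def)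
        then show False using z r by simp
      qed
      then show "w \<in> v ` {z \<in> F. (\<lambda>x. \<iota> r \<otimes>\<^bsub>Q\<^esub> x) ` fst z \<noteq> fst z}" using z by blast
    qed
    then show "finite {w \<in> v ` F. w a \<noteq> 0}" by (rule finite_surj[OF F(3)[OF r(2)]])
  qed
  then show fp.krull unfolding fp.krull_def by blast
next
  let ?A = "\<iota> ` carrier R"
  assume fp.krull
  then obtain W where W: "fp.krull_family W" by (auto simp: fp.krull_def)
  note Wd = fp.krull_familyD[OF W]
  let ?V = "\<lambda>v. {x \<in> carrier Q. (0::int extended) \<le> v x}" and ?P = "\<lambda>v. {x \<in> carrier Q. (0::int extended) < v x}"
  let ?F = "(\<lambda>v. (?V v, ?P v)) ` W"
  have F1: "\<forall>(V, P)\<in>?F. rank_one_DVR Q V P" using Wd(1) by (auto simp: rank_one_DVR_def)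
  have F2: "?A = {x \<in> carrier Q. \<forall>(V, P)\<in>?F. x \<in> V}"
    using Wd(2,3) by auto
  have F3: "finite {(V, P) \<in> ?F. (\<lambda>x. \<iota> a \<otimes>\<^bsub>Q\<^esub> x) ` V \<noteq> V}" if a: "a \<in> regular_elements R" for a
  proof -
    have ac: "a \<in> carrier R" "\<iota> a \<in> Units Q" using a regular_closed iota_Units by auto
    \<comment> \<open>If v(a) = 0, the inverse of a has value 0 too, so multiplication by a permutes
      V.\<close>
    have "(\<lambda>x. \<iota> a \<otimes>\<^bsub>Q\<^esub> x) ` ?V v = ?V v" if v: "v \<in> W" "v (\<iota> a) = 0" for v
    proof
      note val = Wd(1)[OF v(1)]
      show "(\<lambda>x. \<iota> a \<otimes>\<^bsub>Q\<^esub> x) ` ?V v \<subseteq> ?V v"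
        using fp.valuation_mult[OF val, of "\<iota> a"] ac v(2) by auto
      show "?V v \<subseteq> (\<lambda>x. \<iota> a \<otimes>\<^bsub>Q\<^esub> x) ` ?V v"
      proof
        fix x assume x: "x \<in> ?V v"
        obtain n where n: "v (\<iota> a) = Fin n" "v (inv\<^bsub>Q\<^esub> \<iota> a) = Fin (- n)" using fp.valuation_unit[OF val ac(2)] .
        have "v (inv\<^bsub>Q\<^esub> \<iota> a) = 0" using n v(2) by (simp add: zero_extended_def)
        then have "inv\<^bsub>Q\<^esub> \<iota> a \<otimes>\<^bsub>Q\<^esub> x \<in> ?V v" using fp.valuation_mult[OF val, of "inv\<^bsub>Q\<^esub> \<iota> a" x] x ac by simp
        moreover have "x = \<iota> a \<otimes>\<^bsub>Q\<^esub> (inv\<^bsub>Q\<^esub> \<iota> a \<otimes>\<^bsub>Q\<^esub> x)" using fp.unit_cancel(2)[OF ac(2)] x by simp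
        ultimately show "x \<in> (\<lambda>x. \<iota> a \<otimes>\<^bsub>Q\<^esub> x) ` ?V v" by blast
      qed
    qed
    then have "{(V, P) \<in> ?F. (\<lambda>x. \<iota> a \<otimes>\<^bsub>Q\<^esub> x) ` V \<noteq> V} \<subseteq> (\<lambda>v. (?V v, ?P v)) ` {v \<in> W. v (\<iota> a) \<noteq> 0}" by blast
    moreover have "finite {v \<in> W. v (\<iota> a) \<noteq> 0}" using Wd(4)[of "\<iota> a"] ac by simp
    ultimately show ?thesis by (rule finite_surj[rotated])
  qed
  have F4: "P \<inter> \<iota> ` regular_elements R \<noteq> {}" if VP: "(V, P) \<in> ?F" for V P
  proof -
    obtain v where v: "v \<in> W" "P = ?P v" using VP by blast
    then obtain x where x: "x \<in> ?A" "x \<in> Units Q" "0 < v x" using W unfolding fp.krull_family_def by blast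
    then obtain r where "r \<in> carrier R" "x = \<iota> r" by blast
    then have "x \<in> \<iota> ` regular_elements R" using iota_Units x by blast
    then show ?thesis using x v fp.A_carrier[OF x(1)] by blast
  qed
  show "krull_ring R"
    unfolding krull_ring_def
  proof (intro conjI exI[of _ ?F])
    show "\<forall>a\<in>regular_elements R. finite {(V, P) \<in> ?F. (\<lambda>x. \<iota> a \<otimes>\<^bsub>Q\<^esub> x) ` V \<noteq> V}"
      by (rule ballI) (rule F3)
    show "\<forall>(V, P)\<in>?F. P \<inter> \<iota> ` regular_elements R \<noteq> {}" using F4 by (auto simp only: split: prod.split)
  qed (fact is_cring one_neq_zero F1 F2)+
qed

lemma cond5_iff:
  "(\<forall>P. minimal_prime R P \<longrightarrow> principalideal P R) \<longleftrightarrow> (\<forall>P. fp.min_prime P \<longrightarrow> (\<exists>p\<in>\<iota> ` carrier R. P = fp.principal p))"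
proof -
  have m: "fp.min_prime (\<iota> ` P) \<longleftrightarrow> minimal_prime R P" if P: "P \<subseteq> carrier R" for P
  proof
    assume h: "fp.min_prime (\<iota> ` P)"
    show "minimal_prime R P" unfolding minimal_prime_def
    proof (intro conjI allI impI)
      show "primeideal P R" using h A_prime_iota[OF P] by (simp add: fp.min_prime_def)
      fix P' assume P': "primeideal P' R \<and> P' \<subseteq> P"
      then have "fp.A_prime (\<iota> ` P')" "\<iota> ` P' \<subseteq> \<iota> ` P" using A_prime_iota primeideal_carrier by blast+
      then have "\<iota> ` P' = \<iota> ` P" using h by (simp add: fp.min_prime_def)
      then show "P' = P" using inj_on_image_eq_iff[OF tq_embed_inj, of P' P] P P' by blast
    qed
  next
    assume h: "minimal_prime R P"
    show "fp.min_prime (\<iota> ` P)" unfolding fp.min_prime_def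
    proof (intro conjI allI impI)
      show "fp.A_prime (\<iota> ` P)" using h A_prime_iota[OF P] by (simp add: minimal_prime_def)
      fix J assume J: "fp.A_prime J \<and> J \<subseteq> \<iota> ` P"
      then obtain P' where P': "primeideal P' R" "J = \<iota> ` P'" using A_prime_preimage by blast
      have "P' \<subseteq> P" using J P' iota_mem[OF P] primeideal_carrier[OF P'(1)] by blast
      then have "P' = P" using h P'(1) unfolding minimal_prime_def by blast
      then show "J = \<iota> ` P" using P'(2) by simp
    qed
  qed
  have p: "principalideal P R \<longleftrightarrow> (\<exists>p\<in>\<iota> ` carrier R. \<iota> ` P = fp.principal p)" if P: "P \<subseteq> carrier R" for P
  proof
    assume "principalideal P R"
    then obtain i where i: "i \<in> carrier R" "P = Idl {i}" using principalideal.generate by blast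
    then have "\<iota> ` P = fp.principal (\<iota> i)" using cgenideal_eq_genideal[OF i(1)] principal_iota[OF i(1)] by simp
    then show "\<exists>p\<in>\<iota> ` carrier R. \<iota> ` P = fp.principal p" using i by blast
  next
    assume "\<exists>p\<in>\<iota> ` carrier R. \<iota> ` P = fp.principal p"
    then obtain i where i: "i \<in> carrier R" "\<iota> ` P = fp.principal (\<iota> i)" by blast
    have i2: "\<iota> ` P = \<iota> ` (PIdl i)" unfolding principal_iota[OF i(1)] by (rule i(2))
    have "PIdl i \<subseteq> carrier R" using cgenideal_ideal[OF i(1)] ideal_carrier by blast
    from inj_on_image_eq_iff[OF tq_embed_inj P this] have "P = PIdl i" using i2 by blast
    then show "principalideal P R" using cgenideal_is_principalideal[OF i(1)] by simp
  qed
  have mc: "minimal_prime R P \<Longrightarrow> P \<subseteq> carrier R" for P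
    using primeideal_carrier by (simp add: minimal_prime_def)
  show ?thesis
  proof
    assume h: "\<forall>P. minimal_prime R P \<longrightarrow> principalideal P R"
    show "\<forall>P. fp.min_prime P \<longrightarrow> (\<exists>p\<in>\<iota> ` carrier R. P = fp.principal p)"
    proof (intro allI impI)
      fix J assume J: "fp.min_prime J"
      then have "fp.A_prime J" by (simp add: fp.min_prime_def)
      then obtain P where P: "primeideal P R" "J = \<iota> ` P" using A_prime_preimage by blast
      note c = primeideal_carrier[OF P(1)]
      have "minimal_prime R P" using J unfolding P(2) m[OF c] .
      then have "principalideal P R" using h by blast
      then show "\<exists>p\<in>\<iota> ` carrier R. J = fp.principal p" unfolding P(2) p[OF c] .
    qed
  next
    assume h: "\<forall>P. fp.min_prime P \<longrightarrow> (\<exists>p\<in>\<iota> ` carrier R. P = fp.principal p)"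
    show "\<forall>P. minimal_prime R P \<longrightarrow> principalideal P R"
    proof (intro allI impI)
      fix P assume P: "minimal_prime R P"
      then have "fp.min_prime (\<iota> ` P)" unfolding m[OF mc[OF P]] .
      then have "\<exists>p\<in>\<iota> ` carrier R. \<iota> ` P = fp.principal p" using h by blast
      then show "principalideal P R" unfolding p[OF mc[OF P]] .
    qed
  qed
qed

lemma foldr_iota:
  "set ps \<subseteq> carrier R \<Longrightarrow> foldr (\<lambda>x y. x \<otimes> y) ps \<one> \<in> carrier R \<and>
     \<iota> (foldr (\<lambda>x y. x \<otimes> y) ps \<one>) = foldr (\<otimes>\<^bsub>Q\<^esub>) (map \<iota> ps) \<one>\<^bsub>Q\<^esub>"
  by (induct ps) auto

lemma cond6_iff:
  "(\<exists>ps. (\<forall>p \<in> set ps. prime_element R p) \<and> \<zero> = foldr (\<lambda>x y. x \<otimes> y) ps \<one>) \<longleftrightarrow>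
   (\<exists>ps. set ps \<subseteq> \<iota> ` carrier R \<and> (\<forall>p\<in>set ps. fp.A_prime (fp.principal p)) \<and> foldr (\<otimes>\<^bsub>Q\<^esub>) ps \<one>\<^bsub>Q\<^esub> = \<zero>\<^bsub>Q\<^esub>)"
proof -
  have pe: "prime_element R p \<longleftrightarrow> fp.A_prime (fp.principal (\<iota> p))" if "p \<in> carrier R" for p
    using that A_prime_iota[OF ideal_carrier[OF cgenideal_ideal[OF that]]] principal_iota[OF that]
    by (simp add: prime_element_def)
  show ?thesis
  proof
    assume "\<exists>ps. (\<forall>p \<in> set ps. prime_element R p) \<and> \<zero> = foldr (\<lambda>x y. x \<otimes> y) ps \<one>"
    then obtain ps where ps: "\<forall>p \<in> set ps. prime_element R p" "\<zero> = foldr (\<lambda>x y. x \<otimes> y) ps \<one>" by blast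
    have c: "set ps \<subseteq> carrier R" using ps(1) by (auto simp: prime_element_def)
    show "\<exists>ps. set ps \<subseteq> \<iota> ` carrier R \<and> (\<forall>p\<in>set ps. fp.A_prime (fp.principal p)) \<and> foldr (\<otimes>\<^bsub>Q\<^esub>) ps \<one>\<^bsub>Q\<^esub> = \<zero>\<^bsub>Q\<^esub>"
    proof (intro exI[of _ "map \<iota> ps"] conjI)
      show "set (map \<iota> ps) \<subseteq> \<iota> ` carrier R" using c by auto
      show "\<forall>p\<in>set (map \<iota> ps). fp.A_prime (fp.principal p)" using ps(1) pe c by auto
      show "foldr (\<otimes>\<^bsub>Q\<^esub>) (map \<iota> ps) \<one>\<^bsub>Q\<^esub> = \<zero>\<^bsub>Q\<^esub>" using foldr_iota[OF c] ps(2) iota_zero by metis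
    qed
  next
    assume "\<exists>ps. set ps \<subseteq> \<iota> ` carrier R \<and> (\<forall>p\<in>set ps. fp.A_prime (fp.principal p)) \<and> foldr (\<otimes>\<^bsub>Q\<^esub>) ps \<one>\<^bsub>Q\<^esub> = \<zero>\<^bsub>Q\<^esub>"
    then obtain qs where qs: "set qs \<subseteq> \<iota> ` carrier R" "\<forall>p\<in>set qs. fp.A_prime (fp.principal p)" "foldr (\<otimes>\<^bsub>Q\<^esub>) qs \<one>\<^bsub>Q\<^esub> = \<zero>\<^bsub>Q\<^esub>" by blast
    have "\<exists>ps. set ps \<subseteq> carrier R \<and> qs = map \<iota> ps" using qs(1)
    proof (induct qs)
      case (Cons q qs)
      then obtain ps r where "set ps \<subseteq> carrier R" "qs = map \<iota> ps" "r \<in> carrier R" "q = \<iota> r" by auto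
      then show ?case by (intro exI[of _ "r # ps"]) auto
    qed simp
    then obtain ps where ps: "set ps \<subseteq> carrier R" "qs = map \<iota> ps" by blast
    show "\<exists>ps. (\<forall>p \<in> set ps. prime_element R p) \<and> \<zero> = foldr (\<lambda>x y. x \<otimes> y) ps \<one>"
    proof (intro exI[of _ ps] conjI)
      show "\<forall>p\<in>set ps. prime_element R p" using ps qs(2) pe by auto
      have "\<iota> \<zero> = \<iota> (foldr (\<lambda>x y. x \<otimes> y) ps \<one>)" using foldr_iota[OF ps(1)] qs(3) ps(2) by simp
      then show "\<zero> = foldr (\<lambda>x y. x \<otimes> y) ps \<one>" using foldr_iota[OF ps(1)] iota_eq[OF zero_closed] by blast
    qed
  qed
qed

lemma zero_dimensional_iff_regular:
  "fp.zero_dimensional \<longleftrightarrow> (\<forall>P P'. primeideal P R \<and> primeideal P' R \<and> P \<subseteq> P' \<and> P' \<inter> regular_elements R = {} \<longrightarrow> P = P')"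
proof -
  have n: "\<iota> ` P \<inter> Units Q = {} \<longleftrightarrow> P \<inter> regular_elements R = {}" if "P \<subseteq> carrier R" for P
    using that iota_Units by blast
  show ?thesis
  proof
    assume D: fp.zero_dimensional
    show "\<forall>P P'. primeideal P R \<and> primeideal P' R \<and> P \<subseteq> P' \<and> P' \<inter> regular_elements R = {} \<longrightarrow> P = P'"
    proof (intro allI impI)
      fix P P' assume h: "primeideal P R \<and> primeideal P' R \<and> P \<subseteq> P' \<and> P' \<inter> regular_elements R = {}"
      then have c: "P \<subseteq> carrier R" "P' \<subseteq> carrier R" using primeideal_carrier by auto
      have a: "fp.A_prime (\<iota> ` P)" "fp.A_prime (\<iota> ` P')" unfolding A_prime_iota[OF c(1)] A_prime_iota[OF c(2)] using h by simp_all
      have b: "\<iota> ` P \<subseteq> \<iota> ` P'" using h by blast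
      have "\<iota> ` P' \<inter> Units Q = {}" unfolding n[OF c(2)] using h by simp
      from fp.zero_dimensionalD[OF D a b this] have "\<iota> ` P = \<iota> ` P'" .
      then show "P = P'" using inj_on_image_eq_iff[OF tq_embed_inj c] by blast
    qed
  next
    assume D: "\<forall>P P'. primeideal P R \<and> primeideal P' R \<and> P \<subseteq> P' \<and> P' \<inter> regular_elements R = {} \<longrightarrow> P = P'"
    show fp.zero_dimensional unfolding fp.zero_dimensional_def
    proof (intro allI impI)
      fix J J' assume h: "fp.A_prime J \<and> fp.A_prime J' \<and> J \<subseteq> J' \<and> J' \<inter> Units Q = {}"
      then obtain P where P: "primeideal P R" "J = \<iota> ` P" using A_prime_preimage by blast
      obtain P' where P': "primeideal P' R" "J' = \<iota> ` P'" using A_prime_preimage h by blast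
      note c = primeideal_carrier[OF P(1)] primeideal_carrier[OF P'(1)]
      have "P \<subseteq> P'"
      proof
        fix x assume x: "x \<in> P"
        then have "\<iota> x \<in> \<iota> ` P'" using h P P' by blast
        then show "x \<in> P'" using iota_mem[OF c(2)] c(1) x by blast
      qed
      moreover have "P' \<inter> regular_elements R = {}" unfolding n[OF c(2), symmetric] using h P' by simp
      ultimately have "P = P'" using D P(1) P'(1) by simp
      then show "J = J'" using P P' by simp
    qed
  qed
qed

lemma prime_no_units:
  assumes "primeideal N Q" shows "N \<inter> Units Q = {}"
proof -
  have N: "ideal N Q" "\<one>\<^bsub>Q\<^esub> \<notin> N" using assms by (simp_all add: fp.primeideal_iff)
  have False if "u \<in> N" "u \<in> Units Q" for u
  proof -
    have "inv\<^bsub>Q\<^esub> u \<otimes>\<^bsub>Q\<^esub> u \<in> N" using N(1)[unfolded fp.ideal_iff] that fp.Units_inv_closed by blast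
    then show False using N(2) that by simp
  qed
  then show ?thesis by blast
qed

lemma contract_prime:
  assumes "primeideal N Q"
  shows "fp.A_prime (N \<inter> \<iota> ` carrier R)"
  using assms fp.A_add fp.A_mult fp.A_zero fp.A_carrier unfolding fp.primeideal_iff fp.ideal_iff fp.A_prime_def fp.A_ideal_def fp.A_module_def
  by (auto simp del: iota_simps(3,4))

text \<open>The localization of a nonregular prime at the regular elements: fractions with a
  numerator in it.\<close>

lemma extend_prime:
  assumes P: "fp.A_prime P" "P \<inter> Units Q = {}"
  defines "N \<equiv> {x \<in> carrier Q. \<exists>s\<in>\<iota> ` carrier R \<inter> Units Q. s \<otimes>\<^bsub>Q\<^esub> x \<in> P}"
  shows "primeideal N Q" "N \<inter> \<iota> ` carrier R = P"
proof -
  note m = fp.A_moduleD[OF fp.A_prime_A_module[OF P(1)]]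
  let ?A = "\<iota> ` carrier R"
  let ?U = "?A \<inter> Units Q"
  have U: "s \<otimes>\<^bsub>Q\<^esub> t \<in> ?U" if "s \<in> ?U" "t \<in> ?U" for s t using that fp.A_mult by blast
  have NI: "x \<in> N" if "x \<in> carrier Q" "s \<in> ?U" "s \<otimes>\<^bsub>Q\<^esub> x \<in> P" for x s using that by (auto simp: N_def)
  show c: "N \<inter> ?A = P"
  proof
    show "N \<inter> ?A \<subseteq> P"
    proof
      fix x assume "x \<in> N \<inter> ?A"
      then obtain s where s: "x \<in> ?A" "s \<in> ?A" "s \<in> Units Q" "s \<otimes>\<^bsub>Q\<^esub> x \<in> P" by (auto simp: N_def)
      then show "x \<in> P" using fp.A_prime_mem[OF P(1) s(4,2,1)] P(2) by blast
    qed
    have "\<one>\<^bsub>Q\<^esub> \<in> ?U" using fp.A_one by simp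
    then show "P \<subseteq> N \<inter> ?A" using NI[of _ "\<one>\<^bsub>Q\<^esub>"] m(1) fp.A_prime_A[OF P(1)] by auto
  qed
  show "primeideal N Q"
    unfolding fp.primeideal_iff fp.ideal_iff
  proof (intro conjI ballI impI)
    show "N \<subseteq> carrier Q" by (auto simp: N_def)
    show "\<zero>\<^bsub>Q\<^esub> \<in> N" using c m(2) by blast
    show "\<one>\<^bsub>Q\<^esub> \<notin> N" using c fp.A_prime_one[OF P(1)] fp.A_one by blast
    fix x y assume "x \<in> N" "y \<in> N"
    then obtain s t where h: "x \<in> carrier Q" "y \<in> carrier Q" "s \<in> ?U" "s \<otimes>\<^bsub>Q\<^esub> x \<in> P" "t \<in> ?U" "t \<otimes>\<^bsub>Q\<^esub> y \<in> P"
      by (auto simp: N_def)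
    have st: "s \<in> ?A" "t \<in> ?A" "s \<in> carrier Q" "t \<in> carrier Q" using h by auto
    have "(s \<otimes>\<^bsub>Q\<^esub> t) \<otimes>\<^bsub>Q\<^esub> (x \<oplus>\<^bsub>Q\<^esub> y) = t \<otimes>\<^bsub>Q\<^esub> (s \<otimes>\<^bsub>Q\<^esub> x) \<oplus>\<^bsub>Q\<^esub> s \<otimes>\<^bsub>Q\<^esub> (t \<otimes>\<^bsub>Q\<^esub> y)"
      using st(3,4) h(1,2) by (simp add: fp.r_distr fp.m_ac)
    also have "\<dots> \<in> P" using m(3)[OF m(4)[OF st(2) h(4)] m(4)[OF st(1) h(6)]] .
    finally show "x \<oplus>\<^bsub>Q\<^esub> y \<in> N" using NI[OF _ U[OF h(3,5)]] h(1,2) by simp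
  next
    fix a x assume a: "a \<in> carrier Q" and "x \<in> N"
    then obtain s where h: "x \<in> carrier Q" "s \<in> ?U" "s \<otimes>\<^bsub>Q\<^esub> x \<in> P" by (auto simp: N_def)
    obtain t where t: "t \<in> ?U" "t \<otimes>\<^bsub>Q\<^esub> a \<in> ?A" using fp.frac[OF a] by blast
    have st: "s \<in> carrier Q" "t \<in> carrier Q" using h t by auto
    have "(s \<otimes>\<^bsub>Q\<^esub> t) \<otimes>\<^bsub>Q\<^esub> (a \<otimes>\<^bsub>Q\<^esub> x) = (t \<otimes>\<^bsub>Q\<^esub> a) \<otimes>\<^bsub>Q\<^esub> (s \<otimes>\<^bsub>Q\<^esub> x)"
      using st h(1) a by (simp add: fp.m_ac)
    then show "a \<otimes>\<^bsub>Q\<^esub> x \<in> N" using NI[OF _ U[OF h(2) t(1)]] m(4)[OF t(2) h(3)] a h(1) by simp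
  next
    fix x y assume xy: "x \<in> carrier Q" "y \<in> carrier Q" "x \<otimes>\<^bsub>Q\<^esub> y \<in> N"
    obtain s where s: "s \<in> ?U" "s \<otimes>\<^bsub>Q\<^esub> x \<in> ?A" using fp.frac[OF xy(1)] by blast
    obtain t where t: "t \<in> ?U" "t \<otimes>\<^bsub>Q\<^esub> y \<in> ?A" using fp.frac[OF xy(2)] by blast
    obtain r where r: "r \<in> ?U" "r \<otimes>\<^bsub>Q\<^esub> (x \<otimes>\<^bsub>Q\<^esub> y) \<in> P" using xy(3) by (auto simp: N_def)
    have cr: "s \<in> carrier Q" "t \<in> carrier Q" "r \<in> carrier Q" "s \<in> ?A" "t \<in> ?A" "r \<in> ?A" using s t r by auto
    have "r \<otimes>\<^bsub>Q\<^esub> ((s \<otimes>\<^bsub>Q\<^esub> x) \<otimes>\<^bsub>Q\<^esub> (t \<otimes>\<^bsub>Q\<^esub> y)) = (s \<otimes>\<^bsub>Q\<^esub> t) \<otimes>\<^bsub>Q\<^esub> (r \<otimes>\<^bsub>Q\<^esub> (x \<otimes>\<^bsub>Q\<^esub> y))"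
      using cr(1-3) xy(1,2) by (simp add: fp.m_ac)
    also have "\<dots> \<in> P" by (rule m(4)[OF fp.A_mult[OF cr(4,5)] r(2)])
    finally have "r \<in> P \<or> (s \<otimes>\<^bsub>Q\<^esub> x) \<otimes>\<^bsub>Q\<^esub> (t \<otimes>\<^bsub>Q\<^esub> y) \<in> P"
      by (rule fp.A_prime_mem[OF P(1) _ cr(6) fp.A_mult[OF s(2) t(2)]])
    then have "(s \<otimes>\<^bsub>Q\<^esub> x) \<otimes>\<^bsub>Q\<^esub> (t \<otimes>\<^bsub>Q\<^esub> y) \<in> P" using r(1) P(2) by blast
    then have "s \<otimes>\<^bsub>Q\<^esub> x \<in> P \<or> t \<otimes>\<^bsub>Q\<^esub> y \<in> P" by (rule fp.A_prime_mem[OF P(1) _ s(2) t(2)])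
    then show "x \<in> N \<or> y \<in> N" using NI[OF xy(1) s(1)] NI[OF xy(2) t(1)] by blast
  qed
qed

text \<open>A proper inclusion of nonregular primes extends to a chain of length one in
  \<open>Q\<close>, and primes of \<open>Q\<close> contract to nonregular primes.\<close>

lemma zero_dimensional_iff: "krull_dim Q = 0 \<longleftrightarrow> fp.zero_dimensional"
proof
  assume d: "krull_dim Q = 0"
  show fp.zero_dimensional unfolding fp.zero_dimensional_def
  proof (intro allI impI, rule ccontr)
    fix P P' assume h: "fp.A_prime P \<and> fp.A_prime P' \<and> P \<subseteq> P' \<and> P' \<inter> Units Q = {}" and ne: "P \<noteq> P'"
    then have n: "P \<inter> Units Q = {}" by blast
    let ?N = "\<lambda>P. {x \<in> carrier Q. \<exists>s\<in>\<iota> ` carrier R \<inter> Units Q. s \<otimes>\<^bsub>Q\<^esub> x \<in> P}"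
    have 1: "primeideal (?N P) Q" "?N P \<inter> \<iota> ` carrier R = P" using extend_prime[of P] h n by blast+
    have 2: "primeideal (?N P') Q" "?N P' \<inter> \<iota> ` carrier R = P'" using extend_prime[of P'] h by blast+
    have "?N P \<subseteq> ?N P'" using h by blast
    moreover have "?N P \<noteq> ?N P'" using 1(2) 2(2) ne by metis
    ultimately have lt: "?N P \<subset> ?N P'" by blast
    obtain N1 N2 where N: "primeideal N1 Q" "primeideal N2 Q" "N1 \<subset> N2" using that[OF 1(1) 2(1) lt] .
    let ?f = "\<lambda>i::nat. if i = 0 then N1 else N2"
    have "(\<forall>i\<le>1. primeideal (?f i) Q) \<and> (\<forall>i<1. ?f i \<subset> ?f (Suc i))" using N by simp
    then have ex: "\<exists>P. (\<forall>i\<le>1. primeideal (P i) Q) \<and> (\<forall>i<1::nat. P i \<subset> P (Suc i))" by (rule exI[of _ ?f])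
    have "enat 1 \<in> {enat n | n. \<exists>P. (\<forall>i \<le> n. primeideal (P i) Q) \<and> (\<forall>i < n. P i \<subset> P (Suc i))}"
      by (rule CollectI, rule exI[of _ "1::nat"], rule conjI[OF refl ex])
    then have "enat 1 \<le> krull_dim Q" unfolding krull_dim_def by (rule Sup_upper)
    then show False using d by (simp add: enat_0_iff)
  qed
next
  assume D: fp.zero_dimensional
  have "n = 0" if h: "\<forall>i \<le> n. primeideal (P i) Q" "\<forall>i < n. P i \<subset> P (Suc i)" for n and P :: "nat \<Rightarrow> ('a \<times> 'a) set set"
  proof (rule ccontr)
    assume "n \<noteq> 0"
    then have 0: "primeideal (P 0) Q" "primeideal (P 1) Q" "P 0 \<subset> P 1" using h by auto
    let ?A = "\<iota> ` carrier R"
    have "P 0 \<inter> ?A = P 1 \<inter> ?A"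
      by (rule fp.zero_dimensionalD[OF D contract_prime[OF 0(1)] contract_prime[OF 0(2)]]) (use 0(3) prime_no_units[OF 0(2)] in blast)+
    \<comment> \<open>A prime of Q is determined by its contraction, since every element of Q is a
      unit times an element of the ring.\<close>
    have "x \<in> P 0" if x: "x \<in> P 1" for x
    proof -
      have P1: "ideal (P 1) Q" "ideal (P 0) Q" using 0 by (simp_all add: fp.primeideal_iff)
      then have xc: "x \<in> carrier Q" using x by (auto simp: fp.ideal_iff)
      obtain s where s: "s \<in> ?A" "s \<in> Units Q" "s \<otimes>\<^bsub>Q\<^esub> x \<in> ?A" using fp.frac[OF xc] by blast
      have "s \<otimes>\<^bsub>Q\<^esub> x \<in> P 1" using P1(1) x s(2) by (simp add: fp.ideal_iff fp.Units_closed)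
      then have "s \<otimes>\<^bsub>Q\<^esub> x \<in> P 0" using \<open>P 0 \<inter> ?A = P 1 \<inter> ?A\<close> s(3) by blast
      then have "inv\<^bsub>Q\<^esub> s \<otimes>\<^bsub>Q\<^esub> (s \<otimes>\<^bsub>Q\<^esub> x) \<in> P 0" using P1(2) s(2) by (simp add: fp.ideal_iff)
      then show ?thesis using fp.unit_cancel(1)[OF s(2) xc] by simp
    qed
    then show False using 0(3) by blast
  qed
  then have "{enat n | n. \<exists>P. (\<forall>i \<le> n. primeideal (P i) Q) \<and> (\<forall>i < n. P i \<subset> P (Suc i))} \<subseteq> {0}"
    by (auto simp: enat_0_iff)
  then have "krull_dim Q \<le> 0" unfolding krull_dim_def by (intro Sup_least) auto
  then show "krull_dim Q = 0" by simp
qed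

end

section \<open>Krull rings described without the total quotient ring\<close>

text \<open>Being a Krull ring, expressed by the restrictions of the valuations to the ring itself.\<close>

definition krull_vals :: "('a, 'b) ring_scheme \<Rightarrow> ('a \<Rightarrow> int extended) set \<Rightarrow> bool" where
  "krull_vals S W \<longleftrightarrow>
     (\<forall>v\<in>W. (\<forall>a\<in>carrier S. 0 \<le> v a) \<and>
        (\<forall>a\<in>carrier S. \<forall>b\<in>carrier S. v (a \<otimes>\<^bsub>S\<^esub> b) = v a + v b \<and> min (v a) (v b) \<le> v (a \<oplus>\<^bsub>S\<^esub> b)) \<and>
        v \<zero>\<^bsub>S\<^esub> = Pinf \<and> (\<forall>s\<in>regular_elements S. v s \<noteq> Pinf) \<and>
        (\<exists>a\<in>carrier S. \<exists>s\<in>regular_elements S. v a = v s + 1) \<and> (\<exists>r\<in>regular_elements S. 0 < v r)) \<and>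
     (\<forall>a\<in>carrier S. \<forall>s\<in>regular_elements S. (\<forall>v\<in>W. v s \<le> v a) \<longrightarrow> (\<exists>c\<in>carrier S. a = s \<otimes>\<^bsub>S\<^esub> c)) \<and>
     (\<forall>a\<in>regular_elements S. finite {v \<in> W. v a \<noteq> 0})"

lemma krull_valsD:
  assumes "krull_vals S W"
  shows "\<And>v a. v \<in> W \<Longrightarrow> a \<in> carrier S \<Longrightarrow> 0 \<le> v a"
    "\<And>v a b. v \<in> W \<Longrightarrow> a \<in> carrier S \<Longrightarrow> b \<in> carrier S \<Longrightarrow> v (a \<otimes>\<^bsub>S\<^esub> b) = v a + v b"
    "\<And>v a b. v \<in> W \<Longrightarrow> a \<in> carrier S \<Longrightarrow> b \<in> carrier S \<Longrightarrow> min (v a) (v b) \<le> v (a \<oplus>\<^bsub>S\<^esub> b)"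
    "\<And>v. v \<in> W \<Longrightarrow> v \<zero>\<^bsub>S\<^esub> = Pinf"
    "\<And>v s. v \<in> W \<Longrightarrow> s \<in> regular_elements S \<Longrightarrow> v s \<noteq> Pinf"
    "\<And>v. v \<in> W \<Longrightarrow> \<exists>a\<in>carrier S. \<exists>s\<in>regular_elements S. v a = v s + 1"
    "\<And>v. v \<in> W \<Longrightarrow> \<exists>r\<in>regular_elements S. 0 < v r"
    "\<And>a s. a \<in> carrier S \<Longrightarrow> s \<in> regular_elements S \<Longrightarrow> (\<And>v. v \<in> W \<Longrightarrow> v s \<le> v a) \<Longrightarrow> \<exists>c\<in>carrier S. a = s \<otimes>\<^bsub>S\<^esub> c"
    "\<And>a. a \<in> regular_elements S \<Longrightarrow> finite {v \<in> W. v a \<noteq> 0}"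
  using assms unfolding krull_vals_def by simp_all

lemma krull_valsI:
  assumes "\<And>v a. v \<in> W \<Longrightarrow> a \<in> carrier S \<Longrightarrow> 0 \<le> v a"
    "\<And>v a b. v \<in> W \<Longrightarrow> a \<in> carrier S \<Longrightarrow> b \<in> carrier S \<Longrightarrow> v (a \<otimes>\<^bsub>S\<^esub> b) = v a + v b"
    "\<And>v a b. v \<in> W \<Longrightarrow> a \<in> carrier S \<Longrightarrow> b \<in> carrier S \<Longrightarrow> min (v a) (v b) \<le> v (a \<oplus>\<^bsub>S\<^esub> b)"
    "\<And>v. v \<in> W \<Longrightarrow> v \<zero>\<^bsub>S\<^esub> = Pinf"
    "\<And>v s. v \<in> W \<Longrightarrow> s \<in> regular_elements S \<Longrightarrow> v s \<noteq> Pinf"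
    "\<And>v. v \<in> W \<Longrightarrow> \<exists>a\<in>carrier S. \<exists>s\<in>regular_elements S. v a = v s + 1"
    "\<And>v. v \<in> W \<Longrightarrow> \<exists>r\<in>regular_elements S. 0 < v r"
    "\<And>a s. a \<in> carrier S \<Longrightarrow> s \<in> regular_elements S \<Longrightarrow> (\<And>v. v \<in> W \<Longrightarrow> v s \<le> v a) \<Longrightarrow> \<exists>c\<in>carrier S. a = s \<otimes>\<^bsub>S\<^esub> c"
    "\<And>a. a \<in> regular_elements S \<Longrightarrow> finite {v \<in> W. v a \<noteq> 0}"
  shows "krull_vals S W"
  using assms unfolding krull_vals_def by simp

text \<open>The value of a fraction, computed from an arbitrarily chosen representative. The choice
  is immaterial because denominators are regular and so have finite value.\<close>

definition ext_val :: "('a \<Rightarrow> int extended) \<Rightarrow> ('a \<times> 'a) set \<Rightarrow> int extended" where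
  "ext_val v Y = (let z = SOME z. z \<in> Y in v (fst z) + - v (snd z))"

context nontrivial_cring
begin

lemma krull_vals_finite:
  assumes "krull_vals R W" "v \<in> W" "s \<in> regular_elements R"
  obtains n where "v s = Fin n" "0 \<le> n"
  using krull_valsD(1)[OF assms(1,2) regular_closed[OF assms(3)]] krull_valsD(5)[OF assms]
  by (cases "v s") (auto simp: zero_extended_def)

lemma ext_val_frac:
  assumes W: "krull_vals R W" "v \<in> W" and as: "a \<in> carrier R" "s \<in> regular_elements R" and n: "v s = Fin n"
  shows "ext_val v (tq_frac R a s) = v a + Fin (- n)"
proof -
  define z where "z = (SOME z. z \<in> tq_frac R a s)"
  have "(a, s) \<in> tq_frac R a s" using as by (simp add: tq_frac_def)
  then have "z \<in> tq_frac R a s" unfolding z_def by (rule someI)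
  then obtain b t where z: "z = (b, t)" "b \<in> carrier R" "t \<in> regular_elements R" "a \<otimes> t = b \<otimes> s"
    by (auto simp: tq_frac_def)
  obtain m where m: "v t = Fin m" using krull_vals_finite[OF W z(3)] .
  have "v a + v t = v b + v s"
    using krull_valsD(2)[OF W as(1) regular_closed[OF z(3)]] krull_valsD(2)[OF W z(2) regular_closed[OF as(2)]] z(4) by simp
  moreover have "v a \<noteq> Minf" "v b \<noteq> Minf" using krull_valsD(1)[OF W as(1)] krull_valsD(1)[OF W z(2)] by (auto simp: zero_extended_def)
  ultimately have "v b + - v t = v a + Fin (- n)" using n m by (cases "v a"; cases "v b") auto
  then show ?thesis unfolding ext_val_def Let_def z_def[symmetric] z(1) by simp
qed

text \<open>Surjectivity is generated from two clauses of \<open>krull_vals\<close>: a pair with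
  v(a) = v(s) + 1 gives the value 1, and a regular element of positive value gives negative
  ones.\<close>

lemma ext_val_valuation:
  assumes W: "krull_vals R W" "v \<in> W"
  shows "rank_one_discrete_valuation Q (ext_val v)"
proof -
  note f = ext_val_frac[OF W] and fin = krull_vals_finite[OF W] and D = krull_valsD[OF W(1)]
  have mult: "ext_val v (x \<otimes>\<^bsub>Q\<^esub> y) = ext_val v x + ext_val v y" if xy: "x \<in> carrier Q" "y \<in> carrier Q" for x y
  proof -
    obtain a s where x: "a \<in> carrier R" "s \<in> regular_elements R" "x = tq_frac R a s" using xy(1) by (rule tq_carrierE)
    obtain b t where y: "b \<in> carrier R" "t \<in> regular_elements R" "y = tq_frac R b t" using xy(2) by (rule tq_carrierE)
    obtain i j where ij: "v s = Fin i" "v t = Fin j" using fin[OF x(2)] fin[OF y(2)] by metis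
    have st: "v (s \<otimes> t) = Fin (i + j)" using D(2)[OF W(2) regular_closed[OF x(2)] regular_closed[OF y(2)]] ij by simp
    have "ext_val v (x \<otimes>\<^bsub>Q\<^esub> y) = v a + v b + Fin (- (i + j))"
      using f[OF m_closed[OF x(1) y(1)] regular_mult[OF x(2) y(2)] st] x y D(2)[OF W(2) x(1) y(1)] by (simp add: tq_mult_frac)
    then show ?thesis using f[OF x(1,2) ij(1)] f[OF y(1,2) ij(2)] x(3) y(3) by (cases "v a"; cases "v b") auto
  qed
  have add: "min (ext_val v x) (ext_val v y) \<le> ext_val v (x \<oplus>\<^bsub>Q\<^esub> y)" if xy: "x \<in> carrier Q" "y \<in> carrier Q" for x y
  proof -
    obtain a s where x: "a \<in> carrier R" "s \<in> regular_elements R" "x = tq_frac R a s" using xy(1) by (rule tq_carrierE)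
    obtain b t where y: "b \<in> carrier R" "t \<in> regular_elements R" "y = tq_frac R b t" using xy(2) by (rule tq_carrierE)
    obtain i j where ij: "v s = Fin i" "v t = Fin j" using fin[OF x(2)] fin[OF y(2)] by metis
    have c: "s \<in> carrier R" "t \<in> carrier R" using x y regular_closed by auto
    have st: "v (s \<otimes> t) = Fin (i + j)" using D(2)[OF W(2) c] ij by simp
    let ?z = "(a \<otimes> t) \<oplus> (b \<otimes> s)"
    have z: "?z \<in> carrier R" using x y c by simp
    have e: "ext_val v (x \<oplus>\<^bsub>Q\<^esub> y) = v ?z + Fin (- (i + j))"
      using f[OF z regular_mult[OF x(2) y(2)] st] x y by (simp add: tq_add_frac)
    have "min (v a + Fin j) (v b + Fin i) \<le> v ?z"
      using D(3)[OF W(2) m_closed[OF x(1) c(2)] m_closed[OF y(1) c(1)]] D(2)[OF W(2) x(1) c(2)] D(2)[OF W(2) y(1) c(1)] ij by simp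
    then show ?thesis unfolding e using f[OF x(1,2) ij(1)] f[OF y(1,2) ij(2)] x(3) y(3)
      by (cases "v a"; cases "v b"; cases "v ?z") (auto simp: min_def split: if_splits)
  qed
  have nM: "ext_val v x = Pinf \<or> (\<exists>n. ext_val v x = Fin n)" if x: "x \<in> carrier Q" for x
  proof -
    obtain a s where as: "a \<in> carrier R" "s \<in> regular_elements R" "x = tq_frac R a s" using x by (rule tq_carrierE)
    obtain i where i: "v s = Fin i" using fin[OF as(2)] .
    show ?thesis using f[OF as(1,2) i] as(3) D(1)[OF W(2) as(1)] by (cases "v a") (auto simp: zero_extended_def)
  qed
  have one: "v \<one> = Fin 0"
    using D(2)[OF W(2) one_closed one_closed] D(5)[OF W(2) regular_one] by (cases "v \<one>") (use D(1)[OF W(2) one_closed] in \<open>auto simp: zero_extended_def\<close>)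
  have pos: "\<exists>x\<in>carrier Q. ext_val v x = Fin (int n)" for n
  proof (induct n)
    case 0
    have "ext_val v (tq_frac R \<one> \<one>) = Fin 0" using f[OF one_closed regular_one one] one by simp
    then show ?case using tq_frac_closed[OF one_closed regular_one] by auto
  next
    case (Suc n)
    then obtain x where x: "x \<in> carrier Q" "ext_val v x = Fin (int n)" by blast
    obtain a s where as: "a \<in> carrier R" "s \<in> regular_elements R" "v a = v s + 1" using D(6)[OF W(2)] by blast
    obtain i where i: "v s = Fin i" using fin[OF as(2)] .
    have "ext_val v (tq_frac R a s) = Fin 1" using f[OF as(1,2) i] as(3) i by (simp add: one_extended_def)
    then have "ext_val v (x \<otimes>\<^bsub>Q\<^esub> tq_frac R a s) = Fin (int (Suc n))"
      using mult[OF x(1) tq_frac_closed[OF as(1,2)]] x(2) by simp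
    then show ?case using x(1) tq_frac_closed[OF as(1,2)] by (intro bexI[of _ "x \<otimes>\<^bsub>Q\<^esub> tq_frac R a s"]) auto
  qed
  obtain r where r: "r \<in> regular_elements R" "0 < v r" using D(7)[OF W(2)] by blast
  obtain k where k: "v r = Fin k" using fin[OF r(1)] .
  have k0: "0 < k" using r(2) k by (simp add: zero_extended_def)
  have ir: "ext_val v (tq_frac R \<one> r) = Fin (- k)" using f[OF one_closed r(1) k] one by simp
  \<comment> \<open>y has value k - 1 and 1/r has value -k, so their product has value -1.\<close>
  obtain y where y: "y \<in> carrier Q" "ext_val v y = Fin (int (nat (k - 1)))" using pos by blast
  let ?y = "y \<otimes>\<^bsub>Q\<^esub> tq_frac R \<one> r"
  have y1: "ext_val v ?y = Fin (- 1)" "?y \<in> carrier Q"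
    using mult[OF y(1) tq_frac_closed[OF one_closed r(1)]] y ir k0 tq_frac_closed[OF one_closed r(1)] by auto
  have neg: "\<exists>x\<in>carrier Q. ext_val v x = Fin (- int n)" for n
  proof (induct n)
    case 0 then show ?case using pos[of 0] by simp
  next
    case (Suc n)
    then obtain x where x: "x \<in> carrier Q" "ext_val v x = Fin (- int n)" by blast
    have "ext_val v (x \<otimes>\<^bsub>Q\<^esub> ?y) = Fin (- int (Suc n))" using mult[OF x(1) y1(2)] x(2) y1(1) by simp
    then show ?case using x(1) y1(2) fp.m_closed by blast
  qed
  have all: "\<exists>x\<in>carrier Q. ext_val v x = Fin n" for n
    using pos[of "nat n"] neg[of "nat (- n)"] by (cases "0 \<le> n") auto
  have "ext_val v (tq_frac R \<zero> \<one>) = Pinf" using f[OF zero_closed regular_one one] D(4)[OF W(2)] by simp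
  then have inf: "Pinf \<in> ext_val v ` carrier Q" using tq_frac_closed[OF zero_closed regular_one] by (metis imageI)
  have "ext_val v ` carrier Q = insert Pinf (range Fin)"
  proof
    show "ext_val v ` carrier Q \<subseteq> insert Pinf (range Fin)" using nM by blast
    have "Fin n \<in> ext_val v ` carrier Q" for n using all[of n] by (metis imageI)
    then show "insert Pinf (range Fin) \<subseteq> ext_val v ` carrier Q" using inf by blast
  qed
  then show ?thesis unfolding rank_one_discrete_valuation_def using mult add by blast
qed

lemma krull_vals_iff: "krull_ring R \<longleftrightarrow> (\<exists>W. krull_vals R W)"
  unfolding krull_iff
proof
  assume fp.krull
  then obtain W where W: "fp.krull_family W" by (auto simp: fp.krull_def)
  note Wd = fp.krull_familyD[OF W]
  have "krull_vals R ((\<lambda>v. v \<circ> \<iota>) ` W)"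
  proof (rule krull_valsI)
    fix a assume a: "a \<in> regular_elements R"
    have "{w \<in> (\<lambda>v. v \<circ> \<iota>) ` W. w a \<noteq> 0} \<subseteq> (\<lambda>v. v \<circ> \<iota>) ` {v \<in> W. v (\<iota> a) \<noteq> 0}" by auto
    moreover have "finite {v \<in> W. v (\<iota> a) \<noteq> 0}"
      using Wd(4)[of "\<iota> a"] a iota_Units regular_closed by auto
    ultimately show "finite {w \<in> (\<lambda>v. v \<circ> \<iota>) ` W. w a \<noteq> 0}" by (rule finite_surj[rotated])
  next
    fix a s assume as: "a \<in> carrier R" "s \<in> regular_elements R" and le: "\<And>v. v \<in> (\<lambda>v. v \<circ> \<iota>) ` W \<Longrightarrow> v s \<le> v a"
    have s: "s \<in> carrier R" "\<iota> s \<in> Units Q" using as regular_closed iota_Units by auto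
    let ?x = "tq_frac R a s"
    have x: "?x \<in> carrier Q" "\<iota> s \<otimes>\<^bsub>Q\<^esub> ?x = \<iota> a" using tq_frac_closed tq_frac_mult_denominator as by auto
    have "?x \<in> \<iota> ` carrier R"
    proof (rule Wd(2)[OF x(1)])
      fix v assume v: "v \<in> W"
      obtain k where k: "v (\<iota> s) = Fin k" using fp.valuation_unit[OF Wd(1)[OF v] s(2)] .
      have "v (\<iota> a) = v (\<iota> s) + v ?x" using fp.valuation_mult[OF Wd(1)[OF v], of "\<iota> s" ?x] x s by simp
      moreover have "v (\<iota> s) \<le> v (\<iota> a)" using le[of "v \<circ> \<iota>"] v by auto
      ultimately show "0 \<le> v ?x" using k by (cases "v ?x") (auto simp: zero_extended_def)
    qed
    then obtain c where c: "c \<in> carrier R" "?x = \<iota> c" by blast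
    then have "\<iota> (s \<otimes> c) = \<iota> a" using x(2) s c by simp
    then have "s \<otimes> c = a" using iota_eq[of "s \<otimes> c" a] s c as by simp
    then show "\<exists>c\<in>carrier R. a = s \<otimes> c" using c by blast
  next
    fix w assume "w \<in> (\<lambda>v. v \<circ> \<iota>) ` W"
    then obtain v where v: "v \<in> W" "w = v \<circ> \<iota>" by blast
    note val = Wd(1)[OF v(1)]
    show "w \<zero> = Pinf" using fp.valuation_zero[OF val] v by simp
    have "Fin 1 \<in> v ` carrier Q" using val by (simp add: rank_one_discrete_valuation_def)
    then obtain x where x: "x \<in> carrier Q" "v x = Fin 1" by force
    obtain a s where as: "a \<in> carrier R" "s \<in> regular_elements R" "x = tq_frac R a s" using x(1) by (rule tq_carrierE)
    have "v (\<iota> s) + v x = v (\<iota> a)"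
      using fp.valuation_mult[OF val, of "\<iota> s" x] tq_frac_mult_denominator[OF as(1,2)] as(3) x(1) regular_closed[OF as(2)] by simp
    then have "w a = w s + 1" using v x(2) by (simp add: one_extended_def)
    then show "\<exists>a\<in>carrier R. \<exists>s\<in>regular_elements R. w a = w s + 1" using as by blast
    obtain y where y: "y \<in> \<iota> ` carrier R" "y \<in> Units Q" "0 < v y" using W v(1) unfolding fp.krull_family_def by blast
    then obtain r where "r \<in> carrier R" "y = \<iota> r" by blast
    then have "r \<in> regular_elements R" "0 < w r" using y v iota_Units by auto
    then show "\<exists>r\<in>regular_elements R. 0 < w r" by blast
  next
    fix w s assume "w \<in> (\<lambda>v. v \<circ> \<iota>) ` W" "s \<in> regular_elements R"
    then obtain v where v: "v \<in> W" "w = v \<circ> \<iota>" "\<iota> s \<in> Units Q" using iota_Units regular_closed by blast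
    obtain k where "v (\<iota> s) = Fin k" using fp.valuation_unit[OF Wd(1)[OF v(1)] v(3)] .
    then show "w s \<noteq> Pinf" using v by simp
  next
    fix w a assume "w \<in> (\<lambda>v. v \<circ> \<iota>) ` W" "a \<in> carrier R"
    then show "0 \<le> w a" using Wd(3) by auto
  next
    fix w a b assume "w \<in> (\<lambda>v. v \<circ> \<iota>) ` W" and ab: "a \<in> carrier R" "b \<in> carrier R"
    then obtain v where v: "v \<in> W" "w = v \<circ> \<iota>" by blast
    show "w (a \<otimes> b) = w a + w b" using fp.valuation_mult[OF Wd(1)[OF v(1)], of "\<iota> a" "\<iota> b"] ab v by simp
    show "min (w a) (w b) \<le> w (a \<oplus> b)" using fp.valuation_add[OF Wd(1)[OF v(1)], of "\<iota> a" "\<iota> b"] ab v by simp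
  qed
  then show "\<exists>W. krull_vals R W" by blast
next
  assume "\<exists>W. krull_vals R W"
  then obtain W where W: "krull_vals R W" by blast
  note D = krull_valsD[OF W]
  have one: "v \<one> = Fin 0" if "v \<in> W" for v
    using D(2)[OF that one_closed one_closed] D(5)[OF that regular_one] by (cases "v \<one>") (use D(1)[OF that one_closed] in \<open>auto simp: zero_extended_def\<close>)
  have ei: "ext_val v (\<iota> a) = v a" if "v \<in> W" "a \<in> carrier R" for v a
    using ext_val_frac[OF W that(1,2) regular_one one[OF that(1)]] by (cases "v a") (auto simp: tq_embed_def)
  have "fp.krull_family (ext_val ` W)"
    unfolding fp.krull_family_def
  proof (intro conjI ballI)
    fix w assume "w \<in> ext_val ` W"
    then obtain v where v: "v \<in> W" "w = ext_val v" by blast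
    show "rank_one_discrete_valuation Q w" unfolding v(2) by (rule ext_val_valuation[OF W v(1)])
    obtain r where r: "r \<in> regular_elements R" "0 < v r" using D(7)[OF v(1)] by blast
    then have "\<iota> r \<in> \<iota> ` carrier R \<inter> Units Q" "0 < w (\<iota> r)" using regular_closed iota_Units ei v by auto
    then show "\<exists>a\<in>\<iota> ` carrier R \<inter> Units Q. 0 < w a" by blast
  next
    fix x assume x: "x \<in> carrier Q"
    show "(\<forall>w\<in>ext_val ` W. 0 \<le> w x) \<longleftrightarrow> x \<in> \<iota> ` carrier R"
    proof
      assume "x \<in> \<iota> ` carrier R"
      then show "\<forall>w\<in>ext_val ` W. 0 \<le> w x" using ei D(1) by auto
    next
      assume h: "\<forall>w\<in>ext_val ` W. 0 \<le> w x"
      obtain a s where as: "a \<in> carrier R" "s \<in> regular_elements R" "x = tq_frac R a s" using x by (rule tq_carrierE)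
      have "v s \<le> v a" if v: "v \<in> W" for v
      proof -
        obtain n where n: "v s = Fin n" using krull_vals_finite[OF W v as(2)] .
        have "0 \<le> v a + Fin (- n)" using h v ext_val_frac[OF W v as(1,2) n] as(3) by auto
        then show ?thesis using n by (cases "v a") (auto simp: zero_extended_def)
      qed
      then obtain c where c: "c \<in> carrier R" "a = s \<otimes> c" using D(8)[OF as(1,2)] by blast
      have "x = \<iota> c" unfolding as(3) tq_embed_def
        using as c regular_one regular_closed by (subst tq_frac_eq_iff) (auto simp: m_comm)
      then show "x \<in> \<iota> ` carrier R" using c by blast
    qed
  next
    fix a assume "a \<in> \<iota> ` carrier R \<inter> Units Q"
    then obtain r where r: "r \<in> carrier R" "r \<in> regular_elements R" "a = \<iota> r" using iota_Units by blast
    have "{w \<in> ext_val ` W. w a \<noteq> 0} \<subseteq> ext_val ` {v \<in> W. v r \<noteq> 0}" using ei r by auto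
    then show "finite {w \<in> ext_val ` W. w a \<noteq> 0}" by (rule finite_surj[OF D(9)[OF r(2)]])
  qed
  then show fp.krull unfolding fp.krull_def by blast
qed

end

section \<open>Factors cut out by idempotents\<close>

definition idem_ring :: "('a, 'b) ring_scheme \<Rightarrow> 'a \<Rightarrow> 'a ring" where
  "idem_ring R e = \<lparr>carrier = (\<lambda>r. e \<otimes>\<^bsub>R\<^esub> r) ` carrier R, monoid.mult = monoid.mult R, one = e,
     ring.zero = \<zero>\<^bsub>R\<^esub>, ring.add = ring.add R\<rparr>"

lemma idem_ring_simps [simp]:
  "x \<otimes>\<^bsub>idem_ring R e\<^esub> y = x \<otimes>\<^bsub>R\<^esub> y" "x \<oplus>\<^bsub>idem_ring R e\<^esub> y = x \<oplus>\<^bsub>R\<^esub> y"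
  "\<one>\<^bsub>idem_ring R e\<^esub> = e" "\<zero>\<^bsub>idem_ring R e\<^esub> = \<zero>\<^bsub>R\<^esub>"
  by (simp_all add: idem_ring_def)

context nontrivial_cring
begin

lemma idem_ring_carrier:
  assumes "e \<in> carrier R" "e \<otimes> e = e"
  shows "x \<in> carrier (idem_ring R e) \<longleftrightarrow> x \<in> carrier R \<and> e \<otimes> x = x"
proof
  assume "x \<in> carrier (idem_ring R e)"
  then obtain r where r: "r \<in> carrier R" "x = e \<otimes> r" by (auto simp: idem_ring_def)
  have "e \<otimes> (e \<otimes> r) = (e \<otimes> e) \<otimes> r" using assms(1) r(1) by (simp add: m_assoc)
  then show "x \<in> carrier R \<and> e \<otimes> x = x" using r assms by simp
qed (auto simp: idem_ring_def intro: rev_image_eqI)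

lemma idem_ring_mem: "e \<in> carrier R \<Longrightarrow> x \<in> carrier R \<Longrightarrow> e \<otimes> x \<in> carrier (idem_ring R e)"
  by (auto simp: idem_ring_def)

lemma idem_ring_cring:
  assumes e: "e \<in> carrier R" "e \<otimes> e = e"
  shows "cring (idem_ring R e)"
proof (intro cringI abelian_groupI comm_monoidI)
  note c = idem_ring_carrier[OF e]
  fix x assume x: "x \<in> carrier (idem_ring R e)"
  have "e \<otimes> (\<ominus> x) = \<ominus> x" using x e by (simp add: c r_minus)
  then show "\<exists>y\<in>carrier (idem_ring R e). y \<oplus>\<^bsub>idem_ring R e\<^esub> x = \<zero>\<^bsub>idem_ring R e\<^esub>"
    using x by (intro bexI[of _ "\<ominus> x"]) (auto simp: c l_neg)
qed (use e in \<open>auto simp: idem_ring_carrier[OF e] m_assoc a_assoc m_comm a_comm r_distr l_distr m_lcomm a_lcomm\<close>)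

text \<open>Adding 1 - e puts a unit on the complementary factor, which makes a regular element of e
  R regular in R.\<close>

lemma idem_regular:
  assumes e: "e \<in> carrier R" "e \<otimes> e = e" and s: "s \<in> regular_elements (idem_ring R e)"
  shows "s \<oplus> (\<one> \<ominus> e) \<in> regular_elements R" "s \<in> carrier R" "e \<otimes> (s \<oplus> (\<one> \<ominus> e)) = s"
proof -
  note c = idem_ring_carrier[OF e]
  have sc: "s \<in> carrier R" "e \<otimes> s = s" using s c by (auto simp: regular_elements_def)
  then show "s \<in> carrier R" by simp
  have e1: "e \<otimes> (\<one> \<ominus> e) = \<zero>" using e by (simp add: minus_eq r_distr r_minus r_neg)
  then show es: "e \<otimes> (s \<oplus> (\<one> \<ominus> e)) = s" using e sc by (simp add: r_distr)
  have "b = \<zero>" if b: "b \<in> carrier R" "(s \<oplus> (\<one> \<ominus> e)) \<otimes> b = \<zero>" for b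
  proof -
    have "s \<otimes> (e \<otimes> b) = e \<otimes> ((s \<oplus> (\<one> \<ominus> e)) \<otimes> b)"
    proof -
      have "e \<otimes> ((s \<oplus> (\<one> \<ominus> e)) \<otimes> b) = (e \<otimes> (s \<oplus> (\<one> \<ominus> e))) \<otimes> b" using e sc b(1) by (simp add: m_assoc)
      also have "\<dots> = (e \<otimes> s) \<otimes> b" unfolding es sc(2) ..
      finally show ?thesis using e sc(1) b(1) by (simp add: m_ac)
    qed
    then have "s \<otimes> (e \<otimes> b) = \<zero>" using b e by simp
    then have eb: "e \<otimes> b = \<zero>" using s idem_ring_mem[OF e(1) b(1)] by (simp add: regular_elements_def)
    have "b = (\<one> \<ominus> e) \<otimes> b" using e b(1) eb by (simp add: minus_eq l_distr l_minus)
    moreover have "s \<otimes> b = \<zero>"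
    proof -
      have "s \<otimes> b = s \<otimes> (e \<otimes> b)" using sc b(1) e by (metis m_assoc m_comm)
      then show ?thesis using eb sc by simp
    qed
    moreover have "(s \<oplus> (\<one> \<ominus> e)) \<otimes> b = s \<otimes> b \<oplus> (\<one> \<ominus> e) \<otimes> b" using e sc b(1) by (simp add: l_distr)
    ultimately show "b = \<zero>" using b e by simp
  qed
  then show "s \<oplus> (\<one> \<ominus> e) \<in> regular_elements R" using e sc by (simp add: regular_elements_def)
qed

lemma regular_idem:
  assumes e: "e \<in> carrier R" "e \<otimes> e = e" and s: "s \<in> regular_elements R"
  shows "e \<otimes> s \<in> regular_elements (idem_ring R e)"
proof -
  note c = idem_ring_carrier[OF e]
  have sc: "s \<in> carrier R" using regular_closed[OF s] .
  have "b = \<zero>" if b: "b \<in> carrier R" "e \<otimes> b = b" "(e \<otimes> s) \<otimes> b = \<zero>" for b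
  proof -
    have "s \<otimes> b = (e \<otimes> s) \<otimes> b" using b(1,2) e sc by (metis m_assoc m_comm)
    then show ?thesis using s b by (simp add: regular_elements_def)
  qed
  then show ?thesis using idem_ring_mem[OF e(1) sc] by (auto simp: regular_elements_def c)
qed

text \<open>An idempotent has value 0 or infinity. If v(e) is infinite, then v is infinite on all of
  e R and imposes nothing there. The other valuations restrict, with v(s + (1 - e)) = v(s) linking
  the regular elements of the two rings.\<close>

lemma idem_ring_krull_vals:
  assumes e: "e \<in> carrier R" "e \<otimes> e = e" and W: "krull_vals R W"
  shows "krull_vals (idem_ring R e) {v \<in> W. v e = 0}" (is "krull_vals ?B ?W")
proof -
  note c = idem_ring_carrier[OF e] and D = krull_valsD[OF W]
  have reg: "v (s \<oplus> (\<one> \<ominus> e)) = v s" if "v \<in> W" "v e = 0" "s \<in> regular_elements ?B" for v s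
    using D(2)[OF that(1) e(1), of "s \<oplus> (\<one> \<ominus> e)"] idem_regular[OF e that(3)] that(2) e by simp
  have es: "v (e \<otimes> s) = v s" if "v \<in> W" "v e = 0" "s \<in> carrier R" for v s
    using D(2)[OF that(1) e(1) that(3)] that by simp
  have ve: "v e = 0 \<or> v e = Pinf" if "v \<in> W" for v
    using D(2)[OF that e(1) e(1)] D(1)[OF that e(1)] e(2) by (cases "v e") (auto simp: zero_extended_def)
  show ?thesis
  proof (rule krull_valsI)
    fix v s assume v: "v \<in> ?W" and s: "s \<in> regular_elements ?B"
    then show "v s \<noteq> Pinf" using reg[of v s] D(5)[of v] idem_regular(1)[OF e s] by force
  next
    fix v assume "v \<in> ?W"
    then have v: "v \<in> W" "v e = 0" by auto
    show "v \<zero>\<^bsub>?B\<^esub> = Pinf" using D(4) v by simp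
    obtain a s where as: "a \<in> carrier R" "s \<in> regular_elements R" "v a = v s + 1" using D(6)[OF v(1)] by blast
    then have "v (e \<otimes> a) = v (e \<otimes> s) + 1" using es[OF v] regular_closed by simp
    then show "\<exists>a\<in>carrier ?B. \<exists>s\<in>regular_elements ?B. v a = v s + 1"
      using idem_ring_mem[OF e(1) as(1)] regular_idem[OF e as(2)] by blast
    obtain r where r: "r \<in> regular_elements R" "0 < v r" using D(7)[OF v(1)] by blast
    then have "0 < v (e \<otimes> r)" using es[OF v] regular_closed by simp
    then show "\<exists>r\<in>regular_elements ?B. 0 < v r" using regular_idem[OF e r(1)] by blast
  next
    fix a s assume a: "a \<in> carrier ?B" and s: "s \<in> regular_elements ?B" and le: "\<And>v. v \<in> ?W \<Longrightarrow> v s \<le> v a"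
    have ac: "a \<in> carrier R" "e \<otimes> a = a" using a c by auto
    note s' = idem_regular[OF e s]
    have "v (s \<oplus> (\<one> \<ominus> e)) \<le> v a" if v: "v \<in> W" for v
    proof (cases "v e = 0")
      case True then show ?thesis using le[of v] v reg[OF v True s] by simp
    next
      case False
      then have "v e = Pinf" using ve[OF v] by simp
      then have "v a = Pinf" using D(2)[OF v e(1) ac(1)] ac D(1)[OF v ac(1)] by (cases "v a") auto
      then show ?thesis by simp
    qed
    then obtain d where d: "d \<in> carrier R" "a = (s \<oplus> (\<one> \<ominus> e)) \<otimes> d" using D(8)[OF ac(1) s'(1)] by blast
    have "a = e \<otimes> ((s \<oplus> (\<one> \<ominus> e)) \<otimes> d)" using ac(2) d(2) by simp
    also have "\<dots> = (e \<otimes> (s \<oplus> (\<one> \<ominus> e))) \<otimes> d" using e d(1) s'(2) by (simp add: m_assoc)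
    also have "\<dots> = (e \<otimes> s) \<otimes> d" using s'(3) s c by (simp add: regular_elements_def)
    also have "\<dots> = s \<otimes> (e \<otimes> d)" using e d(1) s'(2) by (simp add: m_ac)
    finally show "\<exists>c\<in>carrier ?B. a = s \<otimes>\<^bsub>?B\<^esub> c" using idem_ring_mem[OF e(1) d(1)] by auto
  next
    fix a assume a: "a \<in> regular_elements ?B"
    have "{v \<in> ?W. v a \<noteq> 0} \<subseteq> {v \<in> W. v (a \<oplus> (\<one> \<ominus> e)) \<noteq> 0}"
    proof
      fix v assume "v \<in> {v \<in> ?W. v a \<noteq> 0}"
      then have v: "v \<in> W" "v e = 0" "v a \<noteq> 0" by auto
      show "v \<in> {v \<in> W. v (a \<oplus> (\<one> \<ominus> e)) \<noteq> 0}" using reg[OF v(1,2) a] v(1,3) by simp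
    qed
    then show "finite {v \<in> ?W. v a \<noteq> 0}" using D(9)[OF idem_regular(1)[OF e a]] by (rule finite_subset)
  qed (use D c in auto)
qed

lemma idem_ring_krull_domain:
  assumes e: "e \<in> carrier R" "e \<otimes> e = e" "e \<noteq> \<zero>" and W: "krull_vals R W"
    and dom: "\<And>x y. x \<in> carrier (idem_ring R e) \<Longrightarrow> y \<in> carrier (idem_ring R e) \<Longrightarrow> x \<otimes> y = \<zero> \<Longrightarrow> x = \<zero> \<or> y = \<zero>"
  shows "krull_domain (idem_ring R e)"
proof -
  interpret B: cring "idem_ring R e" by (rule idem_ring_cring[OF e(1,2)])
  interpret B: nontrivial_cring "idem_ring R e" by unfold_locales (use e in simp)
  have "krull_ring (idem_ring R e)" using B.krull_vals_iff idem_ring_krull_vals[OF e(1,2) W] by blast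
  moreover have "domain (idem_ring R e)" by unfold_locales (use e dom in auto)
  ultimately show ?thesis by (simp add: krull_domain_def)
qed

end

lemma (in cring) special_primary_ringI:
  assumes q: "q \<in> carrier R" "q [^] (n::nat) = \<zero>" and one: "\<one> \<notin> PIdl q"
    and loc: "\<And>x. x \<in> carrier R \<Longrightarrow> x \<in> PIdl q \<or> (\<exists>y\<in>carrier R. x \<otimes> y = \<one>)"
  shows "special_primary_ring R"
proof -
  have sub: "J \<subseteq> PIdl q" if J: "ideal J R" "J \<noteq> carrier R" for J
  proof
    fix x assume x: "x \<in> J"
    then have xc: "x \<in> carrier R" using J(1) by (auto simp: ideal_iff)
    show "x \<in> PIdl q"
    proof (rule ccontr)
      assume "x \<notin> PIdl q"
      then obtain y where y: "y \<in> carrier R" "x \<otimes> y = \<one>" using loc[OF xc] by blast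
      then have "y \<otimes> x \<in> J" using J(1) x by (auto simp: ideal_iff)
      then have "\<one> \<in> J" using y xc by (simp add: m_comm)
      then show False using ideal.one_imp_carrier[OF J(1)] J(2) by blast
    qed
  qed
  have M: "maximalideal (PIdl q) R"
  proof (rule maximalidealI)
    show "ideal (PIdl q) R" by (rule cgenideal_ideal[OF q(1)])
    show "carrier R \<noteq> PIdl q" using one by blast
    fix J assume "ideal J R" "PIdl q \<subseteq> J" "J \<subseteq> carrier R"
    then show "J = PIdl q \<or> J = carrier R" using sub by blast
  qed
  have uniq: "M' = PIdl q" if M': "maximalideal M' R" for M'
  proof -
    interpret M': maximalideal M' R by (rule M')
    have "M' \<subseteq> PIdl q" using sub[OF M'.is_ideal] M'.I_notcarr by blast
    then have "PIdl q = M' \<or> PIdl q = carrier R"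
      using M'.I_maximal[OF cgenideal_ideal[OF q(1)]] cgenideal_ideal[OF q(1)] by (auto simp: ideal_iff)
    then show ?thesis using one by auto
  qed
  have pw: "\<exists>c\<in>carrier R. z = q [^] k \<otimes> c" if "z \<in> ideal_prod_list R (replicate k (PIdl q))" for z and k :: nat
    using that
  proof (induct k arbitrary: z)
    case 0 then show ?case by (auto simp: ideal_prod_list_def intro!: bexI[of _ z])
  next
    case (Suc k)
    from Suc(2) have "z \<in> (PIdl q) \<cdot> ideal_prod_list R (replicate k (PIdl q))" by (simp add: ideal_prod_list_def)
    then show ?case
    proof induct
      case (prod i j)
      obtain c where c: "c \<in> carrier R" "i = c \<otimes> q" using prod(1) by (auto simp: cgenideal_def)
      obtain d where d: "d \<in> carrier R" "j = q [^] k \<otimes> d" using Suc(1)[OF prod(2)] by blast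
      have "i \<otimes> j = q [^] Suc k \<otimes> (c \<otimes> d)" unfolding c(2) d(2) using c(1) d(1) q(1) by (simp add: m_ac)
      then show ?case using c(1) d(1) by blast
    next
      case (sum s t)
      then obtain c d where "c \<in> carrier R" "s = q [^] Suc k \<otimes> c" "d \<in> carrier R" "t = q [^] Suc k \<otimes> d" by blast
      then have "s \<oplus> t = q [^] Suc k \<otimes> (c \<oplus> d)" using q(1) by (simp add: r_distr del: nat_pow_Suc)
      then show ?case using \<open>c \<in> carrier R\<close> \<open>d \<in> carrier R\<close> by blast
    qed
  qed
  have z: "\<zero> \<in> ideal_prod_list R (replicate k (PIdl q))" for k
  proof (induct k)
    case (Suc k)
    have "\<zero> \<in> PIdl q" using cgenideal_ideal[OF q(1)] by (simp add: ideal_iff)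
    from ideal_prod.prod[OF this Suc, of R] show ?case by (simp add: ideal_prod_list_def)
  qed (simp add: ideal_prod_list_def)
  \<comment> \<open>The exponent has to be at least 1 while \<open>n\<close> may be 0, hence
    \<open>Suc n\<close>.\<close>
  have nil: "ideal_prod_list R (replicate (Suc n) (PIdl q)) = {\<zero>}"
  proof -
    have "q [^] Suc n = \<zero>" using q by simp
    then have "x = \<zero>" if "x \<in> ideal_prod_list R (replicate (Suc n) (PIdl q))" for x using pw[OF that] by auto
    then show ?thesis using z by blast
  qed
  show ?thesis
    unfolding special_primary_ring_def
  proof (intro conjI exI[of _ "PIdl q"] exI[of _ "Suc n"] allI impI)
    show "1 \<le> Suc n" by simp
    show "principalideal (PIdl q) R" by (rule cgenideal_is_principalideal[OF q(1)])
  qed (fact is_cring M nil | rule uniq, assumption)+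
qed

lemma set_add_memI: "a \<in> I \<Longrightarrow> b \<in> J \<Longrightarrow> a \<oplus>\<^bsub>S\<^esub> b \<in> I <+>\<^bsub>S\<^esub> J"
  unfolding set_add_defs by (intro UN_I) simp_all

section \<open>Direct products\<close>

text \<open>What the two kinds of factors of a general Krull ring have in common; for a special primary ring the
  family of valuations is empty.\<close>

definition krull_factor :: "('a, 'b) ring_scheme \<Rightarrow> bool" where
  "krull_factor S \<longleftrightarrow> cring S \<and> (\<exists>W. krull_vals S W) \<and>
     (\<exists>g\<in>carrier S. \<exists>k::nat. g [^]\<^bsub>S\<^esub> k = \<zero>\<^bsub>S\<^esub> \<and> primeideal (PIdl\<^bsub>S\<^esub> g) S \<and>
        (\<forall>x\<in>carrier S. x \<in> PIdl\<^bsub>S\<^esub> g \<or> x \<in> regular_elements S))"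

lemma krull_domain_factor:
  fixes S (structure)
  assumes "krull_domain S"
  shows "krull_factor S"
proof -
  interpret domain S using assms by (simp add: krull_domain_def)
  interpret nontrivial_cring S by unfold_locales simp
  have z: "PIdl \<zero> = {\<zero>}" using cgenideal_eq_genideal[OF zero_closed] genideal_zero by simp
  have reg: "x = \<zero> \<or> x \<in> regular_elements S" if "x \<in> carrier S" for x
    using that integral by (auto simp: regular_elements_def)
  have "\<exists>W. krull_vals S W" using krull_vals_iff assms by (simp add: krull_domain_def)
  moreover have "\<exists>g\<in>carrier S. \<exists>k::nat. g [^] k = \<zero> \<and> primeideal (PIdl g) S \<and>
        (\<forall>x\<in>carrier S. x \<in> PIdl g \<or> x \<in> regular_elements S)"
    \<comment> \<open>In a domain the nilpotent generator is 0 with exponent 1, and everything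
      outside the zero ideal is regular.\<close>
    using z zeroprimeideal reg by (intro bexI[of _ \<zero>] exI[of _ 1]) auto
  ultimately show ?thesis using is_cring by (simp add: krull_factor_def)
qed

text \<open>If x is outside M, then 1 = m + c x with m nilpotent, so x is invertible. Regular
  elements are therefore units and divide everything, which is all that the empty family of
  valuations demands.\<close>

lemma special_primary_ring_factor:
  fixes S (structure)
  assumes "special_primary_ring S"
  shows "krull_factor S"
proof -
  interpret cring S using assms by (simp add: special_primary_ring_def)
  obtain M n where M: "maximalideal M S" "principalideal M S" "ideal_prod_list S (replicate n M) = {\<zero>}"
    using assms by (auto simp: special_primary_ring_def)
  interpret M: maximalideal M S by (rule M(1))
  obtain g where g: "g \<in> carrier S" "M = Idl {g}" using principalideal.generate[OF M(2)] by blast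
  have Mg: "M = PIdl g" using g cgenideal_eq_genideal by simp
  have nilp: "x [^] n = \<zero>" if x: "x \<in> M" for x
  proof -
    have "x [^] k \<in> ideal_prod_list S (replicate k M)" for k :: nat
    proof (induct k)
      case (Suc k)
      have "x \<otimes> x [^] k \<in> M \<cdot> ideal_prod_list S (replicate k M)" using x Suc by (rule ideal_prod.prod)
      then show ?case using M.Icarr[OF x] by (simp add: ideal_prod_list_def m_comm)
    qed (simp add: ideal_prod_list_def)
    then show ?thesis using M(3) by blast
  qed
  have one: "\<one> \<notin> M" using M.one_imp_carrier M.I_notcarr by blast
  have unit: "\<exists>y\<in>carrier S. x \<otimes> y = \<one>" if x: "x \<in> carrier S" "x \<notin> M" for x
  proof -
    have id: "ideal (M <+>\<^bsub>S\<^esub> PIdl x) S" by (rule add_ideals[OF M.is_ideal cgenideal_ideal[OF x(1)]])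
    have Msub: "M \<subseteq> M <+>\<^bsub>S\<^esub> PIdl x"
    proof
      fix m assume m: "m \<in> M"
      have "\<zero> \<in> PIdl x" using cgenideal_ideal[OF x(1)] by (simp add: ideal_iff)
      then have "m \<oplus> \<zero> \<in> M <+>\<^bsub>S\<^esub> PIdl x" using m by (intro set_add_memI)
      then show "m \<in> M <+>\<^bsub>S\<^esub> PIdl x" using M.Icarr[OF m] by simp
    qed
    have xin: "x \<in> M <+>\<^bsub>S\<^esub> PIdl x"
    proof -
      have "\<zero> \<oplus> x \<in> M <+>\<^bsub>S\<^esub> PIdl x" using cgenideal_self[OF x(1)] M.zero_closed by (intro set_add_memI)
      then show ?thesis using x by simp
    qed
    have "M <+>\<^bsub>S\<^esub> PIdl x \<subseteq> carrier S" using id by (simp add: ideal_iff)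
    from M.I_maximal[OF id Msub this] have "M <+>\<^bsub>S\<^esub> PIdl x = carrier S"
      using xin x(2) by (elim disjE) simp_all
    then have "\<one> \<in> M <+>\<^bsub>S\<^esub> PIdl x" by simp
    then obtain m c where m: "m \<in> M" "c \<in> carrier S" "\<one> = m \<oplus> c \<otimes> x" by (auto simp: set_add_defs cgenideal_def)
    have mc: "m \<in> carrier S" using M.Icarr[OF m(1)] .
    obtain w where w: "w \<in> carrier S" "\<one> \<ominus> m [^] n = (\<one> \<ominus> m) \<otimes> w" using geometric[OF mc] by blast
    have "\<one> \<ominus> m = (c \<otimes> x \<oplus> m) \<ominus> m" using m(2,3) mc x(1) by (simp add: a_comm)
    then have "\<one> \<ominus> m = c \<otimes> x" using m(2) mc x(1) by (simp add: minus_eq a_assoc r_neg)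
    then have "x \<otimes> (c \<otimes> w) = \<one> \<ominus> m [^] n" using w m(2) x(1) by (simp add: m_ac)
    then have "x \<otimes> (c \<otimes> w) = \<one>" using nilp[OF m(1)] by (simp add: minus_eq)
    then show ?thesis using m(2) w(1) by blast
  qed
  have reg: "x \<in> regular_elements S" if x: "x \<in> carrier S" "x \<notin> M" for x
  proof -
    obtain y where y: "y \<in> carrier S" "x \<otimes> y = \<one>" using unit[OF x] by blast
    have "b = \<zero>" if b: "b \<in> carrier S" "x \<otimes> b = \<zero>" for b
    proof -
      have "b = (x \<otimes> y) \<otimes> b" using y b by simp
      also have "\<dots> = y \<otimes> (x \<otimes> b)" using x(1) y(1) b(1) by (simp add: m_ac)
      finally show ?thesis using b y(1) by simp
    qed
    then show ?thesis using x by (simp add: regular_elements_def)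
  qed
  have regM: "s \<notin> M" if s: "s \<in> regular_elements S" for s
  proof
    assume sM: "s \<in> M"
    have "s [^] k \<in> regular_elements S" for k :: nat
      by (induct k) (auto simp: regular_one regular_mult s)
    then have "\<zero> \<in> regular_elements S" using nilp[OF sM] by metis
    then have "\<one> = \<zero>" by (auto simp: regular_elements_def)
    then show False using one M.zero_closed by simp
  qed
  have "krull_vals S {}"
  proof (rule krull_valsI)
    fix a s assume as: "a \<in> carrier S" "s \<in> regular_elements S"
    obtain y where y: "y \<in> carrier S" "s \<otimes> y = \<one>" using unit[OF regular_closed regM, OF as(2,2)] by blast
    have "a = s \<otimes> (y \<otimes> a)" using y as(1) regular_closed[OF as(2)] by (simp add: m_assoc[symmetric])
    then show "\<exists>c\<in>carrier S. a = s \<otimes> c" using y as(1) by blast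
  qed auto
  moreover have "g [^] n = \<zero>" using nilp[of g] cgenideal_self[OF g(1)] unfolding Mg by blast
  moreover have "primeideal M S" by (rule maximalideal_prime[OF M(1)])
  ultimately show ?thesis unfolding krull_factor_def using is_cring g(1) reg Mg by blast
qed

lemma RDirProd_list_ops:
  assumes "xs \<in> carrier (RDirProd_list Rs)" "ys \<in> carrier (RDirProd_list Rs)" "i < length Rs"
  shows "(xs \<otimes>\<^bsub>RDirProd_list Rs\<^esub> ys) ! i = xs ! i \<otimes>\<^bsub>Rs ! i\<^esub> ys ! i"
    "(xs \<oplus>\<^bsub>RDirProd_list Rs\<^esub> ys) ! i = xs ! i \<oplus>\<^bsub>Rs ! i\<^esub> ys ! i"
  using assms
proof (induct Rs arbitrary: xs ys i)
  case (Cons R Rs)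
  let ?P = "RDirProd R (RDirProd_list Rs)"
  have split: "\<exists>x xs'. xs = x # xs' \<and> x \<in> carrier R \<and> xs' \<in> carrier (RDirProd_list Rs)"
    if "xs \<in> carrier (RDirProd_list (R # Rs))" for xs
    using that unfolding RDirProd_list_carrier by auto
  have m: "(x # xs) \<otimes>\<^bsub>RDirProd_list (R # Rs)\<^esub> (y # ys) = (x \<otimes>\<^bsub>R\<^esub> y) # (xs \<otimes>\<^bsub>RDirProd_list Rs\<^esub> ys)"
    "(x # xs) \<oplus>\<^bsub>RDirProd_list (R # Rs)\<^esub> (y # ys) = (x \<oplus>\<^bsub>R\<^esub> y) # (xs \<oplus>\<^bsub>RDirProd_list Rs\<^esub> ys)"
    if "x \<in> carrier R" "xs \<in> carrier (RDirProd_list Rs)" "y \<in> carrier R" "ys \<in> carrier (RDirProd_list Rs)" for x xs y ys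
    using ring_hom_memE(2,3)[OF RDirProd_list_hom1[of R Rs], of "(x, xs)" "(y, ys)"] that
    by (simp_all add: RDirProd_carrier) (simp_all add: RDirProd_def DirProd_def monoid.defs)
  {
    case 1
    obtain x xs' where x: "xs = x # xs'" "x \<in> carrier R" "xs' \<in> carrier (RDirProd_list Rs)" using split[OF 1(1)] by blast
    obtain y ys' where y: "ys = y # ys'" "y \<in> carrier R" "ys' \<in> carrier (RDirProd_list Rs)" using split[OF 1(2)] by blast
    show ?case using m(1)[OF x(2,3) y(2,3)] Cons(1)[OF x(3) y(3)] 1(3) x(1) y(1) by (cases i) auto
  next
    case 2
    obtain x xs' where x: "xs = x # xs'" "x \<in> carrier R" "xs' \<in> carrier (RDirProd_list Rs)" using split[OF 2(1)] by blast
    obtain y ys' where y: "ys = y # ys'" "y \<in> carrier R" "ys' \<in> carrier (RDirProd_list Rs)" using split[OF 2(2)] by blast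
    show ?case using m(2)[OF x(2,3) y(2,3)] Cons(2)[OF x(3) y(3)] 2(3) x(1) y(1) by (cases i) auto
  }
qed simp_all

lemma RDirProd_list_one_nth: "i < length Rs \<Longrightarrow> \<one>\<^bsub>RDirProd_list Rs\<^esub> ! i = \<one>\<^bsub>Rs ! i\<^esub>"
  and RDirProd_list_one_length: "length \<one>\<^bsub>RDirProd_list Rs\<^esub> = length Rs"
proof -
  have "length \<one>\<^bsub>RDirProd_list Rs\<^esub> = length Rs \<and> (\<forall>i<length Rs. \<one>\<^bsub>RDirProd_list Rs\<^esub> ! i = \<one>\<^bsub>Rs ! i\<^esub>)"
    unfolding RDirProd_list_one by (induct Rs) (auto simp: less_Suc_eq_0_disj)
  then show "i < length Rs \<Longrightarrow> \<one>\<^bsub>RDirProd_list Rs\<^esub> ! i = \<one>\<^bsub>Rs ! i\<^esub>" "length \<one>\<^bsub>RDirProd_list Rs\<^esub> = length Rs" by auto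
qed

text \<open>A finite product described by its projections, jointly injective and jointly surjective.
  This form avoids the list encoding and fits both a given isomorphism and multiplication by
  idempotents.\<close>

definition prod_decomp :: "('a, 'b) ring_scheme \<Rightarrow> 'a ring list \<Rightarrow> (nat \<Rightarrow> 'a \<Rightarrow> 'a) \<Rightarrow> bool" where
  "prod_decomp R Rs \<pi> \<longleftrightarrow> (\<forall>i<length Rs. \<pi> i \<in> ring_hom R (Rs ! i)) \<and>
     (\<forall>x\<in>carrier R. \<forall>y\<in>carrier R. (\<forall>i<length Rs. \<pi> i x = \<pi> i y) \<longrightarrow> x = y) \<and>
     (\<forall>z. (\<forall>i<length Rs. z i \<in> carrier (Rs ! i)) \<longrightarrow> (\<exists>r\<in>carrier R. \<forall>i<length Rs. \<pi> i r = z i))"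

lemma iso_prod_decomp:
  assumes "R \<simeq> RDirProd_list Rs"
  shows "\<exists>\<pi>. prod_decomp R Rs \<pi>"
proof -
  obtain h where "h \<in> ring_iso R (RDirProd_list Rs)" using assms by (auto simp: is_ring_iso_def)
  then have h: "h \<in> ring_hom R (RDirProd_list Rs)" "bij_betw h (carrier R) (carrier (RDirProd_list Rs))"
    by (auto simp: ring_iso_def)
  note hm = ring_hom_memE[OF h(1)]
  have "prod_decomp R Rs (\<lambda>i x. h x ! i)"
    unfolding prod_decomp_def
  proof (intro conjI allI ballI impI)
    fix i assume i: "i < length Rs"
    show "(\<lambda>x. h x ! i) \<in> ring_hom R (Rs ! i)"
    proof (rule ring_hom_memI)
      fix x y assume xy: "x \<in> carrier R" "y \<in> carrier R"
      note c = hm(1)[OF xy(1)] hm(1)[OF xy(2)]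
      show "h x ! i \<in> carrier (Rs ! i)" by (rule RDirProd_list_carrier_mem(2)[OF c(1) i])
      show "h (x \<otimes>\<^bsub>R\<^esub> y) ! i = h x ! i \<otimes>\<^bsub>Rs ! i\<^esub> h y ! i"
        unfolding hm(2)[OF xy] by (rule RDirProd_list_ops(1)[OF c i])
      show "h (x \<oplus>\<^bsub>R\<^esub> y) ! i = h x ! i \<oplus>\<^bsub>Rs ! i\<^esub> h y ! i"
        unfolding hm(3)[OF xy] by (rule RDirProd_list_ops(2)[OF c i])
    next
      show "h \<one>\<^bsub>R\<^esub> ! i = \<one>\<^bsub>Rs ! i\<^esub>" unfolding hm(4) by (rule RDirProd_list_one_nth[OF i])
    qed
  next
    fix x y assume xy: "x \<in> carrier R" "y \<in> carrier R" "\<forall>i<length Rs. h x ! i = h y ! i"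
    have "h x = h y" using RDirProd_list_carrier_mem(1)[OF hm(1)] xy by (intro nth_equalityI) auto
    then show "x = y" using h(2) xy by (auto simp: bij_betw_def inj_on_def)
  next
    fix z assume z: "\<forall>i<length Rs. z i \<in> carrier (Rs ! i)"
    have "map z [0..<length Rs] \<in> carrier (RDirProd_list Rs)"
      using z by (intro RDirProd_list_carrier_memI) auto
    then obtain r where "r \<in> carrier R" "h r = map z [0..<length Rs]" using h(2) by (metis bij_betw_imp_surj_on imageE)
    then show "\<exists>r\<in>carrier R. \<forall>i<length Rs. h r ! i = z i" by (intro bexI[of _ r]) auto
  qed
  then show ?thesis by blast
qed

lemma prod_decomp_iso:
  assumes D: "prod_decomp R Rs \<pi>" and R: "ring R" and Rs: "\<And>i. i < length Rs \<Longrightarrow> ring (Rs ! i)"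
  shows "R \<simeq> RDirProd_list Rs"
proof -
  let ?h = "\<lambda>r. map (\<lambda>i. \<pi> i r) [0..<length Rs]"
  let ?P = "RDirProd_list Rs"
  interpret P: ring ?P by (rule RDirProd_list_is_ring[OF Rs])
  interpret R: ring R by (rule R)
  have hom: "\<pi> i \<in> ring_hom R (Rs ! i)" if "i < length Rs" for i using D that by (simp add: prod_decomp_def)
  note pm = ring_hom_memE[OF hom]
  have c: "?h r \<in> carrier ?P" if "r \<in> carrier R" for r
    using pm(1) that by (intro RDirProd_list_carrier_memI) auto
  note len = RDirProd_list_carrier_mem(1)
  have "?h \<in> ring_hom R ?P"
  proof (rule ring_hom_memI)
    fix x y assume xy: "x \<in> carrier R" "y \<in> carrier R"
    note ops = RDirProd_list_ops[OF c[OF xy(1)] c[OF xy(2)]]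
    show "?h (x \<otimes>\<^bsub>R\<^esub> y) = ?h x \<otimes>\<^bsub>?P\<^esub> ?h y"
      using ops pm(2) xy len[OF P.m_closed[OF c[OF xy(1)] c[OF xy(2)]]] by (intro nth_equalityI) auto
    show "?h (x \<oplus>\<^bsub>R\<^esub> y) = ?h x \<oplus>\<^bsub>?P\<^esub> ?h y"
      using ops pm(3) xy len[OF P.a_closed[OF c[OF xy(1)] c[OF xy(2)]]] by (intro nth_equalityI) auto
  next
    show "?h \<one>\<^bsub>R\<^esub> = \<one>\<^bsub>?P\<^esub>"
      using pm(4) RDirProd_list_one_nth[of _ Rs] RDirProd_list_one_length[of Rs] by (intro nth_equalityI) auto
  qed (rule c)
  moreover have "bij_betw ?h (carrier R) (carrier ?P)"
  proof (rule bij_betw_imageI)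
    show "inj_on ?h (carrier R)"
    proof (rule inj_onI)
      fix x y assume xy: "x \<in> carrier R" "y \<in> carrier R" "?h x = ?h y"
      have "\<pi> i x = \<pi> i y" if "i < length Rs" for i using arg_cong[OF xy(3), of "\<lambda>l. l ! i"] that by simp
      then show "x = y" using D xy by (simp add: prod_decomp_def)
    qed
    show "?h ` carrier R = carrier ?P"
    proof
      show "?h ` carrier R \<subseteq> carrier ?P" using c by blast
      show "carrier ?P \<subseteq> ?h ` carrier R"
      proof
        fix xs assume xs: "xs \<in> carrier ?P"
        have "\<forall>i<length Rs. xs ! i \<in> carrier (Rs ! i)" using RDirProd_list_carrier_mem(2)[OF xs] by blast
        then obtain r where r: "r \<in> carrier R" "\<forall>i<length Rs. \<pi> i r = xs ! i" using D unfolding prod_decomp_def by blast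
        have "?h r = xs" using r(2) len[OF xs] by (intro nth_equalityI) auto
        then show "xs \<in> ?h ` carrier R" using r(1) by blast
      qed
    qed
  qed
  ultimately show ?thesis by (auto simp: is_ring_iso_def ring_iso_def)
qed

locale krull_product = nontrivial_cring +
  fixes Rs \<pi>
  assumes decomp: "prod_decomp R Rs \<pi>" and factors: "\<And>i. i < length Rs \<Longrightarrow> krull_factor (Rs ! i)"
begin

abbreviation "n \<equiv> length Rs"

lemma Rs_cring: "i < n \<Longrightarrow> cring (Rs ! i)"
  using factors by (simp add: krull_factor_def)

lemma proj:
  assumes "i < n"
  shows "x \<in> carrier R \<Longrightarrow> \<pi> i x \<in> carrier (Rs ! i)"
    "x \<in> carrier R \<Longrightarrow> y \<in> carrier R \<Longrightarrow> \<pi> i (x \<otimes> y) = \<pi> i x \<otimes>\<^bsub>Rs ! i\<^esub> \<pi> i y"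
    "x \<in> carrier R \<Longrightarrow> y \<in> carrier R \<Longrightarrow> \<pi> i (x \<oplus> y) = \<pi> i x \<oplus>\<^bsub>Rs ! i\<^esub> \<pi> i y"
    "\<pi> i \<one> = \<one>\<^bsub>Rs ! i\<^esub>" "\<pi> i \<zero> = \<zero>\<^bsub>Rs ! i\<^esub>"
    "x \<in> carrier R \<Longrightarrow> y \<in> carrier R \<Longrightarrow> \<pi> i (x \<ominus> y) = \<pi> i x \<ominus>\<^bsub>Rs ! i\<^esub> \<pi> i y"
    "x \<in> carrier R \<Longrightarrow> \<pi> i (x [^] (k::nat)) = \<pi> i x [^]\<^bsub>Rs ! i\<^esub> k"
proof -
  have h: "\<pi> i \<in> ring_hom R (Rs ! i)" using decomp assms by (simp add: prod_decomp_def)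
  interpret S: cring "Rs ! i" by (rule Rs_cring[OF assms])
  interpret H: ring_hom_cring R "Rs ! i" "\<pi> i" by unfold_locales (rule h)
  show "x \<in> carrier R \<Longrightarrow> \<pi> i x \<in> carrier (Rs ! i)"
    "x \<in> carrier R \<Longrightarrow> y \<in> carrier R \<Longrightarrow> \<pi> i (x \<otimes> y) = \<pi> i x \<otimes>\<^bsub>Rs ! i\<^esub> \<pi> i y"
    "x \<in> carrier R \<Longrightarrow> y \<in> carrier R \<Longrightarrow> \<pi> i (x \<oplus> y) = \<pi> i x \<oplus>\<^bsub>Rs ! i\<^esub> \<pi> i y"
    "\<pi> i \<one> = \<one>\<^bsub>Rs ! i\<^esub>" "\<pi> i \<zero> = \<zero>\<^bsub>Rs ! i\<^esub>"
    "x \<in> carrier R \<Longrightarrow> y \<in> carrier R \<Longrightarrow> \<pi> i (x \<ominus> y) = \<pi> i x \<ominus>\<^bsub>Rs ! i\<^esub> \<pi> i y"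
    by (simp_all add: minus_eq S.minus_eq)
  show "\<pi> i (x [^] (k::nat)) = \<pi> i x [^]\<^bsub>Rs ! i\<^esub> k" if "x \<in> carrier R"
    using that by (induct k) auto
qed

lemma proj_eq: "x \<in> carrier R \<Longrightarrow> y \<in> carrier R \<Longrightarrow> (\<And>i. i < n \<Longrightarrow> \<pi> i x = \<pi> i y) \<Longrightarrow> x = y"
  using decomp by (simp add: prod_decomp_def)

lemma proj_surj:
  assumes "\<And>i. i < n \<Longrightarrow> z i \<in> carrier (Rs ! i)"
  obtains r where "r \<in> carrier R" "\<forall>i<n. \<pi> i r = z i"
proof -
  have "\<forall>z. (\<forall>i<n. z i \<in> carrier (Rs ! i)) \<longrightarrow> (\<exists>r\<in>carrier R. \<forall>i<n. \<pi> i r = z i)"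
    using decomp by (simp add: prod_decomp_def)
  then have "\<exists>r\<in>carrier R. \<forall>i<n. \<pi> i r = z i" using assms by blast
  then show thesis using that by blast
qed

lemma proj_single:
  assumes "i < n" "x \<in> carrier (Rs ! i)" "\<And>j. j < n \<Longrightarrow> c j \<in> carrier (Rs ! j)"
  obtains r where "r \<in> carrier R" "\<pi> i r = x" "\<forall>j<n. j \<noteq> i \<longrightarrow> \<pi> j r = c j"
proof -
  have z: "(if j = i then x else c j) \<in> carrier (Rs ! j)" if "j < n" for j using assms that by simp
  obtain r where "r \<in> carrier R" "\<forall>j<n. \<pi> j r = (if j = i then x else c j)" by (rule proj_surj[OF z])
  then show thesis using that[of r] assms(1) by auto
qed

lemma carriers: "j < n \<Longrightarrow> \<one>\<^bsub>Rs ! j\<^esub> \<in> carrier (Rs ! j)" "j < n \<Longrightarrow> \<zero>\<^bsub>Rs ! j\<^esub> \<in> carrier (Rs ! j)"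
  using proj(1)[OF _ one_closed] proj(1)[OF _ zero_closed] proj(4,5) by metis+

lemma proj_regular:
  assumes s: "s \<in> regular_elements R" and i: "i < n"
  shows "\<pi> i s \<in> regular_elements (Rs ! i)"
proof -
  have sc: "s \<in> carrier R" using regular_closed[OF s] .
  have "b = \<zero>\<^bsub>Rs ! i\<^esub>" if b: "b \<in> carrier (Rs ! i)" "\<pi> i s \<otimes>\<^bsub>Rs ! i\<^esub> b = \<zero>\<^bsub>Rs ! i\<^esub>" for b
  proof -
    obtain r where r: "r \<in> carrier R" "\<pi> i r = b" "\<forall>j<n. j \<noteq> i \<longrightarrow> \<pi> j r = \<zero>\<^bsub>Rs ! j\<^esub>"
      using proj_single[OF i b(1) carriers(2)] .
    have "s \<otimes> r = \<zero>"
    proof (rule proj_eq)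
      fix j assume j: "j < n"
      interpret S: cring "Rs ! j" by (rule Rs_cring[OF j])
      show "\<pi> j (s \<otimes> r) = \<pi> j \<zero>" using proj[OF j] sc r b(2) j by (cases "j = i") auto
    qed (use sc r in auto)
    then have "r = \<zero>" using s r(1) by (simp add: regular_elements_def)
    then show ?thesis using r(2) proj(5)[OF i] by simp
  qed
  then show ?thesis using proj(1)[OF i sc] by (simp add: regular_elements_def)
qed

lemma regular_proj:
  assumes s: "s \<in> carrier R" "\<And>i. i < n \<Longrightarrow> \<pi> i s \<in> regular_elements (Rs ! i)"
  shows "s \<in> regular_elements R"
proof -
  have "b = \<zero>" if b: "b \<in> carrier R" "s \<otimes> b = \<zero>" for b
  proof (rule proj_eq)
    fix i assume i: "i < n"
    have "\<pi> i s \<otimes>\<^bsub>Rs ! i\<^esub> \<pi> i b = \<zero>\<^bsub>Rs ! i\<^esub>" using proj(2)[OF i s(1) b(1)] b(2) proj(5)[OF i] by simp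
    then show "\<pi> i b = \<pi> i \<zero>" using s(2)[OF i] proj(1)[OF i b(1)] proj(5)[OF i] by (simp add: regular_elements_def)
  qed (use b in auto)
  then show ?thesis using s by (simp add: regular_elements_def)
qed

lemma regular_single:
  assumes i: "i < n" and x: "x \<in> regular_elements (Rs ! i)"
  obtains s where "s \<in> regular_elements R" "\<pi> i s = x" "\<forall>j<n. j \<noteq> i \<longrightarrow> \<pi> j s = \<one>\<^bsub>Rs ! j\<^esub>"
proof -
  have xc: "x \<in> carrier (Rs ! i)" using x by (simp add: regular_elements_def)
  obtain s where s: "s \<in> carrier R" "\<pi> i s = x" "\<forall>j<n. j \<noteq> i \<longrightarrow> \<pi> j s = \<one>\<^bsub>Rs ! j\<^esub>"
    using proj_single[OF i xc carriers(1)] .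
  have "s \<in> regular_elements R"
  proof (rule regular_proj[OF s(1)])
    fix j assume j: "j < n"
    interpret S: cring "Rs ! j" by (rule Rs_cring[OF j])
    show "\<pi> j s \<in> regular_elements (Rs ! j)" using s(2,3) j x S.regular_one by (cases "j = i") auto
  qed
  then show thesis using that s by blast
qed

text \<open>The valuations are those of the factors composed with the projections. An element is
  regular exactly if all its coordinates are, so each clause can be checked coordinatewise.\<close>

lemma product_krull: "krull_ring R"
proof -
  have "\<forall>i. \<exists>W. i < n \<longrightarrow> krull_vals (Rs ! i) W" using factors by (auto simp: krull_factor_def)
  then obtain W where W: "\<And>i. i < n \<Longrightarrow> krull_vals (Rs ! i) (W i)" by metis
  note D = krull_valsD[OF W]
  let ?W = "\<Union>i<n. (\<lambda>v r. v (\<pi> i r)) ` W i"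
  have mem: "\<exists>i<n. \<exists>v\<in>W i. w = (\<lambda>r. v (\<pi> i r))" if "w \<in> ?W" for w using that by blast
  have "krull_vals R ?W"
  proof (rule krull_valsI)
    fix w a assume "w \<in> ?W" and a: "a \<in> carrier R"
    then obtain i v where "i < n" "v \<in> W i" "w = (\<lambda>r. v (\<pi> i r))" using mem by blast
    then show "0 \<le> w a" using D(1) proj(1) a by simp
  next
    fix w a b assume "w \<in> ?W" and ab: "a \<in> carrier R" "b \<in> carrier R"
    then obtain i v where i: "i < n" "v \<in> W i" "w = (\<lambda>r. v (\<pi> i r))" using mem by blast
    note pc = proj(1)[OF i(1) ab(1)] proj(1)[OF i(1) ab(2)]
    show "w (a \<otimes> b) = w a + w b" using D(2)[OF i(1,2) pc] proj(2)[OF i(1) ab] i(3) by simp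
    show "min (w a) (w b) \<le> w (a \<oplus> b)" using D(3)[OF i(1,2) pc] proj(3)[OF i(1) ab] i(3) by simp
  next
    fix w assume "w \<in> ?W"
    then obtain i v where i: "i < n" "v \<in> W i" "w = (\<lambda>r. v (\<pi> i r))" using mem by blast
    show "w \<zero> = Pinf" using D(4)[OF i(1,2)] proj(5)[OF i(1)] i(3) by simp
    obtain a s where as: "a \<in> carrier (Rs ! i)" "s \<in> regular_elements (Rs ! i)" "v a = v s + 1" using D(6)[OF i(1,2)] by blast
    obtain a' where a': "a' \<in> carrier R" "\<pi> i a' = a" using proj_single[OF i(1) as(1) carriers(1)] by blast
    obtain s' where s': "s' \<in> regular_elements R" "\<pi> i s' = s" using regular_single[OF i(1) as(2)] by blast
    show "\<exists>a\<in>carrier R. \<exists>s\<in>regular_elements R. w a = w s + 1" using a' s' as(3) i(3) by blast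
    obtain r where r: "r \<in> regular_elements (Rs ! i)" "0 < v r" using D(7)[OF i(1,2)] by blast
    obtain r' where "r' \<in> regular_elements R" "\<pi> i r' = r" using regular_single[OF i(1) r(1)] by blast
    then show "\<exists>r\<in>regular_elements R. 0 < w r" using r(2) i(3) by blast
  next
    fix w s assume "w \<in> ?W" and s: "s \<in> regular_elements R"
    then obtain i v where i: "i < n" "v \<in> W i" "w = (\<lambda>r. v (\<pi> i r))" using mem by blast
    then show "w s \<noteq> Pinf" using D(5)[OF i(1,2) proj_regular[OF s i(1)]] by simp
  next
    fix a s assume as: "a \<in> carrier R" "s \<in> regular_elements R" and le: "\<And>w. w \<in> ?W \<Longrightarrow> w s \<le> w a"
    have sc: "s \<in> carrier R" using regular_closed[OF as(2)] .
    have "\<exists>c\<in>carrier (Rs ! i). \<pi> i a = \<pi> i s \<otimes>\<^bsub>Rs ! i\<^esub> c" if i: "i < n" for i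
    proof (rule D(8)[OF i proj(1)[OF i as(1)] proj_regular[OF as(2) i]])
      fix v assume "v \<in> W i"
      then have "(\<lambda>r. v (\<pi> i r)) \<in> ?W" using i by blast
      from le[OF this] show "v (\<pi> i s) \<le> v (\<pi> i a)" .
    qed
    then obtain c where c: "\<And>i. i < n \<Longrightarrow> c i \<in> carrier (Rs ! i)" "\<And>i. i < n \<Longrightarrow> \<pi> i a = \<pi> i s \<otimes>\<^bsub>Rs ! i\<^esub> c i"
      by metis
    obtain r where r: "r \<in> carrier R" "\<forall>i<n. \<pi> i r = c i" using proj_surj[OF c(1)] .
    have "a = s \<otimes> r" by (rule proj_eq) (use as sc r c proj(2) in auto)
    then show "\<exists>c\<in>carrier R. a = s \<otimes> c" using r(1) by blast
  next
    fix a assume a: "a \<in> regular_elements R"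
    have "{w \<in> ?W. w a \<noteq> 0} \<subseteq> (\<Union>i<n. (\<lambda>v r. v (\<pi> i r)) ` {v \<in> W i. v (\<pi> i a) \<noteq> 0})" by auto
    moreover have "finite (\<Union>i<n. (\<lambda>v r. v (\<pi> i r)) ` {v \<in> W i. v (\<pi> i a) \<noteq> 0})"
      using D(9)[OF _ proj_regular[OF a]] by auto
    ultimately show "finite {w \<in> ?W. w a \<noteq> 0}" by (rule finite_subset)
  qed
  then show ?thesis using krull_vals_iff by blast
qed

text \<open>p i has the nilpotent generator in coordinate i and 1 elsewhere, so its principal ideal
  is the preimage of a prime of the i-th factor. The last clause comes from keeping coordinate i of
  r and putting 1 elsewhere; it says that non-members agree with regular elements modulo p i, and it
  yields dimension zero.\<close>

lemma product_primes:
  "\<exists>p k. (\<forall>i<n. p i \<in> carrier R \<and> prime_element R (p i) \<and> \<pi> i (p i) [^]\<^bsub>Rs ! i\<^esub> (k i::nat) = \<zero>\<^bsub>Rs ! i\<^esub> \<and>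
     (\<forall>r\<in>carrier R. r \<in> PIdl (p i) \<or> (\<exists>s\<in>regular_elements R. s \<ominus> r \<in> PIdl (p i))))"
proof -
  have "\<exists>p k. p \<in> carrier R \<and> prime_element R p \<and> \<pi> i p [^]\<^bsub>Rs ! i\<^esub> (k::nat) = \<zero>\<^bsub>Rs ! i\<^esub> \<and>
     (\<forall>r\<in>carrier R. r \<in> PIdl p \<or> (\<exists>s\<in>regular_elements R. s \<ominus> r \<in> PIdl p))" if i: "i < n" for i
  proof -
    interpret S: cring "Rs ! i" by (rule Rs_cring[OF i])
    obtain g k where g: "g \<in> carrier (Rs ! i)" "g [^]\<^bsub>Rs ! i\<^esub> (k::nat) = \<zero>\<^bsub>Rs ! i\<^esub>" "primeideal (PIdl\<^bsub>Rs ! i\<^esub> g) (Rs ! i)"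
      "\<forall>x\<in>carrier (Rs ! i). x \<in> PIdl\<^bsub>Rs ! i\<^esub> g \<or> x \<in> regular_elements (Rs ! i)"
      using factors[OF i] by (auto simp: krull_factor_def)
    obtain p where p: "p \<in> carrier R" "\<pi> i p = g" "\<forall>j<n. j \<noteq> i \<longrightarrow> \<pi> j p = \<one>\<^bsub>Rs ! j\<^esub>"
      using proj_single[OF i g(1) carriers(1)] .
    have P: "r \<in> PIdl p \<longleftrightarrow> \<pi> i r \<in> PIdl\<^bsub>Rs ! i\<^esub> g" if r: "r \<in> carrier R" for r
    proof
      assume "r \<in> PIdl p"
      then obtain c where "c \<in> carrier R" "r = c \<otimes> p" by (auto simp: cgenideal_def)
      then show "\<pi> i r \<in> PIdl\<^bsub>Rs ! i\<^esub> g" using proj(1,2)[OF i] p by (auto simp: cgenideal_def)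
    next
      assume "\<pi> i r \<in> PIdl\<^bsub>Rs ! i\<^esub> g"
      then obtain c where c: "c \<in> carrier (Rs ! i)" "\<pi> i r = c \<otimes>\<^bsub>Rs ! i\<^esub> g" by (auto simp: cgenideal_def)
      obtain d where d: "d \<in> carrier R" "\<pi> i d = c" "\<forall>j<n. j \<noteq> i \<longrightarrow> \<pi> j d = \<pi> j r"
        using proj_single[OF i c(1) proj(1)[OF _ r]] .
      have "r = d \<otimes> p"
      proof (rule proj_eq)
        fix j assume j: "j < n"
        interpret Sj: cring "Rs ! j" by (rule Rs_cring[OF j])
        show "\<pi> j r = \<pi> j (d \<otimes> p)" using proj(1,2)[OF j] r d p c j by (cases "j = i") auto
      qed (use r d p in auto)
      then show "r \<in> PIdl p" using d(1) by (auto simp: cgenideal_def)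
    qed
    have I: "ideal (PIdl p) R" by (rule cgenideal_ideal[OF p(1)])
    have Ic: "PIdl p \<subseteq> carrier R" by (rule ideal_carrier[OF I])
    have "primeideal (PIdl p) R" unfolding primeideal_iff
    proof (intro conjI ballI impI)
      show "\<one> \<notin> PIdl p" using P[OF one_closed] proj(4)[OF i] g(3) S.primeideal_iff by simp
      fix a b assume ab: "a \<in> carrier R" "b \<in> carrier R" "a \<otimes> b \<in> PIdl p"
      then have "\<pi> i a \<otimes>\<^bsub>Rs ! i\<^esub> \<pi> i b \<in> PIdl\<^bsub>Rs ! i\<^esub> g" using P[OF m_closed[OF ab(1,2)]] proj(2)[OF i ab(1,2)] by simp
      then have "\<pi> i a \<in> PIdl\<^bsub>Rs ! i\<^esub> g \<or> \<pi> i b \<in> PIdl\<^bsub>Rs ! i\<^esub> g"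
        using g(3) proj(1)[OF i] ab(1,2) unfolding S.primeideal_iff by blast
      then show "a \<in> PIdl p \<or> b \<in> PIdl p" using P ab(1,2) by blast
    qed (rule I)
    then have "prime_element R p" using p(1) by (simp add: prime_element_def)
    moreover have "r \<in> PIdl p \<or> (\<exists>s\<in>regular_elements R. s \<ominus> r \<in> PIdl p)" if r: "r \<in> carrier R" for r
    proof (subst disj_commute, rule disjCI)
      assume "r \<notin> PIdl p"
      then have "\<pi> i r \<in> regular_elements (Rs ! i)" using P[OF r] g(4) proj(1)[OF i r] by blast
      then obtain s where s: "s \<in> regular_elements R" "\<pi> i s = \<pi> i r" by (rule regular_single[OF i])
      have sc: "s \<in> carrier R" using regular_closed[OF s(1)] .
      have "\<pi> i (s \<ominus> r) = \<zero>\<^bsub>Rs ! i\<^esub>" using proj(6)[OF i sc r] s(2) proj(1)[OF i r] by (simp add: S.minus_eq S.r_neg)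
      moreover have "\<zero>\<^bsub>Rs ! i\<^esub> \<in> PIdl\<^bsub>Rs ! i\<^esub> g" using S.cgenideal_ideal[OF g(1)] by (simp add: S.ideal_iff)
      ultimately have "s \<ominus> r \<in> PIdl p" using P[of "s \<ominus> r"] sc r by simp
      then show "\<exists>s\<in>regular_elements R. s \<ominus> r \<in> PIdl p" using s(1) by blast
    qed
    ultimately show ?thesis using p(1,2) g(2) by metis
  qed
  then show ?thesis by metis
qed

lemma product_prime_elements:
  "\<exists>ps. (\<forall>p\<in>set ps. prime_element R p) \<and> \<zero> = foldr (\<lambda>x y. x \<otimes> y) ps \<one> \<and>
     (\<forall>p\<in>set ps. \<forall>r\<in>carrier R. r \<in> PIdl p \<or> (\<exists>s\<in>regular_elements R. s \<ominus> r \<in> PIdl p))"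
proof -
  obtain p k where p: "\<And>i. i < n \<Longrightarrow> p i \<in> carrier R" "\<And>i. i < n \<Longrightarrow> prime_element R (p i)"
    "\<And>i. i < n \<Longrightarrow> \<pi> i (p i) [^]\<^bsub>Rs ! i\<^esub> (k i::nat) = \<zero>\<^bsub>Rs ! i\<^esub>"
    "\<And>i r. i < n \<Longrightarrow> r \<in> carrier R \<Longrightarrow> r \<in> PIdl (p i) \<or> (\<exists>s\<in>regular_elements R. s \<ominus> r \<in> PIdl (p i))"
    using product_primes by metis
  let ?F = "\<lambda>ps. foldr (\<lambda>x y. x \<otimes> y) ps \<one>"
  have cl: "?F ps \<in> carrier R" if "set ps \<subseteq> carrier R" for ps using foldr_iota[OF that] by blast
  have app: "?F (ps @ qs) = ?F ps \<otimes> ?F qs" if "set ps \<subseteq> carrier R" "set qs \<subseteq> carrier R" for ps qs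
    using that
  proof (induct ps)
    case Nil then show ?case using cl[of qs] by simp
  next
    case (Cons q ps) then show ?case using cl[of qs] cl[of ps] by (simp add: m_assoc)
  qed
  have rep: "?F (replicate l q) = q [^] l" if "q \<in> carrier R" for l :: nat and q
    using that by (induct l) (auto simp: m_comm)
  \<comment> \<open>Each p i is repeated as often as its i-th coordinate needs to become zero, so
    the full product vanishes in every coordinate.\<close>
  let ?L = "\<lambda>m. concat (map (\<lambda>i. replicate (k i) (p i)) [0..<m])"
  have Lc: "set (?L m) \<subseteq> p ` {..<m}" for m by auto
  have LR: "set (?L m) \<subseteq> carrier R" if "m \<le> n" for m using Lc[of m] p(1) that by fastforce
  have z: "\<pi> j (?F (?L m)) = \<zero>\<^bsub>Rs ! j\<^esub>" if "m \<le> n" "j < m" for m j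
    using that
  proof (induct m)
    case (Suc m)
    have m: "m < n" and j: "j < n" using Suc by auto
    interpret S: cring "Rs ! j" by (rule Rs_cring[OF j])
    have c: "set (?L m) \<subseteq> carrier R" "set (replicate (k m) (p m)) \<subseteq> carrier R" using LR[of m] p(1)[OF m] m by auto
    have "?F (?L (Suc m)) = ?F (?L m) \<otimes> p m [^] k m" using app[OF c] rep[OF p(1)[OF m]] by simp
    then have e: "\<pi> j (?F (?L (Suc m))) = \<pi> j (?F (?L m)) \<otimes>\<^bsub>Rs ! j\<^esub> \<pi> j (p m) [^]\<^bsub>Rs ! j\<^esub> k m"
      using proj(2)[OF j cl[OF c(1)], of "p m [^] k m"] proj(7)[OF j p(1)[OF m]] p(1)[OF m] by simp
    have pc: "\<pi> j (p m) \<in> carrier (Rs ! j)" "\<pi> j (?F (?L m)) \<in> carrier (Rs ! j)" using proj(1)[OF j] p(1)[OF m] cl[OF c(1)] by auto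
    show ?case
    proof (cases "j = m")
      case True
      have "\<pi> j (p m) [^]\<^bsub>Rs ! j\<^esub> k m = \<zero>\<^bsub>Rs ! j\<^esub>" using p(3)[OF m] True by simp
      then show ?thesis unfolding e using pc by simp
    next
      case False
      then have "\<pi> j (?F (?L m)) = \<zero>\<^bsub>Rs ! j\<^esub>" using Suc by simp
      then show ?thesis unfolding e using pc by simp
    qed
  qed simp
  have zero: "\<zero> = ?F (?L n)"
    by (rule proj_eq) (use z[OF order_refl] proj(5) cl[OF LR[OF order_refl]] in auto)
  have e: "\<exists>i<n. q = p i" if "q \<in> set (?L n)" for q using Lc[of n] that by blast
  show ?thesis
  proof (intro exI[of _ "?L n"] conjI ballI)
    show "prime_element R q" if "q \<in> set (?L n)" for q using e[OF that] p(2) by blast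
    show "r \<in> PIdl q \<or> (\<exists>s\<in>regular_elements R. s \<ominus> r \<in> PIdl q)" if "q \<in> set (?L n)" "r \<in> carrier R" for q r
      using e[OF that(1)] p(4) that(2) by blast
  qed (rule zero)
qed

text \<open>P contains one of the prime elements p whose product is 0. An r in P' outside P is
  congruent modulo p to a regular element, which would then lie in P'.\<close>

lemma product_zero_dimensional: "fp.zero_dimensional"
  unfolding zero_dimensional_iff_regular
proof (intro allI impI)
  fix P P' assume h: "primeideal P R \<and> primeideal P' R \<and> P \<subseteq> P' \<and> P' \<inter> regular_elements R = {}"
  obtain ps where ps: "\<forall>p\<in>set ps. prime_element R p" "\<zero> = foldr (\<lambda>x y. x \<otimes> y) ps \<one>"
    "\<forall>p\<in>set ps. \<forall>r\<in>carrier R. r \<in> PIdl p \<or> (\<exists>s\<in>regular_elements R. s \<ominus> r \<in> PIdl p)"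
    using product_prime_elements by blast
  have P: "ideal P R" "\<one> \<notin> P" "\<And>a b. a \<in> carrier R \<Longrightarrow> b \<in> carrier R \<Longrightarrow> a \<otimes> b \<in> P \<Longrightarrow> a \<in> P \<or> b \<in> P"
    using h primeideal_iff by auto
  have P': "ideal P' R" using h primeideal_iff by auto
  have "\<exists>p\<in>set qs. p \<in> P" if "set qs \<subseteq> carrier R" "foldr (\<lambda>x y. x \<otimes> y) qs \<one> \<in> P" for qs
    using that
  proof (induct qs)
    case (Cons q qs)
    then have "q \<in> P \<or> foldr (\<lambda>x y. x \<otimes> y) qs \<one> \<in> P"
      using P(3)[of q] foldr_iota[of qs] by simp
    then show ?case using Cons by auto
  qed (use P in simp)
  moreover have "set ps \<subseteq> carrier R" using ps(1) by (auto simp: prime_element_def)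
  moreover have "foldr (\<lambda>x y. x \<otimes> y) ps \<one> \<in> P" using ps(2) P(1) by (simp add: ideal_iff)
  ultimately obtain p where p: "p \<in> set ps" "p \<in> P" by blast
  then have sub: "PIdl p \<subseteq> P" using cgenideal_minimal[OF P(1)] by blast
  have "r \<in> P" if r: "r \<in> P'" for r
  proof (rule ccontr)
    assume "r \<notin> P"
    have rc: "r \<in> carrier R" using r ideal_carrier[OF P'] by blast
    then obtain s where s: "s \<in> regular_elements R" "s \<ominus> r \<in> PIdl p" using ps(3) p(1) sub \<open>r \<notin> P\<close> by blast
    then have "s \<ominus> r \<in> P'" using sub h by blast
    then have "(s \<ominus> r) \<oplus> r \<in> P'" using P' r by (simp add: ideal_iff)
    then have "s \<in> P'" using rc regular_closed[OF s(1)] by (simp add: minus_eq a_assoc l_neg)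
    then show False using h s(1) by blast
  qed
  then show "P = P'" using h by blast
qed

end

section \<open>General Krull rings and decompositions\<close>

context nontrivial_cring
begin

lemma general_krull_imp:
  assumes "general_krull_ring R"
  shows "krull_ring R" "\<exists>ps. (\<forall>p\<in>set ps. prime_element R p) \<and> \<zero> = foldr (\<lambda>x y. x \<otimes> y) ps \<one>" "fp.zero_dimensional"
proof -
  obtain Rs :: "'a ring list" where Rs: "\<forall>S\<in>set Rs. krull_domain S \<or> special_primary_ring S" "R \<simeq> RDirProd_list Rs"
    using assms by (auto simp: general_krull_ring_def)
  obtain \<pi> where \<pi>: "prod_decomp R Rs \<pi>" using iso_prod_decomp[OF Rs(2)] ..
  interpret krull_product R Rs \<pi>
  proof unfold_locales
    fix i assume "i < length Rs"
    then show "krull_factor (Rs ! i)"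
      using Rs(1) krull_domain_factor special_primary_ring_factor nth_mem by blast
  qed (rule \<pi>)
  show "krull_ring R" "fp.zero_dimensional" by (rule product_krull product_zero_dimensional)+
  show "\<exists>ps. (\<forall>p\<in>set ps. prime_element R p) \<and> \<zero> = foldr (\<lambda>x y. x \<otimes> y) ps \<one>"
    using product_prime_elements by blast
qed

text \<open>If e P = 0, primality of P makes e R a domain. Otherwise e p generates the maximal ideal
  of e R and is nilpotent, and elements outside P are invertible.\<close>

lemma component_idem_ring:
  assumes W: "krull_vals R W" and e: "e \<in> carrier R" and C: "fp.component (\<iota> e) P"
  shows "krull_domain (idem_ring R e) \<or> special_primary_ring (idem_ring R e)"
proof -
  note c = fp.componentD[OF C]
  have ee: "e \<otimes> e = e" using c(2) iota_eq[of "e \<otimes> e" e] e by simp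
  have e0: "e \<noteq> \<zero>" using c(4) fp.A_moduleD(2)[OF fp.A_prime_A_module[OF c(3)]] by auto
  note B = idem_ring_carrier[OF e ee]
  interpret B: cring "idem_ring R e" by (rule idem_ring_cring[OF e ee])
  have \<iota>A: "\<iota> x \<in> \<iota> ` carrier R" if "x \<in> carrier R" for x using that by blast
  from C show ?thesis
  proof (cases rule: fp.component_cases)
    case dom
    have "krull_domain (idem_ring R e)"
    proof (rule idem_ring_krull_domain[OF e ee e0 W])
      fix x y assume xy: "x \<in> carrier (idem_ring R e)" "y \<in> carrier (idem_ring R e)" "x \<otimes> y = \<zero>"
      have xc: "x \<in> carrier R" "e \<otimes> x = x" "y \<in> carrier R" "e \<otimes> y = y" using xy(1,2) B by auto
      have z: "z = \<zero>" if z: "z \<in> carrier R" "e \<otimes> z = z" "\<iota> z \<in> P" for z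
      proof -
        have "\<iota> (e \<otimes> z) = \<zero>\<^bsub>Q\<^esub>" using dom z(3) iota_simps(3)[OF e z(1)] by simp
        then have "\<iota> z = \<iota> \<zero>" using z(2) by simp
        then show ?thesis using iota_eq[OF z(1) zero_closed] by blast
      qed
      have "\<iota> x \<otimes>\<^bsub>Q\<^esub> \<iota> y \<in> P" using fp.A_moduleD(2)[OF fp.A_prime_A_module[OF c(3)]] iota_simps(3)[OF xc(1,3)] xy(3) by simp
      then have "\<iota> x \<in> P \<or> \<iota> y \<in> P" using fp.A_prime_mem[OF c(3) _ \<iota>A[OF xc(1)] \<iota>A[OF xc(3)]] by blast
      then show "x = \<zero> \<or> y = \<zero>" using z xc by blast
    qed
    then show ?thesis ..
  next
    case (spr p k)
    obtain p0 where p0: "p0 \<in> carrier R" "p = \<iota> p0" using fp.A_prime_A[OF c(3) spr(2)] by blast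
    define q where "q = e \<otimes> p0"
    have qB: "q \<in> carrier (idem_ring R e)" unfolding q_def by (rule idem_ring_mem[OF e p0(1)])
    have qc: "q \<in> carrier R" using qB B by blast
    have ip: "\<iota> (x [^] m) = \<iota> x [^]\<^bsub>Q\<^esub> m" if "x \<in> carrier R" for x and m :: nat
      using that by (induct m) auto
    have ek: "e \<otimes> p0 [^] k = \<zero>"
    proof -
      have "\<iota> (e \<otimes> p0 [^] k) = \<iota> \<zero>" using spr(3) p0 e ip[OF p0(1)] by simp
      then show ?thesis using iota_eq[of "e \<otimes> p0 [^] k" \<zero>] e p0(1) by simp
    qed
    have pw: "x [^]\<^bsub>idem_ring R e\<^esub> Suc m = x [^] Suc m" if "x \<in> carrier (idem_ring R e)" for x and m :: nat
    proof (induct m)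
      case 0
      then show ?case using that B by simp
    next
      case (Suc m)
      have "x [^]\<^bsub>idem_ring R e\<^esub> Suc (Suc m) = x [^]\<^bsub>idem_ring R e\<^esub> Suc m \<otimes> x" by simp
      then show ?case unfolding Suc by simp
    qed
    have q0: "q [^]\<^bsub>idem_ring R e\<^esub> Suc k = \<zero>\<^bsub>idem_ring R e\<^esub>"
    proof -
      have "q [^] Suc k = e [^] Suc k \<otimes> p0 [^] Suc k" unfolding q_def using e p0(1) by (simp only: nat_pow_distrib)
      also have "\<dots> = e [^] k \<otimes> ((e \<otimes> p0 [^] k) \<otimes> p0)" using e p0(1) by (simp add: m_assoc)
      finally show ?thesis unfolding pw[OF qB] using ek e p0(1) by simp
    qed
    have "special_primary_ring (idem_ring R e)"
    proof (rule B.special_primary_ringI[OF qB q0])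
      show "\<one>\<^bsub>idem_ring R e\<^esub> \<notin> PIdl\<^bsub>idem_ring R e\<^esub> q"
      proof
        assume "\<one>\<^bsub>idem_ring R e\<^esub> \<in> PIdl\<^bsub>idem_ring R e\<^esub> q"
        then obtain d where d: "d \<in> carrier (idem_ring R e)" "e = d \<otimes> q" by (auto simp: cgenideal_def)
        have dc: "d \<in> carrier R" using d(1) B by blast
        have "\<iota> e = \<iota> (d \<otimes> q)" using arg_cong[OF d(2)] .
        also have "\<dots> = (\<iota> d \<otimes>\<^bsub>Q\<^esub> \<iota> e) \<otimes>\<^bsub>Q\<^esub> p" unfolding q_def p0(2) using dc e p0(1) by (simp add: fp.m_assoc)
        also have "\<dots> \<in> P" by (rule fp.A_moduleD(4)[OF fp.A_prime_A_module[OF c(3)] fp.A_mult[OF \<iota>A[OF dc] \<iota>A[OF e]] spr(2)])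
        finally show False using c(4) by simp
      qed
      fix x assume x: "x \<in> carrier (idem_ring R e)"
      have xc: "x \<in> carrier R" "e \<otimes> x = x" using x B by auto
      show "x \<in> PIdl\<^bsub>idem_ring R e\<^esub> q \<or> (\<exists>y\<in>carrier (idem_ring R e). x \<otimes>\<^bsub>idem_ring R e\<^esub> y = \<one>\<^bsub>idem_ring R e\<^esub>)"
      proof (cases "\<iota> x \<in> P")
        case True
        then obtain d where d: "d \<in> carrier R" "\<iota> e \<otimes>\<^bsub>Q\<^esub> \<iota> x = \<iota> e \<otimes>\<^bsub>Q\<^esub> (p \<otimes>\<^bsub>Q\<^esub> \<iota> d)" using spr(4) by blast
        have "\<iota> (e \<otimes> x) = \<iota> (e \<otimes> (p0 \<otimes> d))" using d e xc(1) p0 by simp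
        then have "x = e \<otimes> (p0 \<otimes> d)" using iota_eq[of "e \<otimes> x" "e \<otimes> (p0 \<otimes> d)"] e xc p0(1) d(1) by simp
        also have "\<dots> = (e \<otimes> e) \<otimes> (p0 \<otimes> d)" using ee by simp
        also have "\<dots> = (e \<otimes> d) \<otimes> q" unfolding q_def using e p0(1) d(1) by (simp add: m_ac)
        finally show ?thesis using idem_ring_mem[OF e d(1)] by (auto simp: cgenideal_def)
      next
        case False
        \<comment> \<open>The inverse y is only in Q, but e y lies in the ring because the whole
          factor e Q does.\<close>
        obtain y where y: "y \<in> carrier Q" "\<iota> e \<otimes>\<^bsub>Q\<^esub> (\<iota> x \<otimes>\<^bsub>Q\<^esub> y) = \<iota> e" using c(7)[OF \<iota>A[OF xc(1)] False] by blast
        obtain y0 where y0: "y0 \<in> carrier R" "\<iota> e \<otimes>\<^bsub>Q\<^esub> y = \<iota> y0" using spr(1) y(1) by blast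
        have "\<iota> (x \<otimes> y0) = \<iota> e"
        proof -
          have "\<iota> (x \<otimes> y0) = \<iota> x \<otimes>\<^bsub>Q\<^esub> (\<iota> e \<otimes>\<^bsub>Q\<^esub> y)" using xc y0 by simp
          also have "\<dots> = \<iota> e \<otimes>\<^bsub>Q\<^esub> (\<iota> x \<otimes>\<^bsub>Q\<^esub> y)" using xc(1) e y(1) by (simp add: fp.m_lcomm)
          finally show ?thesis using y(2) by simp
        qed
        then have "x \<otimes> y0 = e" using iota_eq[of "x \<otimes> y0" e] xc y0 e by simp
        moreover have "x \<otimes> (e \<otimes> y0) = e \<otimes> (x \<otimes> y0)" using xc(1) e y0(1) by (simp add: m_lcomm)
        ultimately have "x \<otimes> (e \<otimes> y0) = e" using ee by simp
        then show ?thesis using idem_ring_mem[OF e y0(1)] by auto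
      qed
    qed
    then show ?thesis ..
  qed
qed

lemma decomp_general_krull:
  assumes K: fp.krull and D: "fp.decomp S E"
  shows "general_krull_ring R"
proof -
  obtain W where W: "krull_vals R W" using krull_iff krull_vals_iff K by blast
  note d = fp.decompD[OF D]
  obtain Ls where Ls: "set Ls = S" "distinct Ls" using finite_distinct_list[OF d(1)] by blast
  have "\<exists>x. x \<in> carrier R \<and> \<iota> x = E P" if "P \<in> S" for P using fp.componentD(1)[OF d(2)[OF that]] by auto
  then obtain f where f: "\<And>P. P \<in> S \<Longrightarrow> f P \<in> carrier R \<and> \<iota> (f P) = E P" by metis
  define m where "m = length Ls"
  define e where "e i = f (Ls ! i)" for i
  have LS: "Ls ! i \<in> S" if "i < m" for i using that Ls(1) nth_mem unfolding m_def by blast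
  have e: "e i \<in> carrier R" "\<iota> (e i) = E (Ls ! i)" if "i < m" for i using f[OF LS[OF that]] by (auto simp: e_def)
  have C: "fp.component (\<iota> (e i)) (Ls ! i)" if "i < m" for i using d(2)[OF LS[OF that]] e(2)[OF that] by simp
  have ee: "e i \<otimes> e i = e i" if "i < m" for i
    using fp.componentD(2)[OF C[OF that]] iota_eq[of "e i \<otimes> e i" "e i"] e(1)[OF that] by simp
  have orth: "e i \<otimes> e j = \<zero>" if ij: "i < m" "j < m" "i \<noteq> j" for i j
  proof -
    have "Ls ! i \<noteq> Ls ! j" using Ls(2) ij by (simp add: nth_eq_iff_index_eq m_def)
    then have "\<iota> (e i \<otimes> e j) = \<iota> \<zero>" using d(3)[OF LS[OF ij(1)] LS[OF ij(2)]] e[OF ij(1)] e[OF ij(2)] by simp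
    then show ?thesis using iota_eq[of "e i \<otimes> e j" \<zero>] e(1)[OF ij(1)] e(1)[OF ij(2)] by simp
  qed
  have inj: "x = \<zero>" if x: "x \<in> carrier R" "\<And>i. i < m \<Longrightarrow> e i \<otimes> x = \<zero>" for x
  proof -
    have "\<iota> x = \<zero>\<^bsub>Q\<^esub>"
    proof (rule fp.decomp_zero[OF D])
      fix P assume "P \<in> S"
      then obtain i where i: "i < m" "P = Ls ! i" using Ls(1) by (metis in_set_conv_nth m_def)
      have "\<iota> (e i \<otimes> x) = \<zero>\<^bsub>Q\<^esub>" using x(2)[OF i(1)] by simp
      then show "E P \<otimes>\<^bsub>Q\<^esub> \<iota> x = \<zero>\<^bsub>Q\<^esub>" using e[OF i(1)] x(1) i(2) by simp
    qed (use x in simp)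
    then show ?thesis using iota_eq[OF x(1) zero_closed] by simp
  qed
  define Rs where "Rs = map (\<lambda>i. idem_ring R (e i)) [0..<m]"
  have len: "length Rs = m" and nth: "\<And>i. i < m \<Longrightarrow> Rs ! i = idem_ring R (e i)" by (auto simp: Rs_def)
  have "prod_decomp R Rs (\<lambda>i r. e i \<otimes> r)"
    unfolding prod_decomp_def len
  proof (intro conjI allI ballI impI)
    fix i assume i: "i < m"
    show "(\<lambda>r. e i \<otimes> r) \<in> ring_hom R (Rs ! i)" unfolding nth[OF i]
    proof (rule ring_hom_memI)
      fix x y assume xy: "x \<in> carrier R" "y \<in> carrier R"
      show "e i \<otimes> x \<in> carrier (idem_ring R (e i))" by (rule idem_ring_mem[OF e(1)[OF i] xy(1)])
      have "(e i \<otimes> x) \<otimes> (e i \<otimes> y) = (e i \<otimes> e i) \<otimes> (x \<otimes> y)" using e(1)[OF i] xy by (simp add: m_ac)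
      then show "e i \<otimes> (x \<otimes> y) = e i \<otimes> x \<otimes>\<^bsub>idem_ring R (e i)\<^esub> (e i \<otimes> y)" using ee[OF i] by simp
      show "e i \<otimes> (x \<oplus> y) = e i \<otimes> x \<oplus>\<^bsub>idem_ring R (e i)\<^esub> e i \<otimes> y" using e(1)[OF i] xy by (simp add: r_distr)
    qed (use e(1)[OF i] in simp)
  next
    fix x y assume xy: "x \<in> carrier R" "y \<in> carrier R" "\<forall>i<m. e i \<otimes> x = e i \<otimes> y"
    have "x \<ominus> y = \<zero>"
      by (rule inj) (use xy e(1) in \<open>auto simp: minus_eq r_distr r_minus r_neg\<close>)
    then show "x = y" using xy by simp
  next
    fix z assume z: "\<forall>i<m. z i \<in> carrier (Rs ! i)"
    have zc: "z i \<in> carrier R" "e i \<otimes> z i = z i" if "i < m" for i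
      using z that nth[OF that] idem_ring_carrier[OF e(1)[OF that] ee[OF that]] by auto
    let ?r = "\<Oplus>j\<in>{..<m}. z j"
    have zP: "z \<in> {..<m} \<rightarrow> carrier R" using zc by auto
    have "e i \<otimes> ?r = z i" if i: "i < m" for i
    proof -
      have "e i \<otimes> ?r = (\<Oplus>j\<in>{..<m}. e i \<otimes> z j)" using zP e(1)[OF i] by (intro finsum_rdistr) auto
      also have "\<dots> = (\<Oplus>j\<in>{..<m}. if i = j then z j else \<zero>)"
      proof (rule finsum_cong')
        fix j assume j: "j \<in> {..<m}"
        show "e i \<otimes> z j = (if i = j then z j else \<zero>)"
        proof (cases "i = j")
          case False
          have "e i \<otimes> z j = (e i \<otimes> e j) \<otimes> z j" using zc[of j] e(1)[OF i] e(1)[of j] j by (simp add: m_assoc)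
          then show ?thesis using orth[of i j] i j False zc[of j] by simp
        qed (use zc j in simp)
      qed (use zc in auto)
      also have "\<dots> = z i" using i zP by (intro finsum_singleton) auto
      finally show ?thesis .
    qed
    moreover have "?r \<in> carrier R" using zP by (rule finsum_closed)
    ultimately show "\<exists>r\<in>carrier R. \<forall>i<m. e i \<otimes> r = z i" by blast
  qed
  then have "R \<simeq> RDirProd_list Rs"
  proof (rule prod_decomp_iso)
    fix i assume "i < length Rs"
    then have i: "i < m" by (simp add: len)
    show "ring (Rs ! i)" unfolding nth[OF i] using idem_ring_cring[OF e(1)[OF i] ee[OF i]] by (rule cring.axioms(1))
  qed (rule ring_axioms)
  moreover have "\<forall>S\<in>set Rs. krull_domain S \<or> special_primary_ring S"
    using component_idem_ring[OF W e(1) C] by (auto simp: Rs_def)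
  ultimately show ?thesis unfolding general_krull_ring_def by blast
qed

end

theorem theorem6p6:
  fixes R :: "('a, 'b) ring_scheme"
  assumes "cring R" and "\<one>\<^bsub>R\<^esub> \<noteq> \<zero>\<^bsub>R\<^esub>"
  shows
    "(general_krull_ring R \<longleftrightarrow>
        (\<forall>a \<in> carrier R. finite_u_product_of_primes R (tq_embed R ` (PIdl\<^bsub>R\<^esub> a)))) \<and>
     (general_krull_ring R \<longleftrightarrow>
        (\<forall>a \<in> carrier R.
           finite_u_product_of_primes R (u_closure R (tq_embed R ` (PIdl\<^bsub>R\<^esub> a))))) \<and>
     (general_krull_ring R \<longleftrightarrow>
        (\<forall>I. integral_u_ideal R I \<longrightarrow> finite_u_product_of_primes R (tq_embed R ` I))) \<and>
     (general_krull_ring R \<longleftrightarrow>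
        krull_ring R \<and>
        (\<forall>P. minimal_prime R P \<longrightarrow> principalideal P R) \<and>
        krull_dim (total_quotient_ring R) = 0) \<and>
     (general_krull_ring R \<longleftrightarrow>
        krull_ring R \<and>
        (\<exists>ps. (\<forall>p \<in> set ps. prime_element R p) \<and>
              \<zero>\<^bsub>R\<^esub> = foldr (\<lambda>x y. x \<otimes>\<^bsub>R\<^esub> y) ps \<one>\<^bsub>R\<^esub>) \<and>
        krull_dim (total_quotient_ring R) = 0)"
proof -
  interpret nontrivial_cring R
    by (rule nontrivial_cring.intro) (use assms in \<open>simp_all add: nontrivial_cring_axioms_def\<close>)
  show ?thesis
    (is "(?c1 \<longleftrightarrow> ?c2) \<and> (?c1 \<longleftrightarrow> ?c3) \<and> (?c1 \<longleftrightarrow> ?c4) \<and> (?c1 \<longleftrightarrow> ?c5) \<and> (?c1 \<longleftrightarrow> ?c6)")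
  proof -
    let ?A = "\<iota> ` carrier R"
    \<comment> \<open>The route: (1) gives (6), which gives a decomposition, hence (2) and (4); each
      of these gives (3), and (3) gives a decomposition again, hence (1). Conditions (5) and (6) are
      compared directly.\<close>
    have 16: ?c6 if ?c1 using general_krull_imp[OF that] zero_dimensional_iff by simp
    have 6: "fp.krull \<and> (\<exists>S e. fp.decomp S e)" if ?c6
    proof -
      have h: "fp.krull" "fp.zero_dimensional" using that krull_iff zero_dimensional_iff by simp_all
      have "\<exists>ps. set ps \<subseteq> ?A \<and> (\<forall>p\<in>set ps. fp.A_prime (fp.principal p)) \<and> foldr (\<otimes>\<^bsub>Q\<^esub>) ps \<one>\<^bsub>Q\<^esub> = \<zero>\<^bsub>Q\<^esub>"
        using that cond6_iff by simp
      then obtain ps where "set ps \<subseteq> ?A" "\<And>p. p \<in> set ps \<Longrightarrow> fp.A_prime (fp.principal p)" "foldr (\<otimes>\<^bsub>Q\<^esub>) ps \<one>\<^bsub>Q\<^esub> = \<zero>\<^bsub>Q\<^esub>" by blast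
      then show ?thesis using fp.prime_elements_decomp[OF h] h(1) by blast
    qed
    have S4: ?c4 and S2: ?c2 if "fp.krull" "fp.decomp S e" for S e
    proof -
      show c4: ?c4 unfolding cond4_iff using fp.decomp_factor[OF that] by simp
      show ?c2 unfolding cond2_iff
      proof
        fix a assume a: "a \<in> ?A"
        show "\<exists>Ps. (\<forall>P\<in>set Ps. fp.A_prime P) \<and> fp.principal a = fp.u_hull (fp.ideal_product Ps)"
          by (rule fp.decomp_factor[OF that fp.A_ideal_principal[OF a] fp.decomp_principal[OF that(2) a]])
      qed
    qed
    have 31: ?c1 if ?c3
    proof -
      have "fp.principal_u_factorization" using that cond3_iff by simp
      then show ?thesis using fp.principal_u_factorization_krull fp.principal_u_factorization_decomp decomp_general_krull by blast
    qed
    have 23: ?c3 if ?c2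
      unfolding cond3_iff fp.principal_u_factorization_def
    proof
      fix a assume "a \<in> ?A"
      from bspec[OF iffD1[OF cond2_iff that] this]
      obtain Ps where Ps: "\<forall>P\<in>set Ps. fp.A_prime P" "fp.principal a = fp.u_hull (fp.ideal_product Ps)" by blast
      have "fp.A_ideal (fp.ideal_product Ps)" by (rule fp.A_ideal_ideal_product) (use Ps(1) fp.A_prime_A_ideal in blast)
      then have "fp.ideal_product Ps \<subseteq> carrier Q" using fp.A_ideal_A fp.A_carrier by blast
      then have "fp.u_hull (fp.principal a) = fp.u_hull (fp.ideal_product Ps)" unfolding Ps(2) by (rule fp.u_hull_idem)
      then show "\<exists>Ps. (\<forall>P\<in>set Ps. fp.A_prime P) \<and> fp.u_hull (fp.principal a) = fp.u_hull (fp.ideal_product Ps)" using Ps(1) by blast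
    qed
    have 43: ?c3 if ?c4
      unfolding cond3_iff fp.principal_u_factorization_def
    proof
      fix a assume a: "a \<in> ?A"
      note p = fp.A_ideal_principal[OF a]
      have "fp.principal a \<subseteq> carrier Q" using fp.A_ideal_A[OF p] fp.A_carrier by blast
      then have "fp.A_ideal (fp.u_hull (fp.principal a)) \<and> fp.u_hull (fp.u_hull (fp.principal a)) = fp.u_hull (fp.principal a)"
        using fp.A_ideal_u_hull[OF p] fp.u_hull_idem by simp
      then show "\<exists>Ps. (\<forall>P\<in>set Ps. fp.A_prime P) \<and> fp.u_hull (fp.principal a) = fp.u_hull (fp.ideal_product Ps)"
        by (rule mp[OF spec[OF iffD1[OF cond4_iff that]]])
    qed
    have 61: ?c1 if ?c6 using 6[OF that] decomp_general_krull by blast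
    have 56: "?c5 \<longleftrightarrow> ?c6"
    proof -
      have "(\<forall>P. fp.min_prime P \<longrightarrow> (\<exists>p\<in>?A. P = fp.principal p)) \<longleftrightarrow>
        (\<exists>ps. set ps \<subseteq> ?A \<and> (\<forall>p\<in>set ps. fp.A_prime (fp.principal p)) \<and> foldr (\<otimes>\<^bsub>Q\<^esub>) ps \<one>\<^bsub>Q\<^esub> = \<zero>\<^bsub>Q\<^esub>)"
      proof
        assume "\<forall>P. fp.min_prime P \<longrightarrow> (\<exists>p\<in>?A. P = fp.principal p)"
        then show "\<exists>ps. set ps \<subseteq> ?A \<and> (\<forall>p\<in>set ps. fp.A_prime (fp.principal p)) \<and> foldr (\<otimes>\<^bsub>Q\<^esub>) ps \<one>\<^bsub>Q\<^esub> = \<zero>\<^bsub>Q\<^esub>"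
          by (intro fp.principal_minimal_primes) simp
      next
        assume "\<exists>ps. set ps \<subseteq> ?A \<and> (\<forall>p\<in>set ps. fp.A_prime (fp.principal p)) \<and> foldr (\<otimes>\<^bsub>Q\<^esub>) ps \<one>\<^bsub>Q\<^esub> = \<zero>\<^bsub>Q\<^esub>"
        then obtain ps where ps: "set ps \<subseteq> ?A" "\<forall>p\<in>set ps. fp.A_prime (fp.principal p)" "foldr (\<otimes>\<^bsub>Q\<^esub>) ps \<one>\<^bsub>Q\<^esub> = \<zero>\<^bsub>Q\<^esub>" by blast
        then show "\<forall>P. fp.min_prime P \<longrightarrow> (\<exists>p\<in>?A. P = fp.principal p)"
          using fp.prime_elements_minimal_primes[OF ps(1) _ ps(3)] by simp
      qed
      then show ?thesis unfolding cond5_iff cond6_iff by simp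
    qed
    have 1: "?c1 \<longleftrightarrow> ?c6" using 16 61 by blast
    have 12: ?c2 and 14: ?c4 if ?c1
      using 6[OF 16[OF that]] S2 S4 by blast+
    show ?thesis using 1 56 12 14 23 43 31 by blast
  qed
qed

end
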